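(* A $\Phi$-functional can be computed (Kleene S1–S9) from any $\zeta$-functional together with $\mu^2$. A $\zeta$-functional can be computed from any $\Psi$-functional together with $\mu^2$. Moreover, $\mathsf{ACA}_0^\omega$ proves $\mathsf{URY}\leftrightarrow\mathsf{open}$.
   Context: Computability is Kleene's S1–S9. Framework: Kohlenbach's higher-order arithmetic; $\mathsf{RCA}_0^\omega$ is the base theory (variables of all finite types over $\mathbb{N}$; basic arithmetic, combinators, primitive recursor $\mathbf{R}_0$, extensionality, quantifier-free induction, $\mathsf{QF\text{-}AC}^{1,0}$). $\mu^2$ (Feferman's $\mu$) is the type-2 functional such that if $(\exists n)f(n)=0$ then $\mu(f)$ is the least such $n$, and $\mu(f)=0$ otherwise; $\mathsf{ACA}_0^\omega$ is $\mathsf{RCA}_0^\omega$ plus existence of $\mu^2$. Reals are fast-converging Cauchy sequences of rationals. A set of reals is given by $Y:\mathbb{R}\to\mathbb{R}$, $x\in Y$ meaning $Y(x)>0$; $Y$ is open if for every $x\in Y$ there is a rational $r>0$ with $B(x,r)\subseteq Y$; closed if its complement is open. Fix an enumeration $(q_n,r_n)_{n\in\mathbb{N}}$ of pairs of rationals with $r_n>0$. $\Phi$-functional: any $\Phi^3$ such that for every open $Y\subseteq\mathbb{R}$ and $x\in Y$, $\Phi(Y,x)$ is a rational $r>0$ with $B(x,r)\subseteq Y$. $\Psi$-functional: any $\Psi^3$ such that for every open $Y\subseteq\mathbb{R}$, $\Psi(Y)$ is a pair of sequences of rationals $(a_n),(r_n)$ (with $r_n\ge0$) such that $Y=\bigcup_n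 B(a_n,r_n)$. $\zeta$-functional: any $\zeta$ such that for all disjoint closed $C_0,C_1\subseteq\mathbb{R}$, $\zeta(C_0,C_1)$ is a continuous function $\mathbb{R}\to\mathbb{R}$ with $\zeta(C_0,C_1)(x)=i$ whenever $x\in C_i$, $i=0,1$. $\mathsf{URY}$: for all disjoint closed $C_0,C_1\subseteq\mathbb{R}$ there is a continuous $g:\mathbb{R}\to[0,1]$ with $x\in C_i\leftrightarrow g(x)=i$ for all $x\in\mathbb{R}$, $i\in\{0,1\}$. $\mathsf{open}$: for every open $Y\subseteq\mathbb{R}$ there is $X\subseteq\mathbb{N}$ with $(\forall n)(n\in X\leftrightarrow B(q_n,r_n)\subseteq Y)$. *)

theory Defs
  imports "HOL-Analysis.Analysis" "HOL-Library.Nat_Bijection"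
begin

section \<open>Kleene computability\<close>

text \<open>
  Kleene's schemes S1--S9 over the full type structure of total functionals, for arguments of
  pure type at most 3.  A computation with such arguments only has subcomputations with such
  arguments (S8 adds an argument whose type is lower by 2, S4 and S5 add numbers), so the
  restriction to types at most 3 does not change what is computable from these arguments.
\<close>

datatype arg =
    Num nat
  | Fun1 "nat \<Rightarrow> nat"
  | Fun2 "(nat \<Rightarrow> nat) \<Rightarrow> nat"
  | Fun3 "((nat \<Rightarrow> nat) \<Rightarrow> nat) \<Rightarrow> nat"

text \<open>
  \<open>kleene e as v\<close> is Kleene's \<open>{e}(as) \<simeq> v\<close>.  Arguments of different types are kept in a single
  list, so an index need not record a signature; S6 moves an arbitrary argument to the front,
  which generates all permutations.  Kleene's S8 is split according to the type of the argument,
  and demands that the functional handed to the argument be total.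
\<close>

inductive kleene :: "nat \<Rightarrow> arg list \<Rightarrow> nat \<Rightarrow> bool" where
  S1: "kleene (list_encode [1]) (Num n # as) (Suc n)"
| S2: "kleene (list_encode [2, q]) as q"
| S3: "kleene (list_encode [3]) (Num n # as) n"
| S4: "kleene c as u \<Longrightarrow> kleene d (Num u # as) v \<Longrightarrow> kleene (list_encode [4, c, d]) as v"
| S5_0: "kleene c as v \<Longrightarrow> kleene (list_encode [5, c, d]) (Num 0 # as) v"
| S5_Suc: "kleene (list_encode [5, c, d]) (Num n # as) u \<Longrightarrow>
    kleene d (Num n # Num u # as) v \<Longrightarrow>
    kleene (list_encode [5, c, d]) (Num (Suc n) # as) v"
| S6: "k < length as \<Longrightarrow> kleene c (as ! k # take k as @ drop (Suc k) as) v \<Longrightarrow>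
    kleene (list_encode [6, k, c]) as v"
| S7: "kleene (list_encode [7]) (Fun1 f # Num n # as) (f n)"
| S8_2: "(\<And>n. kleene c (Fun2 F # Num n # as) (g n)) \<Longrightarrow>
    kleene (list_encode [8, c]) (Fun2 F # as) (F g)"
| S8_3: "(\<And>f. kleene c (Fun3 F # Fun1 f # as) (G f)) \<Longrightarrow>
    kleene (list_encode [8, c]) (Fun3 F # as) (F G)"
| S9: "m \<le> length as \<Longrightarrow> kleene e (take m as) v \<Longrightarrow>
    kleene (list_encode [9, m]) (Num e # as) v"

text \<open>
  Objects of type \<open>1 \<rightarrow> 1\<close> and functionals with several arguments are turned into pure objects
  in the usual way.  \<open>to_type2\<close> is a bijection with inverse \<open>from_type2\<close>, and a type-2 object
  \<open>G\<close> codes the sequence of type-2 objects \<open>slice 0 G, slice 1 G, \<dots>\<close>.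
\<close>

definition to_type2 :: "((nat \<Rightarrow> nat) \<Rightarrow> (nat \<Rightarrow> nat)) \<Rightarrow> (nat \<Rightarrow> nat) \<Rightarrow> nat" where
  "to_type2 Y = (\<lambda>h. Y (\<lambda>n. h (Suc n)) (h 0))"

definition from_type2 :: "((nat \<Rightarrow> nat) \<Rightarrow> nat) \<Rightarrow> (nat \<Rightarrow> nat) \<Rightarrow> (nat \<Rightarrow> nat)" where
  "from_type2 F = (\<lambda>x n. F (case_nat n x))"

definition slice :: "nat \<Rightarrow> ((nat \<Rightarrow> nat) \<Rightarrow> nat) \<Rightarrow> (nat \<Rightarrow> nat) \<Rightarrow> nat" where
  "slice i G = (\<lambda>h. G (case_nat i h))"

definition fun2_arg :: "((nat \<Rightarrow> nat) \<Rightarrow> (nat \<Rightarrow> nat)) \<Rightarrow> arg" where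
  "fun2_arg Y = Fun2 (to_type2 Y)"

text \<open>The type-3 form of a \<open>\<zeta>\<close> of type \<open>(1 \<rightarrow> 1) \<rightarrow> (1 \<rightarrow> 1) \<rightarrow> 1 \<rightarrow> 0 \<rightarrow> 0\<close>.\<close>

definition zeta_arg ::
  "(((nat \<Rightarrow> nat) \<Rightarrow> (nat \<Rightarrow> nat)) \<Rightarrow> ((nat \<Rightarrow> nat) \<Rightarrow> (nat \<Rightarrow> nat)) \<Rightarrow>
     (nat \<Rightarrow> nat) \<Rightarrow> (nat \<Rightarrow> nat)) \<Rightarrow> arg" where
  "zeta_arg \<zeta> = Fun3 (\<lambda>G. \<zeta> (from_type2 (slice 0 G)) (from_type2 (slice 1 G))
     (\<lambda>k. slice 2 G (\<lambda>_. k)) (slice 3 G (\<lambda>_. 0)))"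

text \<open>The type-3 form of a \<open>\<Psi>\<close> whose values are pairs of sequences.\<close>

definition psi_arg ::
  "(((nat \<Rightarrow> nat) \<Rightarrow> (nat \<Rightarrow> nat)) \<Rightarrow> (nat \<Rightarrow> nat) \<times> (nat \<Rightarrow> nat)) \<Rightarrow> arg" where
  "psi_arg \<Psi> = Fun3 (\<lambda>G. let p = \<Psi> (from_type2 (slice 0 G)); n = slice 1 G (\<lambda>_. 0)
     in prod_encode (fst p n, snd p n))"

definition Feferman_mu :: "(nat \<Rightarrow> nat) \<Rightarrow> nat" where
  "Feferman_mu f = (if \<exists>n. f n = 0 then LEAST n. f n = 0 else 0)"

section \<open>Representation of the reals and the functionals\<close>

text \<open>
  Rationals are coded by numbers: the pair \<open>(n, d)\<close> stands for \<open>(n / 2) / (d + 1)\<close> if \<open>n\<close> is even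
  and for \<open>- ((n + 1) / 2) / (d + 1)\<close> if \<open>n\<close> is odd.
\<close>

definition rat_of_code :: "nat \<Rightarrow> rat" where
  "rat_of_code k = (case prod_decode k of (n, d) \<Rightarrow> of_int (int_decode n) / of_nat (Suc d))"

definition codes_real :: "(nat \<Rightarrow> nat) \<Rightarrow> bool" where
  "codes_real x \<longleftrightarrow>
     (\<forall>n i. \<bar>rat_of_code (x n) - rat_of_code (x (n + i))\<bar> < 1 / 2 ^ n)"

definition real_of_code :: "(nat \<Rightarrow> nat) \<Rightarrow> real" where
  "real_of_code x = lim (\<lambda>n. real_of_rat (rat_of_code (x n)))"

text \<open>
  \<open>Y\<close> maps codes of reals to codes of reals, respects equality of the coded reals, and the
  function on the reals it induces is \<open>f\<close>.
\<close>

definition represents :: "((nat \<Rightarrow> nat) \<Rightarrow> (nat \<Rightarrow> nat)) \<Rightarrow> (real \<Rightarrow> real) \<Rightarrow> bool" where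
  "represents Y f \<longleftrightarrow>
     (\<forall>x. codes_real x \<longrightarrow> codes_real (Y x) \<and> real_of_code (Y x) = f (real_of_code x))"

definition set_given_by :: "(real \<Rightarrow> real) \<Rightarrow> real set" where
  "set_given_by f = {x. f x > 0}"

definition Phi_functional ::
  "(((nat \<Rightarrow> nat) \<Rightarrow> (nat \<Rightarrow> nat)) \<Rightarrow> (nat \<Rightarrow> nat) \<Rightarrow> nat) \<Rightarrow> bool" where
  "Phi_functional \<Phi> \<longleftrightarrow>
     (\<forall>Y f x. represents Y f \<and> open (set_given_by f) \<and>
        codes_real x \<and> real_of_code x \<in> set_given_by f \<longrightarrow>
        rat_of_code (\<Phi> Y x) > 0 \<and>
        ball (real_of_code x) (real_of_rat (rat_of_code (\<Phi> Y x))) \<subseteq> set_given_by f)"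

definition Psi_functional ::
  "(((nat \<Rightarrow> nat) \<Rightarrow> (nat \<Rightarrow> nat)) \<Rightarrow> (nat \<Rightarrow> nat) \<times> (nat \<Rightarrow> nat)) \<Rightarrow> bool" where
  "Psi_functional \<Psi> \<longleftrightarrow>
     (\<forall>Y f a r. represents Y f \<and> open (set_given_by f) \<and> \<Psi> Y = (a, r) \<longrightarrow>
        (\<forall>n. rat_of_code (r n) \<ge> 0) \<and>
        set_given_by f =
          (\<Union>n. ball (real_of_rat (rat_of_code (a n))) (real_of_rat (rat_of_code (r n)))))"

definition zeta_functional ::
  "(((nat \<Rightarrow> nat) \<Rightarrow> (nat \<Rightarrow> nat)) \<Rightarrow> ((nat \<Rightarrow> nat) \<Rightarrow> (nat \<Rightarrow> nat)) \<Rightarrow>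
     (nat \<Rightarrow> nat) \<Rightarrow> (nat \<Rightarrow> nat)) \<Rightarrow> bool" where
  "zeta_functional \<zeta> \<longleftrightarrow>
     (\<forall>C\<^sub>0 C\<^sub>1 f\<^sub>0 f\<^sub>1. represents C\<^sub>0 f\<^sub>0 \<and> represents C\<^sub>1 f\<^sub>1 \<and>
        closed (set_given_by f\<^sub>0) \<and> closed (set_given_by f\<^sub>1) \<and>
        set_given_by f\<^sub>0 \<inter> set_given_by f\<^sub>1 = {} \<longrightarrow>
        (\<exists>g. represents (\<zeta> C\<^sub>0 C\<^sub>1) g \<and> continuous_on UNIV g \<and>
           (\<forall>x \<in> set_given_by f\<^sub>0. g x = 0) \<and> (\<forall>x \<in> set_given_by f\<^sub>1. g x = 1)))"

section \<open>Higher-order arithmetic\<close>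

datatype ty = Nt | Fn ty ty  (infixr "\<Rrightarrow>" 65)

abbreviation ty1 :: ty where "ty1 \<equiv> Nt \<Rrightarrow> Nt"
abbreviation ty2 :: ty where "ty2 \<equiv> ty1 \<Rrightarrow> Nt"
abbreviation ty11 :: ty where "ty11 \<equiv> ty1 \<Rrightarrow> ty1"

datatype const = Zero | One | Plus | Times | CombK ty ty | CombS ty ty ty | Rec0

primrec const_ty :: "const \<Rightarrow> ty" where
  "const_ty Zero = Nt"
| "const_ty One = Nt"
| "const_ty Plus = Nt \<Rrightarrow> Nt \<Rrightarrow> Nt"
| "const_ty Times = Nt \<Rrightarrow> Nt \<Rrightarrow> Nt"
| "const_ty (CombK \<rho> \<sigma>) = \<rho> \<Rrightarrow> \<sigma> \<Rrightarrow> \<rho>"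
| "const_ty (CombS \<rho> \<sigma> \<tau>) = (\<rho> \<Rrightarrow> \<sigma> \<Rrightarrow> \<tau>) \<Rrightarrow> (\<rho> \<Rrightarrow> \<sigma>) \<Rrightarrow> \<rho> \<Rrightarrow> \<tau>"
| "const_ty Rec0 = (Nt \<Rrightarrow> Nt \<Rrightarrow> Nt) \<Rrightarrow> Nt \<Rrightarrow> Nt \<Rrightarrow> Nt"

text \<open>A variable is a name together with its type; \<open>Var 0 \<rho>\<close> and \<open>Var 0 \<sigma>\<close> are different
  variables if \<open>\<rho> \<noteq> \<sigma>\<close>.\<close>

datatype tm = Var nat ty | Const const | App tm tm  (infixl "\<cdot>" 90)

primrec tm_ty :: "tm \<Rightarrow> ty option" where
  "tm_ty (Var x \<rho>) = Some \<rho>"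
| "tm_ty (Const c) = Some (const_ty c)"
| "tm_ty (s \<cdot> t) = (case tm_ty s of
     Some (\<sigma> \<Rrightarrow> \<tau>) \<Rightarrow> (if tm_ty t = Some \<sigma> then Some \<tau> else None)
   | _ \<Rightarrow> None)"

datatype fm =
    Eq tm tm  (infix "\<^bold>=" 50)
  | Less tm tm  (infix "\<^bold><" 50)
  | Falsum  ("\<^bold>\<bottom>")
  | Imp fm fm  (infixr "\<^bold>\<longrightarrow>" 25)
  | Forall nat ty fm

abbreviation Neg :: "fm \<Rightarrow> fm"  ("\<^bold>\<not> _" [40] 40) where "\<^bold>\<not> A \<equiv> A \<^bold>\<longrightarrow> \<^bold>\<bottom>"
abbreviation Conj :: "fm \<Rightarrow> fm \<Rightarrow> fm"  (infixr "\<^bold>\<and>" 35) where "A \<^bold>\<and> B \<equiv> \<^bold>\<not> (A \<^bold>\<longrightarrow> \<^bold>\<not> B)"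
abbreviation Disj :: "fm \<Rightarrow> fm \<Rightarrow> fm"  (infixr "\<^bold>\<or>" 30) where "A \<^bold>\<or> B \<equiv> \<^bold>\<not> A \<^bold>\<longrightarrow> B"
abbreviation Iff :: "fm \<Rightarrow> fm \<Rightarrow> fm"  (infixr "\<^bold>\<longleftrightarrow>" 25) where
  "A \<^bold>\<longleftrightarrow> B \<equiv> (A \<^bold>\<longrightarrow> B) \<^bold>\<and> (B \<^bold>\<longrightarrow> A)"
abbreviation Exists :: "nat \<Rightarrow> ty \<Rightarrow> fm \<Rightarrow> fm" where "Exists x \<rho> A \<equiv> \<^bold>\<not> Forall x \<rho> (\<^bold>\<not> A)"

abbreviation add_tm :: "tm \<Rightarrow> tm \<Rightarrow> tm"  (infixl "\<^bold>+" 65) where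
  "s \<^bold>+ t \<equiv> Const Plus \<cdot> s \<cdot> t"
abbreviation mult_tm :: "tm \<Rightarrow> tm \<Rightarrow> tm"  (infixl "\<^bold>*" 70) where
  "s \<^bold>* t \<equiv> Const Times \<cdot> s \<cdot> t"
abbreviation zero_tm :: tm  ("\<^bold>0") where "\<^bold>0 \<equiv> Const Zero"
abbreviation one_tm :: tm  ("\<^bold>1") where "\<^bold>1 \<equiv> Const One"
abbreviation leq_fm :: "tm \<Rightarrow> tm \<Rightarrow> fm"  (infix "\<^bold>\<le>" 50) where "s \<^bold>\<le> t \<equiv> \<^bold>\<not> (t \<^bold>< s)"

primrec wf_fm :: "fm \<Rightarrow> bool" where
  "wf_fm (s \<^bold>= t) \<longleftrightarrow> tm_ty s = Some Nt \<and> tm_ty t = Some Nt"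
| "wf_fm (s \<^bold>< t) \<longleftrightarrow> tm_ty s = Some Nt \<and> tm_ty t = Some Nt"
| "wf_fm \<^bold>\<bottom> \<longleftrightarrow> True"
| "wf_fm (A \<^bold>\<longrightarrow> B) \<longleftrightarrow> wf_fm A \<and> wf_fm B"
| "wf_fm (Forall x \<rho> A) \<longleftrightarrow> wf_fm A"

primrec quantifier_free :: "fm \<Rightarrow> bool" where
  "quantifier_free (s \<^bold>= t) \<longleftrightarrow> True"
| "quantifier_free (s \<^bold>< t) \<longleftrightarrow> True"
| "quantifier_free \<^bold>\<bottom> \<longleftrightarrow> True"
| "quantifier_free (A \<^bold>\<longrightarrow> B) \<longleftrightarrow> quantifier_free A \<and> quantifier_free B"
| "quantifier_free (Forall x \<rho> A) \<longleftrightarrow> False"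

primrec vars_tm :: "tm \<Rightarrow> (nat \<times> ty) set" where
  "vars_tm (Var x \<rho>) = {(x, \<rho>)}"
| "vars_tm (Const c) = {}"
| "vars_tm (s \<cdot> t) = vars_tm s \<union> vars_tm t"

primrec free_vars :: "fm \<Rightarrow> (nat \<times> ty) set" where
  "free_vars (s \<^bold>= t) = vars_tm s \<union> vars_tm t"
| "free_vars (s \<^bold>< t) = vars_tm s \<union> vars_tm t"
| "free_vars \<^bold>\<bottom> = {}"
| "free_vars (A \<^bold>\<longrightarrow> B) = free_vars A \<union> free_vars B"
| "free_vars (Forall x \<rho> A) = free_vars A - {(x, \<rho>)}"

primrec subst_tm :: "nat \<Rightarrow> ty \<Rightarrow> tm \<Rightarrow> tm \<Rightarrow> tm" where
  "subst_tm x \<rho> u (Var y \<sigma>) = (if y = x \<and> \<sigma> = \<rho> then u else Var y \<sigma>)"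
| "subst_tm x \<rho> u (Const c) = Const c"
| "subst_tm x \<rho> u (s \<cdot> t) = subst_tm x \<rho> u s \<cdot> subst_tm x \<rho> u t"

primrec subst_fm :: "nat \<Rightarrow> ty \<Rightarrow> tm \<Rightarrow> fm \<Rightarrow> fm" where
  "subst_fm x \<rho> u (s \<^bold>= t) = (subst_tm x \<rho> u s \<^bold>= subst_tm x \<rho> u t)"
| "subst_fm x \<rho> u (s \<^bold>< t) = (subst_tm x \<rho> u s \<^bold>< subst_tm x \<rho> u t)"
| "subst_fm x \<rho> u \<^bold>\<bottom> = \<^bold>\<bottom>"
| "subst_fm x \<rho> u (A \<^bold>\<longrightarrow> B) = (subst_fm x \<rho> u A \<^bold>\<longrightarrow> subst_fm x \<rho> u B)"
| "subst_fm x \<rho> u (Forall y \<sigma> A) =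
     (if y = x \<and> \<sigma> = \<rho> then Forall y \<sigma> A else Forall y \<sigma> (subst_fm x \<rho> u A))"

primrec free_for :: "tm \<Rightarrow> nat \<Rightarrow> ty \<Rightarrow> fm \<Rightarrow> bool" where
  "free_for u x \<rho> (s \<^bold>= t) \<longleftrightarrow> True"
| "free_for u x \<rho> (s \<^bold>< t) \<longleftrightarrow> True"
| "free_for u x \<rho> \<^bold>\<bottom> \<longleftrightarrow> True"
| "free_for u x \<rho> (A \<^bold>\<longrightarrow> B) \<longleftrightarrow> free_for u x \<rho> A \<and> free_for u x \<rho> B"
| "free_for u x \<rho> (Forall y \<sigma> A) \<longleftrightarrow>
     (x, \<rho>) \<notin> free_vars (Forall y \<sigma> A) \<or> ((y, \<sigma>) \<notin> vars_tm u \<and> free_for u x \<rho> A)"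

text \<open>
  Classical natural deduction.  \<open>T\<close> is a set of axioms, whose free variables are understood to
  be universally quantified, and \<open>\<Gamma>\<close> is the set of open assumptions.
\<close>

inductive derivable :: "fm set \<Rightarrow> fm set \<Rightarrow> fm \<Rightarrow> bool" for T :: "fm set" where
  Axiom: "A \<in> T \<Longrightarrow> wf_fm A \<Longrightarrow> derivable T \<Gamma> A"
| Assumption: "A \<in> \<Gamma> \<Longrightarrow> wf_fm A \<Longrightarrow> derivable T \<Gamma> A"
| ImpI: "wf_fm A \<Longrightarrow> derivable T (insert A \<Gamma>) B \<Longrightarrow> derivable T \<Gamma> (A \<^bold>\<longrightarrow> B)"
| ImpE: "derivable T \<Gamma> (A \<^bold>\<longrightarrow> B) \<Longrightarrow> derivable T \<Gamma> A \<Longrightarrow> derivable T \<Gamma> B"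
| Classical: "wf_fm A \<Longrightarrow> derivable T (insert (\<^bold>\<not> A) \<Gamma>) \<^bold>\<bottom> \<Longrightarrow> derivable T \<Gamma> A"
| AllI: "derivable T \<Gamma> A \<Longrightarrow> (\<forall>B \<in> \<Gamma>. (x, \<rho>) \<notin> free_vars B) \<Longrightarrow> derivable T \<Gamma> (Forall x \<rho> A)"
| AllE: "derivable T \<Gamma> (Forall x \<rho> A) \<Longrightarrow> tm_ty u = Some \<rho> \<Longrightarrow> free_for u x \<rho> A \<Longrightarrow>
    derivable T \<Gamma> (subst_fm x \<rho> u A)"

definition proves :: "fm set \<Rightarrow> fm \<Rightarrow> bool"  (infix "\<turnstile>" 50) where
  "(T \<turnstile> A) \<longleftrightarrow> derivable T {} A"

subsection \<open>Quantifiers over fresh variables\<close>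

text \<open>
  To write formulas with metalevel binders, \<open>all_fresh \<rho> F\<close> quantifies over a variable whose
  name exceeds every name, free or bound, in the body.  Hence it captures no variable of the
  terms that occur in \<open>F\<close>.
\<close>

primrec bound_tm :: "tm \<Rightarrow> nat" where
  "bound_tm (Var x \<rho>) = Suc x"
| "bound_tm (Const c) = 0"
| "bound_tm (s \<cdot> t) = max (bound_tm s) (bound_tm t)"

primrec bound_fm :: "fm \<Rightarrow> nat" where
  "bound_fm (s \<^bold>= t) = max (bound_tm s) (bound_tm t)"
| "bound_fm (s \<^bold>< t) = max (bound_tm s) (bound_tm t)"
| "bound_fm \<^bold>\<bottom> = 0"
| "bound_fm (A \<^bold>\<longrightarrow> B) = max (bound_fm A) (bound_fm B)"
| "bound_fm (Forall x \<rho> A) = max (Suc x) (bound_fm A)"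

definition all_fresh :: "ty \<Rightarrow> (tm \<Rightarrow> fm) \<Rightarrow> fm" where
  "all_fresh \<rho> F = (let x = bound_fm (F (Var 0 \<rho>)) in Forall x \<rho> (F (Var x \<rho>)))"

definition all0 :: "(tm \<Rightarrow> fm) \<Rightarrow> fm"  (binder "\<^bold>\<forall>\<^sub>0" 10) where "all0 F = all_fresh Nt F"
definition all1 :: "(tm \<Rightarrow> fm) \<Rightarrow> fm"  (binder "\<^bold>\<forall>\<^sub>1" 10) where "all1 F = all_fresh ty1 F"
definition all11 :: "(tm \<Rightarrow> fm) \<Rightarrow> fm"  (binder "\<^bold>\<forall>\<^sub>1\<^sub>1" 10) where "all11 F = all_fresh ty11 F"
definition ex0 :: "(tm \<Rightarrow> fm) \<Rightarrow> fm"  (binder "\<^bold>\<exists>\<^sub>0" 10) where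
  "ex0 F = (\<^bold>\<not> (\<^bold>\<forall>\<^sub>0x. \<^bold>\<not> F x))"
definition ex1 :: "(tm \<Rightarrow> fm) \<Rightarrow> fm"  (binder "\<^bold>\<exists>\<^sub>1" 10) where
  "ex1 F = (\<^bold>\<not> (\<^bold>\<forall>\<^sub>1x. \<^bold>\<not> F x))"
definition ex11 :: "(tm \<Rightarrow> fm) \<Rightarrow> fm"  (binder "\<^bold>\<exists>\<^sub>1\<^sub>1" 10) where
  "ex11 F = (\<^bold>\<not> (\<^bold>\<forall>\<^sub>1\<^sub>1x. \<^bold>\<not> F x))"
definition ex2 :: "(tm \<Rightarrow> fm) \<Rightarrow> fm"  (binder "\<^bold>\<exists>\<^sub>2" 10) where
  "ex2 F = (\<^bold>\<not> all_fresh ty2 (\<lambda>x. \<^bold>\<not> F x))"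

primrec eq_at :: "ty \<Rightarrow> tm \<Rightarrow> tm \<Rightarrow> fm" where
  "eq_at Nt = (\<lambda>s t. s \<^bold>= t)"
| "eq_at (\<sigma> \<Rrightarrow> \<tau>) = (\<lambda>s t. all_fresh \<sigma> (\<lambda>z. eq_at \<tau> (s \<cdot> z) (t \<cdot> z)))"

subsection \<open>The base theory\<close>

text \<open>
  The arithmetical axioms are the basic axioms of second-order arithmetic, from which the laws
  of a discretely ordered semiring follow by quantifier-free induction.  In \<open>QF_AC\<close> the choice
  variable \<open>Y\<close> is fresh for \<open>A\<close>, and substitution into the quantifier-free \<open>A\<close> captures nothing.
\<close>

inductive_set RCA0w :: "fm set" where
  eq_refl: "(\<^bold>\<forall>\<^sub>0x. x \<^bold>= x) \<in> RCA0w"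
| eq_euclid: "(\<^bold>\<forall>\<^sub>0x. \<^bold>\<forall>\<^sub>0y. \<^bold>\<forall>\<^sub>0z. x \<^bold>= y \<^bold>\<longrightarrow> x \<^bold>= z \<^bold>\<longrightarrow> y \<^bold>= z) \<in> RCA0w"
| less_cong: "(\<^bold>\<forall>\<^sub>0x. \<^bold>\<forall>\<^sub>0y. \<^bold>\<forall>\<^sub>0u. \<^bold>\<forall>\<^sub>0v. x \<^bold>= y \<^bold>\<longrightarrow> u \<^bold>= v \<^bold>\<longrightarrow> x \<^bold>< u \<^bold>\<longrightarrow> y \<^bold>< v) \<in> RCA0w"
| suc_nonzero: "(\<^bold>\<forall>\<^sub>0x. \<^bold>\<not> (x \<^bold>+ \<^bold>1 \<^bold>= \<^bold>0)) \<in> RCA0w"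
| suc_inject: "(\<^bold>\<forall>\<^sub>0x. \<^bold>\<forall>\<^sub>0y. x \<^bold>+ \<^bold>1 \<^bold>= y \<^bold>+ \<^bold>1 \<^bold>\<longrightarrow> x \<^bold>= y) \<in> RCA0w"
| add_zero: "(\<^bold>\<forall>\<^sub>0x. x \<^bold>+ \<^bold>0 \<^bold>= x) \<in> RCA0w"
| add_suc: "(\<^bold>\<forall>\<^sub>0x. \<^bold>\<forall>\<^sub>0y. x \<^bold>+ (y \<^bold>+ \<^bold>1) \<^bold>= (x \<^bold>+ y) \<^bold>+ \<^bold>1) \<in> RCA0w"
| mult_zero: "(\<^bold>\<forall>\<^sub>0x. x \<^bold>* \<^bold>0 \<^bold>= \<^bold>0) \<in> RCA0w"
| mult_suc: "(\<^bold>\<forall>\<^sub>0x. \<^bold>\<forall>\<^sub>0y. x \<^bold>* (y \<^bold>+ \<^bold>1) \<^bold>= (x \<^bold>* y) \<^bold>+ x) \<in> RCA0w"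
| not_less_zero: "(\<^bold>\<forall>\<^sub>0x. \<^bold>\<not> (x \<^bold>< \<^bold>0)) \<in> RCA0w"
| less_suc: "(\<^bold>\<forall>\<^sub>0x. \<^bold>\<forall>\<^sub>0y. x \<^bold>< y \<^bold>+ \<^bold>1 \<^bold>\<longleftrightarrow> x \<^bold>< y \<^bold>\<or> x \<^bold>= y) \<in> RCA0w"
| comb_K: "all_fresh \<rho> (\<lambda>x. all_fresh \<sigma> (\<lambda>y.
    eq_at \<rho> (Const (CombK \<rho> \<sigma>) \<cdot> x \<cdot> y) x)) \<in> RCA0w"
| comb_S: "all_fresh (\<rho> \<Rrightarrow> \<sigma> \<Rrightarrow> \<tau>) (\<lambda>x. all_fresh (\<rho> \<Rrightarrow> \<sigma>) (\<lambda>y. all_fresh \<rho> (\<lambda>z.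
    eq_at \<tau> (Const (CombS \<rho> \<sigma> \<tau>) \<cdot> x \<cdot> y \<cdot> z) (x \<cdot> z \<cdot> (y \<cdot> z))))) \<in> RCA0w"
| rec_zero: "all_fresh (Nt \<Rrightarrow> Nt \<Rrightarrow> Nt) (\<lambda>f. \<^bold>\<forall>\<^sub>0m. Const Rec0 \<cdot> f \<cdot> m \<cdot> \<^bold>0 \<^bold>= m) \<in> RCA0w"
| rec_suc: "all_fresh (Nt \<Rrightarrow> Nt \<Rrightarrow> Nt) (\<lambda>f. \<^bold>\<forall>\<^sub>0m. \<^bold>\<forall>\<^sub>0n.
    Const Rec0 \<cdot> f \<cdot> m \<cdot> (n \<^bold>+ \<^bold>1) \<^bold>= f \<cdot> n \<cdot> (Const Rec0 \<cdot> f \<cdot> m \<cdot> n)) \<in> RCA0w"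
| extensionality: "all_fresh \<rho> (\<lambda>x. all_fresh \<rho> (\<lambda>y. all_fresh (\<rho> \<Rrightarrow> \<tau>) (\<lambda>f.
    eq_at \<rho> x y \<^bold>\<longrightarrow> eq_at \<tau> (f \<cdot> x) (f \<cdot> y)))) \<in> RCA0w"
| QF_induction: "quantifier_free A \<Longrightarrow> wf_fm A \<Longrightarrow>
    (subst_fm x Nt \<^bold>0 A \<^bold>\<longrightarrow> Forall x Nt (A \<^bold>\<longrightarrow> subst_fm x Nt (Var x Nt \<^bold>+ \<^bold>1) A) \<^bold>\<longrightarrow> Forall x Nt A) \<in> RCA0w"
| QF_AC: "quantifier_free A \<Longrightarrow> wf_fm A \<Longrightarrow> (Y, ty2) \<notin> free_vars A \<Longrightarrow>
    (Forall f ty1 (Exists n Nt A) \<^bold>\<longrightarrow>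
     Exists Y ty2 (Forall f ty1 (subst_fm n Nt (Var Y ty2 \<cdot> Var f ty1) A))) \<in> RCA0w"

definition mu_axiom :: fm where
  "mu_axiom = (\<^bold>\<exists>\<^sub>2\<mu>. \<^bold>\<forall>\<^sub>1f.
     ((\<^bold>\<exists>\<^sub>0n. f \<cdot> n \<^bold>= \<^bold>0) \<^bold>\<longrightarrow> f \<cdot> (\<mu> \<cdot> f) \<^bold>= \<^bold>0 \<^bold>\<and> (\<^bold>\<forall>\<^sub>0i. f \<cdot> i \<^bold>= \<^bold>0 \<^bold>\<longrightarrow> \<mu> \<cdot> f \<^bold>\<le> i)) \<^bold>\<and>
     (\<^bold>\<not> (\<^bold>\<exists>\<^sub>0n. f \<cdot> n \<^bold>= \<^bold>0) \<^bold>\<longrightarrow> \<mu> \<cdot> f \<^bold>= \<^bold>0))"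

definition ACA0w :: "fm set" where
  "ACA0w = insert mu_axiom RCA0w"

subsection \<open>Rationals and reals inside the theory\<close>

text \<open>
  A triple \<open>(p, m, d)\<close> of terms of type 0 stands for the rational \<open>(p - m) / d\<close>, where \<open>d\<close> is
  positive.
\<close>

type_synonym frac = "tm \<times> tm \<times> tm"

definition q_zero :: frac where "q_zero = (\<^bold>0, \<^bold>0, \<^bold>1)"

fun q_neg :: "frac \<Rightarrow> frac" where
  "q_neg (p, m, d) = (m, p, d)"

fun q_add :: "frac \<Rightarrow> frac \<Rightarrow> frac" where
  "q_add (p, m, d) (p', m', d') = (p \<^bold>* d' \<^bold>+ p' \<^bold>* d, m \<^bold>* d' \<^bold>+ m' \<^bold>* d, d \<^bold>* d')"

definition q_diff :: "frac \<Rightarrow> frac \<Rightarrow> frac" where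
  "q_diff a b = q_add a (q_neg b)"

fun q_less :: "frac \<Rightarrow> frac \<Rightarrow> fm" where
  "q_less (p, m, d) (p', m', d') = (p \<^bold>* d' \<^bold>+ m' \<^bold>* d \<^bold>< p' \<^bold>* d \<^bold>+ m \<^bold>* d')"

definition q_leq :: "frac \<Rightarrow> frac \<Rightarrow> fm" where
  "q_leq a b = (\<^bold>\<not> q_less b a)"

definition q_abs_less :: "frac \<Rightarrow> frac \<Rightarrow> fm" where
  "q_abs_less a b = (q_less a b \<^bold>\<and> q_less (q_neg a) b)"

definition q_abs_leq :: "frac \<Rightarrow> frac \<Rightarrow> fm" where
  "q_abs_leq a b = (q_leq a b \<^bold>\<and> q_leq (q_neg a) b)"

text \<open>\<open>2 ^ t\<close> as \<open>R\<^sub>0(\<lambda>n m. m + m, 1, t)\<close>; \<open>double_tm\<close> is \<open>\<lambda>m. m + m\<close>.\<close>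

definition double_tm :: tm where
  "double_tm = Const (CombS Nt Nt Nt) \<cdot> Const Plus \<cdot>
     (Const (CombS Nt ty1 Nt) \<cdot> Const (CombK Nt ty1) \<cdot> Const (CombK Nt Nt))"

definition pow2_tm :: "tm \<Rightarrow> tm" where
  "pow2_tm t = Const Rec0 \<cdot> (Const (CombK ty1 Nt) \<cdot> double_tm) \<cdot> \<^bold>1 \<cdot> t"

text \<open>The rationals \<open>2\<^sup>-\<^sup>t\<close> and \<open>2\<^sup>-\<^sup>t\<^sup>+\<^sup>1\<close>.\<close>

definition q_exp :: "tm \<Rightarrow> frac" where "q_exp t = (\<^bold>1, \<^bold>0, pow2_tm t)"
definition q_exp1 :: "tm \<Rightarrow> frac" where "q_exp1 t = (\<^bold>1 \<^bold>+ \<^bold>1, \<^bold>0, pow2_tm t)"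

text \<open>\<open>is_pair k n d\<close> says \<open>k = prod_encode (n, d)\<close>; the coding of rationals is the one of
  \<open>rat_of_code\<close>.  \<open>with_rat k \<Phi>\<close> says that the rational coded by \<open>k\<close> satisfies \<open>\<Phi>\<close>.\<close>

definition is_pair :: "tm \<Rightarrow> tm \<Rightarrow> tm \<Rightarrow> fm" where
  "is_pair k n d = (k \<^bold>+ k \<^bold>= (n \<^bold>+ d) \<^bold>* (n \<^bold>+ d \<^bold>+ \<^bold>1) \<^bold>+ (n \<^bold>+ n))"

definition is_rat :: "tm \<Rightarrow> tm \<Rightarrow> tm \<Rightarrow> tm \<Rightarrow> fm" where
  "is_rat k p m d = (\<^bold>\<exists>\<^sub>0n. is_pair k n d \<^bold>\<and>
     ((n \<^bold>= p \<^bold>+ p \<^bold>\<and> m \<^bold>= \<^bold>0) \<^bold>\<or> (n \<^bold>+ \<^bold>1 \<^bold>= m \<^bold>+ m \<^bold>\<and> p \<^bold>= \<^bold>0)))"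

definition with_rat :: "tm \<Rightarrow> (frac \<Rightarrow> fm) \<Rightarrow> fm" where
  "with_rat k \<Phi> = (\<^bold>\<exists>\<^sub>0p. \<^bold>\<exists>\<^sub>0m. \<^bold>\<exists>\<^sub>0d. is_rat k p m d \<^bold>\<and> \<Phi> (p, m, d \<^bold>+ \<^bold>1))"

definition is_real :: "tm \<Rightarrow> fm" where
  "is_real x = (\<^bold>\<forall>\<^sub>0n. \<^bold>\<forall>\<^sub>0i. with_rat (x \<cdot> n) (\<lambda>a. with_rat (x \<cdot> (n \<^bold>+ i)) (\<lambda>b.
     q_abs_less (q_diff a b) (q_exp n))))"

definition real_eq :: "tm \<Rightarrow> tm \<Rightarrow> fm" where
  "real_eq x y = (\<^bold>\<forall>\<^sub>0n. with_rat (x \<cdot> n) (\<lambda>a. with_rat (y \<cdot> n) (\<lambda>b.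
     q_abs_leq (q_diff a b) (q_exp1 n))))"

definition real_less :: "tm \<Rightarrow> tm \<Rightarrow> fm" where
  "real_less x y = (\<^bold>\<exists>\<^sub>0n. with_rat (x \<cdot> n) (\<lambda>a. with_rat (y \<cdot> n) (\<lambda>b.
     q_less (q_add a (q_exp1 n)) b)))"

definition real_leq :: "tm \<Rightarrow> tm \<Rightarrow> fm" where
  "real_leq x y = (\<^bold>\<not> real_less y x)"

text \<open>\<open>\<bar>x - y\<bar> < r\<close> for reals \<open>x\<close>, \<open>y\<close> and a rational \<open>r\<close>: the \<open>n\<close>-th approximations are within
  \<open>2\<^sup>-\<^sup>n\<close> of \<open>x\<close> and \<open>y\<close>.\<close>

definition dist_less :: "tm \<Rightarrow> tm \<Rightarrow> frac \<Rightarrow> fm" where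
  "dist_less x y r = (\<^bold>\<exists>\<^sub>0n. with_rat (x \<cdot> n) (\<lambda>a. with_rat (y \<cdot> n) (\<lambda>b.
     q_abs_less (q_diff a b) (q_diff r (q_exp1 n)))))"

text \<open>The constant sequence of the rational with code \<open>k\<close>; the codes of 0 and 1 are
  \<open>prod_encode (0, 0) = 0\<close> and \<open>prod_encode (2, 0) = 5\<close>.\<close>

definition const_real :: "tm \<Rightarrow> tm" where
  "const_real k = Const (CombK Nt Nt) \<cdot> k"

definition real_zero :: tm where "real_zero = const_real \<^bold>0"
definition real_one :: tm where "real_one = const_real (\<^bold>1 \<^bold>+ \<^bold>1 \<^bold>+ \<^bold>1 \<^bold>+ \<^bold>1 \<^bold>+ \<^bold>1)"

definition allR :: "(tm \<Rightarrow> fm) \<Rightarrow> fm"  (binder "\<^bold>\<forall>\<^sub>R" 10) where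
  "allR F = (\<^bold>\<forall>\<^sub>1x. is_real x \<^bold>\<longrightarrow> F x)"

definition real_fun :: "tm \<Rightarrow> fm" where
  "real_fun Y = ((\<^bold>\<forall>\<^sub>Rx. is_real (Y \<cdot> x)) \<^bold>\<and>
     (\<^bold>\<forall>\<^sub>Rx. \<^bold>\<forall>\<^sub>Ry. real_eq x y \<^bold>\<longrightarrow> real_eq (Y \<cdot> x) (Y \<cdot> y)))"

definition mem :: "tm \<Rightarrow> tm \<Rightarrow> fm" where
  "mem x Y = real_less real_zero (Y \<cdot> x)"

definition ball_subset :: "tm \<Rightarrow> frac \<Rightarrow> (tm \<Rightarrow> fm) \<Rightarrow> fm" where
  "ball_subset x r P = (\<^bold>\<forall>\<^sub>Ry. dist_less x y r \<^bold>\<longrightarrow> P y)"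

definition is_open :: "(tm \<Rightarrow> fm) \<Rightarrow> fm" where
  "is_open P = (\<^bold>\<forall>\<^sub>Rx. P x \<^bold>\<longrightarrow>
     (\<^bold>\<exists>\<^sub>0k. with_rat k (\<lambda>r. q_less q_zero r \<^bold>\<and> ball_subset x r P)))"

definition open_set :: "tm \<Rightarrow> fm" where
  "open_set Y = (real_fun Y \<^bold>\<and> is_open (\<lambda>x. mem x Y))"

definition closed_set :: "tm \<Rightarrow> fm" where
  "closed_set Y = (real_fun Y \<^bold>\<and> is_open (\<lambda>x. \<^bold>\<not> mem x Y))"

definition cont_fun :: "tm \<Rightarrow> fm" where
  "cont_fun g = (real_fun g \<^bold>\<and>
     (\<^bold>\<forall>\<^sub>Rx. \<^bold>\<forall>\<^sub>0k. \<^bold>\<exists>\<^sub>0l. \<^bold>\<forall>\<^sub>Ry. dist_less x y (q_exp l) \<^bold>\<longrightarrow> dist_less (g \<cdot> x) (g \<cdot> y) (q_exp k)))"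

definition URY :: fm where
  "URY = (\<^bold>\<forall>\<^sub>1\<^sub>1C\<^sub>0. \<^bold>\<forall>\<^sub>1\<^sub>1C\<^sub>1.
     closed_set C\<^sub>0 \<^bold>\<and> closed_set C\<^sub>1 \<^bold>\<and> (\<^bold>\<forall>\<^sub>Rx. \<^bold>\<not> (mem x C\<^sub>0 \<^bold>\<and> mem x C\<^sub>1)) \<^bold>\<longrightarrow>
     (\<^bold>\<exists>\<^sub>1\<^sub>1g. cont_fun g \<^bold>\<and>
        (\<^bold>\<forall>\<^sub>Rx. real_leq real_zero (g \<cdot> x) \<^bold>\<and> real_leq (g \<cdot> x) real_one) \<^bold>\<and>
        (\<^bold>\<forall>\<^sub>Rx. (mem x C\<^sub>0 \<^bold>\<longleftrightarrow> real_eq (g \<cdot> x) real_zero) \<^bold>\<and>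
              (mem x C\<^sub>1 \<^bold>\<longleftrightarrow> real_eq (g \<cdot> x) real_one))))"

text \<open>
  The enumeration \<open>(q\<^sub>n, r\<^sub>n)\<close>: for \<open>n = prod_encode (k, prod_encode (a, b))\<close>, \<open>q\<^sub>n\<close> is the rational
  with code \<open>k\<close> and \<open>r\<^sub>n = (a + 1) / (b + 1)\<close>.
\<close>

definition nth_ball_subset :: "tm \<Rightarrow> (tm \<Rightarrow> fm) \<Rightarrow> fm" where
  "nth_ball_subset n P = (\<^bold>\<exists>\<^sub>0k. \<^bold>\<exists>\<^sub>0l. \<^bold>\<exists>\<^sub>0a. \<^bold>\<exists>\<^sub>0b. is_pair n k l \<^bold>\<and> is_pair l a b \<^bold>\<and>
     ball_subset (const_real k) (a \<^bold>+ \<^bold>1, \<^bold>0, b \<^bold>+ \<^bold>1) P)"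

text \<open>Subsets of the natural numbers are given by characteristic functions.\<close>

definition OPEN :: fm where
  "OPEN = (\<^bold>\<forall>\<^sub>1\<^sub>1Y. open_set Y \<^bold>\<longrightarrow>
     (\<^bold>\<exists>\<^sub>1X. (\<^bold>\<forall>\<^sub>0n. X \<cdot> n \<^bold>\<le> \<^bold>1) \<^bold>\<and>
        (\<^bold>\<forall>\<^sub>0n. X \<cdot> n \<^bold>= \<^bold>1 \<^bold>\<longleftrightarrow> nth_ball_subset n (\<lambda>x. mem x Y))))"

end

theory Submission
  imports Defs "HOL-Library.Countable" "HOL-Computational_Algebra.Fraction_Field"
begin

text \<open>
  Suppose that open sets \<open>U\<^sub>0\<close>, \<open>U\<^sub>1\<close> cover the line and are given as unions of balls \<open>B(a\<^sub>n, r\<^sub>n)\<close>.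
  With \<open>d\<^sub>i(x) = sup\<^sub>n (r\<^sub>n - \<bar>x - a\<^sub>n\<bar>)\<close>, cut off at 0 and 1, the quotient \<open>d\<^sub>0 / (d\<^sub>0 + d\<^sub>1)\<close> is continuous, is 0
  exactly outside \<open>U\<^sub>0\<close> and 1 exactly outside \<open>U\<^sub>1\<close>, and its cuts are arithmetical, hence computable from
  \<open>\<mu>\<close>.  Conversely, a Urysohn function \<open>g\<close> for the complement of \<open>Y\<close> and \<open>{x}\<close> gives a ball around
  \<open>x\<close> inside \<open>Y\<close> by searching for a rational radius on which \<open>g > 1/3\<close> at all rational points; and a
  ball lies in \<open>Y\<close> iff \<open>g\<close> is bounded below on the rational points of each smaller closed interval,
  by compactness.

  These arguments only use arithmetical definitions over a discretely ordered semiring with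
  induction for them, so they are carried out once for computability in \<open>\<mu>\<close> and for definability in
  a model of \<open>ACA0w\<close>, whose numbers may be nonstandard.  The equivalence then follows from
  completeness: were it unprovable, it would fail in an extensional Henkin model.
\<close>

section \<open>Uniform Kleene computability\<close>

text \<open>The functional \<mu> decides quantifiers over numbers but not over reals, and this
  shapes every construction. Functions are tested at rational points only, continuity carries the
  result to all reals, and where a quantifier over the reals of a ball remains, compactness replaces
  it. Reals are handled through their cuts, and a new real arises only as the supremum of a
  decidable cut, because in a nonstandard model nothing guarantees other suprema or other
  inductions. The quotient of distances is continuous because the two sets cover the line: near a
  given point one distance stays above some \<open>k\<close>, which keeps the denominator away from
  0.

  The index in the theorem precedes the functionals, so computability is stated for functions of
  argument lists of fixed sorts, with one index for all lists. In both instances the numbers are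
  embedded in an ordered field, where the algebra of HOL is available for rationals. For a model
  this needs a type built from its numbers; the term model and its quotient therefore both live on
  the fixed type \<open>tm\<close>.\<close>

declare list_encode.simps [simp del]

text \<open>\<open>SMu\<close> has the single value \<open>Fun2 Feferman_mu\<close>. A sort list
  that contains it describes computability relative to \<mu>, with the oracle at a known
  position.\<close>

datatype srt = SNum | SFun1 | SFun2 | SFun3 | SMu

fun fits :: "srt => arg => bool" where
  "fits SNum a \<longleftrightarrow> (\<exists>n. a = Num n)"
| "fits SFun1 a \<longleftrightarrow> (\<exists>f. a = Fun1 f)"
| "fits SFun2 a \<longleftrightarrow> (\<exists>F. a = Fun2 F)"
| "fits SFun3 a \<longleftrightarrow> (\<exists>Z. a = Fun3 Z)"
| "fits SMu a \<longleftrightarrow> a = Fun2 Feferman_mu"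

abbreviation fit :: "srt list => arg list => bool" where "fit \<equiv> list_all2 fits"

primrec (nonexhaustive) num_of :: "arg => nat" where "num_of (Num n) = n"
primrec (nonexhaustive) fun1_of :: "arg => nat => nat" where "fun1_of (Fun1 f) = f"
primrec (nonexhaustive) fun2_of :: "arg => (nat => nat) => nat" where "fun2_of (Fun2 F) = F"
primrec (nonexhaustive) fun3_of :: "arg => ((nat => nat) => nat) => nat" where "fun3_of (Fun3 Z) = Z"

text \<open>One index serves all lists of the given sorts, since the theorem fixes the index before
  the functionals. Totality on these lists is included because S8 hands only total arguments to a
  functional.\<close>

definition ucomp :: "srt list => (arg list => nat) => bool" where
  "ucomp \<Gamma> f \<longleftrightarrow> (\<exists>e. \<forall>as. fit \<Gamma> as --> kleene e as (f as))"

lemma ucomp_cong: "ucomp \<Gamma> f ==> (!!as. fit \<Gamma> as ==> f as = g as) ==> ucomp \<Gamma> g"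
  unfolding ucomp_def by metis

lemma fit_length: "fit \<Gamma> as ==> length as = length \<Gamma>"
  by (simp add: list_all2_lengthD)

lemma ucomp_const: "ucomp \<Gamma> (%_. n)"
  unfolding ucomp_def using S2 by blast

lemma ucomp_let:
  assumes "ucomp \<Gamma> f" "ucomp (SNum # \<Gamma>) g"
  shows "ucomp \<Gamma> (%as. g (Num (f as) # as))"
proof -
  obtain c d where "\<forall>as. fit \<Gamma> as --> kleene c as (f as)"
    "\<forall>as. fit (SNum # \<Gamma>) as --> kleene d as (g as)"
    using assms unfolding ucomp_def by blast
  then have "\<forall>as. fit \<Gamma> as --> kleene (list_encode [4, c, d]) as (g (Num (f as) # as))"
    by (auto intro!: S4)
  then show ?thesis unfolding ucomp_def by blast
qed

lemma ucomp_hd: "ucomp (SNum # \<Gamma>) (%as. num_of (hd as))"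
  unfolding ucomp_def by (intro exI[of _ "list_encode [3]"]) (auto simp: list_all2_Cons1 intro: S3)

lemma ucomp_Suc_hd: "ucomp (SNum # \<Gamma>) (%as. Suc (num_of (hd as)))"
  unfolding ucomp_def by (intro exI[of _ "list_encode [1]"]) (auto simp: list_all2_Cons1 intro: S1[unfolded One_nat_def])

text \<open>Weakening at the end: S4 with a constant function puts the index \<open>e\<close> of
  \<open>f\<close> in front as a number, and S9 then runs it on the first
  \<open>length \<Gamma>\<close> arguments alone.\<close>

lemma ucomp_take:
  assumes "ucomp \<Gamma> f"
  shows "ucomp (\<Gamma> @ \<Delta>) (%as. f (take (length \<Gamma>) as))"
proof -
  obtain e where e: "\<forall>as. fit \<Gamma> as --> kleene e as (f as)"
    using assms unfolding ucomp_def by blast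
  have "kleene (list_encode [4, list_encode [2, e], list_encode [9, length \<Gamma>]]) as (f (take (length \<Gamma>) as))"
    if "fit (\<Gamma> @ \<Delta>) as" for as
  proof (rule S4[OF S2], rule S9)
    have "fit \<Gamma> (take (length \<Gamma>) as)" using that
      by (metis append_eq_conv_conj list_all2_append1 list_all2_lengthD)
    then show "kleene e (take (length \<Gamma>) as) (f (take (length \<Gamma>) as))" using e by blast
    show "length \<Gamma> <= length as" using fit_length[OF that] by simp
  qed
  then show ?thesis unfolding ucomp_def by blast
qed

lemma ucomp_move:
  assumes "ucomp (\<Gamma> ! k # take k \<Gamma> @ drop (Suc k) \<Gamma>) f" "k < length \<Gamma>"
  shows "ucomp \<Gamma> (%as. f (as ! k # take k as @ drop (Suc k) as))"
proof -
  obtain e where e: "\<forall>as. fit (\<Gamma> ! k # take k \<Gamma> @ drop (Suc k) \<Gamma>) as --> kleene e as (f as)"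
    using assms unfolding ucomp_def by blast
  have "kleene (list_encode [6, k, e]) as (f (as ! k # take k as @ drop (Suc k) as))"
    if "fit \<Gamma> as" for as
  proof (rule S6)
    show "k < length as" using that assms(2) fit_length by simp
    have "fit (\<Gamma> ! k # take k \<Gamma> @ drop (Suc k) \<Gamma>) (as ! k # take k as @ drop (Suc k) as)"
      using that assms(2) by (auto simp: list_all2_nthD list_all2_takeI list_all2_dropI intro!: list_all2_appendI)
    then show "kleene e (as ! k # take k as @ drop (Suc k) as) (f (as ! k # take k as @ drop (Suc k) as))"
      using e by blast
  qed
  then show ?thesis unfolding ucomp_def by blast
qed

text \<open>S6 moves entry \<open>k\<close> to the front, which rotates the first
  \<open>k + 1\<close> entries by \<open>k\<close>. Rotations of an initial segment are used because
  powers of such a move contain its inverse, which no scheme provides directly.\<close>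

definition rotp :: "nat => nat => 'a list => 'a list" where
  "rotp k m xs = rotate k (take m xs) @ drop m xs"

lemma rotp_length [simp]: "length (rotp k m xs) = length xs"
  by (simp add: rotp_def)

lemma rotp_rotp: "rotp j m (rotp k m xs) = rotp (j + k) m xs"
proof (cases "m <= length xs")
  case True
  then show ?thesis by (simp add: rotp_def rotate_rotate min_def)
qed (simp add: rotp_def rotate_rotate)

lemma rotp_move: "k < length xs ==> xs ! k # take k xs @ drop (Suc k) xs = rotp k (Suc k) xs"
proof -
  assume "k < length xs"
  then have "take (Suc k) xs = take k xs @ [xs ! k]" by (simp add: take_Suc_conv_app_nth)
  moreover have "length (take k xs) = k" using \<open>k < length xs\<close> by simp
  ultimately show ?thesis unfolding rotp_def
    by (metis append.assoc append_Cons append_Nil rotate_append)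
qed

text \<open>Modulo \<open>m\<close> the number \<open>m - 1\<close> is -1 and has square 1. Hence
  \<open>(m - 1) * k\<close> applications of the rotation by \<open>m - 1\<close>, the one that S6
  offers, amount to a rotation by \<open>k\<close>.\<close>

lemma rotp_square:
  assumes "0 < m" "m <= length xs"
  shows "rotp ((m - 1) * ((m - 1) * k)) m xs = rotp k m xs"
proof -
  obtain q where m: "m = Suc q" using assms(1) gr0_implies_Suc by blast
  have "q * (q * k) + k * (q + 1) = k + (q + 1) * (q * k)" by (simp add: algebra_simps)
  then have "(q * (q * k)) mod (q + 1) = k mod (q + 1)"
    by (metis mod_mult_self1 mod_mult_self2)
  then have "rotate (q * (q * k)) (take m xs) = rotate k (take m xs)"
    using m assms(2)
    by (subst (1 2) rotate_conv_mod) simp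
  then show ?thesis using m by (simp add: rotp_def)
qed

text \<open>Moving the entry with index \<open>m - 1\<close> to the front rotates the first \<open>m\<close> entries by
  \<open>m - 1\<close>, and \<open>m - 1\<close> generates the integers modulo \<open>m\<close>.\<close>

lemma ucomp_rotp:
  assumes "ucomp (rotp k m \<Gamma>) f" "0 < m" "m <= length \<Gamma>"
  shows "ucomp \<Gamma> (%as. f (rotp k m as))"
proof -
  have step: "ucomp \<Gamma> (%as. f (rotp (m - 1) m as))"
    if "ucomp (rotp (m - 1) m \<Gamma>) f" "m <= length \<Gamma>" for f and \<Gamma> :: "srt list"
  proof -
    obtain q where m: "m = Suc q" using assms(2) gr0_implies_Suc by blast
    have "ucomp \<Gamma> (%as. f (as ! q # take q as @ drop (Suc q) as))"
      using that m rotp_move[of q \<Gamma>] by (intro ucomp_move) auto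
    then show ?thesis
      by (rule ucomp_cong) (use that m in \<open>auto simp: rotp_move dest!: fit_length\<close>)
  qed
  have iter: "ucomp (rotp ((m - 1) * j) m \<Gamma>) f ==> ucomp \<Gamma> (%as. f (rotp ((m - 1) * j) m as))" for j f
  proof (induction j arbitrary: f)
    case (Suc j)
    have "ucomp (rotp ((m - 1) * j) m \<Gamma>) (%as. f (rotp (m - 1) m as))"
      by (rule step) (use Suc.prems assms in \<open>auto simp: rotp_rotp\<close>)
    from Suc.IH[OF this] show ?case by (simp add: rotp_rotp)
  next
    case 0
    then show ?case by (simp add: rotp_def)
  qed
  have "ucomp \<Gamma> (%as. f (rotp ((m - 1) * ((m - 1) * k)) m as))"
    using iter[of "(m - 1) * k" f] rotp_square[OF assms(2,3)] assms(1) by simp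
  then show ?thesis
    by (rule ucomp_cong) (use assms in \<open>auto simp: rotp_square[unfolded One_nat_def] dest!: fit_length\<close>)
qed

lemma rotp_one: "rotp 1 (Suc (length xs)) (x # xs) = xs @ [x]"
  by (simp add: rotp_def)

lemma ucomp_snoc_front:
  assumes "ucomp (\<Gamma> @ [s]) f" shows "ucomp (s # \<Gamma>) (%as. f (tl as @ [hd as]))"
proof -
  have "ucomp (s # \<Gamma>) (%as. f (rotp 1 (Suc (length \<Gamma>)) as))"
    by (rule ucomp_rotp) (use assms rotp_one[of \<Gamma> s] in auto)
  then show ?thesis
  proof (rule ucomp_cong)
    fix as assume "fit (s # \<Gamma>) as"
    then obtain a bs where "as = a # bs" "length bs = length \<Gamma>"
      by (auto simp: list_all2_Cons1 dest: fit_length)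
    then show "f (rotp 1 (Suc (length \<Gamma>)) as) = f (tl as @ [hd as])"
      using rotp_one[of bs a] by simp
  qed
qed

lemma ucomp_butlast:
  assumes "ucomp \<Gamma> f" shows "ucomp (\<Gamma> @ [s]) (%as. f (butlast as))"
  by (rule ucomp_cong[OF ucomp_take[OF assms]]) (auto dest!: fit_length simp: butlast_conv_take)

lemma ucomp_tl:
  assumes "ucomp \<Gamma> f" shows "ucomp (s # \<Gamma>) (%as. f (tl as))"
  using ucomp_snoc_front[OF ucomp_butlast[OF assms]] by simp

lemma ucomp_last: "ucomp (\<Gamma> @ [SNum]) (%as. num_of (last as))"
proof -
  have "ucomp (\<Gamma> @ [SNum]) (%as. num_of (hd (rotp (length \<Gamma>) (Suc (length \<Gamma>)) as)))"
    by (rule ucomp_rotp) (auto simp: rotp_def rotate_append intro: ucomp_hd)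
  then show ?thesis
  proof (rule ucomp_cong)
    fix as assume "fit (\<Gamma> @ [SNum]) as"
    then obtain bs b where "as = bs @ [b]" "length bs = length \<Gamma>"
      by (auto simp: list_all2_append1 list_all2_Cons1 dest: fit_length)
    then show "num_of (hd (rotp (length \<Gamma>) (Suc (length \<Gamma>)) as)) = num_of (last as)"
      using rotate_append[of bs "[b]"] by (simp add: rotp_def)
  qed
qed

lemma ucomp_rec:
  assumes "ucomp \<Gamma> f" "ucomp (SNum # SNum # \<Gamma>) g"
  shows "ucomp (SNum # \<Gamma>)
    (%as. rec_nat (f (tl as)) (%n u. g (Num n # Num u # tl as)) (num_of (hd as)))"
proof -
  obtain c d where c: "\<forall>as. fit \<Gamma> as --> kleene c as (f as)"
    and d: "\<forall>as. fit (SNum # SNum # \<Gamma>) as --> kleene d as (g as)"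
    using assms unfolding ucomp_def by blast
  have "kleene (list_encode [5, c, d]) (Num n # as)
      (rec_nat (f as) (%n u. g (Num n # Num u # as)) n)" if "fit \<Gamma> as" for as n
    by (induction n) (use c d that in \<open>auto intro!: S5_0 intro: S5_Suc\<close>)
  then show ?thesis unfolding ucomp_def
    by (intro exI[of _ "list_encode [5, c, d]"]) (auto simp: list_all2_Cons1)
qed

section \<open>Calling the functional arguments by S7 and S8\<close>

lemma nth_split: "j < length xs ==> \<exists>ys z zs. xs = ys @ z # zs \<and> length ys = j"
  by (metis id_take_nth_drop length_take min.absorb4)

text \<open>Brings entry \<open>j\<close> to the front, where S7 and S8 expect the functional that is called, and
  restores the order of the arguments in the subcomputation.\<close>

lemma ucomp_restore:
  assumes "ucomp (\<Gamma> @ [s]) g" "j < length \<Gamma>"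
  shows "ucomp (\<Gamma> ! j # s # take j \<Gamma> @ drop (Suc j) \<Gamma>)
    (%as. g (take j (tl (tl as)) @ hd as # drop j (tl (tl as)) @ [as ! 1]))"
proof -
  obtain A z B where G: "\<Gamma> = A @ z # B" "length A = j"
    using nth_split[OF assms(2)] by blast
  have 1: "ucomp (z # A @ B @ [s]) (%as. g (rotp 1 (Suc j) as))"
    by (rule ucomp_rotp) (use assms G in \<open>auto simp: rotp_def\<close>)
  have 2: "ucomp (s # z # A @ B) (%as. g (rotp 1 (Suc j) (tl as @ [hd as])))"
    using ucomp_snoc_front[of "z # A @ B" s] 1 by simp
  have 3: "ucomp (z # s # A @ B) (%as. g (rotp 1 (Suc j) (tl (rotp 1 2 as) @ [hd (rotp 1 2 as)])))"
    by (rule ucomp_rotp) (use 2 in \<open>auto simp: rotp_def\<close>)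
  have "ucomp (\<Gamma> ! j # s # take j \<Gamma> @ drop (Suc j) \<Gamma>)
     (%as. g (rotp 1 (Suc j) (tl (rotp 1 2 as) @ [hd (rotp 1 2 as)])))"
    using 3 G by (auto simp: nth_append)
  then show ?thesis
  proof (rule ucomp_cong)
    fix as assume "fit (\<Gamma> ! j # s # take j \<Gamma> @ drop (Suc j) \<Gamma>) as"
    then obtain x y cs where as: "as = x # y # cs" "length cs = length A + length B"
      using G by (auto simp: list_all2_Cons1 dest!: fit_length)
    show "g (rotp 1 (Suc j) (tl (rotp 1 2 as) @ [hd (rotp 1 2 as)])) =
        g (take j (tl (tl as)) @ hd as # drop j (tl (tl as)) @ [as ! 1])"
      using as G by (simp add: rotp_def)
  qed
qed

text \<open>S7 wants the function before its argument. The argument, computed by S4, already stands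
  in front, so S6 fetches the function from position \<open>Suc j\<close>.\<close>

lemma ucomp_fun1:
  assumes "ucomp \<Gamma> f" "j < length \<Gamma>" "\<Gamma> ! j = SFun1"
  shows "ucomp \<Gamma> (%as. fun1_of (as ! j) (f as))"
proof -
  have "ucomp (SFun1 # SNum # \<Delta>) (%as. fun1_of (hd as) (num_of (as ! 1)))" for \<Delta>
    unfolding ucomp_def by (intro exI[of _ "list_encode [7]"]) (auto simp: list_all2_Cons1 intro: S7)
  then have "ucomp (SNum # \<Gamma>) (%as. (%as. fun1_of (hd as) (num_of (as ! 1)))
      (as ! Suc j # take (Suc j) as @ drop (Suc (Suc j)) as))"
    by (intro ucomp_move) (use assms in auto)
  from ucomp_let[OF assms(1) this] show ?thesis by simp
qed

lemma fit_insert: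
  assumes "fit \<Gamma> as" "fits s a" "j < length \<Gamma>"
  shows "fit (\<Gamma> ! j # s # take j \<Gamma> @ drop (Suc j) \<Gamma>) (as ! j # a # take j as @ drop (Suc j) as)"
  using assms by (auto simp: list_all2_nthD list_all2_takeI list_all2_dropI intro!: list_all2_appendI)

lemma ucomp_fun2:
  assumes "ucomp (\<Gamma> @ [SNum]) g" "j < length \<Gamma>" "\<Gamma> ! j \<in> {SFun2, SMu}"
  shows "ucomp \<Gamma> (%as. fun2_of (as ! j) (%n. g (as @ [Num n])))"
proof -
  obtain c where c: "\<forall>as. fit (\<Gamma> ! j # SNum # take j \<Gamma> @ drop (Suc j) \<Gamma>) as --> kleene c as
     (g (take j (tl (tl as)) @ hd as # drop j (tl (tl as)) @ [as ! 1]))"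
    using ucomp_restore[OF assms(1,2)] unfolding ucomp_def by blast
  have "kleene (list_encode [6, j, list_encode [8, c]]) as (fun2_of (as ! j) (%n. g (as @ [Num n])))"
    if "fit \<Gamma> as" for as
  proof (rule S6)
    show "j < length as" using that assms(2) fit_length by simp
    then obtain A b B where as: "as = A @ b # B" "length A = j"
      using nth_split by blast
    have "fits (\<Gamma> ! j) (as ! j)" using that assms(2) by (simp add: list_all2_nthD)
    then obtain F where F: "as ! j = Fun2 F" using assms(3) by auto
    have "kleene c (Fun2 F # Num n # take j as @ drop (Suc j) as) (g (as @ [Num n]))" for n
      using c[rule_format, OF fit_insert[OF that, of SNum "Num n" j]] assms(2) F as(1) as(2)[symmetric] by simp
    then show "kleene (list_encode [8, c]) (as ! j # take j as @ drop (Suc j) as)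
        (fun2_of (as ! j) (%n. g (as @ [Num n])))"
      unfolding F fun2_of.simps by (rule S8_2)
  qed
  then show ?thesis unfolding ucomp_def by blast
qed

lemma ucomp_fun3:
  assumes "ucomp (\<Gamma> @ [SFun1]) g" "j < length \<Gamma>" "\<Gamma> ! j = SFun3"
  shows "ucomp \<Gamma> (%as. fun3_of (as ! j) (%h. g (as @ [Fun1 h])))"
proof -
  obtain c where c: "\<forall>as. fit (\<Gamma> ! j # SFun1 # take j \<Gamma> @ drop (Suc j) \<Gamma>) as --> kleene c as
     (g (take j (tl (tl as)) @ hd as # drop j (tl (tl as)) @ [as ! 1]))"
    using ucomp_restore[OF assms(1,2)] unfolding ucomp_def by blast
  have "kleene (list_encode [6, j, list_encode [8, c]]) as (fun3_of (as ! j) (%h. g (as @ [Fun1 h])))"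
    if "fit \<Gamma> as" for as
  proof (rule S6)
    show "j < length as" using that assms(2) fit_length by simp
    then obtain A b B where as: "as = A @ b # B" "length A = j"
      using nth_split by blast
    have "fits (\<Gamma> ! j) (as ! j)" using that assms(2) by (simp add: list_all2_nthD)
    then obtain F where F: "as ! j = Fun3 F" using assms(3) by auto
    have "kleene c (Fun3 F # Fun1 h # take j as @ drop (Suc j) as) (g (as @ [Fun1 h]))" for h
      using c[rule_format, OF fit_insert[OF that, of SFun1 "Fun1 h" j]] assms(2) F as(1) as(2)[symmetric] by simp
    then show "kleene (list_encode [8, c]) (as ! j # take j as @ drop (Suc j) as)
        (fun3_of (as ! j) (%h. g (as @ [Fun1 h])))"
      unfolding F fun3_of.simps by (rule S8_3)
  qed
  then show ?thesis unfolding ucomp_def by blast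
qed

section \<open>Number-theoretic functions by primitive recursion\<close>

definition ucomp2 :: "(nat => nat => nat) => bool" where
  "ucomp2 h \<longleftrightarrow> ucomp [SNum, SNum] (%as. h (num_of (as ! 0)) (num_of (as ! 1)))"

text \<open>By \<open>ucomp_take\<close> the index for \<open>h\<close> can be run in front of
  arbitrary further arguments; two uses of S4 then supply its two numbers.\<close>

lemma ucomp_comp2:
  assumes "ucomp2 h" "ucomp \<Gamma> f" "ucomp \<Gamma> g"
  shows "ucomp \<Gamma> (%as. h (f as) (g as))"
proof -
  have "ucomp ([SNum, SNum] @ \<Gamma>) (%as. h (num_of (as ! 0)) (num_of (as ! 1)))"
    by (rule ucomp_cong[OF ucomp_take[OF assms(1)[unfolded ucomp2_def]]]) (auto dest: fit_length)
  then have "ucomp (SNum # \<Gamma>) (%as. h (f (tl as)) (num_of (hd as)))"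
    using ucomp_let[OF ucomp_tl[OF assms(2)]]
    by (force intro: ucomp_cong simp: list_all2_Cons1)
  from ucomp_let[OF assms(3) this] show ?thesis by simp
qed

lemma ucomp2_rec:
  assumes "ucomp [SNum] (%as. f (num_of (as ! 0)))"
    and "ucomp [SNum, SNum, SNum] (%as. g (num_of (as ! 0)) (num_of (as ! 1)) (num_of (as ! 2)))"
  shows "ucomp2 (%a b. rec_nat (f b) (%n u. g n u b) a)"
  unfolding ucomp2_def
  by (rule ucomp_cong[OF ucomp_rec[OF assms]]) (auto simp: list_all2_Cons1)

lemma ucomp_nth:
  assumes "j < length \<Gamma>" "\<Gamma> ! j = SNum" shows "ucomp \<Gamma> (%as. num_of (as ! j))"
proof -
  have "ucomp \<Gamma> (%as. (%as. num_of (hd as)) (as ! j # take j as @ drop (Suc j) as))"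
    by (rule ucomp_move) (use assms ucomp_hd in auto)
  then show ?thesis by simp
qed

lemma ucomp2_swap: "ucomp2 h ==> ucomp2 (%a b. h b a)"
  unfolding ucomp2_def[of "%a b. h b a"]
  by (intro ucomp_comp2[where h = h] ucomp_nth) auto

lemma ucomp_Suc: "ucomp \<Gamma> f ==> ucomp \<Gamma> (%as. Suc (f as))"
  using ucomp_let[OF _ ucomp_Suc_hd] by force

lemma ucomp2_add: "ucomp2 (+)"
proof -
  have "ucomp2 (%a b. rec_nat b (%n u. Suc u) a)"
    by (intro ucomp2_rec[where f = "%b. b" and g = "%n u b. Suc u"] ucomp_Suc ucomp_nth) auto
  moreover have "rec_nat b (%n u. Suc u) a = a + b" for a b by (induction a) auto
  ultimately show ?thesis by simp
qed

lemma ucomp2_mult: "ucomp2 (*)"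
proof -
  have "ucomp2 (%a b. rec_nat 0 (%n u. u + b) a)"
    by (intro ucomp2_rec[where f = "%b. 0" and g = "%n u b. u + b"] ucomp_comp2[OF ucomp2_add]
        ucomp_nth ucomp_const) auto
  moreover have "rec_nat 0 (%n u. u + b) a = a * b" for a b by (induction a) auto
  ultimately show ?thesis by simp
qed

text \<open>The predecessor is iterated. The recursion runs on the number that is subtracted, hence
  the exchange of arguments at the end.\<close>

lemma ucomp2_minus: "ucomp2 (-)"
proof -
  have "ucomp2 (%a b. rec_nat 0 (%n u. n) a)"
    by (rule ucomp2_rec[where f = "%b. 0" and g = "%n u b. n"]) (auto intro: ucomp_nth ucomp_const)
  moreover have "rec_nat 0 (%n u. n) a = a - 1" for a by (cases a) auto
  ultimately have pred: "ucomp2 (%a b. a - 1)" by simp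
  have "ucomp2 (%a b. rec_nat b (%n u. u - 1) a)"
    by (intro ucomp2_rec[where f = "%b. b" and g = "%n u b. u - 1"] ucomp_comp2[OF pred _ ucomp_const[of _ 0]]
        ucomp_nth ucomp_const) auto
  moreover have "rec_nat b (%n u. u - 1) a = b - a" for a b by (induction a) auto
  ultimately show ?thesis using ucomp2_swap by fastforce
qed

lemma ucomp_pow2:
  assumes "ucomp \<Gamma> f" shows "ucomp \<Gamma> (%as. 2 ^ f as)"
proof -
  have "ucomp2 (%a b. rec_nat 1 (%n u. u + u) a)"
    by (intro ucomp2_rec[where f = "%b. 1" and g = "%n u b. u + u"] ucomp_comp2[OF ucomp2_add]
        ucomp_nth ucomp_const) auto
  moreover have "rec_nat (1 :: nat) (%n u. u + u) a = 2 ^ a" for a by (induction a) (auto simp: mult_2)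
  ultimately have "ucomp2 (%a b. 2 ^ a)" by simp
  from ucomp_comp2[OF this assms assms] show ?thesis .
qed

section \<open>Arithmetically definable functions\<close>

text \<open>
  \<open>N\<close> is a discretely ordered semiring, possibly nonstandard, inside its field of fractions
  \<open>'k\<close>.  \<open>Df \<Gamma> F\<close> says that \<open>F\<close> is a definable \<open>N\<close>-valued function of lists of values of the
  sorts \<open>\<Gamma>\<close>.  The two instances are Kleene computability relative to Feferman's \<open>\<mu>\<close>, and
  definability in a model of \<open>ACA0w\<close>.
\<close>

locale definability =
  fixes N :: "'k::linordered_field set" and pw :: "'k => 'k"
    and Df :: "'s list => ('v list => 'k) => bool" and fits :: "'s => 'v => bool"
    and okc :: "'s list => bool" and sn :: 's and nv :: "'k => 'v"
  assumes N0: "0 \<in> N" and N1: "1 \<in> N"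
    and Nadd: "a \<in> N ==> b \<in> N ==> a + b \<in> N" and Nmult: "a \<in> N ==> b \<in> N ==> a * b \<in> N"
    and Nnonneg: "a \<in> N ==> 0 <= a" and Npos: "a \<in> N ==> 0 < a ==> 1 <= a"
    and Ndiff: "a \<in> N ==> b \<in> N ==> a <= b ==> b - a \<in> N"
    and Nfrac: "\<exists>p\<in>N. \<exists>m\<in>N. \<exists>d\<in>N. x = (p - m) / (d + 1)"
    and pw0: "pw 0 = 1" and pwS: "n \<in> N ==> pw (n + 1) = 2 * pw n" and pwN: "n \<in> N ==> pw n \<in> N"
    and fits_nv: "n \<in> N ==> fits sn (nv n)"
    and okc_snoc: "okc \<Gamma> ==> okc (\<Gamma> @ [s])"
    and okc_inhabited: "\<exists>\<Gamma> l. okc \<Gamma> \<and> list_all2 fits \<Gamma> l"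
    and Df_N: "Df \<Gamma> F ==> list_all2 fits \<Gamma> l ==> F l \<in> N"
    and Df_const: "okc \<Gamma> ==> c \<in> N ==> Df \<Gamma> (%_. c)"
    and Df_last: "okc \<Gamma> ==> \<exists>F. Df (\<Gamma> @ [sn]) F \<and>
      (\<forall>l n. list_all2 fits \<Gamma> l --> n \<in> N --> F (l @ [nv n]) = n)"
    and Df_weak: "Df \<Gamma> F ==> \<exists>G. Df (\<Gamma> @ [s]) G \<and>
      (\<forall>l a. list_all2 fits \<Gamma> l --> fits s a --> G (l @ [a]) = F l)"
    and Df_sub2: "Df (\<Gamma> @ [sn, sn]) F ==> Df (\<Gamma> @ \<Delta>) G ==> Df (\<Gamma> @ \<Delta>) G' ==>
      \<exists>H. Df (\<Gamma> @ \<Delta>) H \<and> (\<forall>l l'. list_all2 fits \<Gamma> l --> list_all2 fits \<Delta> l' -->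
        H (l @ l') = F (l @ [nv (G (l @ l')), nv (G' (l @ l'))]))"
    and Df_add: "Df \<Gamma> F ==> Df \<Gamma> G ==> Df \<Gamma> (%l. F l + G l)"
    and Df_mult: "Df \<Gamma> F ==> Df \<Gamma> G ==> Df \<Gamma> (%l. F l * G l)"
    and Df_monus: "Df \<Gamma> F ==> Df \<Gamma> G ==> Df \<Gamma> (%l. if G l <= F l then F l - G l else 0)"
    and Df_pw: "Df \<Gamma> F ==> Df \<Gamma> (%l. pw (F l))"
    and Df_mu: "okc \<Gamma> ==> Df (\<Gamma> @ [sn]) F ==> \<exists>G. Df \<Gamma> G \<and> (\<forall>l. list_all2 fits \<Gamma> l -->
      ((\<exists>n\<in>N. F (l @ [nv n]) = 0) -->
        F (l @ [nv (G l)]) = 0 \<and> (\<forall>n\<in>N. F (l @ [nv n]) = 0 --> G l <= n)) \<and>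
      (\<not> (\<exists>n\<in>N. F (l @ [nv n]) = 0) --> G l = 0))"
begin

lemma Nsuc_le: assumes "a \<in> N" "b \<in> N" "a < b" shows "a + 1 <= b"
  using Npos[OF Ndiff[of a b]] assms by simp

lemma N2: "2 \<in> N"
  using Nadd[OF N1 N1] by simp

subsection \<open>Environments\<close>

text \<open>An environment \<open>(\<Gamma>, X, \<pi>)\<close> lays out the elements of \<open>X\<close> as lists of values of sorts \<open>\<Gamma>\<close>.
  A bound variable is appended at the end.\<close>

definition valid :: "'s list \<times> 'x set \<times> ('x => 'v list) => bool" where
  "valid c \<longleftrightarrow> (case c of (\<Gamma>, X, \<pi>) => okc \<Gamma> \<and> (\<forall>x\<in>X. list_all2 fits \<Gamma> (\<pi> x)))"

abbreviation dom :: "'s list \<times> 'x set \<times> ('x => 'v list) => 'x set" where "dom c \<equiv> fst (snd c)"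

text \<open>The values of \<open>F\<close> count on \<open>X\<close> only, so \<open>F\<close> may
  be any HOL function of structured data that becomes definable once the data are laid out as
  lists.\<close>

definition df :: "'s list \<times> 'x set \<times> ('x => 'v list) => ('x => 'k) => bool" where
  "df c F \<longleftrightarrow> valid c \<and> (case c of (\<Gamma>, X, \<pi>) => \<exists>F'. Df \<Gamma> F' \<and> (\<forall>x\<in>X. F x = F' (\<pi> x)))"

definition pushv :: "'s => 'a set => ('a => 'v) => 's list \<times> 'x set \<times> ('x => 'v list) =>
    's list \<times> ('x \<times> 'a) set \<times> ('x \<times> 'a => 'v list)" where
  "pushv s A i c = (case c of (\<Gamma>, X, \<pi>) => (\<Gamma> @ [s], X \<times> A, %p. \<pi> (fst p) @ [i (snd p)]))"

abbreviation push :: "'s list \<times> 'x set \<times> ('x => 'v list) =>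
    's list \<times> ('x \<times> 'k) set \<times> ('x \<times> 'k => 'v list)" where
  "push \<equiv> pushv sn N nv"

text \<open>\<open>c'\<close> arises from \<open>c\<close> by further bound variables, appended at
  the end, and \<open>h\<close> forgets them. This is the situation in which a predicate over
  \<open>c\<close> is instantiated under additional quantifiers.\<close>

definition extends :: "'s list \<times> 'x set \<times> ('x => 'v list) => 's list \<times> 'y set \<times> ('y => 'v list) =>
    ('y => 'x) => bool" where
  "extends c c' h \<longleftrightarrow> valid c \<and> valid c' \<and> (case c of (\<Gamma>, X, \<pi>) => case c' of (\<Gamma>', X', \<pi>') =>
     (\<exists>\<Delta>. \<Gamma>' = \<Gamma> @ \<Delta> \<and> (\<forall>y\<in>X'. h y \<in> X \<and> (\<exists>l. \<pi>' y = \<pi> (h y) @ l \<and> list_all2 fits \<Delta> l))))"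

lemma df_valid: "df c F ==> valid c"
  by (simp add: df_def)

lemma df_cong: "df c F ==> (!!x. x \<in> dom c ==> G x = F x) ==> df c G"
  by (auto simp: df_def split: prod.splits)

lemma df_N: "df c F ==> x \<in> dom c ==> F x \<in> N"
  by (auto simp: df_def valid_def Df_N split: prod.splits)

lemma dom_pushv [simp]: "dom (pushv s A i c) = dom c \<times> A"
  by (cases c) (auto simp: pushv_def)

lemma valid_pushv: "valid c ==> (!!a. a \<in> A ==> fits s (i a)) ==> valid (pushv s A i c)"
  by (cases c) (auto simp: valid_def pushv_def okc_snoc intro!: list_all2_appendI)

lemma valid_push: "valid c ==> valid (push c)"
  by (rule valid_pushv) (auto simp: fits_nv)

lemma df_const: "valid c ==> a \<in> N ==> df c (%x. a)"
  by (auto simp: df_def valid_def split: prod.splits intro!: exI[of _ "%_. a"] Df_const)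

lemma df_map2:
  assumes "!!\<Gamma> F G. Df \<Gamma> F ==> Df \<Gamma> G ==> Df \<Gamma> (%l. f (F l) (G l))" "df c F" "df c G"
  shows "df c (%x. f (F x) (G x))"
proof -
  obtain \<Gamma> X \<pi> where c: "c = (\<Gamma>, X, \<pi>)" by (cases c)
  obtain F' G' where "Df \<Gamma> F'" "\<forall>x\<in>X. F x = F' (\<pi> x)" "Df \<Gamma> G'" "\<forall>x\<in>X. G x = G' (\<pi> x)"
    using assms(2,3) unfolding df_def c by auto
  then have "Df \<Gamma> (%l. f (F' l) (G' l))" "\<forall>x\<in>X. f (F x) (G x) = f (F' (\<pi> x)) (G' (\<pi> x))"
    using assms(1) by auto
  then show ?thesis using df_valid[OF assms(2)] unfolding df_def c by blast
qed

lemma df_add: "df c F ==> df c G ==> df c (%x. F x + G x)"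
  by (rule df_map2[where f = "(+)"]) (rule Df_add)

lemma df_mult: "df c F ==> df c G ==> df c (%x. F x * G x)"
  by (rule df_map2[where f = "(*)"]) (rule Df_mult)

lemma df_monus: "df c F ==> df c G ==> df c (%x. if G x <= F x then F x - G x else 0)"
  by (rule df_map2[where f = "%a b. if b <= a then a - b else 0"]) (rule Df_monus)

lemma df_pw: "df c F ==> df c (%x. pw (F x))"
  by (rule df_map2[where f = "%a b. pw a"]) (rule Df_pw)

lemma df_weakv:
  assumes "df c F" "!!a. a \<in> A ==> fits s (i a)" shows "df (pushv s A i c) (%p. F (fst p))"
proof -
  obtain \<Gamma> X \<pi> where c: "c = (\<Gamma>, X, \<pi>)" by (cases c)
  obtain F' where F': "Df \<Gamma> F'" "\<forall>x\<in>X. F x = F' (\<pi> x)" using assms(1) unfolding df_def c by auto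
  obtain G where G: "Df (\<Gamma> @ [s]) G" "\<forall>l a. list_all2 fits \<Gamma> l --> fits s a --> G (l @ [a]) = F' l"
    using Df_weak[OF F'(1)] by blast
  have "valid (pushv s A i c)" using valid_pushv[OF df_valid[OF assms(1)]] assms(2) by blast
  moreover have "\<forall>x\<in>X. list_all2 fits \<Gamma> (\<pi> x)" using df_valid[OF assms(1)] by (simp add: valid_def c)
  ultimately show ?thesis using G F' assms(2) unfolding df_def c pushv_def by auto
qed

lemma df_weak: "df c F ==> df (push c) (%p. F (fst p))"
  by (rule df_weakv) (auto simp: fits_nv)

lemma df_var: assumes "valid c" shows "df (push c) (%p. snd p)"
proof -
  obtain \<Gamma> X \<pi> where c: "c = (\<Gamma>, X, \<pi>)" by (cases c)
  have v: "okc \<Gamma>" "\<forall>x\<in>X. list_all2 fits \<Gamma> (\<pi> x)" using assms by (auto simp: valid_def c)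
  obtain F where F: "Df (\<Gamma> @ [sn]) F" "\<forall>l n. list_all2 fits \<Gamma> l --> n \<in> N --> F (l @ [nv n]) = n"
    using Df_last[OF v(1)] by blast
  then show ?thesis using valid_push[OF assms] v unfolding df_def c pushv_def by auto
qed

lemma extends_refl: "valid c ==> extends c c (%x. x)"
  by (auto simp: extends_def split: prod.splits)

lemma extends_pushv:
  assumes "extends c c' h" "!!a. a \<in> A ==> fits s (i a)"
  shows "extends c (pushv s A i c') (%p. h (fst p))"
proof -
  obtain \<Gamma> X \<pi> \<Gamma>' X' \<pi>' where c: "c = (\<Gamma>, X, \<pi>)" "c' = (\<Gamma>', X', \<pi>')" by (cases c, cases c')
  obtain \<Delta> where "\<Gamma>' = \<Gamma> @ \<Delta>"
    "!!y. y \<in> X' ==> h y \<in> X \<and> (\<exists>l. \<pi>' y = \<pi> (h y) @ l \<and> list_all2 fits \<Delta> l)"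
    using assms(1) unfolding extends_def c by auto
  moreover have "valid c" "valid c'" using assms(1) by (auto simp: extends_def)
  moreover from this have "valid (pushv s A i c')" using valid_pushv assms(2) by blast
  ultimately show ?thesis using assms(2) unfolding extends_def c pushv_def
    by (fastforce intro!: exI[of _ "\<Delta> @ [s]"] list_all2_appendI)
qed

lemma extends_push: "extends c c' h ==> extends c (push c') (%p. h (fst p))"
  by (rule extends_pushv) (auto simp: fits_nv)

text \<open>The substituted values may depend on variables bound after \<open>c\<close>, while
  \<open>F\<close> knows only those of \<open>c\<close>. Two variables are replaced at once because
  later a function is applied to a variable rational point and its value is read at a variable
  index, as in \<open>\<Phi> (%_. k) n\<close>.\<close>

lemma df_sub2:
  assumes "df (push (push c)) (%p. F (fst (fst p)) (snd (fst p)) (snd p))" "extends c c' h"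
    "df c' G" "df c' K"
  shows "df c' (%y. F (h y) (G y) (K y))"
proof -
  obtain \<Gamma> X \<pi> \<Gamma>' X' \<pi>' where c: "c = (\<Gamma>, X, \<pi>)" "c' = (\<Gamma>', X', \<pi>')" by (cases c, cases c')
  obtain \<Delta> where \<Delta>: "\<Gamma>' = \<Gamma> @ \<Delta>"
    "!!y. y \<in> X' ==> h y \<in> X \<and> (\<exists>l. \<pi>' y = \<pi> (h y) @ l \<and> list_all2 fits \<Delta> l)"
    using assms(2) unfolding extends_def c by auto
  have v: "\<forall>x\<in>X. list_all2 fits \<Gamma> (\<pi> x)" using assms(2) by (auto simp: extends_def valid_def c)
  obtain F' where F': "Df (\<Gamma> @ [sn, sn]) F'"
    "!!x n m. x \<in> X ==> n \<in> N ==> m \<in> N ==> F x n m = F' (\<pi> x @ [nv n, nv m])"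
    using assms(1) unfolding df_def c pushv_def by auto
  obtain G' where G': "Df (\<Gamma> @ \<Delta>) G'" "!!y. y \<in> X' ==> G y = G' (\<pi>' y)"
    using assms(3) unfolding df_def c \<Delta> by auto
  obtain K' where K': "Df (\<Gamma> @ \<Delta>) K'" "!!y. y \<in> X' ==> K y = K' (\<pi>' y)"
    using assms(4) unfolding df_def c \<Delta> by auto
  obtain H where H: "Df (\<Gamma> @ \<Delta>) H" "!!l l'. list_all2 fits \<Gamma> l ==> list_all2 fits \<Delta> l' ==>
      H (l @ l') = F' (l @ [nv (G' (l @ l')), nv (K' (l @ l'))])"
    using Df_sub2[OF F'(1) G'(1) K'(1)] by blast
  have "F (h y) (G y) (K y) = H (\<pi>' y)" if y: "y \<in> X'" for y
  proof -
    obtain l where l: "\<pi>' y = \<pi> (h y) @ l" "list_all2 fits \<Delta> l" "h y \<in> X"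
      using \<Delta>(2)[OF y] by auto
    have "G y \<in> N" "K y \<in> N" using df_N[OF assms(3), of y] df_N[OF assms(4), of y] y by (simp_all add: c)
    then show ?thesis using F'(2)[OF l(3)] H(2)[of "\<pi> (h y)" l] v l G'(2)[OF y] K'(2)[OF y] by simp
  qed
  then show ?thesis using H(1) df_valid[OF assms(3)] unfolding df_def c \<Delta> by auto
qed

lemma df_sub:
  assumes "df (push c) (%p. F (fst p) (snd p))" "extends c c' h" "df c' G"
  shows "df c' (%y. F (h y) (G y))"
  using df_sub2[of c "%x n m. F x n", OF df_weak[OF assms(1)] assms(2,3,3)] .

text \<open>The default 0 is that of Feferman's functional. With \<open>THE\<close> the value
  depends on \<open>P\<close> alone and not on the definable function that \<open>Df_mu\<close>
  supplies.\<close>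

definition least :: "('k => bool) => 'k" where
  "least P = (if \<exists>n\<in>N. P n then THE n. n \<in> N \<and> P n \<and> (\<forall>m\<in>N. P m --> n <= m) else 0)"

text \<open>Truth is coded by 0 because \<mu> searches for zeros.\<close>

definition dec :: "'s list \<times> 'x set \<times> ('x => 'v list) => ('x => bool) => bool" where
  "dec c P \<longleftrightarrow> df c (%x. if P x then 0 else 1)"

lemma dec_valid: "dec c P ==> valid c"
  by (simp add: dec_def df_def)

lemma dec_cong: "dec c P ==> (!!x. x \<in> dom c ==> Q x \<longleftrightarrow> P x) ==> dec c Q"
  unfolding dec_def by (erule df_cong) simp

lemma dec_eq0: assumes "df c F" shows "dec c (%x. F x = 0)"
proof -
  \<comment> \<open>Truncated \<open>1 - (1 - F x)\<close> is the sign of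
    \<open>F x\<close>.\<close>
  have "df c (%x. if (if F x <= 1 then 1 - F x else 0) <= 1 then 1 - (if F x <= 1 then 1 - F x else 0) else 0)"
    by (intro df_monus df_const df_valid[OF assms] N1 assms)
  then show ?thesis unfolding dec_def
  proof (rule df_cong)
    fix x assume "x \<in> dom c"
    then have "F x \<in> N" using df_N[OF assms] by blast
    then show "(if F x = 0 then 0 else 1) =
        (if (if F x <= 1 then 1 - F x else 0) <= 1 then 1 - (if F x <= 1 then 1 - F x else 0) else 0)"
      using Nnonneg[of "F x"] Npos[of "F x"] by (cases "F x = 0") auto
  qed
qed

lemma dec_not: assumes "dec c P" shows "dec c (%x. \<not> P x)"
  by (rule dec_cong[OF dec_eq0[OF df_monus[OF df_const[OF dec_valid[OF assms] N1] assms[unfolded dec_def]]]])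
    auto

lemma dec_and: assumes "dec c P" "dec c Q" shows "dec c (%x. P x \<and> Q x)"
  by (rule dec_cong[OF dec_eq0[OF df_add[OF assms[unfolded dec_def]]]]) auto

lemma dec_or: assumes "dec c P" "dec c Q" shows "dec c (%x. P x \<or> Q x)"
  using dec_not[OF dec_and[OF dec_not[OF assms(1)] dec_not[OF assms(2)]]] by simp

lemma dec_imp: assumes "dec c P" "dec c Q" shows "dec c (%x. P x --> Q x)"
  using dec_or[OF dec_not[OF assms(1)] assms(2)] by simp

lemma dec_le: assumes "df c F" "df c G" shows "dec c (%x. F x <= G x)"
  by (rule dec_cong[OF dec_eq0[OF df_monus[OF assms]]]) auto

lemma dec_less: assumes "df c F" "df c G" shows "dec c (%x. F x < G x)"
  using dec_not[OF dec_le[OF assms(2,1)]] by (simp add: not_le)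

lemma dec_eq: assumes "df c F" "df c G" shows "dec c (%x. F x = G x)"
  by (rule dec_cong[OF dec_and[OF dec_le[OF assms] dec_le[OF assms(2,1)]]]) auto

lemma least_spec:
  assumes "valid c" "dec (push c) (%p. P (fst p) (snd p))"
  shows "df c (%x. least (P x))"
    and "x \<in> dom c ==> n \<in> N ==> P x n ==> least (P x) \<in> N \<and> P x (least (P x)) \<and> least (P x) <= n"
proof -
  obtain \<Gamma> X \<pi> where c: "c = (\<Gamma>, X, \<pi>)" by (cases c)
  obtain F where F: "Df (\<Gamma> @ [sn]) F" "!!x n. x \<in> X ==> n \<in> N ==>
      (if P x n then 0 else 1) = F (\<pi> x @ [nv n])"
    using assms(2) unfolding dec_def df_def c pushv_def by auto
  have v: "okc \<Gamma>" "!!x. x \<in> X ==> list_all2 fits \<Gamma> (\<pi> x)" using assms(1) by (auto simp: valid_def c)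
  have F0: "F (\<pi> x @ [nv n]) = 0 \<longleftrightarrow> P x n" if "x \<in> X" "n \<in> N" for x n
    using F(2)[OF that] by (cases "P x n") auto
  obtain G where G: "Df \<Gamma> G" "!!l. list_all2 fits \<Gamma> l ==>
      ((\<exists>n\<in>N. F (l @ [nv n]) = 0) -->
        F (l @ [nv (G l)]) = 0 \<and> (\<forall>n\<in>N. F (l @ [nv n]) = 0 --> G l <= n)) \<and>
      (\<not> (\<exists>n\<in>N. F (l @ [nv n]) = 0) --> G l = 0)"
    using Df_mu[OF v(1) F(1)] by blast
  have GN: "G (\<pi> x) \<in> N" if "x \<in> X" for x using Df_N[OF G(1) v(2)[OF that]] .
  have G1: "P x (G (\<pi> x)) \<and> (\<forall>m\<in>N. P x m --> G (\<pi> x) <= m)" if "x \<in> X" "\<exists>n\<in>N. P x n" for x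
    using G(2)[OF v(2)[OF that(1)]] F0[OF that(1)] GN[OF that(1)] that(2) by metis
  have G2: "G (\<pi> x) = 0" if "x \<in> X" "\<not> (\<exists>n\<in>N. P x n)" for x
    using G(2)[OF v(2)[OF that(1)]] F0[OF that(1)] that(2) by metis
  have eq: "least (P x) = G (\<pi> x)" if x: "x \<in> X" for x
  proof (cases "\<exists>n\<in>N. P x n")
    case True
    have "(THE n. n \<in> N \<and> P x n \<and> (\<forall>m\<in>N. P x m --> n <= m)) = G (\<pi> x)"
    proof (rule the_equality)
      show "G (\<pi> x) \<in> N \<and> P x (G (\<pi> x)) \<and> (\<forall>m\<in>N. P x m --> G (\<pi> x) <= m)"
        using GN[OF x] G1[OF x True] by blast
      fix n assume "n \<in> N \<and> P x n \<and> (\<forall>m\<in>N. P x m --> n <= m)"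
      then show "n = G (\<pi> x)" using GN[OF x] G1[OF x True] by (meson antisym)
    qed
    then show ?thesis using True by (simp add: least_def)
  next
    case False
    then show ?thesis using G2[OF x False] by (simp add: least_def)
  qed
  show "df c (%x. least (P x))" using assms(1) G(1) eq unfolding df_def c by auto
  show "x \<in> dom c ==> n \<in> N ==> P x n ==> least (P x) \<in> N \<and> P x (least (P x)) \<and> least (P x) <= n"
    using eq[of x] GN[of x] G1[of x] by (auto simp: c)
qed

text \<open>Here \<mu> removes a quantifier over \<open>N\<close>: a witness exists iff the least
  one, with the default 0 if there is none, is a witness. Every arithmetical predicate becomes
  decidable in this way.\<close>

lemma dec_ex:
  assumes "valid c" "dec (push c) (%p. P (fst p) (snd p))" shows "dec c (%x. \<exists>n\<in>N. P x n)"
proof -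
  have "dec c (%x. P x (least (P x)))"
    using df_sub[OF assms(2)[unfolded dec_def] extends_refl[OF assms(1)] least_spec(1)[OF assms]]
    by (simp add: dec_def)
  then show ?thesis
  proof (rule dec_cong)
    fix x assume "x \<in> dom c"
    then show "(\<exists>n\<in>N. P x n) = P x (least (P x))"
      using least_spec(2)[OF assms] df_N[OF least_spec(1)[OF assms]] by blast
  qed
qed

lemma dec_all: "valid c ==> dec (push c) (%p. P (fst p) (snd p)) ==> dec c (%x. \<forall>n\<in>N. P x n)"
  using dec_not[OF dec_ex[of c "%x n. \<not> P x n"]] dec_not[of "push c" "%p. P (fst p) (snd p)"] by simp

lemma dec_sub:
  assumes "dec (push c) (%p. P (fst p) (snd p))" "extends c c' h" "df c' G"
  shows "dec c' (%y. P (h y) (G y))"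
  using df_sub[OF assms(1)[unfolded dec_def] assms(2,3)] by (simp add: dec_def)

text \<open>\<open>N\<close> may be nonstandard, so induction is restricted to decidable predicates:
  a counterexample gives a least one, and its predecessor refutes the step.\<close>

lemma N_induct:
  assumes "valid c" "dec (push c) (%p. P (fst p) (snd p))" "x \<in> dom c"
    and "P x 0" "!!n. n \<in> N ==> P x n ==> P x (n + 1)" "n \<in> N"
  shows "P x n"
proof (rule ccontr)
  assume "\<not> P x n"
  have d: "dec (push c) (%p. \<not> P (fst p) (snd p))" by (rule dec_not[OF assms(2)])
  define m where "m = least (%n. \<not> P x n)"
  have m: "m \<in> N" "\<not> P x m" using least_spec(2)[OF assms(1) d assms(3,6) \<open>\<not> P x n\<close>] by (auto simp: m_def)
  have min: "m <= k" if "k \<in> N" "\<not> P x k" for k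
    using least_spec(2)[OF assms(1) d assms(3) that] by (auto simp: m_def)
  have "m ~= 0" using m assms(4) by auto
  then have "1 <= m" using m Npos Nnonneg by (metis order_le_less)
  then have "m - 1 \<in> N" using Ndiff N1 m by blast
  then have "P x (m - 1)" using min[of "m - 1"] by auto
  then show False using assms(5)[OF \<open>m - 1 \<in> N\<close>] m by simp
qed

text \<open>A one-point environment, through which induction and minimisation apply to predicates
  whose parameters are fixed.\<close>

lemma base_env: obtains c :: "'s list \<times> unit set \<times> (unit => 'v list)" where "valid c" "() \<in> dom c"
proof -
  obtain \<Gamma> l where "okc \<Gamma>" "list_all2 fits \<Gamma> l" using okc_inhabited by blast
  then show ?thesis using that[of "(\<Gamma>, {()}, %_. l)"] by (simp add: valid_def)
qed

lemma pw_pos: "n \<in> N ==> 1 <= pw n" and less_pw: "n \<in> N ==> n < pw n"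
proof -
  obtain c :: "'s list \<times> unit set \<times> (unit => 'v list)" where c: "valid c" "() \<in> dom c"
    by (rule base_env)
  have P: "dec (push c) (%p. 1 <= pw (snd p))"
    by (intro dec_le df_const df_pw df_var valid_push c N1)
  show 1: "n \<in> N ==> 1 <= pw n" for n
  proof (rule N_induct[OF c(1) P c(2)])
    fix n assume "n \<in> N" "1 <= pw n"
    then show "1 <= pw (n + 1)" using pwS[of n] by simp
  qed (simp_all add: pw0)
  have Q: "dec (push c) (%p. snd p < pw (snd p))"
    by (intro dec_less df_pw df_var valid_push c)
  show "n \<in> N ==> n < pw n"
  proof (rule N_induct[OF c(1) Q c(2)])
    fix n assume "n \<in> N" "n < pw n"
    then show "n + 1 < pw (n + 1)" using pwS[of n] 1[of n] by simp
  qed (simp_all add: pw0)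
qed

lemma pw_mono: assumes "m \<in> N" "n \<in> N" "m <= n" shows "pw m <= pw n"
proof -
  obtain c :: "'s list \<times> unit set \<times> (unit => 'v list)" where c: "valid c" "() \<in> dom c"
    by (rule base_env)
  have P: "dec (push c) (%p. pw m <= pw (m + snd p))"
    by (intro dec_le df_const df_pw df_add df_var valid_push c pwN assms)
  have "pw m <= pw (m + i)" if "i \<in> N" for i
  proof (rule N_induct[OF c(1) P c(2)])
    fix i assume i: "i \<in> N" "pw m <= pw (m + i)"
    have "pw (m + i + 1) = 2 * pw (m + i)" "1 <= pw (m + i)"
      using pwS pw_pos Nadd assms i by blast+
    then show "pw m <= pw (m + (i + 1))" using i by (simp add: add.assoc)
  qed (use that in simp_all)
  from this[OF Ndiff[OF assms]] show ?thesis by simp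
qed

definition e :: "'k => 'k" where "e n = 1 / pw n"

lemma e_pos: "n \<in> N ==> 0 < e n"
  using pw_pos[of n] by (simp add: e_def)

lemma e_mono: "m \<in> N ==> n \<in> N ==> m <= n ==> e n <= e m"
  using pw_mono[of m n] pw_pos[of m] by (simp add: e_def field_simps)

lemma e_half: "n \<in> N ==> e (n + 1) = e n / 2"
  by (simp add: e_def pwS)

text \<open>Archimedean relative to \<open>N\<close> only: a field element is a fraction with
  denominator at least 1, hence at most the number \<open>p\<close> in its numerator.\<close>

lemma archimedean: "\<exists>n\<in>N. x < n"
proof -
  obtain p m d where "p \<in> N" "m \<in> N" "d \<in> N" "x = (p - m) / (d + 1)" using Nfrac by blast
  moreover from this have "x <= p / 1" unfolding \<open>x = _\<close>
    by (intro frac_le) (use Nnonneg[of m] Nnonneg[of d] Nnonneg[of p] in auto)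
  ultimately show ?thesis using Nadd N1 by (intro bexI[of _ "p + 1"]) auto
qed

lemma e_small: assumes "0 < \<epsilon>" shows "\<exists>n\<in>N. e n < \<epsilon>"
proof -
  obtain n where n: "n \<in> N" "1 / \<epsilon> < n" using archimedean by blast
  then have "1 / \<epsilon> < pw n" using less_pw[of n] by simp
  then show ?thesis using n assms pw_pos[of n] by (intro bexI[of _ n]) (auto simp: e_def field_simps)
qed

subsection \<open>Rational numbers\<close>

text \<open>A field value is given by a difference over a successor, so that no denominator can
  vanish.\<close>

definition dfq :: "'s list \<times> 'x set \<times> ('x => 'v list) => ('x => 'k) => bool" where
  "dfq c F \<longleftrightarrow> (\<exists>p m d. df c p \<and> df c m \<and> df c d \<and> (\<forall>x\<in>dom c. F x = (p x - m x) / (d x + 1)))"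

lemma dfq_df: assumes "df c F" shows "dfq c F"
  unfolding dfq_def using df_const[OF df_valid[OF assms] N0] assms
  by (intro exI[of _ F] exI[of _ "%_. 0"]) auto

lemma dfq_const: "valid c ==> dfq c (%x. q)"
proof -
  obtain p m d where "p \<in> N" "m \<in> N" "d \<in> N" "q = (p - m) / (d + 1)" using Nfrac by blast
  then show "valid c ==> dfq c (%x. q)" unfolding dfq_def
    by (intro exI[of _ "%_. p"] exI[of _ "%_. m"] exI[of _ "%_. d"]) (auto intro: df_const)
qed

lemma dfqE:
  assumes "dfq c F"
  obtains p m d where "df c p" "df c m" "df c d" "!!x. x \<in> dom c ==> F x = (p x - m x) / (d x + 1)"
    "!!x. x \<in> dom c ==> 0 < d x + 1"
  using assms Nnonneg[OF df_N] unfolding dfq_def by (metis add_nonneg_pos zero_less_one)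

lemma dfqI:
  assumes "df c p" "df c m" "df c d" "!!x. x \<in> dom c ==> F x = (p x - m x) / (d x + 1)"
  shows "dfq c F"
  using assms unfolding dfq_def by blast

lemma dfq_valid: "dfq c F ==> valid c"
  by (auto simp: dfq_def df_valid)

lemma dfq_cong: "dfq c F ==> (!!x. x \<in> dom c ==> G x = F x) ==> dfq c G"
  unfolding dfq_def by fastforce

lemma dfq_minus: assumes "dfq c F" shows "dfq c (%x. - F x)"
proof -
  obtain p m d where F: "df c p" "df c m" "df c d" "!!x. x \<in> dom c ==> F x = (p x - m x) / (d x + 1)"
    "!!x. x \<in> dom c ==> 0 < d x + 1" using dfqE[OF assms] by metis
  show ?thesis by (rule dfqI[OF F(2,1,3)]) (simp add: F(4) minus_divide_left)
qed

lemma dfq_add: assumes "dfq c F" "dfq c G" shows "dfq c (%x. F x + G x)"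
proof -
  obtain p m d where F: "df c p" "df c m" "df c d" "!!x. x \<in> dom c ==> F x = (p x - m x) / (d x + 1)"
    "!!x. x \<in> dom c ==> 0 < d x + 1" using dfqE[OF assms(1)] by metis
  obtain p' m' d' where G: "df c p'" "df c m'" "df c d'" "!!x. x \<in> dom c ==> G x = (p' x - m' x) / (d' x + 1)"
    "!!x. x \<in> dom c ==> 0 < d' x + 1" using dfqE[OF assms(2)] by metis
  note v = df_valid[OF F(1)]
  show ?thesis
  proof (rule dfqI)
    \<comment> \<open>Denominators are stored minus 1, and \<open>(d + 1) * (d' + 1)\<close> is
      \<open>(d * d' + d + d') + 1\<close>.\<close>
    show "df c (%x. p x * (d' x + 1) + p' x * (d x + 1))" "df c (%x. m x * (d' x + 1) + m' x * (d x + 1))"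
      "df c (%x. d x * d' x + d x + d' x)"
      by (intro df_add df_mult df_const F G v N1)+
    fix x assume x: "x \<in> dom c"
    have "d x * d' x + d x + d' x + 1 = (d x + 1) * (d' x + 1)" by (simp add: algebra_simps)
    moreover have "d x + 1 ~= 0" "d' x + 1 ~= 0" using F(5)[OF x] G(5)[OF x] by auto
    ultimately show "F x + G x = (p x * (d' x + 1) + p' x * (d x + 1) - (m x * (d' x + 1) + m' x * (d x + 1))) /
        (d x * d' x + d x + d' x + 1)"
      unfolding F(4)[OF x] G(4)[OF x] by (simp add: add_frac_eq) (simp add: algebra_simps)
  qed
qed

lemma dfq_diff: assumes "dfq c F" "dfq c G" shows "dfq c (%x. F x - G x)"
  using dfq_add[OF assms(1) dfq_minus[OF assms(2)]] by simp

lemma dfq_mult: assumes "dfq c F" "dfq c G" shows "dfq c (%x. F x * G x)"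
proof -
  obtain p m d where F: "df c p" "df c m" "df c d" "!!x. x \<in> dom c ==> F x = (p x - m x) / (d x + 1)"
    "!!x. x \<in> dom c ==> 0 < d x + 1" using dfqE[OF assms(1)] by metis
  obtain p' m' d' where G: "df c p'" "df c m'" "df c d'" "!!x. x \<in> dom c ==> G x = (p' x - m' x) / (d' x + 1)"
    "!!x. x \<in> dom c ==> 0 < d' x + 1" using dfqE[OF assms(2)] by metis
  note v = df_valid[OF F(1)]
  show ?thesis
  proof (rule dfqI)
    show "df c (%x. p x * p' x + m x * m' x)" "df c (%x. p x * m' x + m x * p' x)"
      "df c (%x. d x * d' x + d x + d' x)"
      by (intro df_add df_mult df_const F G v N1)+
    fix x assume x: "x \<in> dom c"
    have "d x * d' x + d x + d' x + 1 = (d x + 1) * (d' x + 1)" by (simp add: algebra_simps)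
    then show "F x * G x = (p x * p' x + m x * m' x - (p x * m' x + m x * p' x)) /
        (d x * d' x + d x + d' x + 1)"
      unfolding F(4)[OF x] G(4)[OF x] by (simp add: algebra_simps)
  qed
qed

lemma dfq_e: assumes "df c F" shows "dfq c (%x. e (F x))"
proof (rule dfqI)
  note v = df_valid[OF assms]
  show "df c (%x. 1)" "df c (%x. 0)" "df c (%x. if 1 <= pw (F x) then pw (F x) - 1 else 0)"
    by (intro df_const df_monus df_pw assms v N1 N0)+
  show "e (F x) = (1 - 0) / ((if 1 <= pw (F x) then pw (F x) - 1 else 0) + 1)" if "x \<in> dom c" for x
    using pw_pos[OF df_N[OF assms that]] by (simp add: e_def)
qed

lemma dec_qle: assumes "dfq c F" "dfq c G" shows "dec c (%x. F x <= G x)"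
proof -
  obtain p m d where F: "df c p" "df c m" "df c d" "!!x. x \<in> dom c ==> F x = (p x - m x) / (d x + 1)"
    "!!x. x \<in> dom c ==> 0 < d x + 1" using dfqE[OF assms(1)] by metis
  obtain p' m' d' where G: "df c p'" "df c m'" "df c d'" "!!x. x \<in> dom c ==> G x = (p' x - m' x) / (d' x + 1)"
    "!!x. x \<in> dom c ==> 0 < d' x + 1" using dfqE[OF assms(2)] by metis
  have "dec c (%x. p x * (d' x + 1) + m' x * (d x + 1) <= p' x * (d x + 1) + m x * (d' x + 1))"
    by (intro dec_le df_add df_mult df_const F G df_valid[OF F(1)] N1)
  then show ?thesis
  proof (rule dec_cong)
    fix x assume x: "x \<in> dom c"
    show "(F x <= G x) = (p x * (d' x + 1) + m' x * (d x + 1) <= p' x * (d x + 1) + m x * (d' x + 1))"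
      unfolding F(4)[OF x] G(4)[OF x] using F(5)[OF x] G(5)[OF x]
      by (simp add: divide_le_eq pos_le_divide_eq) (simp add: field_simps)
  qed
qed

lemma dec_qless: assumes "dfq c F" "dfq c G" shows "dec c (%x. F x < G x)"
  using dec_not[OF dec_qle[OF assms(2,1)]] by (simp add: not_le)

lemma dec_qeq: assumes "dfq c F" "dfq c G" shows "dec c (%x. F x = G x)"
  by (rule dec_cong[OF dec_and[OF dec_qle[OF assms] dec_qle[OF assms(2,1)]]]) auto

lemma dfq_sub:
  assumes "dfq (push c) (%p. F (fst p) (snd p))" "extends c c' h" "df c' G"
  shows "dfq c' (%y. F (h y) (G y))"
proof -
  obtain p m d where F: "df (push c) p" "df (push c) m" "df (push c) d"
    "!!x. x \<in> dom (push c) ==> F (fst x) (snd x) = (p x - m x) / (d x + 1)"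
    using dfqE[OF assms(1)] by metis
  have "df c' (%y. u (h y, G y))" if "df (push c) u" for u
    using df_sub[of c "%x n. u (x, n)", OF _ assms(2,3)] that by simp
  moreover have "(h y, G y) \<in> dom (push c)" if "y \<in> dom c'" for y
    using assms(2) df_N[OF assms(3)] that by (auto simp: extends_def split: prod.splits)
  ultimately show ?thesis using F by (intro dfqI[of c' "%y. p (h y, G y)" "%y. m (h y, G y)" "%y. d (h y, G y)"]) force+
qed

lemma dfq_weak: assumes "dfq c F" shows "dfq (push c) (%p. F (fst p))"
proof -
  obtain p m d where F: "df c p" "df c m" "df c d" "!!x. x \<in> dom c ==> F x = (p x - m x) / (d x + 1)"
    using dfqE[OF assms] by metis
  show ?thesis by (rule dfqI[OF df_weak[OF F(1)] df_weak[OF F(2)] df_weak[OF F(3)]]) (auto simp: F(4))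
qed

subsection \<open>Codes of rational numbers\<close>

text \<open>The graph of \<open>prod_encode\<close>, doubled so that no triangular number has to be
  halved; it is the meaning of the formula \<open>is_pair\<close>.\<close>

definition ispair :: "'k => 'k => 'k => bool" where
  "ispair k n d \<longleftrightarrow> k + k = (n + d) * (n + d + 1) + (n + n)"

definition israt :: "'k => 'k => 'k => 'k => bool" where
  "israt k p m d \<longleftrightarrow> (\<exists>n\<in>N. ispair k n d \<and> ((n = p + p \<and> m = 0) \<or> (n + 1 = m + m \<and> p = 0)))"

text \<open>The coding of rationals by \<open>is_rat\<close>, read in the field; in the standard
  instance it is \<open>rat_of_code\<close>.\<close>

definition rat :: "'k => 'k" where
  "rat k = (THE q. \<exists>p\<in>N. \<exists>m\<in>N. \<exists>d\<in>N. israt k p m d \<and> q = (p - m) / (d + 1))"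

lemma dec_ispair: "df c K ==> df c A ==> df c B ==> dec c (%x. ispair (K x) (A x) (B x))"
  unfolding ispair_def by (intro dec_eq df_add df_mult df_const N1 df_valid)

lemma dec_israt: "df c K ==> df c P ==> df c M ==> df c D ==>
    dec c (%x. israt (K x) (P x) (M x) (D x))"
  unfolding israt_def
  by (intro dec_ex dec_and dec_or dec_ispair dec_eq df_add df_const df_var df_weak N1 N0 valid_push df_valid)

text \<open>The induction walks along the diagonals: \<open>(n, d)\<close> is followed by
  \<open>(n + 1, d - 1)\<close>, and after \<open>(n, 0)\<close> the next diagonal starts with
  \<open>(0, n + 1)\<close>.\<close>

lemma ispair_exists: assumes "k \<in> N" shows "\<exists>n\<in>N. \<exists>d\<in>N. ispair k n d"
proof -
  obtain c :: "'s list \<times> unit set \<times> (unit => 'v list)" where c: "valid c" "() \<in> dom c"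
    by (rule base_env)
  have P: "dec (push c) (%p. \<exists>n\<in>N. \<exists>d\<in>N. ispair (snd p) n d)"
    by (intro dec_ex dec_ispair df_var df_weak valid_push c)
  show ?thesis
  proof (rule N_induct[OF c(1) P c(2) _ _ assms])
    show "\<exists>n\<in>N. \<exists>d\<in>N. ispair 0 n d"
      using N0 by (intro bexI[of _ 0]) (auto simp: ispair_def)
    fix k assume "k \<in> N" "\<exists>n\<in>N. \<exists>d\<in>N. ispair k n d"
    then obtain n d where nd: "n \<in> N" "d \<in> N" "k + k = (n + d) * (n + d + 1) + (n + n)"
      by (auto simp: ispair_def)
    show "\<exists>n\<in>N. \<exists>d\<in>N. ispair (k + 1) n d"
    proof (cases "d = 0")
      case True
      then have "ispair (k + 1) 0 (n + 1)" using nd by (simp add: ispair_def algebra_simps)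
      then show ?thesis using nd N0 N1 Nadd by blast
    next
      case False
      then have "d - 1 \<in> N" using nd Ndiff N1 Npos Nnonneg by (metis order_le_less)
      moreover have "ispair (k + 1) (n + 1) (d - 1)" using nd by (simp add: ispair_def algebra_simps)
      ultimately show ?thesis using nd N1 Nadd by blast
    qed
  qed
qed

text \<open>A larger diagonal \<open>n + d\<close> gives a larger code, because the position
  \<open>n\<close> on a diagonal never exceeds \<open>n + d\<close>. On one diagonal the code
  determines \<open>n\<close>.\<close>

lemma ispair_unique:
  assumes "n \<in> N" "d \<in> N" "n' \<in> N" "d' \<in> N" "ispair k n d" "ispair k n' d'"
  shows "n = n' \<and> d = d'"
proof -
  have *: False if "n \<in> N" "d \<in> N" "n' \<in> N" "d' \<in> N" "ispair k n d" "ispair k n' d'" "n + d < n' + d'"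
    for n d n' d'
  proof -
    have "n + d + 1 <= n' + d'" using Nsuc_le that Nadd by blast
    moreover have "0 <= n" "0 <= d" "0 <= n'" "0 <= d'" using Nnonneg that by auto
    ultimately have "(n + d + 1) * (n + d + 2) <= (n' + d') * (n' + d' + 1)"
      by (intro mult_mono) auto
    then have "(n + d) * (n + d + 1) + 2 * (n + d + 1) <= (n' + d') * (n' + d' + 1)"
      by (simp add: algebra_simps)
    moreover have "(n' + d') * (n' + d' + 1) = (n + d) * (n + d + 1) + 2 * n - 2 * n'"
      using that(5,6) unfolding ispair_def by (simp add: algebra_simps)
    ultimately show False using \<open>0 <= d\<close> \<open>0 <= n'\<close> by simp
  qed
  have "n + d = n' + d'" using *[of n d n' d'] *[of n' d' n d] assms by (meson linorder_cases)
  moreover from this have "n = n'" using assms(5,6) by (simp add: ispair_def)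
  ultimately show ?thesis by simp
qed

lemma parity: assumes "n \<in> N" shows "(\<exists>p\<in>N. n = p + p) \<or> (\<exists>m\<in>N. n + 1 = m + m)"
proof -
  obtain c :: "'s list \<times> unit set \<times> (unit => 'v list)" where c: "valid c" "() \<in> dom c"
    by (rule base_env)
  have P: "dec (push c) (%x. (\<exists>p\<in>N. snd x = p + p) \<or> (\<exists>m\<in>N. snd x + 1 = m + m))"
    by (intro dec_or dec_ex dec_eq df_add df_const N1 df_var df_weak valid_push c)
  show ?thesis
  proof (rule N_induct[OF c(1) P c(2) _ _ assms])
    show "(\<exists>p\<in>N. 0 = p + p) \<or> (\<exists>m\<in>N. 0 + 1 = m + m)" using N0 by auto
    fix n assume "n \<in> N" "(\<exists>p\<in>N. n = p + p) \<or> (\<exists>m\<in>N. n + 1 = m + m)"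
    then consider p where "p \<in> N" "n = p + p" | m where "m \<in> N" "n + 1 = m + m" by blast
    then show "(\<exists>p\<in>N. n + 1 = p + p) \<or> (\<exists>m\<in>N. n + 1 + 1 = m + m)"
    proof cases
      case 1
      then show ?thesis using Nadd[OF _ N1] by (intro disjI2 bexI[of _ "p + 1"]) auto
    qed auto
  qed
qed

lemma parity_exclusive: assumes "p \<in> N" "m \<in> N" "p + p + 1 = m + m" shows False
proof -
  have "p < m" using assms(3) by linarith
  then have "p + 1 <= m" using Nsuc_le assms by blast
  then show False using assms(3) by linarith
qed

lemma israt_exists: assumes "k \<in> N" shows "\<exists>p\<in>N. \<exists>m\<in>N. \<exists>d\<in>N. israt k p m d"
proof -
  obtain n d where "n \<in> N" "d \<in> N" "ispair k n d" using ispair_exists[OF assms] by blast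
  then show ?thesis using parity[of n] N0 unfolding israt_def by blast
qed

lemma israt_unique:
  assumes "p \<in> N" "m \<in> N" "d \<in> N" "p' \<in> N" "m' \<in> N" "d' \<in> N" "israt k p m d" "israt k p' m' d'"
  shows "p = p' \<and> m = m' \<and> d = d'"
proof -
  obtain n n' where n: "n \<in> N" "ispair k n d" "(n = p + p \<and> m = 0) \<or> (n + 1 = m + m \<and> p = 0)"
    "n' \<in> N" "ispair k n' d'" "(n' = p' + p' \<and> m' = 0) \<or> (n' + 1 = m' + m' \<and> p' = 0)"
    using assms unfolding israt_def by blast
  have "n = n'" "d = d'" using ispair_unique[OF n(1) assms(3) n(4) assms(6) n(2,5)] by auto
  then show ?thesis using n(3,6) parity_exclusive[of p m'] parity_exclusive[of p' m] assms by auto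
qed

lemma rat_eqI:
  assumes "p \<in> N" "m \<in> N" "d \<in> N" "israt k p m d" shows "rat k = (p - m) / (d + 1)"
  unfolding rat_def
proof (rule the_equality)
  show "\<exists>p'\<in>N. \<exists>m'\<in>N. \<exists>d'\<in>N. israt k p' m' d' \<and> (p - m) / (d + 1) = (p' - m') / (d' + 1)"
    using assms by blast
  fix q assume "\<exists>p\<in>N. \<exists>m\<in>N. \<exists>d\<in>N. israt k p m d \<and> q = (p - m) / (d + 1)"
  then show "q = (p - m) / (d + 1)" using israt_unique assms by blast
qed

text \<open>One of \<open>n + d\<close> and \<open>n + d + 1\<close> is even, so half of their
  product lies in \<open>N\<close>.\<close>

lemma pair_exists: assumes "n \<in> N" "d \<in> N" shows "\<exists>k\<in>N. ispair k n d"
proof -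
  have "(\<exists>h\<in>N. n + d = h + h) \<or> (\<exists>h\<in>N. n + d + 1 = h + h)" using parity[OF Nadd[OF assms]] .
  then consider h where "h \<in> N" "n + d = h + h" | h where "h \<in> N" "n + d + 1 = h + h" by blast
  then show ?thesis
  proof cases
    case 1
    then have "h * (n + d + 1) + n \<in> N" "ispair (h * (n + d + 1) + n) n d"
      using assms N1 N2 by (auto intro!: Nadd Nmult simp: ispair_def algebra_simps)
    then show ?thesis by blast
  next
    case 2
    have "(n + d) * (n + d + 1) = (n + d) * h + (n + d) * h" using 2 by (simp add: algebra_simps)
    then have "(n + d) * h + n \<in> N" "ispair ((n + d) * h + n) n d"
      using assms 2 by (auto intro!: Nadd Nmult simp: ispair_def)
    then show ?thesis by blast
  qed
qed

definition prl :: "'k => 'k" where "prl n = least (%k. \<exists>l\<in>N. ispair n k l)"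
definition prr :: "'k => 'k" where "prr n = least (%l. \<exists>k\<in>N. ispair n k l)"

lemma df_prl: "df c F ==> df c (%x. prl (F x))" and df_prr: "df c F ==> df c (%x. prr (F x))"
  unfolding prl_def prr_def
  by (rule least_spec(1); (intro dec_ex dec_ispair df_weak df_var valid_push)?; auto dest: df_valid intro: valid_push)+

lemma pr_eq: assumes "n \<in> N" "k \<in> N" "l \<in> N" "ispair n k l" shows "prl n = k" "prr n = l"
proof -
  obtain c :: "'s list \<times> unit set \<times> (unit => 'v list)" where c: "valid c" "() \<in> dom c"
    by (rule base_env)
  have "dec (push c) (%p. \<exists>l\<in>N. ispair n (snd p) l)" "dec (push c) (%p. \<exists>k\<in>N. ispair n k (snd p))"
    by (intro dec_ex dec_ispair df_weak df_var df_const valid_push c assms)+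
  from least_spec(2)[of c "%_ k. \<exists>l\<in>N. ispair n k l", OF c(1) this(1) c(2) assms(2)]
    least_spec(2)[of c "%_ l. \<exists>k\<in>N. ispair n k l", OF c(1) this(2) c(2) assms(3)]
  show "prl n = k" "prr n = l"
    using assms ispair_unique unfolding prl_def prr_def by blast+
qed

lemma rat_surj: "\<exists>k\<in>N. rat k = q"
proof -
  obtain p m d where q: "p \<in> N" "m \<in> N" "d \<in> N" "q = (p - m) / (d + 1)" using Nfrac by blast
  show ?thesis
  proof (cases "m <= p")
    case True
    then have pm: "p - m \<in> N" using q Ndiff by blast
    then obtain k where k: "k \<in> N" "ispair k ((p - m) + (p - m)) d" using pair_exists Nadd q(3) by blast
    then have "israt k (p - m) 0 d" using pm Nadd unfolding israt_def by blast
    from rat_eqI[OF pm N0 q(3) this] show ?thesis using k q by auto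
  next
    case False
    then have mp: "m - p \<in> N" "1 <= m - p" using q Ndiff[of p m] Npos[of "m - p"] by auto
    then have "(m - p) + (m - p) - 1 \<in> N" using Ndiff[OF N1 Nadd[OF mp(1) mp(1)]] by simp
    moreover from this obtain k where k: "k \<in> N" "ispair k ((m - p) + (m - p) - 1) d" using pair_exists q(3) by blast
    ultimately have "israt k 0 (m - p) d" unfolding israt_def
      by (intro bexI[of _ "(m - p) + (m - p) - 1"]) auto
    from rat_eqI[OF N0 mp(1) q(3) this] show ?thesis using k q by auto
  qed
qed

lemma dfq_rat: assumes "df c F" shows "dfq c (%x. rat (F x))"
proof -
  note v = df_valid[OF assms]
  let ?P = "%x p. \<exists>m\<in>N. \<exists>d\<in>N. israt (F x) p m d"
  let ?M = "%x m. \<exists>p\<in>N. \<exists>d\<in>N. israt (F x) p m d"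
  let ?D = "%x d. \<exists>p\<in>N. \<exists>m\<in>N. israt (F x) p m d"
  have P: "dec (push c) (%y. ?P (fst y) (snd y))"
    by (intro dec_ex dec_israt df_var df_weak valid_push v assms)
  have M: "dec (push c) (%y. ?M (fst y) (snd y))"
    by (intro dec_ex dec_israt df_var df_weak valid_push v assms)
  have D: "dec (push c) (%y. ?D (fst y) (snd y))"
    by (intro dec_ex dec_israt df_var df_weak valid_push v assms)
  show ?thesis
  proof (rule dfqI[OF least_spec(1)[OF v P] least_spec(1)[OF v M] least_spec(1)[OF v D]])
    fix x assume x: "x \<in> dom c"
    obtain p m d where pmd: "p \<in> N" "m \<in> N" "d \<in> N" "israt (F x) p m d"
      using israt_exists[OF df_N[OF assms x]] by blast
    have "least (?P x) \<in> N \<and> ?P x (least (?P x))" "least (?M x) \<in> N \<and> ?M x (least (?M x))"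
      "least (?D x) \<in> N \<and> ?D x (least (?D x))"
      using least_spec(2)[OF v P x pmd(1)] least_spec(2)[OF v M x pmd(2)] least_spec(2)[OF v D x pmd(3)]
        pmd by blast+
    moreover have "p' = p \<and> m' = m \<and> d' = d"
      if "p' \<in> N" "m' \<in> N" "d' \<in> N" "israt (F x) p' m' d'" for p' m' d'
      by (rule israt_unique[OF that(1-3) pmd(1-3) that(4) pmd(4)])
    ultimately have "least (?P x) = p" "least (?M x) = m" "least (?D x) = d" by blast+
    then show "rat (F x) = (least (?P x) - least (?M x)) / (least (?D x) + 1)"
      using rat_eqI[OF pmd] by simp
  qed
qed

text \<open>Every field element has a code, so quantifiers over the field are number quantifiers in
  disguise and fall to \<mu> as well.\<close>

lemma dec_exq:
  assumes "valid c" "dec (push c) (%p. P (fst p) (rat (snd p)))" shows "dec c (%x. \<exists>q. P x q)"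
  by (rule dec_cong[OF dec_ex[of c "%x n. P x (rat n)", OF assms]]) (metis rat_surj)

lemma dec_subq:
  assumes "dec (push c) (%p. P (fst p) (rat (snd p)))" "extends c c' h" "dfq c' A"
  shows "dec c' (%y. P (h y) (A y))"
proof -
  note v = dfq_valid[OF assms(3)]
  have "dec (push c') (%p. P (h (fst p)) (rat (snd p)))"
    by (rule dec_sub[of c "%x n. P x (rat n)", OF assms(1) extends_push[OF assms(2)] df_var[OF v]])
  \<comment> \<open>A code of \<open>A y\<close> is quantified existentially instead of being
    computed.\<close>
  then have "dec c' (%y. \<exists>k\<in>N. rat k = A y \<and> P (h y) (rat k))"
    by (intro dec_ex dec_and dec_qeq dfq_rat dfq_weak df_var v assms)
  then show ?thesis by (rule dec_cong) (metis rat_surj)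
qed

end

context definability begin

subsection \<open>Real numbers\<close>

text \<open>\<open>lt a \<xi>\<close> and \<open>ut \<xi> b\<close> express \<open>a < \<xi>\<close> and \<open>\<xi> < b\<close> for elements \<open>a\<close>, \<open>b\<close> of the field.
  All notions concerning the real \<open>\<xi>\<close> are reduced to these two.\<close>

definition isreal :: "('k => 'k) => bool" where
  "isreal \<xi> \<longleftrightarrow> (\<forall>n\<in>N. \<xi> n \<in> N) \<and> (\<forall>n\<in>N. \<forall>i\<in>N. \<bar>rat (\<xi> n) - rat (\<xi> (n + i))\<bar> < e n)"

definition lt :: "'k => ('k => 'k) => bool" where
  "lt a \<xi> \<longleftrightarrow> (\<exists>n\<in>N. a + e n < rat (\<xi> n))"

definition ut :: "('k => 'k) => 'k => bool" where
  "ut \<xi> b \<longleftrightarrow> (\<exists>n\<in>N. rat (\<xi> n) + e n < b)"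

text \<open>Strict distance below \<open>\<delta>\<close> without subtracting reals: a common open
  interval of length less than \<open>\<delta>\<close>.\<close>

definition near :: "('k => 'k) => ('k => 'k) => 'k => bool" where
  "near \<xi> \<eta> \<delta> \<longleftrightarrow> (\<exists>a b. lt a \<xi> \<and> lt a \<eta> \<and> ut \<xi> b \<and> ut \<eta> b \<and> b - a < \<delta>)"

lemma isreal_approx:
  assumes "isreal \<xi>" "n \<in> N" "m \<in> N" "n <= m" shows "\<bar>rat (\<xi> n) - rat (\<xi> m)\<bar> < e n"
proof -
  have "n + (m - n) = m" by simp
  then show ?thesis using assms Ndiff[of n m] unfolding isreal_def by metis
qed

lemma lt_mono: "lt a \<xi> ==> a' <= a ==> lt a' \<xi>"
  unfolding lt_def by (meson add_right_mono le_less_trans)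

lemma ut_mono: "ut \<xi> b ==> b <= b' ==> ut \<xi> b'"
  unfolding ut_def by (meson less_le_trans)

lemma lt_ut_less: assumes "isreal \<xi>" "lt a \<xi>" "ut \<xi> b" shows "a < b"
proof -
  obtain n m where nm: "n \<in> N" "a + e n < rat (\<xi> n)" "m \<in> N" "rat (\<xi> m) + e m < b"
    using assms unfolding lt_def ut_def by blast
  show ?thesis
  proof (cases "n <= m")
    case True
    then show ?thesis using isreal_approx[OF assms(1) nm(1,3)] nm e_pos[of m] by (simp add: abs_less_iff)
  next
    case False
    then show ?thesis using isreal_approx[OF assms(1) nm(3,1)] nm e_pos[of n] by (simp add: abs_less_iff)
  qed
qed

text \<open>A single approximation with error below half the gap decides between the
  alternatives.\<close>

lemma located: assumes "a < b" shows "lt a \<xi> \<or> ut \<xi> b"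
proof -
  obtain n where "n \<in> N" "e n < (b - a) / 2" using e_small[of "(b - a) / 2"] assms by auto
  then show ?thesis unfolding lt_def ut_def by (intro disjCI bexI[of _ n]) (auto simp: field_simps)
qed

lemma lt_open: assumes "lt a \<xi>" shows "\<exists>a'>a. lt a' \<xi>"
proof -
  obtain n where n: "n \<in> N" "a + e n < rat (\<xi> n)" using assms unfolding lt_def by blast
  then show ?thesis unfolding lt_def
    by (intro exI[of _ "(a + (rat (\<xi> n) - e n)) / 2"]) (auto intro!: bexI[of _ n] simp: field_simps)
qed

lemma ut_open: assumes "ut \<xi> b" shows "\<exists>b'<b. ut \<xi> b'"
proof -
  obtain n where n: "n \<in> N" "rat (\<xi> n) + e n < b" using assms unfolding ut_def by blast
  then show ?thesis unfolding ut_def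
    by (intro exI[of _ "(b + (rat (\<xi> n) + e n)) / 2"]) (auto intro!: bexI[of _ n] simp: field_simps)
qed

lemma approx: assumes "0 < \<epsilon>" shows "\<exists>a b. lt a \<xi> \<and> ut \<xi> b \<and> b - a < \<epsilon>"
proof -
  obtain n where n: "n \<in> N" "e n < \<epsilon> / 4" using e_small[of "\<epsilon> / 4"] assms by auto
  have "lt (rat (\<xi> n) - 2 * e n) \<xi>" "ut \<xi> (rat (\<xi> n) + 2 * e n)"
    unfolding lt_def ut_def using n e_pos[of n] by (auto intro!: bexI[of _ n])
  then show ?thesis using n by (intro exI) auto
qed

lemma not_lt_ut: "isreal \<xi> ==> \<not> lt a \<xi> ==> a < b ==> ut \<xi> b"
  using located by blast

lemma lt_bounds:
  assumes "isreal \<xi>" "lt a \<xi>" "n \<in> N" shows "a < rat (\<xi> n) + e n"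
  using lt_ut_less[OF assms(1,2)] e_pos[of n] assms(3)
proof -
  have "ut \<xi> b" if "rat (\<xi> n) + e n < b" for b unfolding ut_def using that assms(3) by blast
  then have "a < b" if "rat (\<xi> n) + e n < b" for b using lt_ut_less[OF assms(1,2)] that by blast
  moreover obtain a' where "a < a'" "lt a' \<xi>" using lt_open assms(2) by blast
  moreover have "a' <= rat (\<xi> n) + e n"
    using lt_ut_less[OF assms(1) \<open>lt a' \<xi>\<close>] \<open>!!b. rat (\<xi> n) + e n < b ==> ut \<xi> b\<close>
    by (metis dense less_asym not_le)
  ultimately show ?thesis by simp
qed

lemma ut_bounds:
  assumes "isreal \<xi>" "ut \<xi> b" "n \<in> N" shows "rat (\<xi> n) - e n < b"
proof -
  have lt: "lt a \<xi>" if "a < rat (\<xi> n) - e n" for a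
    unfolding lt_def using that assms(3) by (intro bexI[of _ n]) auto
  obtain b' where "b' < b" "ut \<xi> b'" using ut_open assms(2) by blast
  moreover have "rat (\<xi> n) - e n <= b'"
    using lt_ut_less[OF assms(1) _ \<open>ut \<xi> b'\<close>] lt by (metis dense less_asym not_le)
  ultimately show ?thesis by simp
qed

text \<open>This equivalence, \<open>real_eq_iff\<close> and \<open>near_iff\<close> translate the
  conditions behind \<open>real_less\<close>, \<open>real_eq\<close> and \<open>dist_less\<close>
  into cuts. The tolerance \<open>2 * e n\<close> is the sum of the errors of two approximations
  with index \<open>n\<close>.\<close>

lemma real_less_iff:
  assumes "isreal \<xi>" "isreal \<eta>"
  shows "(\<exists>n\<in>N. rat (\<xi> n) + 2 * e n < rat (\<eta> n)) \<longleftrightarrow> (\<exists>a. ut \<xi> a \<and> lt a \<eta>)"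
proof
  assume "\<exists>n\<in>N. rat (\<xi> n) + 2 * e n < rat (\<eta> n)"
  then obtain n where n: "n \<in> N" "rat (\<xi> n) + 2 * e n < rat (\<eta> n)" by blast
  then show "\<exists>a. ut \<xi> a \<and> lt a \<eta>" unfolding ut_def lt_def
    by (intro exI[of _ "(rat (\<xi> n) + rat (\<eta> n)) / 2"]) (auto intro!: bexI[of _ n] simp: field_simps)
next
  assume "\<exists>a. ut \<xi> a \<and> lt a \<eta>"
  then obtain a a' where a: "ut \<xi> a" "lt a' \<eta>" "a < a'" using lt_open by blast
  \<comment> \<open>Each of the two bounds below loses \<open>e n\<close>, and a gap of
    \<open>2 * e n\<close> must remain.\<close>
  obtain n where n: "n \<in> N" "e n < (a' - a) / 4" using e_small[of "(a' - a) / 4"] a by auto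
  have "rat (\<xi> n) - e n < a" "a' < rat (\<eta> n) + e n" using ut_bounds lt_bounds assms a n by auto
  then show "\<exists>n\<in>N. rat (\<xi> n) + 2 * e n < rat (\<eta> n)"
    using n by (intro bexI[of _ n]) (auto simp: field_simps)
qed

lemma real_eq_iff:
  assumes "isreal \<xi>" "isreal \<eta>"
  shows "(\<forall>n\<in>N. \<bar>rat (\<xi> n) - rat (\<eta> n)\<bar> <= 2 * e n) \<longleftrightarrow> (\<forall>a. lt a \<xi> \<longleftrightarrow> lt a \<eta>)"
proof
  assume L: "\<forall>n\<in>N. \<bar>rat (\<xi> n) - rat (\<eta> n)\<bar> <= 2 * e n"
  have *: "lt a \<eta>" if r: "isreal \<xi>" "isreal \<eta>" and a: "lt a \<xi>"
    and L: "\<forall>n\<in>N. \<bar>rat (\<xi> n) - rat (\<eta> n)\<bar> <= 2 * e n" for \<xi> \<eta> a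
  proof -
    obtain a' where a': "a < a'" "lt a' \<xi>" using lt_open a by blast
    obtain n where n: "n \<in> N" "e n < (a' - a) / 8" using e_small[of "(a' - a) / 8"] a' by auto
    have "a' < rat (\<xi> n) + e n" using lt_bounds r(1) a' n by blast
    then have "a + e n < rat (\<eta> n)" using L n by (auto simp: abs_le_iff field_simps dest!: bspec)
    then show ?thesis unfolding lt_def using n by blast
  qed
  show "\<forall>a. lt a \<xi> \<longleftrightarrow> lt a \<eta>" using *[of \<xi> \<eta>] *[of \<eta> \<xi>] assms L by (metis abs_minus_commute)
next
  assume R: "\<forall>a. lt a \<xi> \<longleftrightarrow> lt a \<eta>"
  have *: False if r: "isreal \<eta>" and R: "\<forall>a. lt a \<xi> --> lt a \<eta>"
    and n: "n \<in> N" "rat (\<eta> n) + 2 * e n < rat (\<xi> n)" for \<xi> \<eta> n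
  proof -
    let ?a = "(rat (\<eta> n) + rat (\<xi> n)) / 2"
    have "lt ?a \<xi>" "ut \<eta> ?a" unfolding lt_def ut_def using n
      by (auto intro!: bexI[of _ n] simp: field_simps)
    then show False using lt_ut_less[OF r] R by blast
  qed
  show "\<forall>n\<in>N. \<bar>rat (\<xi> n) - rat (\<eta> n)\<bar> <= 2 * e n"
  proof
    fix n assume "n \<in> N"
    then have "\<not> rat (\<eta> n) + 2 * e n < rat (\<xi> n)" "\<not> rat (\<xi> n) + 2 * e n < rat (\<eta> n)"
      using *[of \<eta> \<xi> n] *[of \<xi> \<eta> n] assms R by blast+
    then show "\<bar>rat (\<xi> n) - rat (\<eta> n)\<bar> <= 2 * e n" by (simp add: abs_le_iff)
  qed
qed

lemma near_iff:
  assumes "isreal \<xi>" "isreal \<eta>"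
  shows "(\<exists>n\<in>N. \<bar>rat (\<xi> n) - rat (\<eta> n)\<bar> < \<delta> - 2 * e n) \<longleftrightarrow> near \<xi> \<eta> \<delta>"
proof
  assume "\<exists>n\<in>N. \<bar>rat (\<xi> n) - rat (\<eta> n)\<bar> < \<delta> - 2 * e n"
  then obtain n where n: "n \<in> N" "\<bar>rat (\<xi> n) - rat (\<eta> n)\<bar> < \<delta> - 2 * e n" by blast
  \<comment> \<open>A quarter of the slack: widened by \<open>e n + h\<close> on each side, the
    interval spanned by the two approximations still has length less than
    \<open>\<delta>\<close>.\<close>
  define h where "h = (\<delta> - 2 * e n - \<bar>rat (\<xi> n) - rat (\<eta> n)\<bar>) / 4"
  have "4 * h = \<delta> - 2 * e n - \<bar>rat (\<xi> n) - rat (\<eta> n)\<bar>" by (simp add: h_def)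
  then have h: "0 < h" "\<bar>rat (\<xi> n) - rat (\<eta> n)\<bar> + 4 * h = \<delta> - 2 * e n" using n by linarith+
  let ?a = "min (rat (\<xi> n)) (rat (\<eta> n)) - e n - h" and ?b = "max (rat (\<xi> n)) (rat (\<eta> n)) + e n + h"
  have "lt ?a \<xi>" "lt ?a \<eta>" unfolding lt_def using n(1) h(1)
    by (auto intro!: bexI[of _ n] simp: min_def)
  moreover have "ut \<xi> ?b" "ut \<eta> ?b" unfolding ut_def using n(1) h(1)
    by (auto intro!: bexI[of _ n] simp: max_def)
  moreover have "?b - ?a < \<delta>" using h by (simp add: max_def min_def abs_if split: if_splits)
  ultimately show "near \<xi> \<eta> \<delta>" unfolding near_def by blast
next
  assume "near \<xi> \<eta> \<delta>"
  then obtain a b where ab: "lt a \<xi>" "lt a \<eta>" "ut \<xi> b" "ut \<eta> b" "b - a < \<delta>" unfolding near_def by blast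
  obtain n where n: "n \<in> N" "e n < (\<delta> - (b - a)) / 8" using e_small[of "(\<delta> - (b - a)) / 8"] ab by auto
  have "a < rat (\<xi> n) + e n" "a < rat (\<eta> n) + e n" "rat (\<xi> n) - e n < b" "rat (\<eta> n) - e n < b"
    using lt_bounds ut_bounds assms ab n by auto
  then have "\<bar>rat (\<xi> n) - rat (\<eta> n)\<bar> < \<delta> - 2 * e n"
    using n ab(5) by (simp add: abs_less_iff field_simps)
  then show "\<exists>n\<in>N. \<bar>rat (\<xi> n) - rat (\<eta> n)\<bar> < \<delta> - 2 * e n" using n by blast
qed

lemma isreal_const: "k \<in> N ==> isreal (%_. k)"
  by (simp add: isreal_def e_pos)

lemma lt_const [simp]: "lt a (%_. k) \<longleftrightarrow> a < rat k"
proof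
  assume "lt a (%_. k)"
  then obtain n where "n \<in> N" "a + e n < rat k" unfolding lt_def by blast
  then show "a < rat k" using e_pos[of n] by simp
next
  assume "a < rat k"
  then obtain n where "n \<in> N" "e n < rat k - a" using e_small[of "rat k - a"] by auto
  then show "lt a (%_. k)" unfolding lt_def by (intro bexI[of _ n]) auto
qed

lemma ut_const [simp]: "ut (%_. k) b \<longleftrightarrow> rat k < b"
proof
  assume "ut (%_. k) b"
  then obtain n where "n \<in> N" "rat k + e n < b" unfolding ut_def by blast
  then show "rat k < b" using e_pos[of n] by simp
next
  assume "rat k < b"
  then obtain n where "n \<in> N" "e n < b - rat k" using e_small[of "b - rat k"] by auto
  then show "ut (%_. k) b" unfolding ut_def by (intro bexI[of _ n]) auto
qed

lemma near_const: assumes "isreal \<eta>"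
  shows "near (%_. k) \<eta> \<delta> \<longleftrightarrow> lt (rat k - \<delta>) \<eta> \<and> ut \<eta> (rat k + \<delta>)"
proof
  assume "near (%_. k) \<eta> \<delta>"
  then obtain a b where "a < rat k" "lt a \<eta>" "rat k < b" "ut \<eta> b" "b - a < \<delta>" by (auto simp: near_def)
  then show "lt (rat k - \<delta>) \<eta> \<and> ut \<eta> (rat k + \<delta>)" by (auto elim!: lt_mono ut_mono)
next
  assume A: "lt (rat k - \<delta>) \<eta> \<and> ut \<eta> (rat k + \<delta>)"
  then obtain a b where ab: "rat k - \<delta> < a" "lt a \<eta>" "b < rat k + \<delta>" "ut \<eta> b"
    using lt_open ut_open by blast
  have "a < b" using lt_ut_less assms ab by blast
  \<comment> \<open>A quarter of the smaller gap: an interval around \<open>\<eta>\<close> of length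
    below \<open>h\<close>, enlarged to contain \<open>rat k\<close> with margin \<open>h\<close>,
    still has length less than \<open>\<delta>\<close>.\<close>
  define h where "h = min (a - (rat k - \<delta>)) (rat k + \<delta> - b) / 4"
  have h: "0 < h" "4 * h <= a - (rat k - \<delta>)" "4 * h <= rat k + \<delta> - b"
    using ab by (auto simp: h_def min_def)
  obtain a2 b2 where 2: "lt a2 \<eta>" "ut \<eta> b2" "b2 - a2 < h" using approx[OF h(1)] by blast
  have ba: "a2 < b2" using lt_ut_less assms 2 by blast
  have "a < b2" "a2 < b" using lt_ut_less assms 2 ab by blast+
  let ?a = "min a2 (rat k - h)" and ?b = "max b2 (rat k + h)"
  have "lt ?a \<eta>" by (rule lt_mono[OF 2(1)]) simp
  moreover have "ut \<eta> ?b" by (rule ut_mono[OF 2(2)]) simp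
  moreover have "?b - ?a < \<delta>"
  proof -
    have "b2 < rat k + \<delta> - h" "rat k - \<delta> + h < a2" "b2 - a2 < \<delta>" "2 * h < \<delta>"
      using ba \<open>a < b2\<close> \<open>a2 < b\<close> 2(3) h ab(1,3) \<open>a < b\<close> by linarith+
    then show ?thesis by (simp add: min_def max_def)
  qed
  ultimately show "near (%_. k) \<eta> \<delta>" unfolding near_def using h(1)
    by (intro exI[of _ ?a] exI[of _ ?b]) auto
qed

lemma near_sym: "near \<xi> \<eta> \<delta> ==> near \<eta> \<xi> \<delta>"
  unfolding near_def by blast

lemma near_lt: assumes "isreal \<xi>" "near \<xi> \<eta> \<delta>" "lt u \<xi>" shows "lt (u - \<delta>) \<eta>"
proof -
  obtain a b where "lt a \<eta>" "ut \<xi> b" "b - a < \<delta>" using assms(2) unfolding near_def by blast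
  moreover from this have "u < b" using lt_ut_less[OF assms(1,3)] by blast
  ultimately show ?thesis by (rule_tac lt_mono[of a]) auto
qed

lemma near_ut: assumes "isreal \<xi>" "near \<xi> \<eta> \<delta>" "ut \<xi> u" shows "ut \<eta> (u + \<delta>)"
proof -
  obtain a b where "lt a \<xi>" "ut \<eta> b" "b - a < \<delta>" using assms(2) unfolding near_def by blast
  moreover from this have "a < u" using lt_ut_less[OF assms(1) _ assms(3)] by blast
  ultimately show ?thesis by (rule_tac ut_mono[of _ b]) auto
qed

lemma dec_lt:
  assumes "df (push c) (%p. X (fst p) (snd p))" "dfq c A" shows "dec c (%x. lt (A x) (X x))"
  unfolding lt_def
  by (intro dec_ex dec_qless dfq_add dfq_e dfq_rat dfq_weak df_var assms dfq_valid[OF assms(2)])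

lemma dec_ut:
  assumes "df (push c) (%p. X (fst p) (snd p))" "dfq c A" shows "dec c (%x. ut (X x) (A x))"
  unfolding ut_def
  by (intro dec_ex dec_qless dfq_add dfq_e dfq_rat dfq_weak df_var assms dfq_valid[OF assms(2)])

subsection \<open>Reals from cuts\<close>

text \<open>For a left cut \<open>P\<close>, the entry at \<open>n\<close> codes a rational in
  \<open>P\<close> whose shift by \<open>e (n + 1)\<close> is outside, hence one within that
  distance of the supremum. Taking the least code makes the sequence definable.\<close>

definition cutreal :: "('k => bool) => 'k => 'k" where
  "cutreal P n = least (%k. P (rat k) \<and> \<not> P (rat k + e (n + 1)))"

lemma dec_cutreal:
  assumes "dec (push c) (%p. P (fst p) (rat (snd p)))" "valid c"
  shows "dec (push (push c)) (%q. P (fst (fst q)) (rat (snd q)) \<and>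
    \<not> P (fst (fst q)) (rat (snd q) + e (snd (fst q) + 1)))"
  by (intro dec_and dec_not dec_subq[of c P "push (push c)" "%q. fst (fst q)", OF assms(1)] extends_push extends_refl
      dfq_add dfq_e dfq_rat df_add df_const df_var df_weak valid_push N1 assms(2))

lemma df_cutreal:
  assumes "dec (push c) (%p. P (fst p) (rat (snd p)))" "valid c"
  shows "df (push c) (%p. cutreal (P (fst p)) (snd p))"
  unfolding cutreal_def
  using least_spec(1)[OF valid_push[OF assms(2)], of "%p k. P (fst p) (rat k) \<and> \<not> P (fst p) (rat k + e (snd p + 1))"]
    dec_cutreal[OF assms] by simp

text \<open>Dedekind completeness for decidable cuts. Since \<open>P\<close> has no greatest
  element, \<open>lt\<close> recovers it exactly, with no exception at the endpoint.\<close>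

lemma cutreal:
  assumes P: "dec (push c) (%p. P (fst p) (rat (snd p)))" and v: "valid c" and x: "x \<in> dom c"
    and down: "!!q q'. P x q ==> q' <= q ==> P x q'"
    and op: "!!q. P x q ==> \<exists>q'>q. P x q'" and lo: "P x lo" and hi: "\<not> P x hi"
  shows "isreal (cutreal (P x))" "lt a (cutreal (P x)) \<longleftrightarrow> P x a"
proof -
  let ?z = "cutreal (P x)"
  have ex: "\<exists>k\<in>N. P x (rat k) \<and> \<not> P x (rat k + h)" if h: "0 < h" for h
  proof -
    have R: "dec (push c) (%p. P (fst p) (lo + snd p * h))"
      by (intro dec_subq[of c P "push c" fst, OF P] extends_push extends_refl dfq_add dfq_mult dfq_const dfq_df
          df_var v valid_push)
    \<comment> \<open>Steps of width \<open>h\<close> from \<open>lo\<close> must leave the cut: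
      otherwise induction keeps all of them inside, while the Archimedean property carries one past
      \<open>hi\<close>.\<close>
    have "\<exists>j\<in>N. P x (lo + j * h) \<and> \<not> P x (lo + (j + 1) * h)"
    proof (rule ccontr)
      assume "\<not> ?thesis"
      then have all: "P x (lo + j * h)" if "j \<in> N" for j
        by (rule_tac N_induct[OF v R x]) (use lo that in auto)
      obtain j where "j \<in> N" "(hi - lo) / h < j" using archimedean by blast
      then have "hi <= lo + j * h" using h by (simp add: pos_divide_less_eq)
      then show False using all[OF \<open>j \<in> N\<close>] down hi by blast
    qed
    then obtain j where "P x (lo + j * h)" "\<not> P x (lo + (j + 1) * h)" by blast
    moreover obtain k where "k \<in> N" "rat k = lo + j * h" using rat_surj by blast
    moreover have "lo + (j + 1) * h = lo + j * h + h" by (simp add: algebra_simps)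
    ultimately show ?thesis by metis
  qed
  have z: "?z n \<in> N \<and> P x (rat (?z n)) \<and> \<not> P x (rat (?z n) + e (n + 1))" if n: "n \<in> N" for n
  proof -
    have "n + 1 \<in> N" using n N1 Nadd by blast
    then obtain k where k: "k \<in> N" "P x (rat k) \<and> \<not> P x (rat k + e (n + 1))" using ex e_pos by blast
    from least_spec(2)[OF valid_push[OF v], of "%p k. P (fst p) (rat k) \<and> \<not> P (fst p) (rat k + e (snd p + 1))",
        OF dec_cutreal[OF P v], of "(x, n)" k] k x n
    show ?thesis by (simp add: cutreal_def)
  qed
  have between: "rat (?z m) < rat (?z n) + e (n + 1)" if "n \<in> N" "m \<in> N" for n m
    using z that down by (meson not_le)
  show "isreal ?z" unfolding isreal_def
  proof (intro conjI ballI)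
    fix n i assume ni: "n \<in> N" "i \<in> N"
    have "n + i \<in> N" "n + i + 1 \<in> N" using Nadd ni N1 by auto
    moreover from this have "e (n + i + 1) <= e (n + 1)" using ni Nnonneg[of i] by (intro e_mono Nadd N1) auto
    moreover have "e (n + 1) < e n" using e_half[OF ni(1)] e_pos[OF ni(1)] by linarith
    ultimately show "\<bar>rat (?z n) - rat (?z (n + i))\<bar> < e n"
      using between[of n "n + i"] between[of "n + i" n] ni by (simp add: abs_less_iff)
  qed (use z in auto)
  show "lt a ?z \<longleftrightarrow> P x a"
  proof
    assume "lt a ?z"
    then obtain n where n: "n \<in> N" "a + e n < rat (?z n)" unfolding lt_def by blast
    then have "a <= rat (?z n)" using e_pos[of n] by simp
    then show "P x a" using z n down by blast
  next
    assume "P x a"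
    then obtain a' where a': "a < a'" "P x a'" using op by blast
    obtain n where n: "n \<in> N" "e n < (a' - a) / 2" using e_small[of "(a' - a) / 2"] a' by auto
    have "a' < rat (?z n) + e (n + 1)" using z n a' down by (meson not_le)
    moreover have "e (n + 1) < e n" using e_half[OF n(1)] e_pos[OF n(1)] by linarith
    ultimately have "a + e n < rat (?z n)" using n by (simp add: field_simps)
    then show "lt a ?z" unfolding lt_def using n by blast
  qed
qed

subsection \<open>Separating two closed sets\<close>

text \<open>\<open>dlt a r \<xi> t\<close> says \<open>t < sup\<^sub>n (r\<^sub>n - \<bar>\<xi> - a\<^sub>n\<bar>)\<close>.  If the balls \<open>B(a\<^sub>n, r\<^sub>n)\<close> cover the open
  set \<open>U\<close>, this supremum, cut off to the unit interval, is a Lipschitz function \<open>d\<close> that is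
  positive exactly on \<open>U\<close>.  \<open>gcut\<close> is the left cut of \<open>d\<^sub>0 / (d\<^sub>0 + d\<^sub>1)\<close>.\<close>

definition dlt :: "('k => 'k) => ('k => 'k) => ('k => 'k) => 'k => bool" where
  "dlt a r \<xi> t \<longleftrightarrow> (\<exists>n\<in>N. lt (a n - r n + t) \<xi> \<and> ut \<xi> (a n + r n - t))"

text \<open>Division is avoided: \<open>s\<close> is an upper bound of \<open>d\<^sub>1\<close> and
  \<open>t\<close> a positive lower bound of \<open>d\<^sub>0\<close>, both after cutting off at 1,
  and \<open>q * s < (1 - q) * t\<close> places \<open>q\<close> below \<open>t / (s + t)\<close>.
  The disjunct \<open>q < 0\<close> keeps the cut nonempty where \<open>d\<^sub>0\<close>
  vanishes.\<close>

definition gcut :: "('k => 'k) => ('k => 'k) => ('k => 'k) => ('k => 'k) => ('k => 'k) => 'k => bool" where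
  "gcut a\<^sub>0 r\<^sub>0 a\<^sub>1 r\<^sub>1 \<xi> q \<longleftrightarrow> q < 0 \<or> (\<exists>s t. 0 <= s \<and> 0 < t \<and> t <= 1 \<and> (1 <= s \<or> \<not> dlt a\<^sub>1 r\<^sub>1 \<xi> s) \<and>
     dlt a\<^sub>0 r\<^sub>0 \<xi> t \<and> q * s < (1 - q) * t)"

lemma dlt_mono: "dlt a r \<xi> t ==> t' <= t ==> dlt a r \<xi> t'"
  unfolding dlt_def by (meson add_left_mono diff_left_mono lt_mono ut_mono)

lemma dlt_open: assumes "dlt a r \<xi> t" shows "\<exists>t'>t. dlt a r \<xi> t'"
proof -
  obtain n where n: "n \<in> N" "lt (a n - r n + t) \<xi>" "ut \<xi> (a n + r n - t)" using assms unfolding dlt_def by blast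
  obtain u w where uw: "a n - r n + t < u" "lt u \<xi>" "w < a n + r n - t" "ut \<xi> w"
    using lt_open[OF n(2)] ut_open[OF n(3)] by blast
  let ?t = "min (u - (a n - r n)) (a n + r n - w)"
  have "t < ?t" using uw by (simp add: min_def field_simps)
  moreover have "dlt a r \<xi> ?t" unfolding dlt_def
    by (intro bexI[of _ n] conjI lt_mono[OF uw(2)] ut_mono[OF uw(4)] n(1)) (auto simp: min_def field_simps)
  ultimately show ?thesis by blast
qed

text \<open>Each \<open>r\<^sub>n - \<bar>\<xi> - a\<^sub>n\<bar>\<close> is Lipschitz in
  \<open>\<xi>\<close> with constant 1, uniformly in \<open>n\<close>, and so is the
  supremum.\<close>

lemma dlt_near:
  assumes "isreal \<xi>" "near \<xi> \<eta> \<delta>" "dlt a r \<xi> t" shows "dlt a r \<eta> (t - \<delta>)"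
proof -
  obtain n where n: "n \<in> N" "lt (a n - r n + t) \<xi>" "ut \<xi> (a n + r n - t)" using assms(3) unfolding dlt_def by blast
  have "lt (a n - r n + (t - \<delta>)) \<eta>" using near_lt[OF assms(1,2) n(2)] by (simp add: algebra_simps)
  moreover have "ut \<eta> (a n + r n - (t - \<delta>))" using near_ut[OF assms(1,2) n(3)] by (simp add: algebra_simps)
  ultimately show ?thesis unfolding dlt_def using n(1) by blast
qed

context
  fixes a\<^sub>0 r\<^sub>0 a\<^sub>1 r\<^sub>1 :: "'k => 'k"
begin

abbreviation "GC \<equiv> gcut a\<^sub>0 r\<^sub>0 a\<^sub>1 r\<^sub>1"
abbreviation "D\<^sub>0 \<equiv> dlt a\<^sub>0 r\<^sub>0"
abbreviation "D\<^sub>1 \<equiv> dlt a\<^sub>1 r\<^sub>1"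

lemma gcut_mono: assumes "GC \<xi> q" "q' <= q" shows "GC \<xi> q'"
proof (cases "q' < 0")
  case False
  then obtain s t where st: "0 <= s" "0 < t" "t <= 1" "1 <= s \<or> \<not> D\<^sub>1 \<xi> s" "D\<^sub>0 \<xi> t" "q * s < (1 - q) * t"
    using assms unfolding gcut_def by auto
  have "q' * s <= q * s" "(1 - q) * t <= (1 - q') * t" using st assms(2) by (auto intro: mult_right_mono)
  then have "q' * s < (1 - q') * t" using st(6) by linarith
  then show ?thesis unfolding gcut_def using st by blast
qed (simp add: gcut_def)

lemma gcut_open: assumes "GC \<xi> q" shows "\<exists>q'>q. GC \<xi> q'"
proof (cases "q < 0")
  case True
  then show ?thesis unfolding gcut_def by (intro exI[of _ "q / 2"]) auto
next
  case False
  then obtain s t where st: "0 <= s" "0 < t" "t <= 1" "1 <= s \<or> \<not> D\<^sub>1 \<xi> s" "D\<^sub>0 \<xi> t" "q * s < (1 - q) * t"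
    using assms unfolding gcut_def by auto
  \<comment> \<open>Raising \<open>q\<close> by \<open>h\<close> costs \<open>h * (s + t)\<close>,
    which is half of the slack.\<close>
  define h where "h = ((1 - q) * t - q * s) / 2 / (s + t)"
  have pos: "0 < s + t" "0 < (1 - q) * t - q * s" using st by auto
  have hst: "h * (s + t) = ((1 - q) * t - q * s) / 2"
  proof -
    have "x / y * y = x" if "0 < y" for x y :: 'k using that by simp
    from this[OF pos(1)] show ?thesis unfolding h_def .
  qed
  have half: "0 < x / 2 \<and> x / 2 < x" if "0 < x" for x :: 'k using that by simp
  have h1: "0 < h" unfolding h_def
    using half[OF pos(2)] pos(1) by (intro divide_pos_pos[of _ "s + t"]) blast+
  have "h * (s + t) < (1 - q) * t - q * s" unfolding hst using half[OF pos(2)] by blast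
  note h = h1 this
  then have "(q + h) * s < (1 - (q + h)) * t" by (simp add: algebra_simps)
  then have "GC \<xi> (q + h)" unfolding gcut_def using st by blast
  then show ?thesis using h(1) by (intro exI[of _ "q + h"]) auto
qed

lemma gcut_neg: "GC \<xi> (- 1)" and not_gcut_1: "\<not> GC \<xi> 1"
  by (auto simp: gcut_def)

lemma gcut_0_iff: "GC \<xi> 0 \<longleftrightarrow> D\<^sub>0 \<xi> 0"
proof
  assume "GC \<xi> 0"
  then show "D\<^sub>0 \<xi> 0" unfolding gcut_def using dlt_mono by fastforce
next
  assume "D\<^sub>0 \<xi> 0"
  then obtain t where t: "0 < t" "D\<^sub>0 \<xi> t" using dlt_open by blast
  \<comment> \<open>The cut-off makes \<open>s = 1\<close> an upper bound at every point, and for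
    \<open>q = 0\<close> the value of \<open>s\<close> is multiplied by 0.\<close>
  then show "GC \<xi> 0" unfolding gcut_def
    by (intro disjI2 exI[of _ 1] exI[of _ "min 1 t"]) (auto intro: dlt_mono simp: min_def)
qed

lemma gcut_1_iff: assumes "D\<^sub>0 \<xi> 0 \<or> D\<^sub>1 \<xi> 0" shows "(\<forall>q<1. GC \<xi> q) \<longleftrightarrow> \<not> D\<^sub>1 \<xi> 0"
proof
  assume nD: "\<not> D\<^sub>1 \<xi> 0"
  then obtain t where t: "0 < t" "D\<^sub>0 \<xi> t" using dlt_open assms by blast
  show "\<forall>q<1. GC \<xi> q"
  proof (intro allI impI)
    fix q :: 'k assume "q < 1"
    then show "GC \<xi> q" unfolding gcut_def using t nD
      by (intro disjI2 exI[of _ 0] exI[of _ "min 1 t"]) (auto intro: dlt_mono simp: min_def)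
  qed
next
  assume all: "\<forall>q<1. GC \<xi> q"
  show "\<not> D\<^sub>1 \<xi> 0"
  proof
    assume "D\<^sub>1 \<xi> 0"
    then obtain s0 where s0: "0 < s0" "D\<^sub>1 \<xi> s0" using dlt_open by blast
    define \<sigma> where "\<sigma> = min 1 s0"
    have \<sigma>: "0 < \<sigma>" "\<sigma> <= 1" "\<sigma> <= s0" using s0 by (auto simp: \<sigma>_def)
    \<comment> \<open>With \<open>d\<^sub>1\<close> at least \<open>\<sigma>\<close> and
      \<open>d\<^sub>0\<close> at most 1 the quotient is at most \<open>1 / (1 + \<sigma>)\<close>,
      so this \<open>q\<close> cannot lie strictly below it.\<close>
    define q where "q = 1 / (1 + \<sigma>)"
    have q: "0 < q" "q < 1" "q * \<sigma> = 1 - q" using \<sigma> by (auto simp: q_def field_simps)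
    then obtain s t where st: "0 <= s" "0 < t" "t <= 1" "1 <= s \<or> \<not> D\<^sub>1 \<xi> s" "q * s < (1 - q) * t"
      using all unfolding gcut_def by (meson less_asym)
    have "\<sigma> <= s" using st(4) dlt_mono[OF s0(2), of s] \<sigma> by (meson le_cases order_trans)
    then have "q * \<sigma> <= q * s" using q(1) by simp
    moreover have "(1 - q) * t <= 1 - q" using st(3) q(2) by (simp add: mult_left_le)
    ultimately show False using st(5) q(3) by linarith
  qed
qed

text \<open>One distance at \<open>u\<close> is above \<open>k\<close>, so \<open>s + t\<close> may
  be taken to be at least \<open>k\<close>. Passing to \<open>w\<close> raises \<open>s\<close> and
  lowers \<open>t\<close> by \<open>\<delta>\<close>, which costs exactly \<open>\<delta>\<close> in
  the inequality, while lowering \<open>q\<close> by \<open>\<epsilon>\<close> gains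
  \<open>\<epsilon> * (s + t)\<close>. The condition \<open>\<delta> < \<epsilon> * k\<close> pays
  for it.\<close>

lemma gcut_shift:
  assumes "isreal u" "isreal w" "near u w \<delta>" "\<delta> < \<epsilon> * k" "0 < \<epsilon>" "\<epsilon> <= 1" "0 < k" "k <= 1" "0 < \<delta>"
    and "D\<^sub>0 u k \<or> D\<^sub>1 u k" "GC u q"
  shows "GC w (q - \<epsilon>)"
proof (cases "q - \<epsilon> < 0")
  case False
  then have q: "\<epsilon> <= q" "0 <= q" using assms(5) by auto
  then obtain s t' where st': "0 <= s" "0 < t'" "t' <= 1" "1 <= s \<or> \<not> D\<^sub>1 u s" "D\<^sub>0 u t'" "q * s < (1 - q) * t'"
    using assms(11) unfolding gcut_def by auto
  have "0 <= q * s" using q st' by simp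
  then have "0 < (1 - q) * t'" using st'(6) by linarith
  then have q1: "q < 1" using st'(2) by (simp add: zero_less_mult_iff)
  \<comment> \<open>If \<open>d\<^sub>0\<close> is known to exceed \<open>k\<close>, the lower bound
    is improved to at least \<open>k\<close>; otherwise the upper bound \<open>s\<close> of
    \<open>d\<^sub>1\<close> is at least \<open>k\<close>.\<close>
  define t where "t = (if D\<^sub>0 u k then max t' k else t')"
  have st: "0 < t" "t <= 1" "D\<^sub>0 u t" "t' <= t" using st' assms(8) by (auto simp: t_def max_def)
  have "(1 - q) * t' <= (1 - q) * t" using q1 st(4) by (intro mult_left_mono) auto
  then have st6: "q * s < (1 - q) * t" using st'(6) by linarith
  have k: "k <= s \<or> k <= t"
  proof (cases "D\<^sub>0 u k")
    case False
    then have "D\<^sub>1 u k" using assms(10) by blast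
    then have "k <= s" using st'(4) assms(8) dlt_mono[of a\<^sub>1 r\<^sub>1 u k s] by (meson le_cases order_trans)
    then show ?thesis by blast
  qed (simp add: t_def)
  have \<epsilon>k: "\<epsilon> * k <= k" using assms(5-8) by (simp add: mult_left_le_one_le)
  \<comment> \<open>The new lower bound \<open>t - \<delta>\<close> has to be positive. If only
    \<open>s\<close> is known to be large, \<open>\<epsilon> * k <= q * s < (1 - q) * t <= t\<close>
    provides this.\<close>
  have t\<delta>: "\<delta> < t"
  proof (cases "k <= t")
    case False
    then have "k <= s" using k by blast
    have "\<epsilon> * k <= q * s" using q \<open>k <= s\<close> assms(5,7) by (intro mult_mono) auto
    moreover have "(1 - q) * t <= t" using q st by (simp add: mult_left_le_one_le)
    ultimately show ?thesis using st6 assms(4) by linarith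
  qed (use \<epsilon>k assms(4) in linarith)
  have "\<epsilon> * k <= \<epsilon> * (s + t)" using k assms(5) st'(1) st(1) by (intro mult_left_mono) auto
  then have "\<delta> < \<epsilon> * (s + t)" using assms(4) by linarith
  then have "(q - \<epsilon>) * (s + \<delta>) < (1 - (q - \<epsilon>)) * (t - \<delta>)" using st6 by (simp add: algebra_simps)
  moreover have "1 <= s + \<delta> \<or> \<not> D\<^sub>1 w (s + \<delta>)"
    using st'(4) dlt_near[OF assms(2) near_sym[OF assms(3)], of a\<^sub>1 r\<^sub>1 "s + \<delta>"] assms(9) by auto
  moreover have "D\<^sub>0 w (t - \<delta>)" using dlt_near[OF assms(1,3) st(3)] .
  ultimately show ?thesis unfolding gcut_def using st'(1) st(2) t\<delta> assms(9)
    by (intro disjI2 exI[of _ "s + \<delta>"] exI[of _ "t - \<delta>"]) auto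
qed (simp add: gcut_def)

lemma gcut_cont:
  assumes "isreal \<xi>" "D\<^sub>0 \<xi> 0 \<or> D\<^sub>1 \<xi> 0" "0 < \<epsilon>" "\<epsilon> <= 1"
  shows "\<exists>\<delta>>0. \<forall>\<eta>. isreal \<eta> --> near \<xi> \<eta> \<delta> --> (\<forall>q. (GC \<xi> q --> GC \<eta> (q - \<epsilon>)) \<and> (GC \<eta> q --> GC \<xi> (q - \<epsilon>)))"
proof -
  obtain k' where k': "0 < k'" "D\<^sub>0 \<xi> k' \<or> D\<^sub>1 \<xi> k'" using assms(2) dlt_open by blast
  define k where "k = min 1 k'"
  have k: "0 < k" "k <= 1" "D\<^sub>0 \<xi> k \<or> D\<^sub>1 \<xi> k" using k' dlt_mono by (auto simp: k_def min_def)
  \<comment> \<open>With a quarter, one of the distances is still above \<open>k / 2\<close> at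
    every nearby \<open>\<eta>\<close>, so \<open>gcut_shift\<close> applies from
    \<open>\<eta>\<close> back to \<open>\<xi>\<close> as well, with \<open>k / 2\<close> for
    \<open>k\<close>.\<close>
  define \<delta> where "\<delta> = \<epsilon> * k / 4"
  have \<delta>: "0 < \<delta>" "\<delta> < \<epsilon> * k" "\<delta> < \<epsilon> * (k / 2)" "\<delta> <= k / 2"
  proof -
    have "0 < \<epsilon> * k" using assms k by simp
    moreover have "\<epsilon> * k <= k" using assms(3,4) k by (simp add: mult_left_le_one_le)
    ultimately show "0 < \<delta>" "\<delta> < \<epsilon> * k" "\<delta> < \<epsilon> * (k / 2)" "\<delta> <= k / 2" using k by (auto simp: \<delta>_def)
  qed
  have "(GC \<xi> q --> GC \<eta> (q - \<epsilon>)) \<and> (GC \<eta> q --> GC \<xi> (q - \<epsilon>))" if r: "isreal \<eta>" "near \<xi> \<eta> \<delta>" for \<eta> q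
  proof (intro conjI impI)
    assume "GC \<xi> q"
    then show "GC \<eta> (q - \<epsilon>)"
      using gcut_shift[OF assms(1) r \<delta>(2) assms(3,4) k(1,2) \<delta>(1) k(3)] by blast
  next
    assume "GC \<eta> q"
    have half: "k / 2 <= k - \<delta>" using \<delta>(4) by (simp add: field_simps)
    have "D\<^sub>0 \<eta> (k - \<delta>) \<or> D\<^sub>1 \<eta> (k - \<delta>)" using k(3) dlt_near[OF assms(1) r(2)] by blast
    then have "D\<^sub>0 \<eta> (k / 2) \<or> D\<^sub>1 \<eta> (k / 2)" using dlt_mono half by blast
    moreover have "0 < k / 2" "k / 2 <= 1" using k by auto
    ultimately show "GC \<xi> (q - \<epsilon>)"
      using gcut_shift[OF r(1) assms(1) near_sym[OF r(2)] \<delta>(3) assms(3,4) _ _ \<delta>(1)] \<open>GC \<eta> q\<close> by blast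
  qed
  then show ?thesis using \<delta>(1) by blast
qed

end

end

context definability begin

text \<open>Reuses a function of a number under additional binders: the new last variable is
  substituted for the one that followed \<open>c\<close>.\<close>

lemma df_lift: "df (push c) (%p. X (fst p) (snd p)) ==> extends c c' h ==>
    df (push c') (%p. X (h (fst p)) (snd p))"
  using df_sub[of c X "push c'" "%p. h (fst p)" snd] extends_push[of c c' h] df_var[of c']
  by (simp add: extends_def split: prod.splits)

lemma dfq_lift: "dfq (push c) (%p. X (fst p) (snd p)) ==> extends c c' h ==>
    dfq (push c') (%p. X (h (fst p)) (snd p))"
  using dfq_sub[of c X "push c'" "%p. h (fst p)" snd] extends_push[of c c' h] df_var[of c']
  by (simp add: extends_def split: prod.splits)

lemma dec_dlt:
  assumes "dfq (push c) (%p. A (fst p) (snd p))" "dfq (push c) (%p. R (fst p) (snd p))"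
    "df (push c) (%p. X (fst p) (snd p))" "dfq c T"
  shows "dec c (%x. dlt (A x) (R x) (X x) (T x))"
proof -
  note v = dfq_valid[OF assms(4)]
  have X: "df (push (push c)) (%p. X (fst (fst p)) (snd p))"
    by (rule df_lift[OF assms(3) extends_push[OF extends_refl[OF v]]])
  show ?thesis unfolding dlt_def
    by (intro dec_ex dec_and dec_lt dec_ut dfq_add dfq_diff dfq_weak assms v X)
qed

context
  fixes c :: "'s list \<times> 'x set \<times> ('x => 'v list)"
    and A\<^sub>0 R\<^sub>0 A\<^sub>1 R\<^sub>1 X :: "'x => 'k => 'k"
  assumes v: "valid c"
    and A\<^sub>0: "dfq (push c) (%p. A\<^sub>0 (fst p) (snd p))" and R\<^sub>0: "dfq (push c) (%p. R\<^sub>0 (fst p) (snd p))"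
    and A\<^sub>1: "dfq (push c) (%p. A\<^sub>1 (fst p) (snd p))" and R\<^sub>1: "dfq (push c) (%p. R\<^sub>1 (fst p) (snd p))"
    and X: "df (push c) (%p. X (fst p) (snd p))"
begin

lemma dec_gcut:
  "dec (push c) (%p. gcut (A\<^sub>0 (fst p)) (R\<^sub>0 (fst p)) (A\<^sub>1 (fst p)) (R\<^sub>1 (fst p)) (X (fst p)) (rat (snd p)))"
proof -
  let ?h = "%p :: (('x \<times> 'k) \<times> 'k) \<times> 'k. fst (fst (fst p))"
  have ext: "extends c (push (push (push c))) ?h"
    by (intro extends_push extends_refl v)
  note l = dfq_lift[OF A\<^sub>0 ext] dfq_lift[OF R\<^sub>0 ext] dfq_lift[OF A\<^sub>1 ext] dfq_lift[OF R\<^sub>1 ext] df_lift[OF X ext]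
  show ?thesis unfolding gcut_def
    by (intro dec_or dec_exq dec_and dec_not dec_dlt dec_qless dec_qle dfq_mult dfq_diff dfq_const dfq_rat
        df_var df_weak valid_push v l)
qed

lemma df_gfun:
  "df (push c) (%p. cutreal (gcut (A\<^sub>0 (fst p)) (R\<^sub>0 (fst p)) (A\<^sub>1 (fst p)) (R\<^sub>1 (fst p)) (X (fst p))) (snd p))"
  using df_cutreal[of c "%x. gcut (A\<^sub>0 x) (R\<^sub>0 x) (A\<^sub>1 x) (R\<^sub>1 x) (X x)", OF dec_gcut v] .

lemma gfun:
  assumes "x \<in> dom c"
  shows "isreal (cutreal (gcut (A\<^sub>0 x) (R\<^sub>0 x) (A\<^sub>1 x) (R\<^sub>1 x) (X x)))"
    and "lt a (cutreal (gcut (A\<^sub>0 x) (R\<^sub>0 x) (A\<^sub>1 x) (R\<^sub>1 x) (X x))) \<longleftrightarrow>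
      gcut (A\<^sub>0 x) (R\<^sub>0 x) (A\<^sub>1 x) (R\<^sub>1 x) (X x) a"
  using cutreal[of c "%x. gcut (A\<^sub>0 x) (R\<^sub>0 x) (A\<^sub>1 x) (R\<^sub>1 x) (X x)", OF dec_gcut v assms
      gcut_mono gcut_open gcut_neg not_gcut_1] by auto

end

text \<open>If \<open>(a, b)\<close> encloses \<open>\<xi>\<close> with length below
  \<open>\<epsilon>\<close>, the interval from \<open>a - \<epsilon>\<close> to
  \<open>b + 2 * \<epsilon>\<close> encloses both reals. The second \<open>\<epsilon>\<close> on the
  right is the price of passing from a left cut to a right cut by \<open>located\<close>.\<close>

lemma near_shift:
  assumes "isreal \<xi>" "isreal \<eta>" "0 < \<epsilon>"
    and "!!a. lt a \<xi> ==> lt (a - \<epsilon>) \<eta>" "!!a. lt a \<eta> ==> lt (a - \<epsilon>) \<xi>"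
  shows "near \<xi> \<eta> (4 * \<epsilon>)"
proof -
  obtain a b where ab: "lt a \<xi>" "ut \<xi> b" "b - a < \<epsilon>" using approx[OF assms(3)] by blast
  have "lt (a - \<epsilon>) \<xi>" "lt (a - \<epsilon>) \<eta>" "ut \<xi> (b + 2 * \<epsilon>)"
    using ab assms(3,4) by (auto intro: lt_mono[OF ab(1)] ut_mono[OF ab(2)])
  moreover have "ut \<eta> (b + 2 * \<epsilon>)"
  proof -
    have "\<not> lt (b + \<epsilon>) \<eta>" using assms(5)[of "b + \<epsilon>"] lt_ut_less[OF assms(1) _ ab(2), of b] by auto
    then show ?thesis using located[of "b + \<epsilon>" "b + 2 * \<epsilon>" \<eta>] assms(3) by auto
  qed
  moreover have "b + 2 * \<epsilon> - (a - \<epsilon>) < 4 * \<epsilon>" using ab(3) by simp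
  ultimately show ?thesis unfolding near_def by blast
qed

subsection \<open>Balls contained in the positivity set of a continuous function\<close>

text \<open>\<open>R\<close> stands for the reals that are objects of a model, and
  \<open>\<Phi>\<close> for a continuous function on them. Points are obtained from
  \<open>R_df\<close>: a definable real agrees on \<open>N\<close> with some member of
  \<open>R\<close>.\<close>

context
  fixes c :: "'s list \<times> 'x set \<times> ('x => 'v list)" and x\<^sub>0 :: 'x
    and R :: "('k => 'k) => bool" and \<Phi> :: "('k => 'k) => 'k => 'k"
  assumes v: "valid c" and x\<^sub>0: "x\<^sub>0 \<in> dom c"
    and R_real: "!!\<xi>. R \<xi> ==> isreal \<xi>" and \<Phi>_real: "!!\<xi>. R \<xi> ==> isreal (\<Phi> \<xi>)"
    and R_const: "!!k. k \<in> N ==> R (%_. k)"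
    and R_df: "!!F. df (push c) (%p. F (snd p)) ==> isreal F ==> \<exists>\<xi>. R \<xi> \<and> (\<forall>n\<in>N. \<xi> n = F n)"
    and \<Phi>_df: "df (push (push c)) (%p. \<Phi> (%_. snd (fst p)) (snd p))"
    and cont: "!!\<xi> \<epsilon>. R \<xi> ==> 0 < \<epsilon> ==> \<exists>\<delta>>0. \<forall>\<eta>. R \<eta> --> near \<xi> \<eta> \<delta> --> near (\<Phi> \<xi>) (\<Phi> \<eta>) \<epsilon>"
begin

text \<open>A uniform bound at the rational points of an interval is an arithmetical condition,
  whereas positivity on the interval quantifies over reals.\<close>

definition bounded_below :: "'k => 'k => bool" where
  "bounded_below s u \<longleftrightarrow> (\<exists>\<epsilon>>0. \<forall>k\<in>N. s <= rat k \<and> rat k <= u --> lt \<epsilon> (\<Phi> (%_. k)))"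

lemma dec_bounded_below:
  assumes "extends c c' h" "dfq c' S" "dfq c' U" shows "dec c' (%y. bounded_below (S y) (U y))"
proof -
  note v' = dfq_valid[OF assms(2)]
  have ext: "extends c (push (push c')) (%p. h (fst (fst p)))" by (intro extends_push assms)
  have 1: "df (push (push (push c'))) (%p. \<Phi> (%_. snd (fst p)) (snd p))"
    by (rule df_sub2[of c "%x k n. \<Phi> (%_. k) n", OF \<Phi>_df extends_push[OF ext]])
      (intro df_var df_weak valid_push v')+
  show ?thesis unfolding bounded_below_def
    by (intro dec_exq dec_and dec_all dec_imp dec_qless dec_qle dec_lt dfq_const dfq_rat dfq_weak
        df_var df_weak valid_push v' assms 1)
qed

text \<open>The supremum of all \<open>u\<close> such that \<open>\<Phi>\<close> is bounded away from 0 on the rationals of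
  \<open>[s, u]\<close> is a real, and continuity there shows that it is \<open>t\<close>.\<close>

lemma compactness:
  assumes pos: "!!\<xi>. R \<xi> ==> \<not> ut \<xi> s ==> \<not> lt t \<xi> ==> lt 0 (\<Phi> \<xi>)" and "s <= t"
  shows "bounded_below s t"
proof (rule ccontr)
  assume nb: "\<not> bounded_below s t"
  \<comment> \<open>The strict \<open>q < u\<close> makes this left cut open, and
    \<open>q < s\<close> makes it nonempty.\<close>
  define Q where "Q = (%q. q < s \<or> (\<exists>u. q < u \<and> u <= t \<and> bounded_below s u))"
  have dec: "dec (push c) (%p. Q (rat (snd p)))" unfolding Q_def
    by (intro dec_or dec_exq dec_and dec_qless dec_qle
        dec_bounded_below[of "push (push c)" "%p. fst (fst p)"] extends_push extends_refl
        dfq_const dfq_rat df_var df_weak valid_push v)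
  have down: "Q q'" if "Q q" "q' <= q" for q q' using that unfolding Q_def by (meson le_less_trans)
  have op: "\<exists>q'>q. Q q'" if "Q q" for q
    using that unfolding Q_def by (meson dense)
  have lo: "Q (s - 1)" unfolding Q_def by simp
  have hi: "\<not> Q t" using assms(2) unfolding Q_def by auto
  define z where "z = cutreal Q"
  have z: "isreal z" "!!a. lt a z \<longleftrightarrow> Q a"
    using cutreal[of c "%_. Q", OF dec v x\<^sub>0 down op lo hi] by (auto simp: z_def)
  obtain y where y: "R y" "\<forall>n\<in>N. y n = z n"
    using R_df[of z] df_cutreal[of c "%_. Q", OF dec v] z(1) unfolding z_def by blast
  have lty: "lt a y \<longleftrightarrow> Q a" for a using z(2)[of a] y(2) by (simp add: lt_def)
  note ry = R_real[OF y(1)]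
  have "\<not> ut y s"
  proof
    assume "ut y s"
    then obtain b where "b < s" "ut y b" using ut_open by blast
    then show False using lt_ut_less[OF ry, of b b] lty[of b] by (simp add: Q_def)
  qed
  moreover have "\<not> lt t y" using lty hi by simp
  ultimately have "lt 0 (\<Phi> y)" using pos y(1) by blast
  then obtain \<epsilon> where \<epsilon>: "0 < \<epsilon>" "lt \<epsilon> (\<Phi> y)" using lt_open by blast
  obtain \<delta> where \<delta>: "0 < \<delta>" "!!\<eta>. R \<eta> ==> near y \<eta> \<delta> ==> near (\<Phi> y) (\<Phi> \<eta>) (\<epsilon> / 2)"
    using cont[OF y(1), of "\<epsilon> / 2"] \<epsilon>(1) by auto
  obtain a b where ab: "lt a y" "ut y b" "b - a < \<delta>" using approx[OF \<delta>(1)] by blast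
  have near: "lt (\<epsilon> / 2) (\<Phi> (%_. k))" if k: "k \<in> N" "a <= rat k" "rat k <= b" for k
  proof -
    have "lt (rat k - \<delta>) y" "ut y (rat k + \<delta>)"
      using ab k by (auto intro: lt_mono[OF ab(1)] ut_mono[OF ab(2)])
    then have "near y (%_. k) \<delta>" using near_const[OF ry] near_sym by blast
    then have "near (\<Phi> y) (\<Phi> (%_. k)) (\<epsilon> / 2)" using \<delta>(2) R_const k(1) by blast
    from near_lt[OF \<Phi>_real[OF y(1)] this \<epsilon>(2)] show ?thesis by simp
  qed
  \<comment> \<open>A rational of the interval up to \<open>u\<close> has the bound belonging to
    \<open>u\<close>; beyond \<open>u\<close> it lies between \<open>a\<close> and \<open>b\<close>,
    where continuity at \<open>y\<close> leaves \<open>\<epsilon> / 2\<close>.\<close>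
  have b: "bounded_below s (min b t)"
  proof -
    consider "a < s" | u where "a < u" "u <= t" "bounded_below s u" using ab(1) lty unfolding Q_def by blast
    then show ?thesis
    proof cases
      case 1
      then show ?thesis unfolding bounded_below_def using \<epsilon>(1) near by (intro exI[of _ "\<epsilon> / 2"]) auto
    next
      case 2
      then obtain \<epsilon>' where \<epsilon>': "0 < \<epsilon>'" "!!k. k \<in> N ==> s <= rat k ==> rat k <= u ==> lt \<epsilon>' (\<Phi> (%_. k))"
        unfolding bounded_below_def by blast
      have "lt (min \<epsilon>' (\<epsilon> / 2)) (\<Phi> (%_. k))" if k: "k \<in> N" "s <= rat k" "rat k <= min b t" for k
      proof (cases "rat k <= u")
        case True
        show ?thesis by (rule lt_mono[OF \<epsilon>'(2)[OF k(1,2) True]]) simp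
      next
        case False
        then show ?thesis using k 2 by (intro lt_mono[OF near]) auto
      qed
      then show ?thesis unfolding bounded_below_def using \<epsilon>(1) \<epsilon>'(1)
        by (intro exI[of _ "min \<epsilon>' (\<epsilon> / 2)"]) auto
    qed
  qed
  show False
  proof (cases "t <= b")
    case True
    then show False using b nb min.absorb2[OF True] by simp
  next
    case False
    \<comment> \<open>The bound just obtained would put \<open>b'\<close>, which lies above the
      supremum \<open>y\<close>, into the cut.\<close>
    obtain b' where b': "b' < b" "ut y b'" using ut_open ab(2) by blast
    then have "Q b'" unfolding Q_def using b False by (intro disjI2 exI[of _ b]) (auto simp: min_def)
    then show False using lt_ut_less[OF ry _ b'(2)] lty by blast
  qed
qed

text \<open>An open ball is the union of its closed subintervals, and \<open>compactness\<close>
  treats each of them. Conversely, a point of the ball is approximated by rationals of such an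
  interval, and continuity leaves half of their bound.\<close>

lemma ball_subset_iff:
  assumes "q \<in> N"
  shows "(\<forall>\<xi>. R \<xi> --> near (%_. q) \<xi> r --> lt 0 (\<Phi> \<xi>)) \<longleftrightarrow>
    (\<forall>s t. rat q - r < s \<and> s <= t \<and> t < rat q + r --> bounded_below s t)"
proof (intro iffI allI impI)
  fix s t assume L: "\<forall>\<xi>. R \<xi> --> near (%_. q) \<xi> r --> lt 0 (\<Phi> \<xi>)"
    and st: "rat q - r < s \<and> s <= t \<and> t < rat q + r"
  show "bounded_below s t"
  proof (rule compactness)
    fix \<xi> assume \<xi>: "R \<xi>" "\<not> ut \<xi> s" "\<not> lt t \<xi>"
    have "near (%_. q) \<xi> r" unfolding near_const[OF R_real[OF \<xi>(1)]]
      using located \<xi>(2,3) st by blast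
    then show "lt 0 (\<Phi> \<xi>)" using L \<xi>(1) by blast
  qed (use st in simp)
next
  fix \<xi> assume Rr: "\<forall>s t. rat q - r < s \<and> s <= t \<and> t < rat q + r --> bounded_below s t"
    and \<xi>: "R \<xi>" "near (%_. q) \<xi> r"
  note r\<xi> = R_real[OF \<xi>(1)]
  obtain s t where st: "rat q - r < s" "lt s \<xi>" "t < rat q + r" "ut \<xi> t"
    using \<xi>(2) lt_open ut_open unfolding near_const[OF r\<xi>] by blast
  have "s < t" using lt_ut_less[OF r\<xi>] st by blast
  then obtain \<epsilon> where \<epsilon>: "0 < \<epsilon>" "!!k. k \<in> N ==> s <= rat k ==> rat k <= t ==> lt \<epsilon> (\<Phi> (%_. k))"
    using Rr st unfolding bounded_below_def by (metis less_imp_le)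
  obtain \<delta> where \<delta>: "0 < \<delta>" "!!\<eta>. R \<eta> ==> near \<xi> \<eta> \<delta> ==> near (\<Phi> \<xi>) (\<Phi> \<eta>) (\<epsilon> / 2)"
    using cont[OF \<xi>(1), of "\<epsilon> / 2"] \<epsilon>(1) by auto
  obtain a b where ab: "lt a \<xi>" "ut \<xi> b" "b - a < \<delta>" using approx[OF \<delta>(1)] by blast
  \<comment> \<open>The point \<open>max a s\<close> is rational, lies in the interval from
    \<open>s\<close> to \<open>t\<close>, and is closer than \<open>\<delta>\<close> to
    \<open>\<xi>\<close>.\<close>
  obtain k where k: "k \<in> N" "rat k = max a s" using rat_surj by blast
  have "max a s < b" "max a s < t" using lt_ut_less[OF r\<xi>] ab st by (auto simp: max_def)
  then have "lt (rat k - \<delta>) \<xi>" "ut \<xi> (rat k + \<delta>)" unfolding k(2)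
    using ab by (auto intro: lt_mono[OF ab(1)] ut_mono[OF ab(2)] simp: max_def)
  then have "near (\<Phi> (%_. k)) (\<Phi> \<xi>) (\<epsilon> / 2)"
    using near_const[OF r\<xi>] near_sym \<delta>(2) R_const[OF k(1)] by blast
  moreover have "lt \<epsilon> (\<Phi> (%_. k))" using \<epsilon>(2)[OF k(1)] k(2) \<open>max a s < t\<close> by simp
  ultimately have "lt (\<epsilon> - \<epsilon> / 2) (\<Phi> \<xi>)" using near_lt[OF \<Phi>_real[OF R_const[OF k(1)]]] by blast
  then show "lt 0 (\<Phi> \<xi>)" by (rule lt_mono) (use \<epsilon>(1) in simp)
qed

text \<open>In this form only rationals and numbers are quantified, so containment of a ball becomes
  decidable. It yields the characteristic function demanded by \<open>OPEN\<close>.\<close>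

lemma dec_ball_subset:
  assumes "extends c c' h" "dfq c' A" "dfq c' S"
  shows "dec c' (%y. \<forall>s t. A y - S y < s \<and> s <= t \<and> t < A y + S y --> bounded_below s t)"
proof -
  note v' = dfq_valid[OF assms(2)]
  have "dec c' (%y. \<not> (\<exists>s t. (A y - S y < s \<and> s <= t \<and> t < A y + S y) \<and> \<not> bounded_below s t))"
    by (intro dec_not dec_exq dec_and dec_qless dec_qle dec_bounded_below[of "push (push c')" "%p. h (fst (fst p))"]
        extends_push assms(1) dfq_diff dfq_add dfq_weak assms(2,3) dfq_rat df_var df_weak valid_push v')
  then show ?thesis by (rule dec_cong) blast
qed

end

end

section \<open>Codes of 0 and 1, equality of reals, and codes of small balls\<close>

context definability begin

lemma N5: "5 \<in> N"
proof -
  have "5 = (2::'k) + 2 + 1" by simp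
  then show ?thesis using Nadd[OF Nadd[OF N2 N2] N1] by metis
qed

lemma rat_0: "rat 0 = 0" and rat_5: "rat 5 = 1"
proof -
  have "israt 0 0 0 0" unfolding israt_def by (rule bexI[OF _ N0]) (simp add: ispair_def)
  then show "rat 0 = 0" using rat_eqI[of 0 0 0 0] N0 by simp
  have "israt 5 1 0 0" unfolding israt_def by (rule bexI[OF _ N2]) (simp add: ispair_def)
  then show "rat 5 = 1" using rat_eqI[of 1 0 0 5] N0 N1 by simp
qed

end

context definability begin

lemma lt_cong: "(!!n. n \<in> N ==> \<xi> n = \<eta> n) ==> lt a \<xi> \<longleftrightarrow> lt a \<eta>"
  and ut_cong: "(!!n. n \<in> N ==> \<xi> n = \<eta> n) ==> ut \<xi> a \<longleftrightarrow> ut \<eta> a"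
  by (auto simp: lt_def ut_def)

lemma isreal_cong: "(!!n. n \<in> N ==> \<xi> n = \<eta> n) ==> isreal \<xi> \<longleftrightarrow> isreal \<eta>"
  by (auto simp: isreal_def Nadd)

lemma near_mono: "near \<xi> \<eta> \<delta> ==> \<delta> <= \<delta>' ==> near \<xi> \<eta> \<delta>'"
  unfolding near_def by (meson less_le_trans)

lemma ut_iff: "isreal \<xi> ==> ut \<xi> b \<longleftrightarrow> (\<exists>b'<b. \<not> lt b' \<xi>)"
  using ut_open not_lt_ut lt_ut_less by (meson less_asym')

text \<open>Right cuts are determined by left cuts, so everything built from \<open>dlt\<close>
  respects equality of reals.\<close>

lemma dlt_eqreal:
  assumes "isreal \<xi>" "isreal \<eta>" "!!a. lt a \<xi> \<longleftrightarrow> lt a \<eta>" shows "dlt A R \<xi> t \<longleftrightarrow> dlt A R \<eta> t"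
  by (simp add: dlt_def assms(3) ut_iff[OF assms(1)] ut_iff[OF assms(2)])

definition rad :: "'k => 'k" where "rad n = (prl (prr n) + 1) / (prr (prr n) + 1)"

lemma dfq_rad: assumes "df c F" shows "dfq c (%x. rad (F x))"
proof (rule dfqI[of c "%x. prl (prr (F x)) + 1" "%_. 0" "%x. prr (prr (F x))"])
  show "df c (%x. prl (prr (F x)) + 1)" "df c (%x. prr (prr (F x)))" "df c (%_. 0)"
    by (intro df_add df_prl df_prr df_const assms N1 N0 df_valid[OF assms])+
qed (simp add: rad_def)

text \<open>An interval with rational ends around \<open>\<xi>\<close> of length below
  \<open>\<delta>\<close> is described by its midpoint and half its length. The ball therefore
  contains \<open>\<xi>\<close> and stays within \<open>\<delta>\<close> of it, without being
  centred there.\<close>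

lemma ball_code:
  assumes "isreal \<xi>" "0 < \<delta>"
  shows "\<exists>n\<in>N. \<exists>k\<in>N. \<exists>l\<in>N. \<exists>a\<in>N. \<exists>b\<in>N. ispair n k l \<and> ispair l a b \<and>
    prl n = k \<and> rad n = (a + 1) / (b + 1) \<and> lt (rat k - rad n) \<xi> \<and> ut \<xi> (rat k + rad n) \<and>
    (\<forall>\<eta>. lt (rat k - rad n) \<eta> --> ut \<eta> (rat k + rad n) --> near \<xi> \<eta> \<delta>)"
proof -
  obtain u w where uw: "lt u \<xi>" "ut \<xi> w" "w - u < \<delta>" using approx[OF assms(2)] by blast
  then have "u < w" using lt_ut_less[OF assms(1)] by blast
  obtain k where k: "k \<in> N" "rat k = (u + w) / 2" using rat_surj by blast
  obtain p m d where pmd: "p \<in> N" "m \<in> N" "d \<in> N" "(w - u) / 2 = (p - m) / (d + 1)" using Nfrac by blast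
  have "0 < (p - m) / (d + 1)" using \<open>u < w\<close> by (simp flip: pmd(4))
  moreover have "0 < d + 1" using Nnonneg[OF pmd(3)] by simp
  ultimately have "m < p" by (simp add: zero_less_divide_iff)
  then have "p - m \<in> N" "1 <= p - m" using Ndiff[OF pmd(2,1)] Npos[of "p - m"] by auto
  \<comment> \<open>Radii of the enumeration have the form \<open>(a + 1) / (b + 1)\<close>, hence
    \<open>a = p - m - 1\<close>.\<close>
  then have a: "p - m - 1 \<in> N" using Ndiff N1 by blast
  obtain l where l: "l \<in> N" "ispair l (p - m - 1) d" using pair_exists a pmd(3) by blast
  obtain n where n: "n \<in> N" "ispair n k l" using pair_exists k(1) l(1) by blast
  note pr = pr_eq[OF n(1) k(1) l(1) n(2)] pr_eq[OF l(1) a pmd(3) l(2)]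
  have r: "rad n = ((p - m - 1) + 1) / (d + 1)" unfolding rad_def pr ..
  have r': "rad n = (w - u) / 2" unfolding r pmd(4) by simp
  have ends: "rat k - rad n = u" "rat k + rad n = w" by (simp_all add: k(2) r' field_simps)
  have nr: "near \<xi> \<eta> \<delta>" if "lt u \<eta>" "ut \<eta> w" for \<eta> unfolding near_def using uw that by blast
  have "ispair n k l \<and> ispair l (p - m - 1) d \<and> prl n = k \<and> rad n = ((p - m - 1) + 1) / (d + 1) \<and>
      lt (rat k - rad n) \<xi> \<and> ut \<xi> (rat k + rad n) \<and>
      (\<forall>\<eta>. lt (rat k - rad n) \<eta> --> ut \<eta> (rat k + rad n) --> near \<xi> \<eta> \<delta>)"
    using n(2) l(2) pr(1) r uw(1,2) nr unfolding ends by blast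
  then show ?thesis using n(1) k(1) l(1) a pmd(3) by blast
qed

end

section \<open>Kleene computability relative to Feferman's functional\<close>

context definability begin

lemma df_if: assumes "dec c P" "df c A" "df c B" shows "df c (%x. if P x then A x else B x)"
  by (rule df_cong[OF df_add[OF df_mult[OF dec_not[OF assms(1), unfolded dec_def] assms(2)]
      df_mult[OF assms(1)[unfolded dec_def] assms(3)]]]) auto

end

definition KDf :: "srt list => (arg list => rat) => bool" where
  "KDf \<Gamma> F \<longleftrightarrow> (\<exists>f. ucomp \<Gamma> f \<and> (\<forall>as. fit \<Gamma> as --> F as = of_nat (f as)))"

lemma KDf_I: "ucomp \<Gamma> f ==> (!!as. fit \<Gamma> as ==> F as = of_nat (f as)) ==> KDf \<Gamma> F"
  unfolding KDf_def by blast

lemma KDf_E: assumes "KDf \<Gamma> F" obtains f where "ucomp \<Gamma> f" "!!as. fit \<Gamma> as ==> F as = of_nat (f as)"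
  using assms unfolding KDf_def by blast

text \<open>\<open>okc\<close> demands an argument of sort \<open>SMu\<close>, which is what
  minimisation calls. On natural numbers inside \<open>rat\<close>, \<open>nat\<close> of the floor
  inverts the embedding.\<close>

interpretation K: definability "\<nat> :: rat set" "%x. 2 ^ nat \<lfloor>x\<rfloor>" KDf fits "%\<Gamma>. SMu \<in> set \<Gamma>" SNum "%x. Num (nat \<lfloor>x\<rfloor>)"
proof
  show "(0 :: rat) \<in> \<nat>" "(1 :: rat) \<in> \<nat>" by simp_all
  show "a + b \<in> \<nat>" "a * b \<in> \<nat>" if "a \<in> \<nat>" "b \<in> \<nat>" for a b :: rat using that by simp_all
  show "0 <= a" if "a \<in> \<nat>" for a :: rat using that by (auto elim!: Nats_cases)
  show "(2 :: rat) ^ nat \<lfloor>0 :: rat\<rfloor> = 1" by simp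
  show "(2 :: rat) ^ nat \<lfloor>n\<rfloor> \<in> \<nat>" for n :: rat by (metis of_nat_in_Nats of_nat_numeral of_nat_power)
  show "fits SNum (Num (nat \<lfloor>n\<rfloor>))" for n :: rat by simp
  show "SMu \<in> set (\<Gamma> @ [s])" if "SMu \<in> set \<Gamma>" for \<Gamma> s using that by simp
  show "1 <= a" if "a \<in> \<nat>" "0 < a" for a :: rat using that by (auto elim!: Nats_cases)
  show "b - a \<in> \<nat>" if "a \<in> \<nat>" "b \<in> \<nat>" "a <= b" for a b :: rat
    using that by (auto elim!: Nats_cases simp flip: of_nat_diff)
  show "\<exists>p\<in>\<nat>. \<exists>m\<in>\<nat>. \<exists>d\<in>\<nat>. x = (p - m) / (d + 1)" for x :: rat
  proof -
    obtain a b where ab: "x = Rat.Fract a b" "0 < b" by (cases x) auto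
    have "x = of_int a / of_int b" by (simp add: ab Fract_of_int_quotient)
    moreover have "(of_int a :: rat) = of_nat (nat a) - of_nat (nat (- a))" by (cases "0 <= a") auto
    moreover have "(of_int b :: rat) = of_nat (nat (b - 1)) + 1" using ab(2) by simp
    ultimately show ?thesis by (metis of_nat_in_Nats)
  qed
  show "(2 :: rat) ^ nat \<lfloor>n + 1\<rfloor> = 2 * 2 ^ nat \<lfloor>n\<rfloor>" if "n \<in> \<nat>" for n :: rat
    using that by (auto elim!: Nats_cases simp: nat_add_distrib)
  show "\<exists>\<Gamma> l. SMu \<in> set \<Gamma> \<and> fit \<Gamma> l" by (intro exI[of _ "[SMu]"] exI[of _ "[Fun2 Feferman_mu]"]) simp
  show "F l \<in> \<nat>" if "KDf \<Gamma> F" "fit \<Gamma> l" for \<Gamma> F l using that by (auto simp: KDf_def)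
  show "KDf \<Gamma> (%_. c)" if "c \<in> \<nat>" for \<Gamma> c using that ucomp_const by (auto elim!: Nats_cases intro!: KDf_I)
  show "\<exists>F. KDf (\<Gamma> @ [SNum]) F \<and> (\<forall>l n. fit \<Gamma> l --> n \<in> \<nat> --> F (l @ [Num (nat \<lfloor>n\<rfloor>)]) = n)" for \<Gamma>
    by (intro exI[of _ "%as. of_nat (num_of (last as))"] conjI KDf_I[OF ucomp_last]) (auto elim!: Nats_cases)
  show "\<exists>G. KDf (\<Gamma> @ [s]) G \<and> (\<forall>l a. fit \<Gamma> l --> fits s a --> G (l @ [a]) = F l)" if h: "KDf \<Gamma> F" for \<Gamma> F s
  proof -
    obtain f where f: "ucomp \<Gamma> f" "!!as. fit \<Gamma> as ==> F as = of_nat (f as)" using h by (rule KDf_E) blast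
    show ?thesis
      by (intro exI[of _ "%as. of_nat (f (butlast as))"] conjI KDf_I[OF ucomp_butlast[OF f(1)]]) (auto simp: f(2))
  qed
  show "KDf \<Gamma> (%l. F l + G l)" "KDf \<Gamma> (%l. F l * G l)" "KDf \<Gamma> (%l. if G l <= F l then F l - G l else 0)"
    if h: "KDf \<Gamma> F" "KDf \<Gamma> G" for \<Gamma> F G
  proof -
    obtain f where f: "ucomp \<Gamma> f" "!!as. fit \<Gamma> as ==> F as = of_nat (f as)" using h(1) by (rule KDf_E) blast
    obtain g where g: "ucomp \<Gamma> g" "!!as. fit \<Gamma> as ==> G as = of_nat (g as)" using h(2) by (rule KDf_E) blast
    show "KDf \<Gamma> (%l. F l + G l)" by (rule KDf_I[OF ucomp_comp2[OF ucomp2_add f(1) g(1)]]) (simp add: f(2) g(2))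
    show "KDf \<Gamma> (%l. F l * G l)" by (rule KDf_I[OF ucomp_comp2[OF ucomp2_mult f(1) g(1)]]) (simp add: f(2) g(2))
    show "KDf \<Gamma> (%l. if G l <= F l then F l - G l else 0)"
      by (rule KDf_I[OF ucomp_comp2[OF ucomp2_minus f(1) g(1)]]) (simp add: f(2) g(2) of_nat_diff)
  qed
  show "KDf \<Gamma> (%l. 2 ^ nat \<lfloor>F l\<rfloor>)" if h: "KDf \<Gamma> F" for \<Gamma> F
  proof -
    obtain f where f: "ucomp \<Gamma> f" "!!as. fit \<Gamma> as ==> F as = of_nat (f as)" using h by (rule KDf_E) blast
    show ?thesis by (rule KDf_I[OF ucomp_pow2[OF f(1)]]) (simp add: f(2))
  qed
  show "\<exists>H. KDf (\<Gamma> @ \<Delta>) H \<and> (\<forall>l l'. fit \<Gamma> l --> fit \<Delta> l' -->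
        H (l @ l') = F (l @ [Num (nat \<lfloor>G (l @ l')\<rfloor>), Num (nat \<lfloor>G' (l @ l')\<rfloor>)]))"
    if h: "KDf (\<Gamma> @ [SNum, SNum]) F" "KDf (\<Gamma> @ \<Delta>) G" "KDf (\<Gamma> @ \<Delta>) G'" for \<Gamma> \<Delta> F G G'
  proof -
    obtain f where f: "ucomp (\<Gamma> @ [SNum, SNum]) f" "!!as. fit (\<Gamma> @ [SNum, SNum]) as ==> F as = of_nat (f as)"
      using h(1) by (rule KDf_E) blast
    obtain g where g: "ucomp (\<Gamma> @ \<Delta>) g" "!!as. fit (\<Gamma> @ \<Delta>) as ==> G as = of_nat (g as)" using h(2) by (rule KDf_E) blast
    obtain g' where g': "ucomp (\<Gamma> @ \<Delta>) g'" "!!as. fit (\<Gamma> @ \<Delta>) as ==> G' as = of_nat (g' as)" using h(3) by (rule KDf_E) blast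
    \<comment> \<open>S4 prepends the two numbers, while \<open>f\<close> expects them after the
      entries of \<open>\<Gamma>\<close>; \<open>k\<close> moves them there one by one.\<close>
    define k where "k = (%as. (%as. f (tl as @ [hd as])) (tl as @ [hd as]))"
    have "ucomp (SNum # \<Gamma> @ [SNum]) (%as. f (tl as @ [hd as]))"
      using ucomp_snoc_front[of "\<Gamma> @ [SNum]" SNum f] f(1) by simp
    then have "ucomp (SNum # SNum # \<Gamma>) k" unfolding k_def
      using ucomp_snoc_front[of "SNum # \<Gamma>" SNum "%as. f (tl as @ [hd as])"] by simp
    from ucomp_take[OF this, of \<Delta>]
    have "ucomp (SNum # SNum # \<Gamma> @ \<Delta>) (%as. k (take (length (SNum # SNum # \<Gamma>)) as))" by simp
    from ucomp_let[OF ucomp_tl[OF g(1)] this]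
    have "ucomp (SNum # \<Gamma> @ \<Delta>) (%as. k (take (length (SNum # SNum # \<Gamma>)) (Num (g (tl as)) # as)))" .
    from ucomp_let[OF g'(1) this]
    have u: "ucomp (\<Gamma> @ \<Delta>) (%as. k (take (length (SNum # SNum # \<Gamma>)) (Num (g as) # Num (g' as) # as)))" by simp
    have "of_nat (k (take (length (SNum # SNum # \<Gamma>)) (Num (g (l @ l')) # Num (g' (l @ l')) # l @ l'))) =
        F (l @ [Num (nat \<lfloor>G (l @ l')\<rfloor>), Num (nat \<lfloor>G' (l @ l')\<rfloor>)])" if l: "fit \<Gamma> l" "fit \<Delta> l'" for l l'
      using l f(2) g(2) g'(2) by (simp add: k_def fit_length list_all2_appendI)
    moreover have "KDf (\<Gamma> @ \<Delta>) (%as. of_nat (k (take (length (SNum # SNum # \<Gamma>)) (Num (g as) # Num (g' as) # as))))"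
      by (rule KDf_I[OF u]) (rule refl)
    ultimately show ?thesis
      by (intro exI[of _ "%as. of_nat (k (take (length (SNum # SNum # \<Gamma>)) (Num (g as) # Num (g' as) # as)))"]) blast
  qed
  show "\<exists>G. KDf \<Gamma> G \<and> (\<forall>l. fit \<Gamma> l -->
      ((\<exists>n\<in>\<nat>. F (l @ [Num (nat \<lfloor>n\<rfloor>)]) = 0) -->
        F (l @ [Num (nat \<lfloor>G l\<rfloor>)]) = 0 \<and> (\<forall>n\<in>\<nat>. F (l @ [Num (nat \<lfloor>n\<rfloor>)]) = 0 --> G l <= n)) \<and>
      (\<not> (\<exists>n\<in>\<nat>. F (l @ [Num (nat \<lfloor>n\<rfloor>)]) = 0) --> G l = 0))"
    if h: "SMu \<in> set \<Gamma>" "KDf (\<Gamma> @ [SNum]) F" for \<Gamma> F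
  proof -
    obtain f where f: "ucomp (\<Gamma> @ [SNum]) f" "!!as. fit (\<Gamma> @ [SNum]) as ==> F as = of_nat (f as)"
      using h(2) by (rule KDf_E) blast
    obtain j where j: "j < length \<Gamma>" "\<Gamma> ! j = SMu" using h(1) by (metis in_set_conv_nth)
    have u: "ucomp \<Gamma> (%as. fun2_of (as ! j) (%n. f (as @ [Num n])))" by (rule ucomp_fun2[OF f(1) j(1)]) (simp add: j)
    let ?g = "%l. of_nat (fun2_of (l ! j) (%n. f (l @ [Num n]))) :: rat"
    have mu: "((\<exists>n\<in>\<nat>. F (l @ [Num (nat \<lfloor>n\<rfloor>)]) = 0) -->
        F (l @ [Num (nat \<lfloor>?g l\<rfloor>)]) = 0 \<and> (\<forall>n\<in>\<nat>. F (l @ [Num (nat \<lfloor>n\<rfloor>)]) = 0 --> ?g l <= n)) \<and>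
      (\<not> (\<exists>n\<in>\<nat>. F (l @ [Num (nat \<lfloor>n\<rfloor>)]) = 0) --> ?g l = 0)" if l: "fit \<Gamma> l" for l
    proof -
      have lj: "l ! j = Fun2 Feferman_mu" using list_all2_nthD2[OF l, of j] j fit_length[OF l] by simp
      let ?h = "%n. f (l @ [Num n])"
      have F: "F (l @ [Num n]) = of_nat (?h n)" for n using f(2) l by (simp add: list_all2_appendI)
      have ex: "(\<exists>n\<in>\<nat>. F (l @ [Num (nat \<lfloor>n\<rfloor>)]) = 0) \<longleftrightarrow> (\<exists>n. ?h n = 0)"
        unfolding F by (auto elim!: Nats_cases) (metis floor_of_nat nat_int of_nat_in_Nats)
      show ?thesis
      proof (cases "\<exists>n. ?h n = 0")
        case True
        then have g: "?g l = of_nat (LEAST n. ?h n = 0)" by (simp add: lj Feferman_mu_def)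
        have "F (l @ [Num (nat \<lfloor>?g l\<rfloor>)]) = 0" unfolding g F using LeastI_ex[OF True] by simp
        moreover have "\<forall>n\<in>\<nat>. F (l @ [Num (nat \<lfloor>n\<rfloor>)]) = 0 --> ?g l <= n"
          unfolding g F using Least_le[of "%n. ?h n = 0"] by (auto elim!: Nats_cases)
        ultimately show ?thesis using True ex by blast
      next
        case False
        have "Feferman_mu ?h = 0" unfolding Feferman_mu_def by (rule if_not_P[OF False])
        then have "?g l = 0" by (simp add: lj)
        moreover have "\<not> (\<exists>n\<in>\<nat>. F (l @ [Num (nat \<lfloor>n\<rfloor>)]) = 0)" using False ex by blast
        ultimately show ?thesis by blast
      qed
    qed
    have K: "KDf \<Gamma> ?g" by (rule KDf_I[OF u]) (rule refl)
    show ?thesis by (rule exI[of _ ?g], rule conjI[OF K], intro allI impI, rule mu)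
  qed
qed

section \<open>Computing with the functional arguments\<close>

lemma K_kleene:
  assumes "K.df (\<Gamma>, X, \<pi>) (%x. of_nat (F x))" shows "\<exists>e. \<forall>x\<in>X. kleene e (\<pi> x) (F x)"
proof -
  obtain F' where F': "KDf \<Gamma> F'" "!!x. x \<in> X ==> of_nat (F x) = F' (\<pi> x)" "!!x. x \<in> X ==> fit \<Gamma> (\<pi> x)"
    using assms unfolding K.df_def K.valid_def by auto
  obtain f where f: "ucomp \<Gamma> f" "!!as. fit \<Gamma> as ==> F' as = of_nat (f as)" using F'(1) by (rule KDf_E) blast
  obtain e where "!!as. fit \<Gamma> as ==> kleene e as (f as)" using f(1) unfolding ucomp_def by blast
  moreover have "F x = f (\<pi> x)" if "x \<in> X" for x
  proof -
    have "(of_nat (F x) :: rat) = of_nat (f (\<pi> x))" using F'(2,3)[OF that] f(2) by simp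
    then show ?thesis by (simp only: of_nat_eq_iff)
  qed
  ultimately show ?thesis using F'(3) by (intro exI[of _ e]) simp
qed

text \<open>Bound variables are appended at the end, so the position of an argument survives
  \<open>pushv\<close>.\<close>

definition holds_at :: "srt list \<times> 'x set \<times> ('x => arg list) => nat => srt => ('x => arg) => bool" where
  "holds_at c j s A \<longleftrightarrow> K.valid c \<and> j < length (fst c) \<and> fst c ! j = s \<and> (\<forall>x\<in>fst (snd c). snd (snd c) x ! j = A x)"

lemma holds_at_pushv:
  assumes "holds_at c j s A" "!!a. a \<in> B ==> fits t (i a)"
  shows "holds_at (K.pushv t B i c) j s (%p. A (fst p))"
proof -
  obtain \<Gamma> X \<pi> where c: "c = (\<Gamma>, X, \<pi>)" by (cases c)
  have "K.valid (K.pushv t B i c)" using assms by (intro K.valid_pushv) (auto simp: holds_at_def)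
  moreover have "length (\<pi> x) = length \<Gamma>" if "x \<in> X" for x
    using assms(1) that unfolding holds_at_def c K.valid_def by (auto dest: fit_length)
  ultimately show ?thesis using assms(1) unfolding holds_at_def c by (auto simp: K.pushv_def nth_append)
qed

lemma holds_at_push: "holds_at c j s A ==> holds_at (K.push c) j s (%p. A (fst p))"
  by (rule holds_at_pushv) auto

lemma holds_at_last:
  assumes "K.valid c" "!!a. a \<in> B ==> fits t (i a)"
  shows "holds_at (K.pushv t B i c) (length (fst c)) t (%p. i (snd p))"
proof -
  obtain \<Gamma> X \<pi> where c: "c = (\<Gamma>, X, \<pi>)" by (cases c)
  have "K.valid (K.pushv t B i c)" using assms by (intro K.valid_pushv)
  moreover have "length (\<pi> x) = length \<Gamma>" if "x \<in> X" for x
    using assms(1) that unfolding c K.valid_def by (auto dest: fit_length)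
  ultimately show ?thesis unfolding holds_at_def c by (auto simp: K.pushv_def nth_append)
qed

text \<open>A sequence of numbers as a function on the field, which is the form in which the locale
  treats reals.\<close>

definition rq :: "(nat => nat) => rat => rat" where "rq y r = of_nat (y (nat \<lfloor>r\<rfloor>))"

lemma rq_nat [simp]: "rq y (of_nat n) = of_nat (y n)"
  by (simp add: rq_def)

abbreviation dfn :: "srt list \<times> 'x set \<times> ('x => arg list) => ('x => nat => nat) => bool" where
  "dfn c Y \<equiv> K.df (K.push c) (%p. rq (Y (fst p)) (snd p))"

lemma df_fun1:
  assumes "K.df c F" "holds_at c j SFun1 (%x. Fun1 (A x))" shows "K.df c (%x. of_nat (A x (nat \<lfloor>F x\<rfloor>)))"
proof -
  obtain \<Gamma> X \<pi> where c: "c = (\<Gamma>, X, \<pi>)" by (cases c)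
  obtain F' where F': "KDf \<Gamma> F'" "!!x. x \<in> X ==> F x = F' (\<pi> x)" "!!x. x \<in> X ==> fit \<Gamma> (\<pi> x)"
    using assms unfolding c K.df_def K.valid_def by auto
  obtain f where f: "ucomp \<Gamma> f" "!!as. fit \<Gamma> as ==> F' as = of_nat (f as)" using F'(1) by (rule KDf_E) blast
  have j: "K.valid c" "j < length \<Gamma>" "\<Gamma> ! j = SFun1" "!!x. x \<in> X ==> \<pi> x ! j = Fun1 (A x)"
    using assms(2) by (auto simp: holds_at_def c)
  have "KDf \<Gamma> (%as. of_nat (fun1_of (as ! j) (f as)))" by (rule KDf_I[OF ucomp_fun1[OF f(1) j(2,3)]]) simp
  moreover have "\<forall>x\<in>X. of_nat (A x (nat \<lfloor>F x\<rfloor>)) = (of_nat (fun1_of (\<pi> x ! j) (f (\<pi> x))) :: rat)"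
    using j(4) F'(2,3) f(2) by simp
  ultimately show ?thesis using j(1) unfolding c K.df_def
    by (auto intro!: exI[of _ "%as. of_nat (fun1_of (as ! j) (f as))"])
qed

lemma df_fun2:
  assumes "dfn c T" "holds_at c j SFun2 (%x. Fun2 (B x))" shows "K.df c (%x. of_nat (B x (T x)))"
proof -
  obtain \<Gamma> X \<pi> where c: "c = (\<Gamma>, X, \<pi>)" by (cases c)
  have j: "K.valid c" "j < length \<Gamma>" "\<Gamma> ! j = SFun2" "!!x. x \<in> X ==> \<pi> x ! j = Fun2 (B x)"
    using assms(2) by (auto simp: holds_at_def c)
  have fit: "!!x. x \<in> X ==> fit \<Gamma> (\<pi> x)" using j(1) by (auto simp: c K.valid_def)
  obtain F' where F': "KDf (\<Gamma> @ [SNum]) F'"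
    "!!x r. x \<in> X ==> r \<in> \<nat> ==> rq (T x) r = F' (\<pi> x @ [Num (nat \<lfloor>r\<rfloor>)])"
    using assms(1) unfolding c K.df_def K.pushv_def by auto
  obtain f where f: "ucomp (\<Gamma> @ [SNum]) f" "!!as. fit (\<Gamma> @ [SNum]) as ==> F' as = of_nat (f as)"
    using F'(1) by (rule KDf_E) blast
  have T: "T x n = f (\<pi> x @ [Num n])" if "x \<in> X" for x n
  proof -
    have "(of_nat (T x n) :: rat) = of_nat (f (\<pi> x @ [Num n]))"
      using F'(2)[OF that of_nat_in_Nats, of n] f(2)[of "\<pi> x @ [Num n]"] fit[OF that] by (simp add: list_all2_appendI)
    then show ?thesis by (simp only: of_nat_eq_iff)
  qed
  have "KDf \<Gamma> (%as. of_nat (fun2_of (as ! j) (%n. f (as @ [Num n]))))"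
    by (rule KDf_I[OF ucomp_fun2[OF f(1) j(2)]]) (simp_all add: j(3))
  moreover have "\<forall>x\<in>X. of_nat (B x (T x)) = (of_nat (fun2_of (\<pi> x ! j) (%n. f (\<pi> x @ [Num n]))) :: rat)"
    using j(4) T by (simp flip: T)
  ultimately show ?thesis using j(1) unfolding c K.df_def
    by (auto intro!: exI[of _ "%as. of_nat (fun2_of (as ! j) (%n. f (as @ [Num n])))"])
qed

text \<open>S8 in environment form: the type-2 object handed to the functional is given as a
  computable value over one more variable, a function of type 1 pushed last.\<close>

lemma df_fun3:
  assumes "K.df (K.pushv SFun1 UNIV Fun1 c) (%p. of_nat (G (fst p) (snd p)))"
    and "holds_at c j SFun3 (%x. Fun3 (B x))"
  shows "K.df c (%x. of_nat (B x (G x)))"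
proof -
  obtain \<Gamma> X \<pi> where c: "c = (\<Gamma>, X, \<pi>)" by (cases c)
  have j: "K.valid c" "j < length \<Gamma>" "\<Gamma> ! j = SFun3" "!!x. x \<in> X ==> \<pi> x ! j = Fun3 (B x)"
    using assms(2) by (auto simp: holds_at_def c)
  have fit: "!!x. x \<in> X ==> fit \<Gamma> (\<pi> x)" using j(1) by (auto simp: c K.valid_def)
  obtain F' where F': "KDf (\<Gamma> @ [SFun1]) F'" "!!x h. x \<in> X ==> of_nat (G x h) = F' (\<pi> x @ [Fun1 h])"
    using assms(1) unfolding c K.df_def K.pushv_def by auto
  obtain f where f: "ucomp (\<Gamma> @ [SFun1]) f" "!!as. fit (\<Gamma> @ [SFun1]) as ==> F' as = of_nat (f as)"
    using F'(1) by (rule KDf_E) blast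
  have G: "G x h = f (\<pi> x @ [Fun1 h])" if "x \<in> X" for x h
  proof -
    have "(of_nat (G x h) :: rat) = of_nat (f (\<pi> x @ [Fun1 h]))"
      using F'(2)[OF that, of h] f(2)[of "\<pi> x @ [Fun1 h]"] fit[OF that] by (simp add: list_all2_appendI)
    then show ?thesis by (simp only: of_nat_eq_iff)
  qed
  have "KDf \<Gamma> (%as. of_nat (fun3_of (as ! j) (%h. f (as @ [Fun1 h]))))"
    by (rule KDf_I[OF ucomp_fun3[OF f(1) j(2,3)]]) simp
  moreover have "\<forall>x\<in>X. of_nat (B x (G x)) = (of_nat (fun3_of (\<pi> x ! j) (%h. f (\<pi> x @ [Fun1 h]))) :: rat)"
    using j(4) G by (simp flip: G)
  ultimately show ?thesis using j(1) unfolding c K.df_def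
    by (auto intro!: exI[of _ "%as. of_nat (fun3_of (as ! j) (%h. f (as @ [Fun1 h])))"])
qed

lemma df_snd: "K.valid c ==> K.df (K.push c) (%p. of_nat (nat \<lfloor>snd p\<rfloor>))"
  by (rule K.df_cong[OF K.df_var]) (auto elim!: Nats_cases)

lemma dfn_push: assumes "K.valid c" "dfn c T" shows "dfn (K.push c) (%p. T (fst p))"
  using K.df_lift[OF _ K.extends_push[OF K.extends_refl[OF assms(1)]], of "%x. rq (T x)"] assms(2) by simp

lemma dfn_fun1: assumes "holds_at c j SFun1 (%x. Fun1 (A x))" shows "dfn c A"
proof -
  have "K.valid c" using assms by (simp add: holds_at_def)
  from df_fun1[OF K.df_var[OF this] holds_at_push[OF assms]] show ?thesis by (simp add: rq_def)
qed

text \<open>\<open>to_type2\<close> finds the index in entry 0 and the real in the later entries, so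
  the functional is called with \<open>N x\<close> prepended to \<open>T x\<close>; truncated
  subtraction shifts the indices back.\<close>

lemma df_fun2_arg:
  assumes "dfn c T" "K.df c (%x. of_nat (N x))" "holds_at c j SFun2 (%x. fun2_arg (B x))"
  shows "K.df c (%x. of_nat (B x (T x) (N x)))"
proof -
  have v: "K.valid c" using assms(3) by (simp add: holds_at_def)
  let ?G = "%x. case_nat (N x) (T x)"
  let ?m = "%p :: _ \<times> rat. if 1 <= snd p then snd p - 1 else 0"
  have "K.df (K.push c) ?m" by (intro K.df_monus K.df_var K.df_const K.valid_push v K.N1)
  from K.df_sub[OF assms(1) K.extends_push[OF K.extends_refl[OF v]] this]
  have "K.df (K.push c) (%p. rq (T (fst p)) (?m p))" by simp
  then have "K.df (K.push c) (%p. if snd p = 0 then of_nat (N (fst p)) else rq (T (fst p)) (?m p))"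
    by (intro K.df_if K.dec_eq0 K.df_var v K.df_weak[OF assms(2)])
  then have "dfn c ?G"
  proof (rule K.df_cong)
    fix p assume "p \<in> fst (snd (K.push c))"
    then obtain n where n: "snd p = of_nat n" by (auto elim!: Nats_cases)
    show "rq (?G (fst p)) (snd p) = (if snd p = 0 then of_nat (N (fst p)) else rq (T (fst p)) (?m p))"
      unfolding n by (cases n) (auto simp: rq_def nat_add_distrib)
  qed
  from df_fun2[OF this assms(3)[unfolded fun2_arg_def]] show ?thesis by (simp add: to_type2_def)
qed

lemma dfn_fun2_arg:
  assumes "dfn c T" "holds_at c j SFun2 (%x. fun2_arg (B x))" shows "dfn c (%x. B x (T x))"
proof -
  have v: "K.valid c" using assms(2) by (simp add: holds_at_def)
  from df_fun2_arg[OF dfn_push[OF v assms(1)] df_snd[OF v] holds_at_push[OF assms(2)]]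
  show ?thesis by (simp add: rq_def)
qed

text \<open>The numbers 0 and 5 are codes of the rationals 0 and 1.\<close>

definition compl :: "((nat => nat) => nat => nat) => (nat => nat) => nat => nat" where
  "compl C y n = (if K.lt 0 (rq (C y)) then 0 else 5)"

text \<open>The indicator function of the single real coded by \<open>x\<close>. Comparing left cuts
  makes it respect equality of reals and needs only a quantifier over rationals.\<close>

definition point :: "(nat => nat) => (nat => nat) => nat => nat" where
  "point x y n = (if \<exists>q. K.lt q (rq y) ~= K.lt q (rq x) then 0 else 5)"

lemma df_compl:
  assumes "dfn c T" "holds_at c j SFun2 (%x. fun2_arg (B x))" shows "K.df c (%x. of_nat (compl (B x) (T x) (N x)))"
proof -
  have v: "K.valid c" using assms(2) by (simp add: holds_at_def)
  have "K.dec c (%x. K.lt 0 (rq (B x (T x))))"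
    by (rule K.dec_lt[OF dfn_fun2_arg[OF assms] K.dfq_const[OF v]])
  from K.df_if[OF this K.df_const[OF v, of "of_nat 0"] K.df_const[OF v, of "of_nat 5"]]
  show ?thesis by (rule K.df_cong) (auto simp: compl_def)
qed

lemma df_point:
  assumes "dfn c T" "dfn c A" "K.valid c" shows "K.df c (%x. of_nat (point (A x) (T x) (N x)))"
proof -
  have lt: "K.dec (K.push c) (%p. K.lt (K.rat (snd p)) (rq (T (fst p))))" if "dfn c T" for T
    by (rule K.dec_lt[OF dfn_push[OF assms(3) that] K.dfq_rat[OF K.df_var[OF assms(3)]]])
  have "K.dec c (%x. \<exists>q. (K.lt q (rq (T x)) \<and> \<not> K.lt q (rq (A x))) \<or> (\<not> K.lt q (rq (T x)) \<and> K.lt q (rq (A x))))"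
    by (rule K.dec_exq[OF assms(3)]) (intro K.dec_or K.dec_and K.dec_not lt assms)
  then have "K.dec c (%x. \<exists>q. K.lt q (rq (T x)) ~= K.lt q (rq (A x)))" by (rule K.dec_cong) blast
  from K.df_if[OF this K.df_const[OF assms(3), of "of_nat 0"] K.df_const[OF assms(3), of "of_nat 5"]]
  show ?thesis by (rule K.df_cong) (auto simp: point_def)
qed

section \<open>Type-3 functionals applied to coded type-2 objects\<close>

abbreviation push1 where "push1 c \<equiv> K.pushv SFun1 UNIV Fun1 c"

text \<open>When a coded type-2 object is called with \<open>h\<close>, the entry \<open>h 0\<close>
  selects the slice, \<open>h 1\<close> is the index at which the value is read, and the real
  follows; hence the shift by 2.\<close>

lemma push1: assumes "K.valid c"
  shows "K.valid (push1 c)" "holds_at (push1 c) (length (fst c)) SFun1 (%p. Fun1 (snd p))"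
    "K.df (push1 c) (%p. of_nat (snd p k))" "dfn (push1 c) (%p j. snd p (j + 2))"
proof -
  show v: "K.valid (push1 c)" by (rule K.valid_pushv[OF assms]) simp
  show h: "holds_at (push1 c) (length (fst c)) SFun1 (%p. Fun1 (snd p))" by (rule holds_at_last[OF assms]) simp
  show "K.df (push1 c) (%p. of_nat (snd p k))" using df_fun1[OF K.df_const[OF v of_nat_in_Nats] h, of k] by simp
  have "K.df (K.push (push1 c)) (%p. snd p + of_nat 2)"
    by (intro K.df_add K.df_var K.df_const K.valid_push v of_nat_in_Nats)
  from df_fun1[OF this holds_at_push[OF h]] show "dfn (push1 c) (%p j. snd p (j + 2))"
    by (rule K.df_cong) (auto simp: rq_def nat_add_distrib elim!: Nats_cases)
qed

lemma dec_num: "K.df c (%x. of_nat (F x)) ==> K.dec c (%x. F x = k)"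
  by (rule K.dec_cong[OF K.dec_eq[OF _ K.df_const[OF _ of_nat_in_Nats, of c k]]]) (auto dest: K.df_valid)

lemma df_push1: "K.df c F ==> K.df (push1 c) (%p. F (fst p))"
  by (rule K.df_weakv) auto

lemma dfn_push1: assumes "K.valid c" "dfn c T" shows "dfn (push1 c) (%p. T (fst p))"
proof -
  have "K.extends c (push1 c) (%p. fst p)" by (rule K.extends_pushv[OF K.extends_refl[OF assms(1)]]) simp
  from K.df_lift[OF _ this, of "%x. rq (T x)"] assms(2) show ?thesis by simp
qed

definition psi_seq :: "(((nat => nat) => (nat => nat)) => (nat => nat) \<times> (nat => nat)) =>
    ((nat => nat) => nat => nat) => nat => nat" where
  "psi_seq \<Psi> C n = prod_encode (fst (\<Psi> (compl C)) n, snd (\<Psi> (compl C)) n)"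

lemma dfn_psi_seq:
  assumes "holds_at c i SFun3 (%x. psi_arg (\<Psi> x))" "holds_at c j SFun2 (%x. fun2_arg (B x))"
  shows "dfn c (%x. psi_seq (\<Psi> x) (B x))"
proof -
  have v: "K.valid c" using assms(1) by (simp add: holds_at_def)
  note vp = K.valid_push[OF v]
  \<comment> \<open>Slice 0 is the complement of the given set; the other slices return the index at
    which the sequences are wanted.\<close>
  let ?G = "%p h. if h 0 = 0 then compl (B (fst p)) (%j. h (j + 2)) (h 1) else nat \<lfloor>snd p\<rfloor>"
  note at = holds_at_pushv[OF holds_at_push[OF assms(2)], of UNIV SFun1 Fun1]
  have "K.df (push1 (K.push c)) (%p. if snd p 0 = 0 then of_nat (compl (B (fst (fst p))) (%j. snd p (j + 2)) (snd p 1))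
      else of_nat (nat \<lfloor>snd (fst p)\<rfloor>))"
    by (intro K.df_if dec_num push1(3)[OF vp] df_compl[OF push1(4)[OF vp] at] df_push1[OF df_snd[OF v]]) simp
  then have "K.df (push1 (K.push c)) (%p. of_nat (?G (fst p) (snd p)))" by (rule K.df_cong) simp
  from df_fun3[OF this holds_at_push[OF assms(1)[unfolded psi_arg_def]]]
  show ?thesis
    by (rule K.df_cong) (simp add: rq_def psi_seq_def Let_def slice_def from_type2_def fun_eq_iff[symmetric])
qed

definition zeta_val where
  "zeta_val \<zeta> Y x z = \<zeta> (compl Y) (point x) z"

lemma dfn_zeta_val:
  assumes "holds_at c i SFun3 (%x. zeta_arg (\<zeta> x))" "holds_at c j SFun2 (%x. fun2_arg (Y x))"
    and "holds_at c k SFun1 (%x. Fun1 (A x))" "K.df c (%x. of_nat (N x))"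
  shows "dfn c (%x. zeta_val (\<zeta> x) (Y x) (A x) (%_. N x))"
proof -
  have v: "K.valid c" using assms(1) by (simp add: holds_at_def)
  note vp = K.valid_push[OF v]
  \<comment> \<open>Slices 0 and 1 are the two closed sets, slice 2 is the constant sequence of the
    code \<open>N x\<close>, that is a rational point, and slice 3 is the index of the wanted
    approximation.\<close>
  let ?G = "%p h. if h 0 = 0 then compl (Y (fst p)) (%j. h (j + 2)) (h 1) else
    if h 0 = 1 then point (A (fst p)) (%j. h (j + 2)) (h 1) else
    if h 0 = 2 then N (fst p) else nat \<lfloor>snd p\<rfloor>"
  note at = holds_at_pushv[OF holds_at_push[OF assms(2)], of UNIV SFun1 Fun1]
  have "K.df (push1 (K.push c)) (%p. if snd p 0 = 0 then of_nat (compl (Y (fst (fst p))) (%j. snd p (j + 2)) (snd p 1))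
      else if snd p 0 = 1 then of_nat (point (A (fst (fst p))) (%j. snd p (j + 2)) (snd p 1))
      else if snd p 0 = 2 then of_nat (N (fst (fst p))) else of_nat (nat \<lfloor>snd (fst p)\<rfloor>))"
    by (intro K.df_if dec_num push1(3)[OF vp] df_compl[OF push1(4)[OF vp] at] df_push1[OF df_snd[OF v]]
        df_point[OF push1(4)[OF vp] dfn_push1[OF vp dfn_push[OF v dfn_fun1[OF assms(3)]]] push1(1)[OF vp]]
        df_push1[OF K.df_weak[OF assms(4)]]) simp
  then have "K.df (push1 (K.push c)) (%p. of_nat (?G (fst p) (snd p)))" by (rule K.df_cong) simp
  from df_fun3[OF this holds_at_push[OF assms(1)[unfolded zeta_arg_def]]]
  show ?thesis
    by (rule K.df_cong) (simp add: rq_def zeta_val_def slice_def from_type2_def)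
qed

section \<open>The two algorithms\<close>

lemma nat_floor_Nats: "r \<in> \<nat> ==> of_nat (nat \<lfloor>r\<rfloor>) = (r :: rat)"
  by (auto elim!: Nats_cases)

text \<open>Here \<open>\<zeta>\<close> separates the complement of \<open>Y\<close>, with value 0,
  from the point \<open>x\<close>, with value 1. More than 1/3 at the rational points of the ball
  means at least 1/3 on the whole ball, which therefore misses the complement. Any threshold
  strictly between 0 and 1 would serve.\<close>

definition Phi_test where
  "Phi_test \<zeta> Y x k \<longleftrightarrow> 0 < K.rat k \<and> (\<forall>p\<in>\<nat>. K.lt (K.rat p - K.rat k) (rq x) \<and> K.ut (rq x) (K.rat p + K.rat k) -->
     K.lt (1 / 3) (rq (zeta_val \<zeta> Y x (%_. nat \<lfloor>p\<rfloor>))))"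

definition Phi_of where "Phi_of \<zeta> Y x = nat \<lfloor>K.least (Phi_test \<zeta> Y x)\<rfloor>"

definition Phi_env where "Phi_env = ([SFun3, SMu, SFun2, SFun1], UNIV, %t. case t of (\<zeta>, Y, x) =>
  [zeta_arg \<zeta>, Fun2 Feferman_mu, fun2_arg Y, Fun1 x])"

lemma Phi_env: "K.valid Phi_env" "holds_at Phi_env 0 SFun3 (%t. zeta_arg (fst t))"
  "holds_at Phi_env 2 SFun2 (%t. fun2_arg (fst (snd t)))" "holds_at Phi_env 3 SFun1 (%t. Fun1 (snd (snd t)))"
  by (auto simp: holds_at_def K.valid_def Phi_env_def zeta_arg_def fun2_arg_def)

lemma dec_Phi_test: "K.dec (K.push Phi_env) (%p. Phi_test (fst (fst p)) (fst (snd (fst p))) (snd (snd (fst p))) (snd p))"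
proof -
  note v = Phi_env(1) and vp = K.valid_push[OF Phi_env(1)]
  note at = Phi_env(2-4)[THEN holds_at_push, THEN holds_at_push]
  have X: "dfn (K.push (K.push Phi_env)) (%q. snd (snd (fst (fst q))))" by (rule dfn_fun1[OF at(3)])
  have Z: "dfn (K.push (K.push Phi_env)) (%q. zeta_val (fst (fst (fst q))) (fst (snd (fst (fst q)))) (snd (snd (fst (fst q)))) (%_. nat \<lfloor>snd q\<rfloor>))"
    by (rule dfn_zeta_val[OF at df_snd[OF vp]])
  have k: "K.dfq (K.push (K.push Phi_env)) (%q. K.rat (snd (fst q)))"
    by (rule K.dfq_rat[OF K.df_weak[OF K.df_var[OF v]]])
  have p: "K.dfq (K.push (K.push Phi_env)) (%q. K.rat (snd q))" by (rule K.dfq_rat[OF K.df_var[OF vp]])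
  show ?thesis unfolding Phi_test_def
    by (intro K.dec_and K.dec_qless K.dfq_const vp K.dfq_rat K.df_var v K.dec_all K.dec_imp
        K.dec_lt[OF X] K.dec_ut[OF X] K.dec_lt[OF Z] K.dfq_diff K.dfq_add k p K.valid_push)
qed

lemma Phi_computable: "\<exists>e. \<forall>\<zeta> Y x. kleene e [zeta_arg \<zeta>, Fun2 Feferman_mu, fun2_arg Y, Fun1 x] (Phi_of \<zeta> Y x)"
proof -
  let ?F = "%t. K.least (Phi_test (fst t) (fst (snd t)) (snd (snd t)))"
  have d: "K.df Phi_env ?F" by (rule K.least_spec(1)[OF Phi_env(1) dec_Phi_test])
  then have "K.df Phi_env (%t. of_nat (nat \<lfloor>?F t\<rfloor>))"
    by (rule K.df_cong) (rule nat_floor_Nats[OF K.df_N[OF d]])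
  from K_kleene[OF this[unfolded Phi_env_def]] show ?thesis by (auto simp: Phi_of_def)
qed

definition zcen where "zcen \<Psi> C n = K.rat (K.prl (rq (psi_seq \<Psi> C) n))"
definition zrad where "zrad \<Psi> C n = K.rat (K.prr (rq (psi_seq \<Psi> C) n))"

abbreviation zcut where "zcut \<Psi> C D x \<equiv> K.gcut (zcen \<Psi> C) (zrad \<Psi> C) (zcen \<Psi> D) (zrad \<Psi> D) (rq x)"

definition zeta_of where "zeta_of \<Psi> C D x n = nat \<lfloor>K.cutreal (zcut \<Psi> C D x) (of_nat n)\<rfloor>"

definition zeta_env where "zeta_env = ([SFun3, SMu, SFun2, SFun2, SFun1], UNIV, %t. case t of (\<Psi>, C, D, x) =>
  [psi_arg \<Psi>, Fun2 Feferman_mu, fun2_arg C, fun2_arg D, Fun1 x])"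

lemma zeta_env: "K.valid zeta_env" "holds_at zeta_env 0 SFun3 (%t. psi_arg (fst t))"
  "holds_at zeta_env 2 SFun2 (%t. fun2_arg (fst (snd t)))" "holds_at zeta_env 3 SFun2 (%t. fun2_arg (fst (snd (snd t))))"
  "holds_at zeta_env 4 SFun1 (%t. Fun1 (snd (snd (snd t))))"
  by (auto simp: holds_at_def K.valid_def zeta_env_def psi_arg_def fun2_arg_def)

lemma dfq_zcen:
  "K.dfq (K.push zeta_env) (%p. zcen (fst (fst p)) (fst (snd (fst p))) (snd p))"
  "K.dfq (K.push zeta_env) (%p. zrad (fst (fst p)) (fst (snd (fst p))) (snd p))"
  "K.dfq (K.push zeta_env) (%p. zcen (fst (fst p)) (fst (snd (snd (fst p)))) (snd p))"
  "K.dfq (K.push zeta_env) (%p. zrad (fst (fst p)) (fst (snd (snd (fst p)))) (snd p))"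
  unfolding zcen_def zrad_def
  by (intro K.dfq_rat K.df_prl K.df_prr dfn_psi_seq[OF zeta_env(2,3)] dfn_psi_seq[OF zeta_env(2,4)])+

lemmas zeta_df = zeta_env(1) dfq_zcen dfn_fun1[OF zeta_env(5)]

text \<open>The index \<open>n\<close> of the approximation is the variable pushed last, which is
  its place in the argument list of the theorem.\<close>

lemma zeta_computable: "\<exists>e. \<forall>\<Psi> C D x n. kleene e
  [psi_arg \<Psi>, Fun2 Feferman_mu, fun2_arg C, fun2_arg D, Fun1 x, Num n] (zeta_of \<Psi> C D x n)"
proof -
  let ?F = "%p. K.cutreal (zcut (fst (fst p)) (fst (snd (fst p))) (fst (snd (snd (fst p)))) (snd (snd (snd (fst p))))) (snd p)"
  have d: "K.df (K.push zeta_env) ?F" by (rule K.df_gfun[OF zeta_df])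
  then have "K.df (K.push zeta_env) (%p. of_nat (nat \<lfloor>?F p\<rfloor>))"
    by (rule K.df_cong) (rule nat_floor_Nats[OF K.df_N[OF d]])
  from K_kleene[OF this[unfolded zeta_env_def K.pushv_def prod.case]] obtain e where
    e: "!!p. p \<in> UNIV \<times> \<nat> ==> kleene e ((%t. case t of (\<Psi>, C, D, x) =>
      [psi_arg \<Psi>, Fun2 Feferman_mu, fun2_arg C, fun2_arg D, Fun1 x]) (fst p) @ [Num (nat \<lfloor>snd p\<rfloor>)]) (nat \<lfloor>?F p\<rfloor>)" by blast
  have "kleene e [psi_arg \<Psi>, Fun2 Feferman_mu, fun2_arg C, fun2_arg D, Fun1 x, Num n] (zeta_of \<Psi> C D x n)" for \<Psi> C D x n
    using e[of "((\<Psi>, C, D, x), of_nat n)"] by (simp add: zeta_of_def)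
  then show ?thesis by blast
qed

section \<open>Codes of reals\<close>

lemma K_e [simp]: "K.e (of_nat n) = 1 / 2 ^ n"
  by (simp add: K.e_def)

lemma ball_Nats: "(\<forall>r\<in>\<nat>. P (r :: rat)) \<longleftrightarrow> (\<forall>n. P (of_nat n))" and bex_Nats: "(\<exists>r\<in>\<nat>. P (r :: rat)) \<longleftrightarrow> (\<exists>n. P (of_nat n))"
  by (auto elim!: Nats_cases)

lemma K_ispair: "K.ispair (of_nat (prod_encode (n, d))) (of_nat n) (of_nat d)"
proof -
  have "2 * triangle m = m * Suc m" for m by (simp add: triangle_def)
  then have "prod_encode (n, d) + prod_encode (n, d) = (n + d) * (n + d + 1) + (n + n)"
    by (simp add: prod_encode_def mult_2[symmetric])
  then have "(of_nat (prod_encode (n, d) + prod_encode (n, d)) :: rat) = of_nat ((n + d) * (n + d + 1) + (n + n))" by metis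
  then show ?thesis unfolding K.ispair_def by (simp only: of_nat_add of_nat_mult of_nat_1)
qed

lemma K_pr: "K.prl (of_nat (prod_encode (n, d))) = of_nat n" "K.prr (of_nat (prod_encode (n, d))) = of_nat d"
  using K.pr_eq[OF _ _ _ K_ispair] by auto

lemma K_rat: "K.rat (of_nat k) = rat_of_code k"
proof -
  obtain n d where nd: "prod_decode k = (n, d)" by (cases "prod_decode k")
  then have k: "k = prod_encode (n, d)" by (metis prod_decode_inverse)
  show ?thesis
  proof (cases "even n")
    case True
    then obtain p where p: "n = p + p" by (metis evenE mult_2)
    have "K.israt (of_nat k) (of_nat p) (of_nat 0) (of_nat d)" unfolding K.israt_def k
      by (intro bexI[of _ "of_nat n"] conjI K_ispair disjI1) (simp_all add: p)
    from K.rat_eqI[OF _ _ _ this] show ?thesis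
      by (simp add: rat_of_code_def nd int_decode_def sum_decode_def True p add.commute)
  next
    case False
    then obtain p where p: "n = p + p + 1" by (metis oddE mult_2)
    have "K.israt (of_nat k) (of_nat 0) (of_nat (p + 1)) (of_nat d)" unfolding K.israt_def k
      by (intro bexI[of _ "of_nat n"] conjI K_ispair disjI2) (simp_all add: p)
    from K.rat_eqI[OF _ _ _ this] show ?thesis
      by (simp add: rat_of_code_def nd int_decode_def sum_decode_def False p add.commute minus_divide_left)
  qed
qed

lemma rat_of_code_surj: "\<exists>k. rat_of_code k = q"
  using K.rat_surj[of q] by (auto simp: bex_Nats K_rat)

lemma isreal_iff: "K.isreal (rq x) \<longleftrightarrow> codes_real x"
proof -
  have "rq x (of_nat n + of_nat i) = of_nat (x (n + i))" for n i using rq_nat[of x "n + i"] by simp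
  then show ?thesis unfolding K.isreal_def codes_real_def ball_Nats by (simp add: K_rat)
qed

definition ap_real :: "(nat => nat) => nat => real" where "ap_real x n = real_of_rat (rat_of_code (x n))"

lemma of_rat_pow: "real_of_rat (1 / 2 ^ n) = 1 / 2 ^ n"
  by (simp add: of_rat_divide of_rat_power)

lemma of_rat_abs_less: "\<bar>a - b\<bar> < c \<longleftrightarrow> \<bar>real_of_rat a - real_of_rat b\<bar> < real_of_rat c"
proof -
  have "\<bar>real_of_rat a - real_of_rat b\<bar> < real_of_rat c \<longleftrightarrow>
      real_of_rat (a - b) < real_of_rat c \<and> real_of_rat (b - a) < real_of_rat c"
    by (auto simp: of_rat_diff abs_less_iff)
  then show ?thesis by (auto simp: of_rat_less abs_less_iff)
qed

lemma pow_small: assumes "0 < (\<epsilon> :: real)" shows "\<exists>n. 1 / 2 ^ n < \<epsilon>"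
  using real_arch_pow_inv[OF assms, of "1 / 2"] by (auto simp: power_one_over)

lemma pow_small2: assumes "0 < (\<epsilon> :: real)" shows "\<exists>n. 1 / 2 ^ n + 1 / 2 ^ n < \<epsilon>"
proof -
  obtain n where "1 / 2 ^ n < \<epsilon> / 2" using pow_small[of "\<epsilon> / 2"] assms by auto
  from add_strict_mono[OF this this] show ?thesis by (intro exI[of _ n]) simp
qed

lemma ap_close: "codes_real x ==> \<bar>ap_real x n - ap_real x (n + i)\<bar> < 1 / 2 ^ n"
  unfolding codes_real_def ap_real_def using of_rat_abs_less[of _ _ "1 / 2 ^ n"] of_rat_pow by auto

lemma ap_lim: assumes "codes_real x" shows "\<bar>ap_real x n - real_of_code x\<bar> <= 1 / 2 ^ n"
proof -
  have "Cauchy (ap_real x)"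
  proof (rule metric_CauchyI)
    fix \<epsilon> :: real assume "0 < \<epsilon>"
    then obtain N where N: "1 / 2 ^ N < \<epsilon> / 2" using pow_small[of "\<epsilon> / 2"] by auto
    have A: "\<bar>ap_real x N - ap_real x m\<bar> < \<epsilon> / 2" if "N <= m" for m
      using ap_close[OF assms, of N "m - N"] that N by simp
    have "dist (ap_real x m) (ap_real x n) < \<epsilon>" if "N <= m" "N <= n" for m n
      using A[OF that(1)] A[OF that(2)] unfolding dist_real_def by arith
    then show "\<exists>M. \<forall>m\<ge>M. \<forall>n\<ge>M. dist (ap_real x m) (ap_real x n) < \<epsilon>" by blast
  qed
  moreover have "real_of_code x = lim (ap_real x)" by (simp add: real_of_code_def ap_real_def[abs_def])
  ultimately have "ap_real x \<longlonglongrightarrow> real_of_code x" by (simp only: Cauchy_convergent_iff convergent_LIMSEQ_iff)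
  then have "(%i. ap_real x (i + n)) \<longlonglongrightarrow> real_of_code x" by (rule LIMSEQ_ignore_initial_segment)
  then have "(%i. \<bar>ap_real x n - ap_real x (i + n)\<bar>) \<longlonglongrightarrow> \<bar>ap_real x n - real_of_code x\<bar>"
    by (intro tendsto_intros)
  then show ?thesis
    by (rule LIMSEQ_le_const2) (use ap_close[OF assms, of n] in \<open>auto simp: add.commute intro: less_imp_le\<close>)
qed

text \<open>The limit may differ from the approximation at \<open>n\<close> by as much as
  \<open>1 / 2 ^ n\<close>, so to find a witness in the cut a precision below half the gap is
  taken.\<close>

lemma lt_iff: assumes "codes_real x"
  shows "K.lt a (rq x) \<longleftrightarrow> real_of_rat a < real_of_code x" "K.ut (rq x) a \<longleftrightarrow> real_of_code x < real_of_rat a"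
proof -
  have lt: "K.lt a (rq x) \<longleftrightarrow> (\<exists>n. real_of_rat a + 1 / 2 ^ n < ap_real x n)"
  proof -
    have "a + 1 / 2 ^ n < rat_of_code (x n) \<longleftrightarrow> real_of_rat a + 1 / 2 ^ n < ap_real x n" for n
      using of_rat_less[where 'a = real, of "a + 1 / 2 ^ n" "rat_of_code (x n)"] by (simp add: of_rat_add of_rat_pow ap_real_def)
    then show ?thesis unfolding K.lt_def bex_Nats by (simp add: K_rat)
  qed
  have ut: "K.ut (rq x) a \<longleftrightarrow> (\<exists>n. ap_real x n + 1 / 2 ^ n < real_of_rat a)"
  proof -
    have "rat_of_code (x n) + 1 / 2 ^ n < a \<longleftrightarrow> ap_real x n + 1 / 2 ^ n < real_of_rat a" for n
      using of_rat_less[where 'a = real, of "rat_of_code (x n) + 1 / 2 ^ n" a] by (simp add: of_rat_add of_rat_pow ap_real_def)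
    then show ?thesis unfolding K.ut_def bex_Nats by (simp add: K_rat)
  qed
  show "K.lt a (rq x) \<longleftrightarrow> real_of_rat a < real_of_code x"
  proof
    assume "K.lt a (rq x)"
    then obtain n where "real_of_rat a + 1 / 2 ^ n < ap_real x n" using lt by blast
    then show "real_of_rat a < real_of_code x" using ap_lim[OF assms, of n] by linarith
  next
    assume "real_of_rat a < real_of_code x"
    then obtain n where "1 / 2 ^ n + 1 / 2 ^ n < real_of_code x - real_of_rat a"
      using pow_small2[of "real_of_code x - real_of_rat a"] by auto
    then have "real_of_rat a + 1 / 2 ^ n < ap_real x n" using ap_lim[OF assms, of n] by linarith
    then show "K.lt a (rq x)" using lt by blast
  qed
  show "K.ut (rq x) a \<longleftrightarrow> real_of_code x < real_of_rat a"
  proof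
    assume "K.ut (rq x) a"
    then obtain n where "ap_real x n + 1 / 2 ^ n < real_of_rat a" using ut by blast
    then show "real_of_code x < real_of_rat a" using ap_lim[OF assms, of n] by linarith
  next
    assume "real_of_code x < real_of_rat a"
    then obtain n where "1 / 2 ^ n + 1 / 2 ^ n < real_of_rat a - real_of_code x"
      using pow_small2[of "real_of_rat a - real_of_code x"] by auto
    then have "ap_real x n + 1 / 2 ^ n < real_of_rat a" using ap_lim[OF assms, of n] by linarith
    then show "K.ut (rq x) a" using ut by blast
  qed
qed

lemma code_exists: "\<exists>x. codes_real x \<and> real_of_code x = r"
proof -
  \<comment> \<open>The exponent \<open>n + 1\<close> leaves room for two errors within the bound
    \<open>1 / 2 ^ n\<close> of the Cauchy condition.\<close>
  have "\<exists>k. \<bar>real_of_rat (rat_of_code k) - r\<bar> < 1 / 2 ^ (n + 1)" for n :: nat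
  proof -
    obtain q where q: "r < real_of_rat q" "real_of_rat q < r + 1 / 2 ^ (n + 1)"
      using of_rat_dense[of r "r + 1 / 2 ^ (n + 1)"] by auto
    obtain k where "rat_of_code k = q" using rat_of_code_surj by blast
    then show ?thesis using q by (intro exI[of _ k]) auto
  qed
  then obtain x where x: "!!n :: nat. \<bar>ap_real x n - r\<bar> < 1 / 2 ^ (n + 1)" unfolding ap_real_def by metis
  have c: "codes_real x" unfolding codes_real_def
  proof (intro allI)
    fix n i :: nat
    have "(1 :: real) / 2 ^ (n + i + 1) <= 1 / 2 ^ (n + 1)" by (intro divide_left_mono power_increasing) auto
    then have "\<bar>ap_real x n - ap_real x (n + i)\<bar> < 1 / 2 ^ (n + 1) + 1 / 2 ^ (n + 1)" using x[of n] x[of "n + i"] by linarith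
    also have "\<dots> = 1 / 2 ^ n" by simp
    finally show "\<bar>rat_of_code (x n) - rat_of_code (x (n + i))\<bar> < 1 / 2 ^ n"
      unfolding of_rat_abs_less of_rat_pow ap_real_def .
  qed
  have "real_of_code x = r"
  proof (rule ccontr)
    assume "real_of_code x ~= r"
    then obtain n where n: "1 / 2 ^ n + 1 / 2 ^ n < \<bar>real_of_code x - r\<bar>" using pow_small2[of "\<bar>real_of_code x - r\<bar>"] by auto
    have "(1 :: real) / 2 ^ (n + 1) <= 1 / 2 ^ n" by (intro divide_left_mono power_increasing) auto
    then have "\<bar>ap_real x n - r\<bar> < 1 / 2 ^ n" by (rule less_le_trans[OF x[of n]])
    then have "\<bar>real_of_code x - r\<bar> < 1 / 2 ^ n + 1 / 2 ^ n" using ap_lim[OF c, of n] by arith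
    then show False using n by simp
  qed
  then show ?thesis using c by blast
qed

lemma real_eqI:
  assumes "!!a. real_of_rat a < u \<longleftrightarrow> real_of_rat a < w" shows "u = w"
proof (cases u w rule: linorder_cases)
  case less
  then obtain a where "u < real_of_rat a" "real_of_rat a < w" using of_rat_dense by blast
  then show ?thesis using assms[of a] by simp
next
  case greater
  then obtain a where "w < real_of_rat a" "real_of_rat a < u" using of_rat_dense by blast
  then show ?thesis using assms[of a] by simp
qed

lemma near_codes:
  assumes "codes_real x" "codes_real y" "\<bar>real_of_code x - real_of_code y\<bar> < real_of_rat \<delta>"
  shows "K.near (rq x) (rq y) \<delta>"
proof -
  define \<eta> where "\<eta> = (real_of_rat \<delta> - \<bar>real_of_code x - real_of_code y\<bar>) / 2"
  let ?m = "min (real_of_code x) (real_of_code y)" and ?M = "max (real_of_code x) (real_of_code y)"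
  have "0 < \<eta>" using assms(3) by (simp add: \<eta>_def)
  then have "?m - \<eta> < ?m" "?M < ?M + \<eta>" by linarith+
  then obtain a b where ab: "?m - \<eta> < real_of_rat a" "real_of_rat a < ?m" "?M < real_of_rat b" "real_of_rat b < ?M + \<eta>"
    using of_rat_dense by meson
  have "2 * \<eta> = real_of_rat \<delta> - \<bar>real_of_code x - real_of_code y\<bar>" by (simp add: \<eta>_def)
  moreover have "?M - ?m = \<bar>real_of_code x - real_of_code y\<bar>" by (auto simp: min_def max_def)
  ultimately have "real_of_rat (b - a) < real_of_rat \<delta>" using ab by (simp add: of_rat_diff)
  then have "b - a < \<delta>" by (simp add: of_rat_less)
  then show ?thesis unfolding K.near_def using ab lt_iff[OF assms(1)] lt_iff[OF assms(2)]
    by (intro exI[of _ a] exI[of _ b]) auto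
qed

lemma code_0_5: "rat_of_code 0 = 0" "rat_of_code 5 = 1"
  using K_rat[of 0] K_rat[of 5] K.rat_0 K.rat_5 by simp_all

lemma const_code: "codes_real (%_. k)" "real_of_code (%_. k) = real_of_rat (rat_of_code k)"
  by (simp_all add: codes_real_def real_of_code_def lim_const)

lemma represents_compl:
  assumes "represents C f" shows "represents (compl C) (%r. if 0 < f r then 0 else 1)"
  unfolding represents_def
proof (intro allI impI)
  fix x assume x: "codes_real x"
  then have "K.lt 0 (rq (C x)) \<longleftrightarrow> 0 < f (real_of_code x)"
    using assms lt_iff(1)[of "C x" 0] by (simp add: represents_def)
  then have "compl C x = (%_. if 0 < f (real_of_code x) then 0 else 5)" by (simp add: compl_def fun_eq_iff)
  then show "codes_real (compl C x) \<and> real_of_code (compl C x) = (if 0 < f (real_of_code x) then 0 else 1)"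
    using const_code by (simp add: code_0_5)
qed

lemma set_compl: "set_given_by (%r. if 0 < f r then 0 else 1) = - set_given_by f"
  by (auto simp: set_given_by_def)

lemma represents_point:
  assumes "codes_real x" shows "represents (point x) (%r. if r = real_of_code x then 1 else 0)"
  unfolding represents_def
proof (intro allI impI)
  fix y assume y: "codes_real y"
  have "(\<exists>q. K.lt q (rq y) ~= K.lt q (rq x)) \<longleftrightarrow> real_of_code y ~= real_of_code x"
    using lt_iff(1)[OF assms] lt_iff(1)[OF y] real_eqI[of "real_of_code y" "real_of_code x"] by auto
  then have "point x y = (%_. if real_of_code y = real_of_code x then 5 else 0)" by (auto simp: point_def fun_eq_iff)
  then show "codes_real (point x y) \<and> real_of_code (point x y) = (if real_of_code y = real_of_code x then 1 else 0)"
    using const_code by (simp add: code_0_5)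
qed

section \<open>The reductions\<close>

lemma Phi_of_correct: assumes "zeta_functional \<zeta>" shows "Phi_functional (Phi_of \<zeta>)"
  unfolding Phi_functional_def
proof (intro allI impI, elim conjE)
  fix Y f x
  assume Y: "represents Y f" "open (set_given_by f)" and x: "codes_real x" "real_of_code x \<in> set_given_by f"
  let ?X = "real_of_code x" and ?S = "set_given_by f"
  let ?f0 = "%r. if 0 < f r then 0 else 1 :: real" and ?f1 = "%r. if r = ?X then 1 else 0 :: real"
  have s1: "set_given_by ?f1 = {?X}" by (auto simp: set_given_by_def)
  have prem: "represents (compl Y) ?f0 \<and> represents (point x) ?f1 \<and> closed (set_given_by ?f0) \<and>
      closed (set_given_by ?f1) \<and> set_given_by ?f0 \<inter> set_given_by ?f1 = {}"
    unfolding set_compl s1 using represents_compl[OF Y(1)] represents_point[OF x(1)] Y(2) x(2) by auto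
  obtain g where g: "represents (\<zeta> (compl Y) (point x)) g" "continuous_on UNIV g"
    "\<forall>z\<in>set_given_by ?f0. g z = 0" "\<forall>z\<in>set_given_by ?f1. g z = 1"
    using assms[unfolded zeta_functional_def, rule_format, OF prem] by blast
  have g0: "g z = 0" if "z \<notin> ?S" for z using g(3) that unfolding set_compl by blast
  have g1: "g ?X = 1" using g(4) unfolding s1 by simp
  have op: "open {z. a < g z}" "open {z. g z < a}" for a
    using g(2) by (auto intro!: open_Collect_less continuous_on_const)
  have third: "real_of_rat (1 / 3) = 1 / 3" by (simp add: of_rat_divide)
  have val: "K.lt (1 / 3) (rq (zeta_val \<zeta> Y x (%_. p))) \<longleftrightarrow> 1 / 3 < g (real_of_rat (rat_of_code p))" for p
  proof -
    have z: "codes_real (\<zeta> (compl Y) (point x) (%_. p))"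
      "real_of_code (\<zeta> (compl Y) (point x) (%_. p)) = g (real_of_rat (rat_of_code p))"
      using g(1) const_code[of p] by (simp_all add: represents_def)
    show ?thesis unfolding zeta_val_def lt_iff(1)[OF z(1)] z(2) third ..
  qed
  have test: "Phi_test \<zeta> Y x (of_nat k) \<longleftrightarrow> 0 < rat_of_code k \<and>
      (\<forall>p. \<bar>real_of_rat (rat_of_code p) - ?X\<bar> < real_of_rat (rat_of_code k) --> 1 / 3 < g (real_of_rat (rat_of_code p)))" for k
  proof -
    have "K.lt (rat_of_code p - rat_of_code k) (rq x) \<and> K.ut (rq x) (rat_of_code p + rat_of_code k) \<longleftrightarrow>
        \<bar>real_of_rat (rat_of_code p) - ?X\<bar> < real_of_rat (rat_of_code k)" for p
      unfolding lt_iff[OF x(1)] by (auto simp: of_rat_diff of_rat_add abs_less_iff)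
    then show ?thesis unfolding Phi_test_def ball_Nats by (simp add: K_rat val)
  qed
  \<comment> \<open>Some radius passes the test, because \<open>g\<close> is 1 at the point and the
    set where it exceeds 1/3 is open. Minimisation then finds one.\<close>
  obtain \<epsilon> where \<epsilon>: "0 < \<epsilon>" "ball ?X \<epsilon> \<subseteq> {z. 1 / 3 < g z}"
    using op(1)[of "1 / 3"] g1 openE[of "{z. 1 / 3 < g z}" ?X] by auto
  obtain q where q: "0 < real_of_rat q" "real_of_rat q < \<epsilon>" using of_rat_dense[OF \<epsilon>(1)] by blast
  obtain k0 where "rat_of_code k0 = q" using rat_of_code_surj by blast
  moreover have "0 < q" using q(1) by (simp add: zero_less_of_rat_iff)
  ultimately have "Phi_test \<zeta> Y x (of_nat k0)" unfolding test using q(2) \<epsilon>(2) by (auto simp: subset_iff dist_real_def)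
  moreover have "(\<zeta>, Y, x) \<in> fst (snd Phi_env)" by (simp add: Phi_env_def)
  ultimately have L: "K.least (Phi_test \<zeta> Y x) \<in> \<nat>" "Phi_test \<zeta> Y x (K.least (Phi_test \<zeta> Y x))"
    using K.least_spec(2)[OF Phi_env(1) dec_Phi_test, of "(\<zeta>, Y, x)" "of_nat k0"] by auto
  define k where "k = Phi_of \<zeta> Y x"
  have "Phi_test \<zeta> Y x (of_nat k)" using L nat_floor_Nats[OF L(1)] by (simp add: k_def Phi_of_def)
  then have k: "0 < rat_of_code k"
    "!!p. \<bar>real_of_rat (rat_of_code p) - ?X\<bar> < real_of_rat (rat_of_code k) ==> 1 / 3 < g (real_of_rat (rat_of_code p))"
    unfolding test by auto
  have "ball ?X (real_of_rat (rat_of_code k)) \<subseteq> ?S"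
  proof (rule subsetI, rule ccontr)
    fix z assume z: "z \<in> ball ?X (real_of_rat (rat_of_code k))" "z \<notin> ?S"
    \<comment> \<open>At \<open>z\<close> the function \<open>g\<close> is 0, so it is below 1/3 on
      a neighbourhood; a rational of the ball in that neighbourhood contradicts the test.\<close>
    have "open (ball ?X (real_of_rat (rat_of_code k)) \<inter> {z. g z < 1 / 3})" using op(2) by blast
    moreover have "z \<in> ball ?X (real_of_rat (rat_of_code k)) \<inter> {z. g z < 1 / 3}" using z g0 by simp
    ultimately obtain \<delta> where \<delta>: "0 < \<delta>" "ball z \<delta> \<subseteq> ball ?X (real_of_rat (rat_of_code k)) \<inter> {z. g z < 1 / 3}"
      using openE by blast
    obtain q where q: "z < real_of_rat q" "real_of_rat q < z + \<delta>" using of_rat_dense[of z "z + \<delta>"] \<delta>(1) by auto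
    obtain p where p: "rat_of_code p = q" using rat_of_code_surj by blast
    have "real_of_rat q \<in> ball z \<delta>" using q by (simp add: dist_real_def)
    then have "real_of_rat q \<in> ball ?X (real_of_rat (rat_of_code k)) \<inter> {z. g z < 1 / 3}" using \<delta>(2) by blast
    then show False using k(2)[of p] p by (simp add: dist_real_def abs_minus_commute)
  qed
  then show "0 < rat_of_code (Phi_of \<zeta> Y x) \<and> ball ?X (real_of_rat (rat_of_code (Phi_of \<zeta> Y x))) \<subseteq> ?S"
    using k(1) by (simp add: k_def)
qed

text \<open>At level 0 \<open>dlt\<close> asks for membership in one of the balls, and the sequences
  returned for the complement of the closed set cover exactly that complement.\<close>

lemma dlt_psi:
  assumes "Psi_functional \<Psi>" "represents C f" "closed (set_given_by f)" "codes_real x"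
  shows "K.dlt (zcen \<Psi> C) (zrad \<Psi> C) (rq x) 0 \<longleftrightarrow> real_of_code x \<notin> set_given_by f"
proof -
  obtain a r where ar: "\<Psi> (compl C) = (a, r)" by (cases "\<Psi> (compl C)")
  have "represents (compl C) (%r. if 0 < f r then 0 else 1) \<and> open (set_given_by (%r. if 0 < f r then 0 else 1)) \<and> \<Psi> (compl C) = (a, r)"
    unfolding set_compl using represents_compl[OF assms(2)] assms(3) ar by auto
  from assms(1)[unfolded Psi_functional_def, rule_format, OF this]
  have un: "- set_given_by f = (\<Union>n. ball (real_of_rat (rat_of_code (a n))) (real_of_rat (rat_of_code (r n))))"
    unfolding set_compl by blast
  have z: "zcen \<Psi> C (of_nat n) = rat_of_code (a n)" "zrad \<Psi> C (of_nat n) = rat_of_code (r n)" for n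
    by (simp_all add: zcen_def zrad_def psi_seq_def ar K_pr K_rat)
  have "K.dlt (zcen \<Psi> C) (zrad \<Psi> C) (rq x) 0 \<longleftrightarrow>
      (\<exists>n. real_of_code x \<in> ball (real_of_rat (rat_of_code (a n))) (real_of_rat (rat_of_code (r n))))"
    unfolding K.dlt_def bex_Nats z lt_iff[OF assms(4)]
    by (auto simp: of_rat_diff of_rat_add dist_real_def abs_less_iff algebra_simps)
  then show ?thesis using un by blast
qed

lemma zeta_of_correct: assumes "Psi_functional \<Psi>" shows "zeta_functional (zeta_of \<Psi>)"
  unfolding zeta_functional_def
proof (intro allI impI, elim conjE)
  fix C D f0 f1
  assume C: "represents C f0" "represents D f1" "closed (set_given_by f0)" "closed (set_given_by f1)"
    and dis: "set_given_by f0 \<inter> set_given_by f1 = {}"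
  let ?Z = "zeta_of \<Psi> C D"
  note d0 = dlt_psi[OF assms C(1,3)] and d1 = dlt_psi[OF assms C(2,4)]
  have x: "(\<Psi>, C, D, x) \<in> fst (snd zeta_env)" for x by (simp add: zeta_env_def)
  have cut: "rq (?Z x) n = K.cutreal (zcut \<Psi> C D x) n" if "n \<in> \<nat>" for n x
  proof -
    have "K.isreal (K.cutreal (zcut \<Psi> C D x))" using K.gfun(1)[OF zeta_df x[of x]] by simp
    then have "K.cutreal (zcut \<Psi> C D x) n \<in> \<nat>" using that by (simp add: K.isreal_def)
    then show ?thesis using that by (auto simp: zeta_of_def nat_floor_Nats elim!: Nats_cases)
  qed
  have code: "codes_real (?Z x)" for x
    using K.gfun(1)[OF zeta_df x[of x]] K.isreal_cong[of "rq (?Z x)", OF cut] by (simp add: isreal_iff[symmetric])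
  have ltZ: "real_of_rat a < real_of_code (?Z x) \<longleftrightarrow> zcut \<Psi> C D x a" for a x
    using K.gfun(2)[OF zeta_df x[of x], of a] K.lt_cong[of "rq (?Z x)", OF cut] lt_iff(1)[OF code] by simp
  have same: "real_of_code (?Z x) = real_of_code (?Z y)"
    if "codes_real x" "codes_real y" "real_of_code x = real_of_code y" for x y
  proof -
    have "K.dlt A R (rq x) t \<longleftrightarrow> K.dlt A R (rq y) t" for A R t
      unfolding K.dlt_def lt_iff[OF that(1)] lt_iff[OF that(2)] that(3) ..
    then have "zcut \<Psi> C D x a = zcut \<Psi> C D y a" for a by (simp add: K.gcut_def)
    then show ?thesis by (intro real_eqI) (simp add: ltZ)
  qed
  \<comment> \<open>The induced function on the reals is read off at chosen codes; by
    \<open>same\<close> the choice does not affect its values.\<close>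
  define c where "c = (%r. SOME x. codes_real x \<and> real_of_code x = r)"
  have c: "codes_real (c r)" "real_of_code (c r) = r" for r
    using someI_ex[OF code_exists[of r]] by (simp_all add: c_def)
  define g where "g = (%r. real_of_code (?Z (c r)))"
  have "represents ?Z g" unfolding represents_def g_def
  proof (intro allI impI conjI)
    fix x assume "codes_real x"
    then show "real_of_code (?Z x) = real_of_code (?Z (c (real_of_code x)))"
      by (rule same[OF _ c(1)]) (simp only: c(2))
  qed (rule code)
  moreover have "isCont g u" for u
    unfolding isCont_def
  proof (rule LIM_I)
    fix \<epsilon> :: real assume "0 < \<epsilon>"
    \<comment> \<open>\<open>gcut_cont\<close> takes a rational tolerance that is at most 1.\<close>
    then obtain q where q: "0 < real_of_rat q" "real_of_rat q < min \<epsilon> 1" using of_rat_dense[of 0 "min \<epsilon> 1"] by auto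
    have "real_of_rat q < real_of_rat 1" using q(2) by simp
    then have "q < 1" by (simp only: of_rat_less)
    then have q': "0 < q" "q <= 1" using q(1) by (simp_all add: zero_less_of_rat_iff)
    have "K.dlt (zcen \<Psi> C) (zrad \<Psi> C) (rq (c u)) 0 \<or> K.dlt (zcen \<Psi> D) (zrad \<Psi> D) (rq (c u)) 0"
      using d0[OF c(1)] d1[OF c(1)] dis c(2) by auto
    from K.gcut_cont[OF isreal_iff[THEN iffD2, OF c(1)] this q'] obtain \<delta> where \<delta>: "0 < \<delta>"
      "!!\<eta> a. K.isreal \<eta> ==> K.near (rq (c u)) \<eta> \<delta> ==>
        (zcut \<Psi> C D (c u) a --> K.gcut (zcen \<Psi> C) (zrad \<Psi> C) (zcen \<Psi> D) (zrad \<Psi> D) \<eta> (a - q)) \<and>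
        (K.gcut (zcen \<Psi> C) (zrad \<Psi> C) (zcen \<Psi> D) (zrad \<Psi> D) \<eta> a --> zcut \<Psi> C D (c u) (a - q))" by blast
    have "norm (g w - g u) < \<epsilon>" if w: "w ~= u" "norm (w - u) < real_of_rat \<delta>" for w
    proof -
      have "K.near (rq (c u)) (rq (c w)) \<delta>" by (rule near_codes[OF c(1) c(1)]) (use w in \<open>simp add: c abs_minus_commute\<close>)
      note sh = \<delta>(2)[OF isreal_iff[THEN iffD2, OF c(1)] this]
      have s1: "real_of_rat a - real_of_rat q < g w" if "real_of_rat a < g u" for a
        using sh[of a] that ltZ[of a "c u"] ltZ[of "a - q" "c w"] by (simp add: g_def of_rat_diff)
      have s2: "real_of_rat a - real_of_rat q < g u" if "real_of_rat a < g w" for a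
        using sh[of a] that ltZ[of a "c w"] ltZ[of "a - q" "c u"] by (simp add: g_def of_rat_diff)
      have "g u <= g w + real_of_rat q"
      proof (rule ccontr)
        assume "\<not> ?thesis"
        then obtain a where "g w + real_of_rat q < real_of_rat a" "real_of_rat a < g u"
          using of_rat_dense[of "g w + real_of_rat q" "g u"] by auto
        then show False using s1[of a] by simp
      qed
      moreover have "g w <= g u + real_of_rat q"
      proof (rule ccontr)
        assume "\<not> ?thesis"
        then obtain a where "g u + real_of_rat q < real_of_rat a" "real_of_rat a < g w"
          using of_rat_dense[of "g u + real_of_rat q" "g w"] by auto
        then show False using s2[of a] by simp
      qed
      moreover have "real_of_rat q < \<epsilon>" using q(2) by simp
      ultimately show ?thesis unfolding real_norm_def by linarith
    qed
    moreover have "0 < real_of_rat \<delta>" using \<delta>(1) by (simp add: zero_less_of_rat_iff)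
    ultimately show "\<exists>s>0. \<forall>w. w ~= u \<and> norm (w - u) < s --> norm (g w - g u) < \<epsilon>" by blast
  qed
  then have "continuous_on UNIV g" by (simp add: continuous_at_imp_continuous_on)
  moreover have "g u = 0" if "u \<in> set_given_by f0" for u
  proof -
    have "\<not> zcut \<Psi> C D (c u) 0" using K.gcut_0_iff d0[OF c(1)] c(2) that by simp
    then have "zcut \<Psi> C D (c u) a \<longleftrightarrow> a < 0" for a
    proof (cases "a < 0")
      case True
      then show ?thesis by (simp add: K.gcut_def)
    next
      case False
      then have "0 <= a" by simp
      then show ?thesis using \<open>\<not> zcut \<Psi> C D (c u) 0\<close> K.gcut_mono False by blast
    qed
    then show ?thesis unfolding g_def by (intro real_eqI) (simp add: ltZ)
  qed
  moreover have "g u = 1" if "u \<in> set_given_by f1" for u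
  proof -
    have "\<not> K.dlt (zcen \<Psi> D) (zrad \<Psi> D) (rq (c u)) 0" using d1[OF c(1)] c(2) that by simp
    moreover have "K.dlt (zcen \<Psi> C) (zrad \<Psi> C) (rq (c u)) 0" using d0[OF c(1)] c(2) that dis by auto
    ultimately have "zcut \<Psi> C D (c u) a" if "a < 1" for a
      using K.gcut_1_iff[of "zcen \<Psi> C" "zrad \<Psi> C" "rq (c u)" "zcen \<Psi> D" "zrad \<Psi> D"] that by blast
    moreover have "\<not> zcut \<Psi> C D (c u) a" if "\<not> a < 1" for a
    proof
      assume "zcut \<Psi> C D (c u) a"
      then have "zcut \<Psi> C D (c u) 1" by (rule K.gcut_mono) (use that in simp)
      then show False using K.not_gcut_1 by blast
    qed
    ultimately have "zcut \<Psi> C D (c u) a \<longleftrightarrow> a < 1" for a by blast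
    then show ?thesis unfolding g_def by (intro real_eqI) (simp add: ltZ)
  qed
  ultimately show "\<exists>g. represents ?Z g \<and> continuous_on UNIV g \<and>
      (\<forall>x\<in>set_given_by f0. g x = 0) \<and> (\<forall>x\<in>set_given_by f1. g x = 1)"
    by (intro exI[of _ g] conjI ballI)
qed

section \<open>Simultaneous substitution\<close>

lemma tm_ty_subst: "tm_ty u = Some \<rho> ==> tm_ty (subst_tm x \<rho> u t) = tm_ty t"
  by (induction t) (auto split: option.splits ty.splits)

lemma wf_subst: "tm_ty u = Some \<rho> ==> wf_fm A ==> wf_fm (subst_fm x \<rho> u A)"
  by (induction A) (auto simp: tm_ty_subst)

lemma derivable_wf: "derivable T \<Gamma> A ==> wf_fm A"
  by (induction rule: derivable.induct) (auto simp: wf_subst)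

lemma finite_vars_tm: "finite (vars_tm t)"
  by (induction t) auto

lemma finite_free_vars: "finite (free_vars A)"
  by (induction A) (auto simp: finite_vars_tm)

lemma vars_tm_bound: "z \<in> vars_tm t ==> fst z < bound_tm t"
  by (induction t) auto

lemma free_vars_bound: "z \<in> free_vars A ==> fst z < bound_fm A"
  by (induction A) (auto dest: vars_tm_bound)

primrec tsub :: "(nat \<times> ty => tm) => tm => tm" where
  "tsub \<sigma> (Var x \<rho>) = \<sigma> (x, \<rho>)"
| "tsub \<sigma> (Const c) = Const c"
| "tsub \<sigma> (s \<cdot> t) = tsub \<sigma> s \<cdot> tsub \<sigma> t"

text \<open>\<open>fsub f \<sigma> A\<close> substitutes \<open>\<sigma>\<close> for the free variables of \<open>A\<close> and renames bound names by \<open>f\<close>.\<close>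

primrec fsub :: "(nat => nat) => (nat \<times> ty => tm) => fm => fm" where
  "fsub f \<sigma> (s \<^bold>= t) = (tsub \<sigma> s \<^bold>= tsub \<sigma> t)"
| "fsub f \<sigma> (s \<^bold>< t) = (tsub \<sigma> s \<^bold>< tsub \<sigma> t)"
| "fsub f \<sigma> \<^bold>\<bottom> = \<^bold>\<bottom>"
| "fsub f \<sigma> (A \<^bold>\<longrightarrow> B) = (fsub f \<sigma> A \<^bold>\<longrightarrow> fsub f \<sigma> B)"
| "fsub f \<sigma> (Forall x \<rho> A) = Forall (f x) \<rho> (fsub f (\<sigma>((x, \<rho>) := Var (f x) \<rho>)) A)"

abbreviation idsub :: "nat \<times> ty => tm" where "idsub \<equiv> %z. Var (fst z) (snd z)"

definition wts :: "(nat \<times> ty => tm) => bool" where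
  "wts \<sigma> \<longleftrightarrow> (\<forall>z. tm_ty (\<sigma> z) = Some (snd z))"

lemma wts_upd: "wts \<sigma> ==> tm_ty u = Some \<rho> ==> wts (\<sigma>((x, \<rho>) := u))"
  by (auto simp: wts_def)

lemma tm_ty_tsub: "wts \<sigma> ==> tm_ty (tsub \<sigma> t) = tm_ty t"
  by (induction t) (auto simp: wts_def split: option.splits ty.splits)

lemma wf_fsub: "wts \<sigma> ==> wf_fm A ==> wf_fm (fsub f \<sigma> A)"
  by (induction A arbitrary: \<sigma>) (auto simp: tm_ty_tsub wts_upd)

lemma tsub_id: "tsub idsub t = t"
  by (induction t) auto

lemma fsub_id: "fsub id idsub A = A"
proof (induction A)
  case (Forall x \<rho> A)
  have "idsub((x, \<rho>) := Var x \<rho>) = idsub" by auto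
  then show ?case using Forall by simp
qed (simp_all add: tsub_id)

lemma tsub_cong: "(!!z. z \<in> vars_tm t ==> \<sigma> z = \<tau> z) ==> tsub \<sigma> t = tsub \<tau> t"
  by (induction t) auto

lemma fsub_cong: "(!!z. z \<in> free_vars A ==> \<sigma> z = \<tau> z) ==> fsub f \<sigma> A = fsub f \<tau> A"
proof (induction A arbitrary: \<sigma> \<tau>)
  case (Eq s t)
  then show ?case using tsub_cong[of s \<sigma> \<tau>] tsub_cong[of t \<sigma> \<tau>] by simp
next
  case (Less s t)
  then show ?case using tsub_cong[of s \<sigma> \<tau>] tsub_cong[of t \<sigma> \<tau>] by simp
next
  case (Forall x \<rho> A)
  show ?case by (auto intro!: Forall.IH Forall.prems)
next
  case (Imp A B)
  have "fsub f \<sigma> A = fsub f \<tau> A" by (rule Imp.IH(1)) (simp add: Imp.prems)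
  moreover have "fsub f \<sigma> B = fsub f \<tau> B" by (rule Imp.IH(2)) (simp add: Imp.prems)
  ultimately show ?case by simp
qed simp

lemma vars_tsub: "vars_tm (tsub \<sigma> t) = (\<Union>z\<in>vars_tm t. vars_tm (\<sigma> z))"
  by (induction t) auto

lemma free_vars_fsub: "free_vars (fsub f \<sigma> A) \<subseteq> (\<Union>z\<in>free_vars A. vars_tm (\<sigma> z))"
proof (induction A arbitrary: \<sigma>)
  case (Forall x \<rho> A)
  show ?case using Forall[of "\<sigma>((x, \<rho>) := Var (f x) \<rho>)"] by (fastforce split: if_splits)
next
  case (Imp A B)
  show ?case using Imp.IH(1)[of \<sigma>] Imp.IH(2)[of \<sigma>] by (simp, blast)
qed (auto simp: vars_tsub)

lemma subst_tm_fresh: "(a, \<rho>) \<notin> vars_tm t ==> subst_tm a \<rho> u t = t"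
  by (induction t) auto

lemma subst_tsub: "subst_tm a \<rho> u (tsub \<sigma> t) = tsub (%z. subst_tm a \<rho> u (\<sigma> z)) t"
  by (induction t) auto

text \<open>Substitution for \<open>(a, \<rho>)\<close> stops at a binder of type
  \<open>\<rho>\<close> whose new name is \<open>a\<close>. The hypothesis ensures that under such a
  binder \<open>a\<close> enters only through the bound variable itself, so no occurrence is
  missed.\<close>

lemma subst_fsub:
  assumes "!!y z. y < bound_fm A ==> f y = a ==> z \<in> free_vars A ==> (a, \<rho>) \<in> vars_tm (\<sigma> z) ==> z = (y, \<rho>)"
  shows "subst_fm a \<rho> u (fsub f \<sigma> A) = fsub f (%z. subst_tm a \<rho> u (\<sigma> z)) A"
  using assms
proof (induction A arbitrary: \<sigma>)
  case (Imp A B)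
  have "subst_fm a \<rho> u (fsub f \<sigma> A) = fsub f (%z. subst_tm a \<rho> u (\<sigma> z)) A"
    by (rule Imp.IH(1), rule Imp.prems) simp_all
  moreover have "subst_fm a \<rho> u (fsub f \<sigma> B) = fsub f (%z. subst_tm a \<rho> u (\<sigma> z)) B"
    by (rule Imp.IH(2), rule Imp.prems) simp_all
  ultimately show ?case by (simp only: fsub.simps subst_fm.simps)
next
  case (Forall y \<tau> A)
  show ?case
  proof (cases "f y = a \<and> \<tau> = \<rho>")
    case True
    have "fsub f (\<sigma>((y, \<tau>) := Var (f y) \<tau>)) A =
        fsub f ((%z. subst_tm a \<rho> u (\<sigma> z))((y, \<tau>) := Var (f y) \<tau>)) A"
    proof (rule fsub_cong)
      fix z assume z: "z \<in> free_vars A"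
      show "(\<sigma>((y, \<tau>) := Var (f y) \<tau>)) z = ((%z. subst_tm a \<rho> u (\<sigma> z))((y, \<tau>) := Var (f y) \<tau>)) z"
      proof (cases "z = (y, \<tau>)")
        case False
        have "(a, \<rho>) \<notin> vars_tm (\<sigma> z)"
        proof
          assume "(a, \<rho>) \<in> vars_tm (\<sigma> z)"
          then have "z = (y, \<rho>)" using z True False by (intro Forall.prems) simp_all
          then show False using True False by simp
        qed
        then show ?thesis using False by (simp add: subst_tm_fresh)
      qed simp
    qed
    then show ?thesis using True by simp
  next
    case False
    have eq: "(%z. subst_tm a \<rho> u ((\<sigma>((y, \<tau>) := Var (f y) \<tau>)) z)) =
        (%z. subst_tm a \<rho> u (\<sigma> z))((y, \<tau>) := Var (f y) \<tau>)"
      using False by auto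
    have "subst_fm a \<rho> u (fsub f (\<sigma>((y, \<tau>) := Var (f y) \<tau>)) A) =
        fsub f (%z. subst_tm a \<rho> u ((\<sigma>((y, \<tau>) := Var (f y) \<tau>)) z)) A"
    proof (rule Forall.IH)
      fix y' z assume *: "y' < bound_fm A" "f y' = a" "z \<in> free_vars A"
        "(a, \<rho>) \<in> vars_tm ((\<sigma>((y, \<tau>) := Var (f y) \<tau>)) z)"
      then have "z ~= (y, \<tau>)" using False by auto
      then show "z = (y', \<rho>)" using * by (intro Forall.prems) (simp_all split: if_splits)
    qed
    then show ?thesis by (simp only: fsub.simps subst_fm.simps eq if_not_P[OF False])
  qed
next
  case (Eq s t)
  show ?case by (simp add: subst_tsub)
next
  case (Less s t)
  show ?case by (simp add: subst_tsub)
next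
  case Falsum
  show ?case by simp
qed

text \<open>A binder can capture a variable of \<open>u\<close> only if its new name occurs in
  \<open>u\<close>, and under such a binder the hypothesis leaves no free occurrence of
  \<open>(a, \<rho>)\<close>.\<close>

lemma free_for_fsub:
  assumes "!!y \<tau> z. y < bound_fm A ==> (f y, \<tau>) \<in> vars_tm u ==> z \<in> free_vars A ==>
    (a, \<rho>) \<in> vars_tm (\<sigma> z) ==> z = (y, \<tau>)"
  shows "free_for u a \<rho> (fsub f \<sigma> A)"
  using assms
proof (induction A arbitrary: \<sigma>)
  case (Imp A B)
  have "free_for u a \<rho> (fsub f \<sigma> A)" by (rule Imp.IH(1), rule Imp.prems) simp_all
  moreover have "free_for u a \<rho> (fsub f \<sigma> B)" by (rule Imp.IH(2), rule Imp.prems) simp_all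
  ultimately show ?case by simp
next
  case (Forall y \<tau> A)
  let ?\<sigma> = "\<sigma>((y, \<tau>) := Var (f y) \<tau>)"
  consider "(a, \<rho>) = (f y, \<tau>)" | "(a, \<rho>) ~= (f y, \<tau>)" "(f y, \<tau>) \<in> vars_tm u"
    | "(a, \<rho>) ~= (f y, \<tau>)" "(f y, \<tau>) \<notin> vars_tm u" by blast
  then show ?case
  proof cases
    case 1
    then show ?thesis by simp
  next
    case 2
    have "(a, \<rho>) \<notin> free_vars (fsub f ?\<sigma> A)"
    proof
      assume "(a, \<rho>) \<in> free_vars (fsub f ?\<sigma> A)"
      then obtain z where z: "z \<in> free_vars A" "(a, \<rho>) \<in> vars_tm (?\<sigma> z)"
        using free_vars_fsub by blast
      then have "z ~= (y, \<tau>)" using 2 by auto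
      then have "z = (y, \<tau>)" using z 2 by (intro Forall.prems) (simp_all split: if_splits)
      then show False using \<open>z ~= (y, \<tau>)\<close> by simp
    qed
    then show ?thesis by simp
  next
    case 3
    have "free_for u a \<rho> (fsub f ?\<sigma> A)"
    proof (rule Forall.IH)
      fix y' \<tau>' z assume *: "y' < bound_fm A" "(f y', \<tau>') \<in> vars_tm u" "z \<in> free_vars A"
        "(a, \<rho>) \<in> vars_tm (?\<sigma> z)"
      then have "z ~= (y, \<tau>)" using 3 by auto
      then show "z = (y', \<tau>')" using * by (intro Forall.prems) (simp_all split: if_splits)
    qed
    then show ?thesis using 3 by simp
  qed
next
  case (Eq s t)
  show ?case by simp
next
  case (Less s t)
  show ?case by simp
next
  case Falsum
  show ?case by simp
qed

lemma subst_id: "subst_fm x \<rho> (Var x \<rho>) A = A"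
proof -
  have "subst_tm x \<rho> (Var x \<rho>) t = t" for t by (induction t) auto
  then show ?thesis by (induction A) auto
qed

lemma free_for_id: "free_for (Var x \<rho>) x \<rho> A"
  by (induction A) auto

text \<open>Through these facts, a proof of the instance with a fresh variable yields the universal
  formula with its original bound variable.\<close>

lemma subst_fresh_inverse:
  assumes "bound_fm A <= y"
  shows "subst_fm y \<rho> (Var x \<rho>) (subst_fm x \<rho> (Var y \<rho>) A) = A"
    and "free_for (Var x \<rho>) y \<rho> (subst_fm x \<rho> (Var y \<rho>) A)"
    and "free_for (Var y \<rho>) x \<rho> A"
    and "(x, \<rho>) ~= (y, \<rho>) ==> (x, \<rho>) \<notin> free_vars (subst_fm x \<rho> (Var y \<rho>) A)"
proof -
  have tm: "bound_tm t <= y ==> subst_tm y \<rho> (Var x \<rho>) (subst_tm x \<rho> (Var y \<rho>) t) = t" for t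
    by (induction t) auto
  have vt: "x ~= y ==> (x, \<rho>) \<notin> vars_tm (subst_tm x \<rho> (Var y \<rho>) t)" for t
    by (induction t) auto
  have fr: "bound_fm A <= y ==> subst_fm y \<rho> (Var x \<rho>) A = A" for A
  proof (induction A)
    case (Eq s t)
    then show ?case using vars_tm_bound[of "(y, \<rho>)" s] vars_tm_bound[of "(y, \<rho>)" t]
      by (auto intro!: subst_tm_fresh)
  next
    case (Less s t)
    then show ?case using vars_tm_bound[of "(y, \<rho>)" s] vars_tm_bound[of "(y, \<rho>)" t]
      by (auto intro!: subst_tm_fresh)
  qed auto
  show "subst_fm y \<rho> (Var x \<rho>) (subst_fm x \<rho> (Var y \<rho>) A) = A"
    using assms by (induction A) (auto simp: tm fr)
  have nf: "bound_fm A <= y ==> (y, \<rho>) \<notin> free_vars A" for A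
    using free_vars_bound[of "(y, \<rho>)" A] by auto
  have fv: "x ~= y ==> (x, \<rho>) \<notin> free_vars (subst_fm x \<rho> (Var y \<rho>) A)" for A
    by (induction A) (auto simp: vt)
  then show "(x, \<rho>) ~= (y, \<rho>) ==> (x, \<rho>) \<notin> free_vars (subst_fm x \<rho> (Var y \<rho>) A)" by simp
  show "free_for (Var y \<rho>) x \<rho> A"
    using assms by (induction A) auto
  have ff: "bound_fm A <= y ==> free_for (Var x \<rho>) y \<rho> A" for A
    by (induction A) (auto simp: nf)
  show "free_for (Var x \<rho>) y \<rho> (subst_fm x \<rho> (Var y \<rho>) A)"
    using assms by (induction A) (auto simp: ff nf)
qed

section \<open>Derivations without assumptions\<close>

text \<open>\<open>derivable\<close> has no weakening rule, and the eigenvariable condition makes weakening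
  inadmissible without a renaming of bound variables.  Completeness is therefore derived from
  the theorems with empty context, which form a Hilbert-style calculus.\<close>

locale calculus =
  fixes T :: "fm set"
begin

definition pv :: "fm => bool" where "pv A \<longleftrightarrow> derivable T {} A"

lemma pv_wf: "pv A ==> wf_fm A"
  by (simp add: pv_def derivable_wf)

lemma pv_axiom: "A \<in> T ==> wf_fm A ==> pv A"
  by (simp add: pv_def Axiom)

lemma pv_mp: "pv (A \<^bold>\<longrightarrow> B) ==> pv A ==> pv B"
  unfolding pv_def by (rule ImpE)

lemma pv_refl: "wf_fm A ==> pv (A \<^bold>\<longrightarrow> A)"
  unfolding pv_def by (rule ImpI, assumption, rule Assumption) auto

lemma pv_K: "wf_fm A ==> wf_fm B ==> pv (A \<^bold>\<longrightarrow> B \<^bold>\<longrightarrow> A)"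
  unfolding pv_def by (rule ImpI, assumption, rule ImpI, assumption, rule Assumption) auto

lemma pv_S: assumes "wf_fm A" "wf_fm B" "wf_fm C"
  shows "pv ((A \<^bold>\<longrightarrow> B \<^bold>\<longrightarrow> C) \<^bold>\<longrightarrow> (A \<^bold>\<longrightarrow> B) \<^bold>\<longrightarrow> A \<^bold>\<longrightarrow> C)"
  unfolding pv_def
proof (intro ImpI)
  let ?G = "{A, A \<^bold>\<longrightarrow> B, A \<^bold>\<longrightarrow> B \<^bold>\<longrightarrow> C}"
  have "derivable T ?G A" "derivable T ?G (A \<^bold>\<longrightarrow> B)" "derivable T ?G (A \<^bold>\<longrightarrow> B \<^bold>\<longrightarrow> C)"
    using assms by (auto intro!: Assumption)
  then show "derivable T ?G C" by (blast intro: ImpE)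
qed (use assms in auto)

lemma pv_trans: "pv (A \<^bold>\<longrightarrow> B) ==> pv (B \<^bold>\<longrightarrow> C) ==> pv (A \<^bold>\<longrightarrow> C)"
  using pv_mp[OF pv_mp[OF pv_S[of A B C]]] pv_mp[OF pv_K[of "B \<^bold>\<longrightarrow> C" A]]
    pv_wf[of "A \<^bold>\<longrightarrow> B"] pv_wf[of "B \<^bold>\<longrightarrow> C"] by simp

lemma pv_export: assumes "wf_fm A" "wf_fm B" "wf_fm C"
  shows "pv ((C \<^bold>\<and> A \<^bold>\<longrightarrow> B) \<^bold>\<longrightarrow> C \<^bold>\<longrightarrow> A \<^bold>\<longrightarrow> B)"
  unfolding pv_def
proof (intro ImpI)
  let ?G = "{A, C, C \<^bold>\<and> A \<^bold>\<longrightarrow> B}"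
  have "derivable T (insert (C \<^bold>\<longrightarrow> \<^bold>\<not> A) ?G) (C \<^bold>\<longrightarrow> \<^bold>\<not> A)"
    "derivable T (insert (C \<^bold>\<longrightarrow> \<^bold>\<not> A) ?G) C" "derivable T (insert (C \<^bold>\<longrightarrow> \<^bold>\<not> A) ?G) A"
    using assms by (auto intro!: Assumption)
  then have "derivable T ?G (C \<^bold>\<and> A)" using assms by (intro ImpI) (auto intro: ImpE)
  moreover have "derivable T ?G (C \<^bold>\<and> A \<^bold>\<longrightarrow> B)" using assms by (auto intro!: Assumption)
  ultimately show "derivable T ?G B" by (blast intro: ImpE)
qed (use assms in auto)

lemma pv_import: assumes "wf_fm A" "wf_fm B" "wf_fm C"
  shows "pv ((C \<^bold>\<longrightarrow> A \<^bold>\<longrightarrow> B) \<^bold>\<longrightarrow> C \<^bold>\<and> A \<^bold>\<longrightarrow> B)"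
  unfolding pv_def
proof (intro ImpI)
  let ?G = "insert (\<^bold>\<not> B) {C \<^bold>\<and> A, C \<^bold>\<longrightarrow> A \<^bold>\<longrightarrow> B}"
  let ?H = "insert A (insert C ?G)"
  have "derivable T ?H (C \<^bold>\<longrightarrow> A \<^bold>\<longrightarrow> B)" "derivable T ?H C" "derivable T ?H A" "derivable T ?H (\<^bold>\<not> B)"
    using assms by (auto intro!: Assumption)
  then have "derivable T ?H \<^bold>\<bottom>" by (blast intro: ImpE)
  then have "derivable T ?G (C \<^bold>\<longrightarrow> \<^bold>\<not> A)" using assms by (intro ImpI) auto
  moreover have "derivable T ?G (C \<^bold>\<and> A)" using assms by (auto intro!: Assumption)
  ultimately have "derivable T ?G \<^bold>\<bottom>" by (rule ImpE[rotated])
  then show "derivable T {C \<^bold>\<and> A, C \<^bold>\<longrightarrow> A \<^bold>\<longrightarrow> B} B" by (rule Classical[OF assms(2)])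
qed (use assms in auto)

lemma pv_dne: assumes "wf_fm A" shows "pv (\<^bold>\<not> \<^bold>\<not> A \<^bold>\<longrightarrow> A)"
  unfolding pv_def
proof (rule ImpI, use assms in simp, rule Classical[OF assms])
  have "derivable T {\<^bold>\<not> A, \<^bold>\<not> \<^bold>\<not> A} (\<^bold>\<not> \<^bold>\<not> A)" "derivable T {\<^bold>\<not> A, \<^bold>\<not> \<^bold>\<not> A} (\<^bold>\<not> A)"
    using assms by (auto intro!: Assumption)
  then show "derivable T {\<^bold>\<not> A, \<^bold>\<not> \<^bold>\<not> A} \<^bold>\<bottom>" by (blast intro: ImpE)
qed

lemma pv_allE: "wf_fm A ==> tm_ty u = Some \<rho> ==> free_for u x \<rho> A ==>
    pv (Forall x \<rho> A \<^bold>\<longrightarrow> subst_fm x \<rho> u A)"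
  unfolding pv_def by (intro ImpI AllE Assumption) auto

lemma pv_gen: "pv A ==> pv (Forall x \<rho> A)"
  unfolding pv_def by (rule AllI) auto

lemma pv_inst: "pv A ==> tm_ty u = Some \<rho> ==> free_for u x \<rho> A ==> pv (subst_fm x \<rho> u A)"
  using pv_mp[OF pv_allE pv_gen] pv_wf by blast

lemma pv_allI: assumes "pv (C \<^bold>\<longrightarrow> A)" "(x, \<rho>) \<notin> free_vars C"
  shows "pv (C \<^bold>\<longrightarrow> Forall x \<rho> A)"
proof -
  have wf: "wf_fm C" "wf_fm A" using pv_wf[OF assms(1)] by auto
  let ?G = "{C, Forall x \<rho> (C \<^bold>\<longrightarrow> A)}"
  have "derivable T ?G (Forall x \<rho> (C \<^bold>\<longrightarrow> A))" "derivable T ?G C"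
    using wf by (auto intro!: Assumption)
  from AllE[OF this(1), of "Var x \<rho>"] this(2) have "derivable T ?G A"
    by (auto simp: subst_id free_for_id intro: ImpE)
  then have "derivable T ?G (Forall x \<rho> A)" using assms(2) by (intro AllI) auto
  then have "pv (Forall x \<rho> (C \<^bold>\<longrightarrow> A) \<^bold>\<longrightarrow> C \<^bold>\<longrightarrow> Forall x \<rho> A)"
    unfolding pv_def using wf by (intro ImpI) auto
  then show ?thesis using pv_mp pv_gen[OF assms(1)] by blast
qed

lemma pv_imp_cong: assumes "pv (A' \<^bold>\<longrightarrow> A)" "pv (B \<^bold>\<longrightarrow> B')"
  shows "pv ((A \<^bold>\<longrightarrow> B) \<^bold>\<longrightarrow> A' \<^bold>\<longrightarrow> B')"
proof -
  have wf: "wf_fm A" "wf_fm A'" "wf_fm B" "wf_fm B'"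
    using pv_wf[OF assms(1)] pv_wf[OF assms(2)] by auto
  have 1: "pv ((A \<^bold>\<longrightarrow> B) \<^bold>\<longrightarrow> A' \<^bold>\<longrightarrow> A \<^bold>\<longrightarrow> B)" using wf by (intro pv_K) auto
  have 2: "pv ((A' \<^bold>\<longrightarrow> A \<^bold>\<longrightarrow> B) \<^bold>\<longrightarrow> (A' \<^bold>\<longrightarrow> A) \<^bold>\<longrightarrow> A' \<^bold>\<longrightarrow> B)" using wf by (intro pv_S) auto
  have 3: "pv ((A \<^bold>\<longrightarrow> B) \<^bold>\<longrightarrow> (A' \<^bold>\<longrightarrow> A) \<^bold>\<longrightarrow> A' \<^bold>\<longrightarrow> B)" by (rule pv_trans[OF 1 2])
  have 4: "pv ((A \<^bold>\<longrightarrow> B) \<^bold>\<longrightarrow> A' \<^bold>\<longrightarrow> A)" using pv_mp[OF pv_K assms(1)] wf by auto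
  have 5: "pv ((A \<^bold>\<longrightarrow> B) \<^bold>\<longrightarrow> A' \<^bold>\<longrightarrow> B)"
    using pv_mp[OF pv_mp[OF pv_S 3] 4] wf by auto
  have "pv (A' \<^bold>\<longrightarrow> B \<^bold>\<longrightarrow> B')" using pv_mp[OF pv_K assms(2)] wf by auto
  then have "pv ((A' \<^bold>\<longrightarrow> B) \<^bold>\<longrightarrow> A' \<^bold>\<longrightarrow> B')" using pv_mp[OF pv_S] wf by auto
  then show ?thesis using pv_trans[OF 5] by blast
qed

text \<open>Each binder is renamed from \<open>f x\<close> to \<open>g x\<close> through a name
  \<open>w\<close> that is new for both, which avoids clashes between old and new names. The
  hypotheses are symmetric in \<open>f\<close> and \<open>g\<close> because the left side of an
  implication needs the converse renaming.\<close>

lemma pv_alpha: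
  assumes "inj f" "inj g" "bound_fm A <= N" "wf_fm A"
    and "!!z. \<exists>y. \<sigma> z = Var y (snd z) \<and> (\<forall>x<N. f x ~= y \<and> g x ~= y)"
  shows "pv (fsub f \<sigma> A \<^bold>\<longrightarrow> fsub g \<sigma> A)"
  using assms
proof (induction A arbitrary: \<sigma> f g)
  case (Imp A B)
  have "pv (fsub g \<sigma> A \<^bold>\<longrightarrow> fsub f \<sigma> A)" by (rule Imp.IH(1)) (use Imp.prems in force)+
  moreover have "pv (fsub f \<sigma> B \<^bold>\<longrightarrow> fsub g \<sigma> B)" by (rule Imp.IH(2)) (use Imp.prems in force)+
  ultimately show ?case by (simp add: pv_imp_cong)
next
  case (Forall x \<rho> A)
  obtain nm where nm: "!!z. \<sigma> z = Var (nm z) (snd z)" "!!z x. x < N ==> f x ~= nm z"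
      "!!z x. x < N ==> g x ~= nm z"
    using Forall.prems(5) by metis
  have "x < N" using Forall.prems(3) by simp
  have wts: "wts \<sigma>" using nm by (simp add: wts_def)
  obtain w where w: "w \<notin> f ` {..<N} \<union> g ` {..<N} \<union> nm ` free_vars A"
    using ex_new_if_finite[OF infinite_UNIV_nat] finite_free_vars by (metis finite_UnI finite_imageI finite_lessThan)
  let ?X = "(x, \<rho>)"
  let ?w = "\<sigma>(?X := Var w \<rho>)"
  define F where "F = fsub f (\<sigma>(?X := Var (f x) \<rho>)) A"
  define G where "G = fsub g (\<sigma>(?X := Var (g x) \<rho>)) A"
  define F' where "F' = fsub f ?w A"
  define G' where "G' = fsub g ?w A"
  have wf: "wf_fm F" "wf_fm G" "wf_fm F'" "wf_fm G'"
    unfolding F_def G_def F'_def G'_def using wts Forall.prems(4) by (auto intro!: wf_fsub wts_upd)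
  have bN: "y < N" if "y < bound_fm A" for y using that Forall.prems(3) by simp
  have "subst_fm (f x) \<rho> (Var w \<rho>) F =
      fsub f (%z. subst_tm (f x) \<rho> (Var w \<rho>) ((\<sigma>(?X := Var (f x) \<rho>)) z)) A"
    unfolding F_def
  proof (rule subst_fsub)
    fix y z assume "y < bound_fm A" "f y = f x" "(f x, \<rho>) \<in> vars_tm ((\<sigma>(?X := Var (f x) \<rho>)) z)"
    then show "z = (y, \<rho>)" using nm(1)[of z] nm(2)[OF \<open>x < N\<close>, of z] Forall.prems(1)
      by (auto split: if_splits dest: injD)
  qed
  also have "\<dots> = F'" unfolding F'_def
    by (rule fsub_cong) (use nm(1) nm(2)[OF \<open>x < N\<close>] in \<open>auto simp: eq_commute[of _ "f x"]\<close>)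
  finally have sF: "subst_fm (f x) \<rho> (Var w \<rho>) F = F'" .
  have "free_for (Var w \<rho>) (f x) \<rho> F" unfolding F_def
    by (rule free_for_fsub) (use w bN in auto)
  then have 1: "pv (Forall (f x) \<rho> F \<^bold>\<longrightarrow> F')"
    using pv_allE[OF wf(1), of "Var w \<rho>" \<rho> "f x"] sF by simp
  have 2: "pv (F' \<^bold>\<longrightarrow> G')" unfolding F'_def G'_def
  proof (rule Forall.IH)
    fix z show "\<exists>y. ?w z = Var y (snd z) \<and> (\<forall>x<N. f x ~= y \<and> g x ~= y)"
      using w nm by (cases "z = ?X") auto
  qed (use Forall.prems in auto)
  have "(w, \<rho>) \<notin> free_vars (Forall (f x) \<rho> F)"
  proof -
    have "(w, \<rho>) \<notin> (\<Union>z\<in>free_vars A. vars_tm ((\<sigma>(?X := Var (f x) \<rho>)) z))"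
      using w \<open>x < N\<close> nm(1) by auto
    then show ?thesis using free_vars_fsub[of f "\<sigma>(?X := Var (f x) \<rho>)" A]
      unfolding F_def free_vars.simps by blast
  qed
  then have 3: "pv (Forall (f x) \<rho> F \<^bold>\<longrightarrow> Forall w \<rho> G')"
    using pv_allI[OF pv_trans[OF 1 2]] by blast
  have "subst_fm w \<rho> (Var (g x) \<rho>) G' = fsub g (%z. subst_tm w \<rho> (Var (g x) \<rho>) (?w z)) A"
    unfolding G'_def by (rule subst_fsub) (use w bN in auto)
  also have "\<dots> = G" unfolding G_def
    by (rule fsub_cong) (use w nm(1) in auto)
  finally have sG: "subst_fm w \<rho> (Var (g x) \<rho>) G' = G" .
  have "free_for (Var (g x) \<rho>) w \<rho> G'" unfolding G'_def
  proof (rule free_for_fsub)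
    fix y \<tau> z assume "(g y, \<tau>) \<in> vars_tm (Var (g x) \<rho>)" "z \<in> free_vars A" "(w, \<rho>) \<in> vars_tm (?w z)"
    then show "z = (y, \<tau>)" using w nm(1) Forall.prems(2)
      by (auto split: if_splits dest: injD)
  qed
  then have 4: "pv (Forall w \<rho> G' \<^bold>\<longrightarrow> G)"
    using pv_allE[OF wf(4), of "Var (g x) \<rho>" \<rho> w] sG by simp
  have "(g x, \<rho>) \<notin> free_vars (Forall w \<rho> G')"
  proof -
    have "(g x, \<rho>) \<notin> (\<Union>z\<in>free_vars A. vars_tm (?w z)) - {(w, \<rho>)}"
      using nm(1) nm(3)[OF \<open>x < N\<close>] by auto
    then show ?thesis using free_vars_fsub[of g ?w A] unfolding G'_def free_vars.simps by blast
  qed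
  from pv_trans[OF 3 pv_allI[OF 4 this]] show ?case unfolding F_def G_def by simp
next
  case (Eq s t)
  have "wts \<sigma>" unfolding wts_def using Eq.prems(5) by (metis tm_ty.simps(1))
  then show ?case using Eq.prems(4) by (auto intro: pv_refl simp: tm_ty_tsub)
next
  case (Less s t)
  have "wts \<sigma>" unfolding wts_def using Less.prems(5) by (metis tm_ty.simps(1))
  then show ?case using Less.prems(4) by (auto intro: pv_refl simp: tm_ty_tsub)
next
  case Falsum
  show ?case by (auto intro: pv_refl)
qed

text \<open>Even names are reserved for bound variables and odd names for free ones:
  \<open>dsub\<close> doubles the bound names, so that a term with odd names is never
  captured.\<close>

definition odd_tm :: "tm => bool" where "odd_tm t \<longleftrightarrow> (\<forall>z\<in>vars_tm t. odd (fst z))"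

abbreviation dsub :: "(nat \<times> ty => tm) => fm => fm" where "dsub \<equiv> fsub (%x. 2 * x)"

lemma pv_conjD: assumes "wf_fm A" "wf_fm C" shows "pv (C \<^bold>\<and> A \<^bold>\<longrightarrow> C)" "pv (C \<^bold>\<and> A \<^bold>\<longrightarrow> A)"
proof -
  have "pv (C \<^bold>\<longrightarrow> A \<^bold>\<longrightarrow> C)" using pv_K assms by blast
  then show "pv (C \<^bold>\<and> A \<^bold>\<longrightarrow> C)" by (rule pv_mp[OF pv_import[OF assms(1,2,2)]])
  have "pv (C \<^bold>\<longrightarrow> A \<^bold>\<longrightarrow> A)" using pv_mp[OF pv_K pv_refl] assms by simp
  then show "pv (C \<^bold>\<and> A \<^bold>\<longrightarrow> A)" by (rule pv_mp[OF pv_import[OF assms(1,1,2)]])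
qed

lemma pv_deduct: "pv (C \<^bold>\<and> A \<^bold>\<longrightarrow> B) ==> pv (C \<^bold>\<longrightarrow> A \<^bold>\<longrightarrow> B)"
  by (rule pv_mp[OF pv_export]) (auto dest: pv_wf)

lemma pv_ent_mp: "pv (C \<^bold>\<longrightarrow> A \<^bold>\<longrightarrow> B) ==> pv (C \<^bold>\<longrightarrow> A) ==> pv (C \<^bold>\<longrightarrow> B)"
  by (rule pv_mp[OF pv_mp[OF pv_S[of C A B]]]) (auto dest: pv_wf)

lemma pv_classical: "pv (C \<^bold>\<and> \<^bold>\<not> A \<^bold>\<longrightarrow> \<^bold>\<bottom>) ==> pv (C \<^bold>\<longrightarrow> A)"
  by (rule pv_trans[OF pv_deduct pv_dne]) (auto dest: pv_wf)

text \<open>A simultaneous substitution is reduced to single ones in two rounds, since the terms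
  \<open>\<sigma> z\<close> may contain variables that still have to be replaced: the free variables
  become new odd names, the bound names are doubled, and only then are the new names
  replaced.\<close>

lemma pv_dsub:
  assumes "pv A" "wts \<sigma>" "!!z. odd_tm (\<sigma> z)"
  shows "pv (dsub \<sigma> A)"
proof -
  define N where "N = bound_fm A"
  have wf: "wf_fm A" using assms(1) by (rule pv_wf)
  obtain K where K: "!!z z'. z \<in> free_vars A ==> z' \<in> vars_tm (\<sigma> z) ==> fst z' < K" "N <= K"
  proof -
    have "finite (fst ` (\<Union>z\<in>free_vars A. vars_tm (\<sigma> z)) \<union> {N})"
      by (auto simp: finite_free_vars finite_vars_tm)
    then obtain K where "\<forall>k \<in> fst ` (\<Union>z\<in>free_vars A. vars_tm (\<sigma> z)) \<union> {N}. k < K"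
      using finite_nat_set_iff_bounded by metis
    then show ?thesis by (intro that[of K]) auto
  qed
  \<comment> \<open>The shift by \<open>K\<close> puts these names above all names of
    \<open>A\<close> and above those of the terms substituted for its free variables.\<close>
  define \<tau> :: "nat \<times> ty => tm" where "\<tau> = (%z. Var (2 * (fst z + K) + 1) (snd z))"
  have FN: "fst z < N" if "z \<in> free_vars A" for z using free_vars_bound that N_def by blast
  have 1: "pv (fsub id (%z. if z \<in> V then \<tau> z else idsub z) A)" if "finite V" "V \<subseteq> free_vars A" for V
    using that
  proof (induction V)
    case empty
    then show ?case using assms(1) fsub_id[of A] by (simp add: id_def)
  next
    case (insert v V)
    obtain x \<rho> where v: "v = (x, \<rho>)" by (cases v)
    let ?s = "%z. if z \<in> V then \<tau> z else idsub z"
    have big: "2 * (fst z + K) + 1 ~= x" for z using FN[of v] K(2) insert.prems v by auto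
    have "free_for (\<tau> v) x \<rho> (fsub id ?s A)"
    proof (rule free_for_fsub)
      fix y \<tau>' z assume "y < bound_fm A" "(id y, \<tau>') \<in> vars_tm (\<tau> v)"
      then show "z = (y, \<tau>')" using K(2) by (auto simp: \<tau>_def N_def)
    qed
    moreover have "tm_ty (\<tau> v) = Some \<rho>" by (simp add: \<tau>_def v)
    ultimately have "pv (subst_fm x \<rho> (\<tau> v) (fsub id ?s A))"
      using pv_inst insert by blast
    also have "subst_fm x \<rho> (\<tau> v) (fsub id ?s A) = fsub id (%z. subst_tm x \<rho> (\<tau> v) (?s z)) A"
    proof (rule subst_fsub)
      fix y z assume "id y = x" "(x, \<rho>) \<in> vars_tm (?s z)"
      then show "z = (y, \<rho>)" using big[of z] by (auto simp: \<tau>_def split: if_splits)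
    qed
    also have "\<dots> = fsub id (%z. if z \<in> insert v V then \<tau> z else idsub z) A"
    proof (rule fsub_cong)
      fix z
      show "subst_tm x \<rho> (\<tau> v) (?s z) = (if z \<in> insert v V then \<tau> z else idsub z)"
        using big[of z] insert(2) v by (cases "z = v"; cases z) (simp_all add: \<tau>_def)
    qed
    finally show ?case .
  qed
  have "pv (fsub id \<tau> A)"
    using 1[OF finite_free_vars subset_refl] by (rule back_subst[of pv]) (auto intro: fsub_cong)
  moreover have "pv (fsub id \<tau> A \<^bold>\<longrightarrow> dsub \<tau> A)"
  proof (rule pv_alpha)
    show "\<exists>y. \<tau> z = Var y (snd z) \<and> (\<forall>x<N. id x ~= y \<and> 2 * x ~= y)" for z
      using K(2) by (auto simp: \<tau>_def)
  qed (auto simp: inj_on_def wf N_def)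
  ultimately have 2: "pv (dsub \<tau> A)" using pv_mp by blast
  have 3: "pv (dsub (%z. if z \<in> V then \<sigma> z else \<tau> z) A)" if "finite V" "V \<subseteq> free_vars A" for V
    using that
  proof (induction V)
    case empty
    then show ?case using 2 by simp
  next
    case (insert v V)
    obtain x \<rho> where v: "v = (x, \<rho>)" by (cases v)
    let ?s = "%z. if z \<in> V then \<sigma> z else \<tau> z"
    let ?a = "2 * (x + K) + 1"
    have small: "(?a, \<rho>) \<notin> vars_tm (\<sigma> z)" if "z \<in> V" for z
      using K(1)[of z "(?a, \<rho>)"] that insert.prems by auto
    have "free_for (\<sigma> v) ?a \<rho> (dsub ?s A)"
    proof (rule free_for_fsub)
      fix y \<tau>' z assume "(2 * y, \<tau>') \<in> vars_tm (\<sigma> v)"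
      then show "z = (y, \<tau>')" using assms(3)[of v] by (auto simp: odd_tm_def)
    qed
    moreover have "tm_ty (\<sigma> v) = Some \<rho>" using assms(2) by (simp add: wts_def v)
    ultimately have "pv (subst_fm ?a \<rho> (\<sigma> v) (dsub ?s A))"
      using pv_inst insert by blast
    also have "subst_fm ?a \<rho> (\<sigma> v) (dsub ?s A) = dsub (%z. subst_tm ?a \<rho> (\<sigma> v) (?s z)) A"
    proof (rule subst_fsub)
      fix y z assume "2 * y = ?a"
      then have False by presburger
      then show "z = (y, \<rho>)" by blast
    qed
    also have "\<dots> = dsub (%z. if z \<in> insert v V then \<sigma> z else \<tau> z) A"
      using small insert(2) v by (intro fsub_cong) (auto simp: \<tau>_def subst_tm_fresh)
    finally show ?case .
  qed
  show ?thesis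
    using 3[OF finite_free_vars subset_refl] by (rule back_subst[of pv]) (auto intro: fsub_cong)
qed

text \<open>One step of Henkin's construction. The theory is kept as a single formula
  \<open>C\<close>, so that a fresh odd name can be written down and theorems with empty context
  suffice. A universal formula that \<open>C\<close> refutes receives a variable as
  counterexample.\<close>

definition step :: "fm => fm => fm" where
  "step C \<phi> = (if \<not> wf_fm \<phi> then C else if \<not> pv (C \<^bold>\<and> \<phi> \<^bold>\<longrightarrow> \<^bold>\<bottom>) then C \<^bold>\<and> \<phi> else
    case \<phi> of Forall x \<rho> B =>
      C \<^bold>\<and> \<^bold>\<not> subst_fm x \<rho> (Var (2 * (bound_fm C + bound_fm B + x) + 1) \<rho>) B | _ => C)"

lemma step_consistent:
  assumes "wf_fm C" "\<not> pv (C \<^bold>\<longrightarrow> \<^bold>\<bottom>)"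
  shows "wf_fm (step C \<phi>)" "\<not> pv (step C \<phi> \<^bold>\<longrightarrow> \<^bold>\<bottom>)" "pv (step C \<phi> \<^bold>\<longrightarrow> C)"
proof -
  have "wf_fm (step C \<phi>) \<and> \<not> pv (step C \<phi> \<^bold>\<longrightarrow> \<^bold>\<bottom>) \<and> pv (step C \<phi> \<^bold>\<longrightarrow> C)"
  proof (cases "wf_fm \<phi> \<and> pv (C \<^bold>\<and> \<phi> \<^bold>\<longrightarrow> \<^bold>\<bottom>)")
    case False
    then show ?thesis using assms pv_conjD[of \<phi> C] pv_refl[of C] by (auto simp: step_def)
  next
    case True
    then have neg: "pv (C \<^bold>\<longrightarrow> \<^bold>\<not> \<phi>)" using pv_deduct by blast
    show ?thesis
    proof (cases \<phi>)
      case (Forall x \<rho> B)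
      let ?y = "2 * (bound_fm C + bound_fm B + x) + 1"
      let ?By = "subst_fm x \<rho> (Var ?y \<rho>) B"
      have wf: "wf_fm B" "wf_fm ?By" using True Forall by (auto simp: wf_subst)
      have y: "bound_fm B <= ?y" "x ~= ?y" "(?y, \<rho>) \<notin> free_vars C" using free_vars_bound[of "(?y, \<rho>)" C] by auto
      have "\<not> pv (C \<^bold>\<and> \<^bold>\<not> ?By \<^bold>\<longrightarrow> \<^bold>\<bottom>)"
      proof
        assume "pv (C \<^bold>\<and> \<^bold>\<not> ?By \<^bold>\<longrightarrow> \<^bold>\<bottom>)"
        \<comment> \<open>If the counterexample could not be added, \<open>C\<close> would prove the
          instance with the fresh variable, and thus the universal formula that it refutes.\<close>
        then have 1: "pv (C \<^bold>\<longrightarrow> Forall ?y \<rho> ?By)" using pv_classical pv_allI y(3) by blast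
        have "pv (Forall ?y \<rho> ?By \<^bold>\<longrightarrow> B)"
          using pv_allE[OF wf(2), of "Var x \<rho>" \<rho> ?y] subst_fresh_inverse[OF y(1)] by simp
        moreover have "(x, \<rho>) \<notin> free_vars (Forall ?y \<rho> ?By)"
          using subst_fresh_inverse(4)[OF y(1), of x \<rho>] y(2) by simp
        ultimately have "pv (Forall ?y \<rho> ?By \<^bold>\<longrightarrow> \<phi>)" unfolding Forall using pv_allI by blast
        from pv_ent_mp[OF neg pv_trans[OF 1 this]] show False using assms(2) by blast
      qed
      then show ?thesis using True Forall assms wf pv_conjD[of "\<^bold>\<not> ?By" C] by (simp add: step_def)
    qed (use True assms pv_refl[of C] in \<open>simp_all add: step_def\<close>)
  qed
  then show "wf_fm (step C \<phi>)" "\<not> pv (step C \<phi> \<^bold>\<longrightarrow> \<^bold>\<bottom>)" "pv (step C \<phi> \<^bold>\<longrightarrow> C)" by auto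
qed

lemma step_decides:
  assumes "wf_fm C" "\<not> pv (C \<^bold>\<longrightarrow> \<^bold>\<bottom>)" "wf_fm \<phi>"
  shows "pv (step C \<phi> \<^bold>\<longrightarrow> \<phi>) \<or> pv (step C \<phi> \<^bold>\<longrightarrow> \<^bold>\<not> \<phi>)"
proof (cases "pv (C \<^bold>\<and> \<phi> \<^bold>\<longrightarrow> \<^bold>\<bottom>)")
  case True
  then show ?thesis using pv_trans[OF step_consistent(3) pv_deduct] assms by blast
next
  case False
  then show ?thesis using assms pv_conjD[of \<phi> C] by (simp add: step_def)
qed

lemma step_witness:
  assumes "wf_fm C" "\<not> pv (C \<^bold>\<longrightarrow> \<^bold>\<bottom>)" "wf_fm B"
  shows "pv (step C (Forall x \<rho> B) \<^bold>\<longrightarrow> Forall x \<rho> B) \<or>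
    (\<exists>y. odd y \<and> bound_fm B <= y \<and> pv (step C (Forall x \<rho> B) \<^bold>\<longrightarrow> \<^bold>\<not> subst_fm x \<rho> (Var y \<rho>) B))"
proof (cases "pv (C \<^bold>\<and> Forall x \<rho> B \<^bold>\<longrightarrow> \<^bold>\<bottom>)")
  case True
  let ?y = "2 * (bound_fm C + bound_fm B + x) + 1"
  have "pv (step C (Forall x \<rho> B) \<^bold>\<longrightarrow> \<^bold>\<not> subst_fm x \<rho> (Var ?y \<rho>) B)"
    using True assms pv_conjD(2)[of "\<^bold>\<not> subst_fm x \<rho> (Var ?y \<rho>) B" C] by (simp add: step_def wf_subst)
  moreover have "odd ?y" "bound_fm B <= ?y" by auto
  ultimately show ?thesis by blast
next
  case False
  then show ?thesis using assms pv_conjD[of "Forall x \<rho> B" C] by (simp add: step_def)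
qed

end

instance ty :: countable by countable_datatype
instance const :: countable by countable_datatype
instance tm :: countable by countable_datatype
instance fm :: countable by countable_datatype

text \<open>Instances at odd variables are enough for \<open>del_wit\<close>, because such variables
  belong to the domain of the term model, whose terms have odd names.\<close>

locale henkin_set = calculus +
  fixes \<Delta> :: "fm set"
  assumes del_wf: "A \<in> \<Delta> ==> wf_fm A"
    and del_thm: "pv A ==> A \<in> \<Delta>"
    and del_mp: "(A \<^bold>\<longrightarrow> B) \<in> \<Delta> ==> A \<in> \<Delta> ==> B \<in> \<Delta>"
    and del_cons: "\<^bold>\<bottom> \<notin> \<Delta>"
    and del_compl: "wf_fm A ==> A \<in> \<Delta> \<or> (\<^bold>\<not> A) \<in> \<Delta>"
    and del_wit: "wf_fm A ==> (!!y. odd y ==> bound_fm A <= y ==> subst_fm x \<rho> (Var y \<rho>) A \<in> \<Delta>) ==>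
      Forall x \<rho> A \<in> \<Delta>"

lemma (in calculus) henkin_set_exists:
  assumes "wf_fm G" "\<not> pv G"
  shows "\<exists>\<Delta>. henkin_set T \<Delta> \<and> (\<^bold>\<not> G) \<in> \<Delta>"
proof -
  \<comment> \<open>Stage \<open>n\<close> treats the formula with number \<open>n\<close> in an
    enumeration of the countable type \<open>fm\<close>.\<close>
  define Cs where "Cs = rec_nat (\<^bold>\<not> G) (%n C. step C (from_nat n))"
  define \<Delta> where "\<Delta> = {A. \<exists>n. pv (Cs n \<^bold>\<longrightarrow> A)}"
  have Cs: "Cs 0 = (\<^bold>\<not> G)" "!!n. Cs (Suc n) = step (Cs n) (from_nat n)"
    by (auto simp: Cs_def)
  have "\<not> pv (\<^bold>\<not> \<^bold>\<not> G)" using pv_mp[OF pv_dne] assms by blast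
  then have ok: "wf_fm (Cs n) \<and> \<not> pv (Cs n \<^bold>\<longrightarrow> \<^bold>\<bottom>)" for n
    by (induction n) (auto simp: Cs assms step_consistent)
  have mono: "pv (Cs (n + k) \<^bold>\<longrightarrow> Cs n)" for n k
  proof (induction k)
    case (Suc k)
    have "pv (Cs (Suc (n + k)) \<^bold>\<longrightarrow> Cs (n + k))"
      using step_consistent(3) ok by (simp add: Cs)
    then show ?case using pv_trans Suc by simp
  qed (use ok pv_refl in simp)
  have up: "pv (Cs n \<^bold>\<longrightarrow> A) ==> n <= m ==> pv (Cs m \<^bold>\<longrightarrow> A)" for n m A
    using pv_trans[OF mono] by (metis le_add_diff_inverse)
  have no: "\<not> (A \<in> \<Delta> \<and> (\<^bold>\<not> A) \<in> \<Delta>)" for A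
  proof
    assume "A \<in> \<Delta> \<and> (\<^bold>\<not> A) \<in> \<Delta>"
    then obtain n m where "pv (Cs n \<^bold>\<longrightarrow> A)" "pv (Cs m \<^bold>\<longrightarrow> \<^bold>\<not> A)" by (auto simp: \<Delta>_def)
    then have "pv (Cs (max n m) \<^bold>\<longrightarrow> A)" "pv (Cs (max n m) \<^bold>\<longrightarrow> \<^bold>\<not> A)"
      by (auto elim: up)
    then show False using pv_ent_mp ok by blast
  qed
  have "henkin_set T \<Delta>"
  proof
    show "A \<in> \<Delta> ==> wf_fm A" for A using pv_wf by (fastforce simp: \<Delta>_def)
    show "pv A ==> A \<in> \<Delta>" for A using pv_mp[OF pv_K] ok pv_wf by (auto simp: \<Delta>_def)
    show "B \<in> \<Delta>" if AB: "(A \<^bold>\<longrightarrow> B) \<in> \<Delta>" "A \<in> \<Delta>" for A B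
    proof -
      obtain n m where "pv (Cs n \<^bold>\<longrightarrow> A)" "pv (Cs m \<^bold>\<longrightarrow> A \<^bold>\<longrightarrow> B)" using AB by (auto simp: \<Delta>_def)
      then have "pv (Cs (max n m) \<^bold>\<longrightarrow> A)" "pv (Cs (max n m) \<^bold>\<longrightarrow> A \<^bold>\<longrightarrow> B)"
        by (auto elim: up)
      then show ?thesis using pv_ent_mp by (auto simp: \<Delta>_def)
    qed
    show "\<^bold>\<bottom> \<notin> \<Delta>" using ok by (auto simp: \<Delta>_def)
    show "A \<in> \<Delta> \<or> (\<^bold>\<not> A) \<in> \<Delta>" if "wf_fm A" for A
      using step_decides[OF _ _ that, of "Cs (to_nat A)"] ok[of "to_nat A"] Cs(2)[of "to_nat A"]
      by (auto simp: \<Delta>_def) metis+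
    show "Forall x \<rho> A \<in> \<Delta>"
      if A: "wf_fm A" "!!y. odd y ==> bound_fm A <= y ==> subst_fm x \<rho> (Var y \<rho>) A \<in> \<Delta>" for x \<rho> A
    proof -
      let ?n = "to_nat (Forall x \<rho> A)"
      have "Cs (Suc ?n) = step (Cs ?n) (Forall x \<rho> A)" by (simp add: Cs)
      then consider "pv (Cs (Suc ?n) \<^bold>\<longrightarrow> Forall x \<rho> A)"
        | y where "odd y" "bound_fm A <= y" "pv (Cs (Suc ?n) \<^bold>\<longrightarrow> \<^bold>\<not> subst_fm x \<rho> (Var y \<rho>) A)"
        using step_witness[OF _ _ A(1), of "Cs ?n" x \<rho>] ok[of ?n] by auto
      then show ?thesis
      proof cases
        case 1
        then show ?thesis unfolding \<Delta>_def by blast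
      next
        case 2
        then have "(\<^bold>\<not> subst_fm x \<rho> (Var y \<rho>) A) \<in> \<Delta>" unfolding \<Delta>_def by blast
        then show ?thesis using no A(2)[OF 2(1,2)] by blast
      qed
    qed
  qed
  moreover have "(\<^bold>\<not> G) \<in> \<Delta>" using Cs(1) pv_refl[of "\<^bold>\<not> G"] assms(1) unfolding \<Delta>_def
    by (metis mem_Collect_eq wf_fm.simps(3,4))
  ultimately show ?thesis by blast
qed

section \<open>Structures\<close>

text \<open>Equality of numbers is an arbitrary relation at first: membership of the equation in the
  Henkin set for the term model, identity after the quotient.\<close>

locale prestructure =
  fixes D :: "ty => 'd set" and ap :: "'d => 'd => 'd" and cv :: "const => 'd"
    and eqr ltr :: "'d => 'd => bool"
  assumes cv_in: "cv c \<in> D (const_ty c)"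
    and ap_in: "f \<in> D (\<sigma> \<Rrightarrow> \<tau>) ==> x \<in> D \<sigma> ==> ap f x \<in> D \<tau>"
    and D_nonempty: "D \<rho> ~= {}"
begin

primrec ev :: "(nat \<times> ty => 'd) => tm => 'd" where
  "ev v (Var x \<rho>) = v (x, \<rho>)"
| "ev v (Const c) = cv c"
| "ev v (s \<cdot> t) = ap (ev v s) (ev v t)"

primrec holds :: "(nat \<times> ty => 'd) => fm => bool" where
  "holds v (s \<^bold>= t) \<longleftrightarrow> eqr (ev v s) (ev v t)"
| "holds v (s \<^bold>< t) \<longleftrightarrow> ltr (ev v s) (ev v t)"
| "holds v \<^bold>\<bottom> \<longleftrightarrow> False"
| "holds v (A \<^bold>\<longrightarrow> B) \<longleftrightarrow> (holds v A --> holds v B)"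
| "holds v (Forall x \<rho> A) \<longleftrightarrow> (\<forall>d\<in>D \<rho>. holds (v((x, \<rho>) := d)) A)"

definition val :: "(nat \<times> ty => 'd) => bool" where
  "val v \<longleftrightarrow> (\<forall>z. v z \<in> D (snd z))"

lemma val_upd [simp]: "val v ==> d \<in> D \<rho> ==> val (v((x, \<rho>) := d))"
  by (auto simp: val_def)

lemma val_in: "val v ==> v (x, \<rho>) \<in> D \<rho>"
  by (auto simp: val_def)

lemma val_exists: "\<exists>v. val v"
  unfolding val_def using D_nonempty
  by (intro exI[of _ "%z. SOME d. d \<in> D (snd z)"]) (auto simp: some_in_eq)

lemma ev_in: "val v ==> tm_ty t = Some \<rho> ==> ev v t \<in> D \<rho>"
  by (induction t arbitrary: \<rho>)
    (auto simp: val_in cv_in split: option.splits ty.splits if_splits intro: ap_in)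

lemma ev_cong: "(!!z. z \<in> vars_tm t ==> v z = w z) ==> ev v t = ev w t"
  by (induction t) auto

lemma ev_upd [simp]: "bound_tm t <= x ==> ev (v((x, \<rho>) := d)) t = ev v t"
  by (rule ev_cong) (auto dest: vars_tm_bound)

text \<open>The hypothesis covers every name above those of the body, so the name that
  \<open>all_fresh\<close> actually chooses never has to be computed.\<close>

lemma all_fresh_iff:
  assumes "!!x d. bound_fm (F (Var 0 \<rho>)) <= x ==> d \<in> D \<rho> ==>
    holds (v((x, \<rho>) := d)) (F (Var x \<rho>)) \<longleftrightarrow> P d"
  shows "holds v (all_fresh \<rho> F) \<longleftrightarrow> (\<forall>d\<in>D \<rho>. P d)"
  using assms by (simp add: all_fresh_def Let_def)

primrec EQ :: "ty => 'd => 'd => bool" where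
  "EQ Nt a b \<longleftrightarrow> eqr a b"
| "EQ (\<sigma> \<Rrightarrow> \<tau>) a b \<longleftrightarrow> (\<forall>x\<in>D \<sigma>. EQ \<tau> (ap a x) (ap b x))"

end

lemma bound_all_fresh: "bound_fm (all_fresh \<rho> F) <= x ==> bound_fm (F (Var 0 \<rho>)) <= x"
  by (simp add: all_fresh_def Let_def)

lemma bound_eq_at: "bound_fm (eq_at \<rho> s t) <= x ==> bound_tm s <= x \<and> bound_tm t <= x"
  by (induction \<rho> arbitrary: s t) (force dest: bound_all_fresh)+

lemma wf_all_fresh: "(!!x. wf_fm (F (Var x \<rho>))) ==> wf_fm (all_fresh \<rho> F)"
  by (simp add: all_fresh_def Let_def)

lemma wf_eq_at: "tm_ty s = Some \<rho> ==> tm_ty t = Some \<rho> ==> wf_fm (eq_at \<rho> s t)"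
  by (induction \<rho> arbitrary: s t) (auto intro!: wf_all_fresh)

lemma (in prestructure) holds_eq_at: "holds v (eq_at \<rho> s t) \<longleftrightarrow> EQ \<rho> (ev v s) (ev v t)"
proof (induction \<rho> arbitrary: s t v)
  case (Fn \<sigma> \<tau>)
  show ?case unfolding eq_at.simps EQ.simps
  proof (rule all_fresh_iff)
    fix x d assume "bound_fm (eq_at \<tau> (s \<cdot> Var 0 \<sigma>) (t \<cdot> Var 0 \<sigma>)) <= x"
    then have "bound_tm s <= x" "bound_tm t <= x" by (auto dest!: bound_eq_at)
    moreover have "holds (v((x, \<sigma>) := d)) (eq_at \<tau> (s \<cdot> Var x \<sigma>) (t \<cdot> Var x \<sigma>)) \<longleftrightarrow>
        EQ \<tau> (ev (v((x, \<sigma>) := d)) (s \<cdot> Var x \<sigma>)) (ev (v((x, \<sigma>) := d)) (t \<cdot> Var x \<sigma>))"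
      by (rule Fn)
    ultimately show "holds (v((x, \<sigma>) := d)) (eq_at \<tau> (s \<cdot> Var x \<sigma>) (t \<cdot> Var x \<sigma>)) \<longleftrightarrow>
        EQ \<tau> (ap (ev v s) d) (ap (ev v t) d)" by simp
  qed
qed simp

section \<open>The term model and its extensional quotient\<close>

text \<open>Undoes a \<open>dsub\<close> that merely renames variables. An unprovable formula thus
  stays unprovable after its free names are made odd and its bound names even, which is the form the
  Henkin construction needs.\<close>

lemma (in calculus) pv_undsub:
  assumes "pv (dsub \<tau> A)" "wf_fm A" "bound_fm A <= K"
    and \<tau>: "\<tau> = (%z. Var (2 * (fst z + K) + 1) (snd z))"
  shows "pv A"
proof -
  have "pv (dsub \<tau> A \<^bold>\<longrightarrow> fsub id \<tau> A)"
  proof (rule pv_alpha[where N = "bound_fm A"])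
    show "\<exists>y. \<tau> z = Var y (snd z) \<and> (\<forall>x<bound_fm A. 2 * x ~= y \<and> id x ~= y)" for z
      using assms(3) by (auto simp: \<tau>)
  qed (auto simp: inj_on_def assms)
  then have 1: "pv (fsub id \<tau> A)" using assms(1) pv_mp by blast
  have "pv (fsub id (%z. if z \<in> V then idsub z else \<tau> z) A)" if "finite V" "V \<subseteq> free_vars A" for V
    using that
  proof (induction V)
    case empty
    then show ?case using 1 by (simp add: id_def)
  next
    case (insert v V)
    obtain x \<rho> where v: "v = (x, \<rho>)" by (cases v)
    let ?s = "%z. if z \<in> V then idsub z else \<tau> z"
    let ?a = "2 * (x + K) + 1"
    have small: "fst z ~= ?a" if "z \<in> free_vars A" for z
      using free_vars_bound[OF that] assms(3) by simp
    have eq: "z = v" if "z \<in> free_vars A" "(?a, \<rho>) \<in> vars_tm (?s z)" for z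
      using that small[OF that(1)] v by (cases z) (auto simp: \<tau> split: if_splits)
    have ff: "free_for (Var x \<rho>) ?a \<rho> (fsub id ?s A)"
    proof (rule free_for_fsub)
      fix y \<tau>' z assume "(id y, \<tau>') \<in> vars_tm (Var x \<rho>)" "z \<in> free_vars A" "(?a, \<rho>) \<in> vars_tm (?s z)"
      then show "z = (y, \<tau>')" using eq v by auto
    qed
    have "pv (fsub id ?s A)" using insert by blast
    from pv_inst[OF this tm_ty.simps(1) ff]
    have "pv (subst_fm ?a \<rho> (Var x \<rho>) (fsub id ?s A))" .
    also have "subst_fm ?a \<rho> (Var x \<rho>) (fsub id ?s A) = fsub id (%z. subst_tm ?a \<rho> (Var x \<rho>) (?s z)) A"
      by (rule subst_fsub) (use assms(3) in auto)
    also have "\<dots> = fsub id (%z. if z \<in> insert v V then idsub z else \<tau> z) A"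
    proof (rule fsub_cong)
      fix z assume "z \<in> free_vars A"
      from small[OF this]
      show "subst_tm ?a \<rho> (Var x \<rho>) (?s z) = (if z \<in> insert v V then idsub z else \<tau> z)"
        using insert(2) v by (cases "z = v"; cases z) (auto simp: \<tau>)
    qed
    finally show ?case .
  qed
  from this[OF finite_free_vars subset_refl] have "pv (fsub id idsub A)"
    by (rule back_subst[of pv]) (auto intro: fsub_cong)
  then show ?thesis using fsub_id[of A] by (simp add: id_def)
qed

lemma (in calculus) pv_absurd: "wf_fm A ==> wf_fm B ==> pv (\<^bold>\<not> A \<^bold>\<longrightarrow> A \<^bold>\<longrightarrow> B)"
proof -
  assume wf: "wf_fm A" "wf_fm B"
  let ?G = "insert (\<^bold>\<not> B) {A, \<^bold>\<not> A}"
  have "derivable T ?G (\<^bold>\<not> A)" "derivable T ?G A" using wf by (auto intro!: Assumption)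
  then have "derivable T ?G \<^bold>\<bottom>" by (rule ImpE)
  then have "derivable T {A, \<^bold>\<not> A} B" by (rule Classical[OF wf(2)])
  then show ?thesis unfolding pv_def using wf by (intro ImpI) auto
qed

context henkin_set begin

definition D0 :: "ty => tm set" where "D0 \<rho> = {t. tm_ty t = Some \<rho> \<and> odd_tm t}"

definition eqD :: "tm => tm => bool" where "eqD s t \<longleftrightarrow> (s \<^bold>= t) \<in> \<Delta>"
definition ltD :: "tm => tm => bool" where "ltD s t \<longleftrightarrow> (s \<^bold>< t) \<in> \<Delta>"

sublocale tmod: prestructure D0 App Const eqD ltD
proof
  show "D0 \<rho> ~= {}" for \<rho>
  proof -
    have "Var 1 \<rho> \<in> D0 \<rho>" by (simp add: D0_def odd_tm_def)
    then show ?thesis by blast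
  qed
qed (auto simp: D0_def odd_tm_def)

lemma tmod_ev: "tmod.ev \<sigma> t = tsub \<sigma> t"
  by (induction t) auto

lemma tmod_val: "tmod.val \<sigma> \<longleftrightarrow> wts \<sigma> \<and> (\<forall>z. odd_tm (\<sigma> z))"
  by (auto simp: tmod.val_def wts_def D0_def)

lemma imp_in: "wf_fm A ==> wf_fm B ==> (A \<^bold>\<longrightarrow> B) \<in> \<Delta> \<longleftrightarrow> (A \<in> \<Delta> --> B \<in> \<Delta>)"
  using del_mp[OF del_thm[OF pv_absurd[of A B]]] del_mp[OF del_thm[OF pv_K[of B A]]] del_mp del_compl[of A]
  by blast

lemma subst_dsub:
  assumes "!!z. odd_tm (\<sigma> z)"
  shows "subst_fm (2 * x) \<rho> u (dsub (\<sigma>((x, \<rho>) := Var (2 * x) \<rho>)) A) = dsub (\<sigma>((x, \<rho>) := u)) A"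
proof -
  have odd: "(2 * x, \<rho>) \<notin> vars_tm (\<sigma> z)" for z using assms[of z] by (auto simp: odd_tm_def)
  let ?s = "\<sigma>((x, \<rho>) := Var (2 * x) \<rho>)"
  have "subst_fm (2 * x) \<rho> u (dsub ?s A) = dsub (%z. subst_tm (2 * x) \<rho> u (?s z)) A"
  proof (rule subst_fsub)
    fix y z assume "2 * y = 2 * x" "(2 * x, \<rho>) \<in> vars_tm (?s z)"
    then show "z = (y, \<rho>)" using odd[of z] by (cases "z = (x, \<rho>)") auto
  qed
  also have "\<dots> = dsub (\<sigma>((x, \<rho>) := u)) A"
    by (rule fsub_cong) (auto simp: subst_tm_fresh[OF odd])
  finally show ?thesis .
qed

text \<open>In the universal case, a term with odd names can be instantiated because the bound name
  is even; the other direction is \<open>del_wit\<close>.\<close>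

lemma truth: "wf_fm A ==> tmod.val \<sigma> ==> dsub \<sigma> A \<in> \<Delta> \<longleftrightarrow> tmod.holds \<sigma> A"
proof (induction A arbitrary: \<sigma>)
  case (Imp A B)
  then show ?case using imp_in wf_fsub by (simp add: tmod_val)
next
  case (Forall x \<rho> A)
  have odd: "!!z. odd_tm (\<sigma> z)" and wts: "wts \<sigma>" using Forall.prems(2) by (auto simp: tmod_val)
  let ?B = "dsub (\<sigma>((x, \<rho>) := Var (2 * x) \<rho>)) A"
  have wfB: "wf_fm ?B" using Forall.prems(1) wts by (auto intro!: wf_fsub wts_upd)
  have IH: "dsub (\<sigma>((x, \<rho>) := u)) A \<in> \<Delta> \<longleftrightarrow> tmod.holds (\<sigma>((x, \<rho>) := u)) A" if "u \<in> D0 \<rho>" for u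
    using that Forall by simp
  show ?case
  proof
    assume L: "dsub \<sigma> (Forall x \<rho> A) \<in> \<Delta>"
    have "tmod.holds (\<sigma>((x, \<rho>) := u)) A" if u: "u \<in> D0 \<rho>" for u
    proof -
      have "free_for u (2 * x) \<rho> ?B"
        by (rule free_for_fsub) (use u in \<open>auto simp: D0_def odd_tm_def\<close>)
      then have "pv (Forall (2 * x) \<rho> ?B \<^bold>\<longrightarrow> subst_fm (2 * x) \<rho> u ?B)"
        using pv_allE[OF wfB] u by (simp add: D0_def)
      then have "subst_fm (2 * x) \<rho> u ?B \<in> \<Delta>" using L del_mp del_thm by auto
      then show ?thesis using IH[OF u] subst_dsub[OF odd] by simp
    qed
    then show "tmod.holds \<sigma> (Forall x \<rho> A)" by simp
  next
    assume R: "tmod.holds \<sigma> (Forall x \<rho> A)"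
    have "Forall (2 * x) \<rho> ?B \<in> \<Delta>"
    proof (rule del_wit[OF wfB])
      fix y :: nat assume "odd y"
      then have "Var y \<rho> \<in> D0 \<rho>" by (simp add: D0_def odd_tm_def)
      then show "subst_fm (2 * x) \<rho> (Var y \<rho>) ?B \<in> \<Delta>"
        using R IH subst_dsub[OF odd] by simp
    qed
    then show "dsub \<sigma> (Forall x \<rho> A) \<in> \<Delta>" by simp
  qed
qed (simp_all add: tmod_ev eqD_def ltD_def del_cons)

lemma axioms_hold: "B \<in> T ==> wf_fm B ==> tmod.val \<sigma> ==> tmod.holds \<sigma> B"
  using truth[of B \<sigma>] del_thm[OF pv_dsub[OF pv_axiom]] tmod_val by blast

end

text \<open>What the quotient by extensional equality requires of the term model.
  \<open>D_disjoint\<close> allows a representative to be chosen without naming a type.\<close>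

locale pre_ext = prestructure +
  assumes eq_refl: "a \<in> D Nt ==> eqr a a"
    and eq_euclid: "a \<in> D Nt ==> b \<in> D Nt ==> c \<in> D Nt ==> eqr a b ==> eqr a c ==> eqr b c"
    and lt_cong: "a \<in> D Nt ==> b \<in> D Nt ==> c \<in> D Nt ==> d \<in> D Nt ==>
      eqr a b ==> eqr c d ==> ltr a c ==> ltr b d"
    and EQ_ap: "x \<in> D \<rho> ==> y \<in> D \<rho> ==> f \<in> D (\<rho> \<Rrightarrow> \<tau>) ==> EQ \<rho> x y ==> EQ \<tau> (ap f x) (ap f y)"
    and D_disjoint: "a \<in> D \<rho> ==> a \<in> D \<sigma> ==> \<rho> = \<sigma>"
begin

lemma EQ_refl: "a \<in> D \<rho> ==> EQ \<rho> a a"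
  by (induction \<rho> arbitrary: a) (auto intro: eq_refl ap_in)

lemma EQ_sym: "a \<in> D \<rho> ==> b \<in> D \<rho> ==> EQ \<rho> a b ==> EQ \<rho> b a"
proof (induction \<rho> arbitrary: a b)
  case Nt
  then show ?case using eq_euclid[of a b a] eq_refl[of a] by simp
next
  case (Fn \<sigma> \<tau>)
  then show ?case using ap_in by simp
qed

lemma EQ_trans: "a \<in> D \<rho> ==> b \<in> D \<rho> ==> c \<in> D \<rho> ==> EQ \<rho> a b ==> EQ \<rho> b c ==> EQ \<rho> a c"
proof (induction \<rho> arbitrary: a b c)
  case Nt
  then have "eqr a b" "eqr b c" by simp_all
  then have "eqr b a" using EQ_sym[of a Nt b] Nt.prems(1,2) by simp
  then show ?case using eq_euclid[OF Nt.prems(2,1,3)] \<open>eqr b c\<close> by simp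
next
  case (Fn \<sigma> \<tau>)
  show ?case unfolding EQ.simps
  proof
    fix x assume "x \<in> D \<sigma>"
    moreover from this have "ap a x \<in> D \<tau>" "ap b x \<in> D \<tau>" "ap c x \<in> D \<tau>"
      using ap_in Fn.prems by blast+
    ultimately show "EQ \<tau> (ap a x) (ap c x)" using Fn.prems(4,5)
      by (intro Fn.IH(2)[of "ap a x" "ap b x" "ap c x"]) simp_all
  qed
qed

definition rp :: "'a => 'a" where
  "rp a = (SOME b. \<exists>\<rho>. a \<in> D \<rho> \<and> b \<in> D \<rho> \<and> EQ \<rho> a b)"

lemma rp: assumes "a \<in> D \<rho>" shows "rp a \<in> D \<rho>" "EQ \<rho> a (rp a)"
proof -
  have "\<exists>\<rho>'. a \<in> D \<rho>' \<and> rp a \<in> D \<rho>' \<and> EQ \<rho>' a (rp a)"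
    unfolding rp_def by (rule someI_ex) (use assms EQ_refl in blast)
  then show "rp a \<in> D \<rho>" "EQ \<rho> a (rp a)" using assms D_disjoint by blast+
qed

lemma rp_eq_iff: assumes "a \<in> D \<rho>" "b \<in> D \<rho>" shows "rp a = rp b \<longleftrightarrow> EQ \<rho> a b"
proof
  assume "rp a = rp b"
  then show "EQ \<rho> a b" using rp[OF assms(1)] rp[OF assms(2)] assms EQ_sym EQ_trans by metis
next
  assume ab: "EQ \<rho> a b"
  have "(\<exists>\<rho>. a \<in> D \<rho> \<and> c \<in> D \<rho> \<and> EQ \<rho> a c) \<longleftrightarrow> (\<exists>\<rho>. b \<in> D \<rho> \<and> c \<in> D \<rho> \<and> EQ \<rho> b c)" for c
    using ab assms EQ_sym EQ_trans D_disjoint by metis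
  then show "rp a = rp b" by (simp add: rp_def)
qed

lemma rp_rp: "a \<in> D \<rho> ==> rp (rp a) = rp a"
  using rp rp_eq_iff EQ_sym by metis

definition Dq :: "ty => 'a set" where "Dq \<rho> = rp ` D \<rho>"

lemma Dq_sub: "a \<in> Dq \<rho> ==> a \<in> D \<rho>"
  using rp by (auto simp: Dq_def)

lemma Dq_rp: "a \<in> Dq \<rho> ==> rp a = a"
  using rp_rp by (auto simp: Dq_def)

text \<open>The quotient consists of chosen representatives instead of classes, so its elements
  remain in the original type.\<close>

sublocale Q: prestructure Dq "%f x. rp (ap f x)" "%c. rp (cv c)" "(=)" ltr
proof
  show "rp (cv c) \<in> Dq (const_ty c)" for c using cv_in by (simp add: Dq_def)
  show "rp (ap f x) \<in> Dq \<tau>" if "f \<in> Dq (\<sigma> \<Rrightarrow> \<tau>)" "x \<in> Dq \<sigma>" for f \<sigma> \<tau> x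
  proof -
    have "ap f x \<in> D \<tau>" using that ap_in Dq_sub by blast
    then show ?thesis by (simp add: Dq_def)
  qed
  show "Dq \<rho> ~= {}" for \<rho> using D_nonempty by (simp add: Dq_def)
qed

lemma EQ_ap2:
  assumes "f \<in> D (\<sigma> \<Rrightarrow> \<tau>)" "g \<in> D (\<sigma> \<Rrightarrow> \<tau>)" "x \<in> D \<sigma>" "y \<in> D \<sigma>" "EQ (\<sigma> \<Rrightarrow> \<tau>) f g" "EQ \<sigma> x y"
  shows "EQ \<tau> (ap f x) (ap g y)"
proof (rule EQ_trans[of _ _ "ap f y"])
  show "EQ \<tau> (ap f x) (ap f y)" using assms by (intro EQ_ap)
qed (use assms ap_in in auto)

lemma Q_ev: "val v ==> tm_ty t = Some \<rho> ==> Q.ev (%z. rp (v z)) t = rp (ev v t)"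
proof (induction t arbitrary: \<rho>)
  case (App s t)
  then obtain \<sigma> where ty: "tm_ty s = Some (\<sigma> \<Rrightarrow> \<rho>)" "tm_ty t = Some \<sigma>"
    by (auto split: option.splits ty.splits if_splits)
  have in_: "ev v s \<in> D (\<sigma> \<Rrightarrow> \<rho>)" "ev v t \<in> D \<sigma>" using ev_in App.prems(1) ty by auto
  have "EQ \<rho> (ap (ev v s) (ev v t)) (ap (rp (ev v s)) (rp (ev v t)))"
    using EQ_ap2[OF in_(1) rp(1)[OF in_(1)] in_(2) rp(1)[OF in_(2)] rp(2)[OF in_(1)] rp(2)[OF in_(2)]] .
  moreover have "ap (ev v s) (ev v t) \<in> D \<rho>" "ap (rp (ev v s)) (rp (ev v t)) \<in> D \<rho>"
    using in_ rp ap_in by blast+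
  ultimately have "rp (ap (rp (ev v s)) (rp (ev v t))) = rp (ap (ev v s) (ev v t))"
    using rp_eq_iff by metis
  then show ?case using App.IH(1)[OF App.prems(1) ty(1)] App.IH(2)[OF App.prems(1) ty(2)] by simp
qed auto

lemma Q_holds: "val v ==> wf_fm A ==> Q.holds (%z. rp (v z)) A \<longleftrightarrow> holds v A"
proof (induction A arbitrary: v)
  case (Eq s t)
  then have in_: "ev v s \<in> D Nt" "ev v t \<in> D Nt" using ev_in by auto
  show ?case using Eq rp_eq_iff[OF in_] Q_ev[OF Eq.prems(1), of s] Q_ev[OF Eq.prems(1), of t] by simp
next
  case (Less s t)
  then have in_: "ev v s \<in> D Nt" "ev v t \<in> D Nt" using ev_in by auto
  have "ltr (rp (ev v s)) (rp (ev v t)) \<longleftrightarrow> ltr (ev v s) (ev v t)"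
    using rp[OF in_(1)] rp[OF in_(2)] in_ lt_cong EQ_sym[OF in_(1)] EQ_sym[OF in_(2)]
    unfolding EQ.simps by blast
  then show ?case using Less Q_ev[OF Less.prems(1), of s] Q_ev[OF Less.prems(1), of t] by simp
next
  case (Forall x \<rho> A)
  have step: "Q.holds ((%z. rp (v z))((x, \<rho>) := rp d)) A \<longleftrightarrow> holds (v((x, \<rho>) := d)) A"
    if "d \<in> D \<rho>" for d
  proof -
    define w where "w = v((x, \<rho>) := d)"
    have eq: "(%z. rp (v z))((x, \<rho>) := rp d) = (%z. rp (w z))" unfolding w_def by auto
    have "val w" unfolding w_def using that Forall.prems by simp
    then show ?thesis unfolding eq w_def[symmetric]
      by (rule Forall.IH) (use Forall.prems in simp)
  qed
  have Dq: "(\<forall>e\<in>Dq \<rho>. P e) \<longleftrightarrow> (\<forall>d\<in>D \<rho>. P (rp d))" for P unfolding Dq_def by simp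
  show ?case unfolding Q.holds.simps holds.simps Dq by (intro ball_cong refl step)
qed simp_all

text \<open>Agreement on representatives extends to all arguments because functions respect
  extensional equality.\<close>

lemma Q_ext:
  assumes "f \<in> Dq (\<sigma> \<Rrightarrow> \<tau>)" "g \<in> Dq (\<sigma> \<Rrightarrow> \<tau>)" "!!x. x \<in> Dq \<sigma> ==> rp (ap f x) = rp (ap g x)"
  shows "f = g"
proof -
  have fg: "f \<in> D (\<sigma> \<Rrightarrow> \<tau>)" "g \<in> D (\<sigma> \<Rrightarrow> \<tau>)" using assms Dq_sub by auto
  have "EQ \<tau> (ap f x) (ap g x)" if x: "x \<in> D \<sigma>" for x
  proof -
    have r: "rp x \<in> D \<sigma>" "EQ \<sigma> x (rp x)" "EQ \<sigma> (rp x) x" using rp[OF x] EQ_sym x by auto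
    have "rp (ap f (rp x)) = rp (ap g (rp x))" using assms(3) x by (simp add: Dq_def)
    then have 1: "EQ \<tau> (ap f (rp x)) (ap g (rp x))"
      using rp_eq_iff[OF ap_in[OF fg(1) r(1)] ap_in[OF fg(2) r(1)]] by simp
    have 2: "EQ \<tau> (ap f x) (ap f (rp x))" "EQ \<tau> (ap g (rp x)) (ap g x)"
      using EQ_ap fg r x by blast+
    have i: "ap f x \<in> D \<tau>" "ap g x \<in> D \<tau>" "ap f (rp x) \<in> D \<tau>" "ap g (rp x) \<in> D \<tau>"
      using ap_in fg r(1) x by blast+
    show ?thesis using EQ_trans[OF i(1,3,2) 2(1) EQ_trans[OF i(3,4,2) 1 2(2)]] .
  qed
  then have "EQ (\<sigma> \<Rrightarrow> \<tau>) f g" by simp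
  then have "rp f = rp g" using rp_eq_iff fg by blast
  then show ?thesis using assms Dq_rp by metis
qed

end

locale ext_model = prestructure D ap cv "(=)" ltr
  for D :: "ty => 'd set" and ap cv and ltr :: "'d => 'd => bool" +
  assumes ext: "f \<in> D (\<sigma> \<Rrightarrow> \<tau>) ==> g \<in> D (\<sigma> \<Rrightarrow> \<tau>) ==> (!!x. x \<in> D \<sigma> ==> ap f x = ap g x) ==> f = g"

section \<open>A countermodel for every unprovable formula\<close>

context prestructure begin

lemma holds_eq_refl: "holds v (\<^bold>\<forall>\<^sub>0x. x \<^bold>= x) \<longleftrightarrow> (\<forall>a\<in>D Nt. eqr a a)"
  unfolding all0_def by (rule all_fresh_iff) simp

lemma holds_eq_euclid: "holds v (\<^bold>\<forall>\<^sub>0x. \<^bold>\<forall>\<^sub>0y. \<^bold>\<forall>\<^sub>0z. x \<^bold>= y \<^bold>\<longrightarrow> x \<^bold>= z \<^bold>\<longrightarrow> y \<^bold>= z) \<longleftrightarrow>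
    (\<forall>a\<in>D Nt. \<forall>b\<in>D Nt. \<forall>c\<in>D Nt. eqr a b --> eqr a c --> eqr b c)"
  unfolding all0_def by (rule all_fresh_iff, rule all_fresh_iff, rule all_fresh_iff)
    (auto dest!: bound_all_fresh)

lemma holds_less_cong:
  "holds v (\<^bold>\<forall>\<^sub>0x. \<^bold>\<forall>\<^sub>0y. \<^bold>\<forall>\<^sub>0u. \<^bold>\<forall>\<^sub>0v. x \<^bold>= y \<^bold>\<longrightarrow> u \<^bold>= v \<^bold>\<longrightarrow> x \<^bold>< u \<^bold>\<longrightarrow> y \<^bold>< v) \<longleftrightarrow>
    (\<forall>a\<in>D Nt. \<forall>b\<in>D Nt. \<forall>c\<in>D Nt. \<forall>d\<in>D Nt. eqr a b --> eqr c d --> ltr a c --> ltr b d)"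
  unfolding all0_def
  by (rule all_fresh_iff, rule all_fresh_iff, rule all_fresh_iff, rule all_fresh_iff)
    (auto dest!: bound_all_fresh)

lemma holds_ext_axiom:
  "holds v (all_fresh \<rho> (%x. all_fresh \<rho> (%y. all_fresh (\<rho> \<Rrightarrow> \<tau>) (%f.
      eq_at \<rho> x y \<^bold>\<longrightarrow> eq_at \<tau> (f \<cdot> x) (f \<cdot> y))))) \<longleftrightarrow>
    (\<forall>x\<in>D \<rho>. \<forall>y\<in>D \<rho>. \<forall>f\<in>D (\<rho> \<Rrightarrow> \<tau>). EQ \<rho> x y --> EQ \<tau> (ap f x) (ap f y))"
  by (rule all_fresh_iff, rule all_fresh_iff, rule all_fresh_iff)
    (auto simp: holds_eq_at dest!: bound_all_fresh bound_eq_at)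

end

lemma wf_eq_refl: "wf_fm (\<^bold>\<forall>\<^sub>0x. x \<^bold>= x)"
  unfolding all0_def by (intro wf_all_fresh) simp

lemma wf_eq_euclid: "wf_fm (\<^bold>\<forall>\<^sub>0x. \<^bold>\<forall>\<^sub>0y. \<^bold>\<forall>\<^sub>0z. x \<^bold>= y \<^bold>\<longrightarrow> x \<^bold>= z \<^bold>\<longrightarrow> y \<^bold>= z)"
  unfolding all0_def by (intro wf_all_fresh) simp

lemma wf_less_cong: "wf_fm (\<^bold>\<forall>\<^sub>0x. \<^bold>\<forall>\<^sub>0y. \<^bold>\<forall>\<^sub>0u. \<^bold>\<forall>\<^sub>0v. x \<^bold>= y \<^bold>\<longrightarrow> u \<^bold>= v \<^bold>\<longrightarrow> x \<^bold>< u \<^bold>\<longrightarrow> y \<^bold>< v)"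
  unfolding all0_def by (intro wf_all_fresh) simp

lemma wf_extensionality: "wf_fm (all_fresh \<rho> (%x. all_fresh \<rho> (%y. all_fresh (\<rho> \<Rrightarrow> \<tau>) (%f.
    eq_at \<rho> x y \<^bold>\<longrightarrow> eq_at \<tau> (f \<cdot> x) (f \<cdot> y)))))"
  by (intro wf_all_fresh) (simp add: wf_eq_at)

text \<open>The carrier is always a set of elements of the fixed type \<open>tm\<close>; this is
  what later permits a type to be defined from the numbers of a countermodel.\<close>

theorem model_existence:
  assumes "RCA0w \<subseteq> T" "wf_fm A" "\<not> T \<turnstile> A"
  shows "\<exists>(D :: ty => tm set) ap cv ltr. ext_model D ap cv \<and>
    (\<forall>B v. B \<in> T --> wf_fm B --> prestructure.val D v --> prestructure.holds D ap cv (=) ltr v B) \<and>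
    (\<exists>v. prestructure.val D v \<and> \<not> prestructure.holds D ap cv (=) ltr v A)"
proof -
  define v0 :: "nat \<times> ty => tm" where "v0 = (%z. Var (2 * (fst z + bound_fm A) + 1) (snd z))"
  have "wts v0" by (simp add: wts_def v0_def)
  have "\<not> calculus.pv T (fsub ((*) 2) v0 A)"
  proof
    assume "calculus.pv T (fsub ((*) 2) v0 A)"
    then have "calculus.pv T A"
      by (rule calculus.pv_undsub[where K = "bound_fm A"]) (use assms(2) v0_def in auto)
    then show False using assms(3) by (simp add: calculus.pv_def proves_def)
  qed
  then obtain \<Delta> where \<Delta>: "henkin_set T \<Delta>" "(\<^bold>\<not> fsub ((*) 2) v0 A) \<in> \<Delta>"
    using calculus.henkin_set_exists wf_fsub[OF \<open>wts v0\<close> assms(2)] by blast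
  interpret henkin_set T \<Delta> by (rule \<Delta>(1))
  have v0: "tmod.val v0" using \<open>wts v0\<close> by (auto simp: tmod_val odd_tm_def v0_def)
  have ax: "tmod.holds v0 B" if "B \<in> RCA0w" "wf_fm B" for B
    using axioms_hold assms(1) that v0 by blast
  interpret pre_ext D0 App Const eqD ltD
  proof
    show "eqD a a" if "a \<in> D0 Nt" for a
      using ax[OF RCA0w.eq_refl wf_eq_refl, unfolded tmod.holds_eq_refl] that by blast
    show "eqD b c" if "a \<in> D0 Nt" "b \<in> D0 Nt" "c \<in> D0 Nt" "eqD a b" "eqD a c" for a b c
      using ax[OF RCA0w.eq_euclid wf_eq_euclid, unfolded tmod.holds_eq_euclid] that by blast
    show "ltD b d" if "a \<in> D0 Nt" "b \<in> D0 Nt" "c \<in> D0 Nt" "d \<in> D0 Nt" "eqD a b" "eqD c d" "ltD a c"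
      for a b c d
      using ax[OF RCA0w.less_cong wf_less_cong, unfolded tmod.holds_less_cong] that by blast
    show "tmod.EQ \<tau> (App f x) (App f y)"
      if "x \<in> D0 \<rho>" "y \<in> D0 \<rho>" "f \<in> D0 (\<rho> \<Rrightarrow> \<tau>)" "tmod.EQ \<rho> x y" for x y f \<rho> \<tau>
      using ax[OF RCA0w.extensionality[of \<rho> \<tau>] wf_extensionality, unfolded tmod.holds_ext_axiom] that
      by blast
    show "\<rho> = \<sigma>" if "a \<in> D0 \<rho>" "a \<in> D0 \<sigma>" for a \<rho> \<sigma> using that by (simp add: D0_def)
  qed
  have em: "ext_model Dq (%f x. rp (App f x)) (%c. rp (Const c))"
    by unfold_locales (rule Q_ext)
  have "Q.holds w B" if B: "B \<in> T" "wf_fm B" and w: "Q.val w" for B w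
  proof -
    have "tmod.val w" using w Dq_sub by (auto simp: Q.val_def tmod.val_def)
    moreover have "(%z. rp (w z)) = w" using w Dq_rp by (fastforce simp: Q.val_def)
    ultimately show ?thesis using Q_holds[of w B] axioms_hold B by simp
  qed
  moreover have "Q.val (%z. rp (v0 z))" using v0 by (auto simp: Q.val_def tmod.val_def Dq_def)
  moreover have "\<not> Q.holds (%z. rp (v0 z)) A"
  proof -
    have "fsub ((*) 2) v0 (\<^bold>\<not> A) \<in> \<Delta>" using \<Delta>(2) by simp
    then show ?thesis using truth[of "\<^bold>\<not> A" v0] Q_holds[OF v0] v0 assms(2) by simp
  qed
  ultimately show ?thesis using em by blast
qed

section \<open>Arithmetic in a model\<close>

lemma (in prestructure) holds_subst_qf:
  "quantifier_free A ==> holds v (subst_fm x \<rho> u A) \<longleftrightarrow> holds (v((x, \<rho>) := ev v u)) A"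
proof -
  have ev: "ev v (subst_tm x \<rho> u t) = ev (v((x, \<rho>) := ev v u)) t" for t by (induction t) auto
  show "quantifier_free A ==> ?thesis" by (induction A) (auto simp: ev)
qed

locale aca_model = ext_model +
  assumes sound: "B \<in> ACA0w ==> wf_fm B ==> val v ==> holds v B"
begin

abbreviation C :: "'a set" where "C \<equiv> D Nt"
abbreviation zr :: 'a where "zr \<equiv> cv Zero"
abbreviation on :: 'a where "on \<equiv> cv One"
abbreviation pl :: "'a => 'a => 'a" where "pl a b \<equiv> ap (ap (cv Plus) a) b"
abbreviation ti :: "'a => 'a => 'a" where "ti a b \<equiv> ap (ap (cv Times) a) b"

definition v0 :: "nat \<times> ty => 'a" where "v0 = (SOME v. val v)"

lemma v0 [simp]: "val v0"
  unfolding v0_def using val_exists by (rule someI_ex)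

lemma sound0: "B \<in> RCA0w ==> wf_fm B ==> holds v0 B"
  by (rule sound) (auto simp: ACA0w_def)

lemma zr_in [simp]: "zr \<in> C" and on_in [simp]: "on \<in> C"
  using cv_in[of Zero] cv_in[of One] by auto

lemma pl_in [simp]: "a \<in> C ==> b \<in> C ==> pl a b \<in> C"
  using cv_in[of Plus] by (auto intro: ap_in)

lemma ti_in [simp]: "a \<in> C ==> b \<in> C ==> ti a b \<in> C"
  using cv_in[of Times] by (auto intro: ap_in)

lemma ax_suc_inject: "a \<in> C ==> b \<in> C ==> pl a on = pl b on ==> a = b"
proof -
  have "holds v0 (\<^bold>\<forall>\<^sub>0x. \<^bold>\<forall>\<^sub>0y. x \<^bold>+ \<^bold>1 \<^bold>= y \<^bold>+ \<^bold>1 \<^bold>\<longrightarrow> x \<^bold>= y) \<longleftrightarrow> (\<forall>a\<in>C. \<forall>b\<in>C. pl a on = pl b on --> a = b)"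
    unfolding all0_def by (rule all_fresh_iff, rule all_fresh_iff) simp
  moreover have "holds v0 (\<^bold>\<forall>\<^sub>0x. \<^bold>\<forall>\<^sub>0y. x \<^bold>+ \<^bold>1 \<^bold>= y \<^bold>+ \<^bold>1 \<^bold>\<longrightarrow> x \<^bold>= y)"
    by (rule sound0[OF RCA0w.suc_inject], unfold all0_def, intro wf_all_fresh) simp
  ultimately show "a \<in> C ==> b \<in> C ==> pl a on = pl b on ==> a = b" by blast
qed

lemma add_z [simp]: "a \<in> C ==> pl a zr = a"
proof -
  have "holds v0 (\<^bold>\<forall>\<^sub>0x. x \<^bold>+ \<^bold>0 \<^bold>= x) \<longleftrightarrow> (\<forall>a\<in>C. pl a zr = a)"
    unfolding all0_def by (rule all_fresh_iff) simp
  moreover have "holds v0 (\<^bold>\<forall>\<^sub>0x. x \<^bold>+ \<^bold>0 \<^bold>= x)"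
    by (rule sound0[OF RCA0w.add_zero], unfold all0_def, intro wf_all_fresh) simp
  ultimately show "a \<in> C ==> pl a zr = a" by blast
qed

lemma add_S: "a \<in> C ==> b \<in> C ==> pl a (pl b on) = pl (pl a b) on"
proof -
  have "holds v0 (\<^bold>\<forall>\<^sub>0x. \<^bold>\<forall>\<^sub>0y. x \<^bold>+ (y \<^bold>+ \<^bold>1) \<^bold>= (x \<^bold>+ y) \<^bold>+ \<^bold>1) \<longleftrightarrow>
      (\<forall>a\<in>C. \<forall>b\<in>C. pl a (pl b on) = pl (pl a b) on)"
    unfolding all0_def by (rule all_fresh_iff, rule all_fresh_iff) simp
  moreover have "holds v0 (\<^bold>\<forall>\<^sub>0x. \<^bold>\<forall>\<^sub>0y. x \<^bold>+ (y \<^bold>+ \<^bold>1) \<^bold>= (x \<^bold>+ y) \<^bold>+ \<^bold>1)"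
    by (rule sound0[OF RCA0w.add_suc], unfold all0_def, intro wf_all_fresh) simp
  ultimately show "a \<in> C ==> b \<in> C ==> pl a (pl b on) = pl (pl a b) on" by blast
qed

lemma mult_z [simp]: "a \<in> C ==> ti a zr = zr"
proof -
  have "holds v0 (\<^bold>\<forall>\<^sub>0x. x \<^bold>* \<^bold>0 \<^bold>= \<^bold>0) \<longleftrightarrow> (\<forall>a\<in>C. ti a zr = zr)"
    unfolding all0_def by (rule all_fresh_iff) simp
  moreover have "holds v0 (\<^bold>\<forall>\<^sub>0x. x \<^bold>* \<^bold>0 \<^bold>= \<^bold>0)"
    by (rule sound0[OF RCA0w.mult_zero], unfold all0_def, intro wf_all_fresh) simp
  ultimately show "a \<in> C ==> ti a zr = zr" by blast
qed

lemma mult_S: "a \<in> C ==> b \<in> C ==> ti a (pl b on) = pl (ti a b) a"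
proof -
  have "holds v0 (\<^bold>\<forall>\<^sub>0x. \<^bold>\<forall>\<^sub>0y. x \<^bold>* (y \<^bold>+ \<^bold>1) \<^bold>= (x \<^bold>* y) \<^bold>+ x) \<longleftrightarrow>
      (\<forall>a\<in>C. \<forall>b\<in>C. ti a (pl b on) = pl (ti a b) a)"
    unfolding all0_def by (rule all_fresh_iff, rule all_fresh_iff) simp
  moreover have "holds v0 (\<^bold>\<forall>\<^sub>0x. \<^bold>\<forall>\<^sub>0y. x \<^bold>* (y \<^bold>+ \<^bold>1) \<^bold>= (x \<^bold>* y) \<^bold>+ x)"
    by (rule sound0[OF RCA0w.mult_suc], unfold all0_def, intro wf_all_fresh) simp
  ultimately show "a \<in> C ==> b \<in> C ==> ti a (pl b on) = pl (ti a b) a" by blast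
qed

lemma not_lt_z [simp]: "a \<in> C ==> \<not> ltr a zr"
proof -
  have "holds v0 (\<^bold>\<forall>\<^sub>0x. \<^bold>\<not> (x \<^bold>< \<^bold>0)) \<longleftrightarrow> (\<forall>a\<in>C. \<not> ltr a zr)"
    unfolding all0_def by (rule all_fresh_iff) simp
  moreover have "holds v0 (\<^bold>\<forall>\<^sub>0x. \<^bold>\<not> (x \<^bold>< \<^bold>0))"
    by (rule sound0[OF RCA0w.not_less_zero], unfold all0_def, intro wf_all_fresh) simp
  ultimately show "a \<in> C ==> \<not> ltr a zr" by blast
qed

lemma lt_S: "a \<in> C ==> b \<in> C ==> ltr a (pl b on) \<longleftrightarrow> ltr a b \<or> a = b"
proof -
  have "holds v0 (\<^bold>\<forall>\<^sub>0x. \<^bold>\<forall>\<^sub>0y. x \<^bold>< y \<^bold>+ \<^bold>1 \<^bold>\<longleftrightarrow> x \<^bold>< y \<^bold>\<or> x \<^bold>= y) \<longleftrightarrow>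
      (\<forall>a\<in>C. \<forall>b\<in>C. ltr a (pl b on) \<longleftrightarrow> ltr a b \<or> a = b)"
    unfolding all0_def by (rule all_fresh_iff, rule all_fresh_iff) auto
  moreover have "holds v0 (\<^bold>\<forall>\<^sub>0x. \<^bold>\<forall>\<^sub>0y. x \<^bold>< y \<^bold>+ \<^bold>1 \<^bold>\<longleftrightarrow> x \<^bold>< y \<^bold>\<or> x \<^bold>= y)"
    by (rule sound0[OF RCA0w.less_suc], unfold all0_def, intro wf_all_fresh) simp
  ultimately show "a \<in> C ==> b \<in> C ==> ltr a (pl b on) \<longleftrightarrow> ltr a b \<or> a = b" by blast
qed

text \<open>Quantifier-free induction with the induction variable under the name 0. The valuation
  supplies the parameters of \<open>A\<close>, which may be of any type.\<close>

lemma ind: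
  assumes A: "quantifier_free A" "wf_fm A" and v: "val v"
    and P: "!!d. d \<in> C ==> holds (v((0, Nt) := d)) A \<longleftrightarrow> P d"
    and base: "P zr" and step: "!!d. d \<in> C ==> P d ==> P (pl d on)" and d: "d \<in> C"
  shows "P d"
proof -
  have "(subst_fm 0 Nt \<^bold>0 A \<^bold>\<longrightarrow> Forall 0 Nt (A \<^bold>\<longrightarrow> subst_fm 0 Nt (Var 0 Nt \<^bold>+ \<^bold>1) A) \<^bold>\<longrightarrow> Forall 0 Nt A) \<in> ACA0w"
    using RCA0w.QF_induction[OF A] by (simp add: ACA0w_def)
  from sound[OF this _ v] have "holds v (subst_fm 0 Nt \<^bold>0 A) -->
      holds v (Forall 0 Nt (A \<^bold>\<longrightarrow> subst_fm 0 Nt (Var 0 Nt \<^bold>+ \<^bold>1) A)) --> holds v (Forall 0 Nt A)"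
    using A(2) by (simp add: wf_subst)
  moreover have "holds v (subst_fm 0 Nt \<^bold>0 A)"
    unfolding holds_subst_qf[OF A(1)] ev.simps using base P[OF zr_in] by blast
  moreover have "holds v (Forall 0 Nt (A \<^bold>\<longrightarrow> subst_fm 0 Nt (Var 0 Nt \<^bold>+ \<^bold>1) A))"
    unfolding holds.simps
  proof (intro ballI impI)
    fix d assume d: "d \<in> C" "holds (v((0, Nt) := d)) A"
    then have "P (pl d on)" using P step by blast
    then have "holds (v((0, Nt) := pl d on)) A" using P d(1) pl_in on_in by blast
    then show "holds (v((0, Nt) := d)) (subst_fm 0 Nt (Var 0 Nt \<^bold>+ \<^bold>1) A)"
      by (simp add: holds_subst_qf[OF A(1)])
  qed
  ultimately have "holds v (Forall 0 Nt A)" by blast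
  then show ?thesis using P[OF d] d unfolding holds.simps by blast
qed

section \<open>Laws of a discretely ordered semiring, by induction in the model\<close>

abbreviation "x0 \<equiv> Var 0 Nt"
abbreviation "x1 \<equiv> Var 1 Nt"
abbreviation "x2 \<equiv> Var 2 Nt"

abbreviation v2 :: "'a => 'a => nat \<times> ty => 'a" where
  "v2 a b \<equiv> v0((1, Nt) := a, (2, Nt) := b)"

lemma z_add [simp]: "d \<in> C ==> pl zr d = d"
  by (rule ind[where P = "%d. pl zr d = d" and A = "\<^bold>0 \<^bold>+ x0 \<^bold>= x0" and v = v0]) (simp_all add: add_S)

lemma S_add: "a \<in> C ==> d \<in> C ==> pl (pl a on) d = pl (pl a d) on"
  by (rule ind[where P = "%d. pl (pl a on) d = pl (pl a d) on" and A = "(x1 \<^bold>+ \<^bold>1) \<^bold>+ x0 \<^bold>= (x1 \<^bold>+ x0) \<^bold>+ \<^bold>1" and v = "v2 a a"])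
    (simp_all add: add_S)

lemma add_comm: "a \<in> C ==> d \<in> C ==> pl a d = pl d a"
  by (rule ind[where P = "%d. pl a d = pl d a" and A = "x1 \<^bold>+ x0 \<^bold>= x0 \<^bold>+ x1" and v = "v2 a a"]) (simp_all add: add_S S_add)

lemma add_assoc: "a \<in> C ==> b \<in> C ==> d \<in> C ==> pl (pl a b) d = pl a (pl b d)"
  by (rule ind[where P = "%d. pl (pl a b) d = pl a (pl b d)" and A = "(x1 \<^bold>+ x2) \<^bold>+ x0 \<^bold>= x1 \<^bold>+ (x2 \<^bold>+ x0)" and v = "v2 a b"]) (simp_all add: add_S)

lemma add_right_comm: "a \<in> C ==> b \<in> C ==> d \<in> C ==> pl (pl a b) d = pl (pl a d) b"
  using add_assoc[of a b d] add_assoc[of a d b] add_comm[of b d] by simp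

lemma z_mult [simp]: "d \<in> C ==> ti zr d = zr"
  by (rule ind[where P = "%d. ti zr d = zr" and A = "\<^bold>0 \<^bold>* x0 \<^bold>= \<^bold>0" and v = v0]) (simp_all add: mult_S)

lemma S_mult: assumes "a \<in> C" "d \<in> C" shows "ti (pl a on) d = pl (ti a d) d"
proof (rule ind[where P = "%d. ti (pl a on) d = pl (ti a d) d" and A = "(x1 \<^bold>+ \<^bold>1) \<^bold>* x0 \<^bold>= x1 \<^bold>* x0 \<^bold>+ x0" and v = "v2 a a"])
  fix d assume "d \<in> C" "ti (pl a on) d = pl (ti a d) d"
  then show "ti (pl a on) (pl d on) = pl (ti a (pl d on)) (pl d on)"
    using assms(1) add_right_comm[of "ti a d" d a] by (simp add: mult_S add_S)
qed (use assms in simp_all)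

lemma mult_comm: "a \<in> C ==> d \<in> C ==> ti a d = ti d a"
  by (rule ind[where P = "%d. ti a d = ti d a" and A = "x1 \<^bold>* x0 \<^bold>= x0 \<^bold>* x1" and v = "v2 a a"]) (simp_all add: mult_S S_mult)

lemma distrib: assumes "a \<in> C" "b \<in> C" "d \<in> C" shows "ti a (pl b d) = pl (ti a b) (ti a d)"
proof (rule ind[where P = "%d. ti a (pl b d) = pl (ti a b) (ti a d)" and A = "x1 \<^bold>* (x2 \<^bold>+ x0) \<^bold>= x1 \<^bold>* x2 \<^bold>+ x1 \<^bold>* x0" and v = "v2 a b"])
  fix d assume "d \<in> C" "ti a (pl b d) = pl (ti a b) (ti a d)"
  then show "ti a (pl b (pl d on)) = pl (ti a b) (ti a (pl d on))"
    using assms(1,2) add_assoc[of "ti a b" "ti a d" a] by (simp add: mult_S add_S)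
qed (use assms in simp_all)

lemma mult_on [simp]: "a \<in> C ==> ti a on = a"
  using mult_S[of a zr] by simp

lemma mult_assoc: "a \<in> C ==> b \<in> C ==> d \<in> C ==> ti (ti a b) d = ti a (ti b d)"
  by (rule ind[where P = "%d. ti (ti a b) d = ti a (ti b d)" and A = "(x1 \<^bold>* x2) \<^bold>* x0 \<^bold>= x1 \<^bold>* (x2 \<^bold>* x0)" and v = "v2 a b"])
    (simp_all add: mult_S distrib)

lemma cancel: assumes "a \<in> C" "b \<in> C" "d \<in> C" shows "pl a d = pl b d --> a = b"
proof (rule ind[where P = "%d. pl a d = pl b d --> a = b" and A = "x1 \<^bold>+ x0 \<^bold>= x2 \<^bold>+ x0 \<^bold>\<longrightarrow> x1 \<^bold>= x2" and v = "v2 a b"])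
  fix d assume "d \<in> C" "pl a d = pl b d --> a = b"
  then show "pl a (pl d on) = pl b (pl d on) --> a = b"
    using assms(1,2) ax_suc_inject[of "pl a d" "pl b d"] by (simp add: add_S)
qed (use assms in simp_all)

lemma z_le: "d \<in> C ==> d = zr \<or> ltr zr d"
proof (rule ind[where P = "%d. d = zr \<or> ltr zr d" and A = "x0 \<^bold>= \<^bold>0 \<^bold>\<or> \<^bold>0 \<^bold>< x0" and v = v0])
qed (auto simp: lt_S)

lemma lt_trans: "a \<in> C ==> b \<in> C ==> d \<in> C ==> ltr a b --> ltr b d --> ltr a d"
  by (rule ind[where P = "%d. ltr a b --> ltr b d --> ltr a d" and A = "x1 \<^bold>< x2 \<^bold>\<longrightarrow> x2 \<^bold>< x0 \<^bold>\<longrightarrow> x1 \<^bold>< x0" and v = "v2 a b"]) (auto simp: lt_S)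

lemma lt_irrefl: assumes "d \<in> C" shows "\<not> ltr d d"
proof (rule ind[where P = "%d. \<not> ltr d d" and A = "\<^bold>\<not> (x0 \<^bold>< x0)" and v = v0])
  fix d assume d: "d \<in> C" "\<not> ltr d d"
  have lt: "ltr d (pl d on)" using d by (simp add: lt_S)
  show "\<not> ltr (pl d on) (pl d on)"
  proof
    assume "ltr (pl d on) (pl d on)"
    then have "ltr (pl d on) d \<or> pl d on = d" using lt_S[of "pl d on" d] d by simp
    then show False using lt d lt_trans[of d "pl d on" d] pl_in on_in by metis
  qed
qed (use assms in simp_all)

lemma S_le: "a \<in> C ==> d \<in> C ==> ltr a d --> pl a on = d \<or> ltr (pl a on) d"
  by (rule ind[where P = "%d. ltr a d --> pl a on = d \<or> ltr (pl a on) d" and A = "x1 \<^bold>< x0 \<^bold>\<longrightarrow> x1 \<^bold>+ \<^bold>1 \<^bold>= x0 \<^bold>\<or> x1 \<^bold>+ \<^bold>1 \<^bold>< x0" and v = "v2 a a"]) (auto simp: lt_S)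

lemma lt_total: assumes "a \<in> C" "d \<in> C" shows "ltr a d \<or> a = d \<or> ltr d a"
proof (rule ind[where P = "%d. ltr a d \<or> a = d \<or> ltr d a" and A = "x1 \<^bold>< x0 \<^bold>\<or> x1 \<^bold>= x0 \<^bold>\<or> x0 \<^bold>< x1" and v = "v2 a a"])
  fix d assume "d \<in> C" "ltr a d \<or> a = d \<or> ltr d a"
  then show "ltr a (pl d on) \<or> a = pl d on \<or> ltr (pl d on) a"
    using assms(1) S_le[of d a] by (auto simp: lt_S)
qed (use assms z_le[OF assms(1)] in auto)

lemma S_lt: "a \<in> C ==> b \<in> C ==> ltr a b ==> ltr (pl a on) (pl b on)"
  using S_le[of a b] by (auto simp: lt_S)

lemma add_mono: "a \<in> C ==> b \<in> C ==> d \<in> C ==> ltr a b --> ltr (pl a d) (pl b d)"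
  by (rule ind[where P = "%d. ltr a b --> ltr (pl a d) (pl b d)" and A = "x1 \<^bold>< x2 \<^bold>\<longrightarrow> x1 \<^bold>+ x0 \<^bold>< x2 \<^bold>+ x0" and v = "v2 a b"])
    (auto simp: add_S S_lt)

text \<open>The positive factor is written as a successor, so that the induction can start at the
  factor 1.\<close>

lemma mult_mono: assumes "a \<in> C" "b \<in> C" "d \<in> C"
  shows "ltr a b --> ltr (ti a (pl d on)) (ti b (pl d on))"
proof (rule ind[where P = "%d. ltr a b --> ltr (ti a (pl d on)) (ti b (pl d on))" and A = "x1 \<^bold>< x2 \<^bold>\<longrightarrow> x1 \<^bold>* (x0 \<^bold>+ \<^bold>1) \<^bold>< x2 \<^bold>* (x0 \<^bold>+ \<^bold>1)" and v = "v2 a b"])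
  fix d assume "d \<in> C" "ltr a b --> ltr (ti a (pl d on)) (ti b (pl d on))"
  note * = assms(1,2) this
  show "ltr a b --> ltr (ti a (pl (pl d on) on)) (ti b (pl (pl d on) on))"
  proof
    assume ab: "ltr a b"
    let ?x = "ti a (pl d on)" and ?y = "ti b (pl d on)"
    have "ltr (pl ?x a) (pl ?y a)" using * ab add_mono[of ?x ?y a] by simp
    moreover have "ltr (pl a ?y) (pl b ?y)" using * ab add_mono[of a b ?y] by simp
    moreover have "pl a ?y = pl ?y a" "pl b ?y = pl ?y b" by (rule add_comm; use * in simp)+
    ultimately have "ltr (pl ?x a) (pl ?y b)"
      using * lt_trans[of "pl ?x a" "pl ?y a" "pl ?y b"] by simp
    then show "ltr (ti a (pl (pl d on) on)) (ti b (pl (pl d on) on))"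
      using * mult_S[of a "pl d on"] mult_S[of b "pl d on"] by simp
  qed
qed (use assms in simp_all)

subsection \<open>Combinators and recursion\<close>

lemma EQ_iff: "a \<in> D \<rho> ==> b \<in> D \<rho> ==> EQ \<rho> a b \<longleftrightarrow> a = b"
proof (induction \<rho> arbitrary: a b)
  case (Fn \<sigma> \<tau>)
  then show ?case using ext[OF Fn.prems] ap_in by auto
qed simp

lemma ap_K:
  assumes "x \<in> D \<rho>" "y \<in> D \<sigma>" shows "ap (ap (cv (CombK \<rho> \<sigma>)) x) y = x"
proof -
  let ?B = "all_fresh \<rho> (%x. all_fresh \<sigma> (%y. eq_at \<rho> (Const (CombK \<rho> \<sigma>) \<cdot> x \<cdot> y) x))"
  have "holds v0 ?B \<longleftrightarrow> (\<forall>x\<in>D \<rho>. \<forall>y\<in>D \<sigma>. EQ \<rho> (ap (ap (cv (CombK \<rho> \<sigma>)) x) y) x)"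
    by (rule all_fresh_iff, rule all_fresh_iff)
      (auto simp: holds_eq_at dest!: bound_all_fresh bound_eq_at)
  moreover have "holds v0 ?B"
    by (rule sound0[OF RCA0w.comb_K], intro wf_all_fresh wf_eq_at) simp_all
  moreover have "ap (ap (cv (CombK \<rho> \<sigma>)) x) y \<in> D \<rho>"
    using cv_in[of "CombK \<rho> \<sigma>"] assms by (auto intro: ap_in)
  ultimately show ?thesis using EQ_iff assms by blast
qed

lemma ap_S:
  assumes "x \<in> D (\<rho> \<Rrightarrow> \<sigma> \<Rrightarrow> \<tau>)" "y \<in> D (\<rho> \<Rrightarrow> \<sigma>)" "z \<in> D \<rho>"
  shows "ap (ap (ap (cv (CombS \<rho> \<sigma> \<tau>)) x) y) z = ap (ap x z) (ap y z)"
proof -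
  let ?B = "all_fresh (\<rho> \<Rrightarrow> \<sigma> \<Rrightarrow> \<tau>) (%x. all_fresh (\<rho> \<Rrightarrow> \<sigma>) (%y. all_fresh \<rho> (%z.
    eq_at \<tau> (Const (CombS \<rho> \<sigma> \<tau>) \<cdot> x \<cdot> y \<cdot> z) (x \<cdot> z \<cdot> (y \<cdot> z)))))"
  have "holds v0 ?B \<longleftrightarrow> (\<forall>x\<in>D (\<rho> \<Rrightarrow> \<sigma> \<Rrightarrow> \<tau>). \<forall>y\<in>D (\<rho> \<Rrightarrow> \<sigma>). \<forall>z\<in>D \<rho>.
      EQ \<tau> (ap (ap (ap (cv (CombS \<rho> \<sigma> \<tau>)) x) y) z) (ap (ap x z) (ap y z)))"
    by (rule all_fresh_iff, rule all_fresh_iff, rule all_fresh_iff)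
      (auto simp: holds_eq_at dest!: bound_all_fresh bound_eq_at)
  moreover have "holds v0 ?B"
    by (rule sound0[OF RCA0w.comb_S], intro wf_all_fresh wf_eq_at) simp_all
  moreover have "ap (ap (ap (cv (CombS \<rho> \<sigma> \<tau>)) x) y) z \<in> D \<tau>" "ap (ap x z) (ap y z) \<in> D \<tau>"
    using cv_in[of "CombS \<rho> \<sigma> \<tau>"] assms by (auto intro: ap_in)
  ultimately show ?thesis using EQ_iff assms by blast
qed

lemma rec_zero:
  assumes "f \<in> D (Nt \<Rrightarrow> Nt \<Rrightarrow> Nt)" "m \<in> C" shows "ap (ap (ap (cv Rec0) f) m) zr = m"
proof -
  let ?B = "all_fresh (Nt \<Rrightarrow> Nt \<Rrightarrow> Nt) (%f. \<^bold>\<forall>\<^sub>0m. Const Rec0 \<cdot> f \<cdot> m \<cdot> \<^bold>0 \<^bold>= m)"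
  have "holds v0 ?B \<longleftrightarrow> (\<forall>f\<in>D (Nt \<Rrightarrow> Nt \<Rrightarrow> Nt). \<forall>m\<in>C. ap (ap (ap (cv Rec0) f) m) zr = m)"
    unfolding all0_def by (rule all_fresh_iff, rule all_fresh_iff) simp
  moreover have "holds v0 ?B"
    by (rule sound0[OF RCA0w.rec_zero], unfold all0_def, intro wf_all_fresh) simp_all
  ultimately show ?thesis using assms by blast
qed

lemma rec_suc:
  assumes "f \<in> D (Nt \<Rrightarrow> Nt \<Rrightarrow> Nt)" "m \<in> C" "n \<in> C"
  shows "ap (ap (ap (cv Rec0) f) m) (pl n on) = ap (ap f n) (ap (ap (ap (cv Rec0) f) m) n)"
proof -
  let ?B = "all_fresh (Nt \<Rrightarrow> Nt \<Rrightarrow> Nt) (%f. \<^bold>\<forall>\<^sub>0m. \<^bold>\<forall>\<^sub>0n.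
    Const Rec0 \<cdot> f \<cdot> m \<cdot> (n \<^bold>+ \<^bold>1) \<^bold>= f \<cdot> n \<cdot> (Const Rec0 \<cdot> f \<cdot> m \<cdot> n))"
  have "holds v0 ?B \<longleftrightarrow> (\<forall>f\<in>D (Nt \<Rrightarrow> Nt \<Rrightarrow> Nt). \<forall>m\<in>C. \<forall>n\<in>C.
      ap (ap (ap (cv Rec0) f) m) (pl n on) = ap (ap f n) (ap (ap (ap (cv Rec0) f) m) n))"
    unfolding all0_def by (rule all_fresh_iff, rule all_fresh_iff, rule all_fresh_iff)
      (auto dest!: bound_all_fresh)
  moreover have "holds v0 ?B"
    by (rule sound0[OF RCA0w.rec_suc], unfold all0_def, intro wf_all_fresh) simp_all
  ultimately show ?thesis using assms by blast
qed

lemma mu_exists: "\<exists>\<mu>\<in>D ty2. \<forall>f\<in>D ty1. ((\<exists>n\<in>C. ap f n = zr) -->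
    ap f (ap \<mu> f) = zr \<and> (\<forall>i\<in>C. ap f i = zr --> \<not> ltr i (ap \<mu> f))) \<and>
    (\<not> (\<exists>n\<in>C. ap f n = zr) --> ap \<mu> f = zr)"
proof -
  have E: "holds v (\<^bold>\<exists>\<^sub>0n. Var x ty1 \<cdot> n \<^bold>= \<^bold>0) \<longleftrightarrow> (\<exists>n\<in>C. ap (v (x, ty1)) n = zr)" for v x
    unfolding ex0_def all0_def holds.simps
    by (subst all_fresh_iff[where P = "%n. ap (v (x, ty1)) n ~= zr"]) auto
  have U: "holds v (\<^bold>\<forall>\<^sub>0i. Var x ty1 \<cdot> i \<^bold>= \<^bold>0 \<^bold>\<longrightarrow> Var y ty2 \<cdot> Var x ty1 \<^bold>\<le> i) \<longleftrightarrow>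
      (\<forall>i\<in>C. ap (v (x, ty1)) i = zr --> \<not> ltr i (ap (v (y, ty2)) (v (x, ty1))))" for v x y
    unfolding all0_def by (rule all_fresh_iff) auto
  have "holds v0 mu_axiom \<longleftrightarrow> (\<not> (\<forall>\<mu>\<in>D ty2. \<not> (\<forall>f\<in>D ty1. ((\<exists>n\<in>C. ap f n = zr) -->
    ap f (ap \<mu> f) = zr \<and> (\<forall>i\<in>C. ap f i = zr --> \<not> ltr i (ap \<mu> f))) \<and>
    (\<not> (\<exists>n\<in>C. ap f n = zr) --> ap \<mu> f = zr))))"
    unfolding mu_axiom_def ex2_def holds.simps
    by (subst all_fresh_iff, unfold all1_def holds.simps, subst all_fresh_iff)
      (auto simp: E U)
  moreover have "holds v0 mu_axiom"
    by (rule sound) (auto simp: ACA0w_def mu_axiom_def ex2_def ex0_def all0_def all1_def intro!: wf_all_fresh)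
  ultimately show ?thesis by blast
qed

end

section \<open>The field of fractions of a model\<close>

text \<open>Discretely ordered semirings on a carrier set, because the numbers of a model form a
  subset of \<open>tm\<close>; the type of numbers is defined from this set.\<close>

locale dosr =
  fixes C :: "'a set" and z u :: 'a and p t :: "'a => 'a => 'a" and l :: "'a => 'a => bool"
  assumes z_in: "z \<in> C" and u_in: "u \<in> C"
    and p_in: "a \<in> C ==> b \<in> C ==> p a b \<in> C" and t_in: "a \<in> C ==> b \<in> C ==> t a b \<in> C"
    and p_comm: "a \<in> C ==> b \<in> C ==> p a b = p b a"
    and p_assoc: "a \<in> C ==> b \<in> C ==> c \<in> C ==> p (p a b) c = p a (p b c)"
    and z_p: "a \<in> C ==> p z a = a"
    and t_comm: "a \<in> C ==> b \<in> C ==> t a b = t b a"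
    and t_assoc: "a \<in> C ==> b \<in> C ==> c \<in> C ==> t (t a b) c = t a (t b c)"
    and u_t: "a \<in> C ==> t u a = a" and z_t: "a \<in> C ==> t z a = z"
    and distr: "a \<in> C ==> b \<in> C ==> c \<in> C ==> t (p a b) c = p (t a c) (t b c)"
    and p_cancel: "a \<in> C ==> b \<in> C ==> c \<in> C ==> p a c = p b c ==> a = b"
    and l_irrefl: "a \<in> C ==> \<not> l a a"
    and l_trans: "a \<in> C ==> b \<in> C ==> c \<in> C ==> l a b ==> l b c ==> l a c"
    and l_total: "a \<in> C ==> b \<in> C ==> l a b \<or> a = b \<or> l b a"
    and l_p: "a \<in> C ==> b \<in> C ==> c \<in> C ==> l a b ==> l (p c a) (p c b)"
    and l_t: "a \<in> C ==> b \<in> C ==> c \<in> C ==> l a b ==> l z c ==> l (t c a) (t c b)"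
    and z_least: "a \<in> C ==> a = z \<or> l z a" and z_l_u: "l z u"
    and l_diff: "a \<in> C ==> b \<in> C ==> l a b ==> \<exists>c\<in>C. b = p (p a c) u"

section \<open>Predecessor, truncated subtraction and differences\<close>

context aca_model begin

text \<open>Recursion with the combinator that returns the stage and forgets the previous value.
  Iterating the predecessor gives truncated subtraction, through which differences exist in the
  model.\<close>

definition prd :: 'a where "prd = ap (ap (cv Rec0) (cv (CombK Nt Nt))) zr"

definition msf :: "'a => 'a" where "msf a = ap (ap (cv Rec0) (ap (cv (CombK ty1 Nt)) prd)) a"

lemma K_in: "cv (CombK \<rho> \<sigma>) \<in> D (\<rho> \<Rrightarrow> \<sigma> \<Rrightarrow> \<rho>)"
  using cv_in[of "CombK \<rho> \<sigma>"] by simp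

lemma rec_in: "f \<in> D (Nt \<Rrightarrow> Nt \<Rrightarrow> Nt) ==> m \<in> C ==> ap (ap (cv Rec0) f) m \<in> D ty1"
  using cv_in[of Rec0] by (auto intro: ap_in)

lemma prd_in: "prd \<in> D ty1"
  unfolding prd_def by (intro rec_in K_in zr_in)

lemma prd_S: "n \<in> C ==> ap prd (pl n on) = n" and prd_z: "ap prd zr = zr"
proof -
  show "ap prd zr = zr" unfolding prd_def by (rule rec_zero[OF K_in zr_in])
  show "n \<in> C ==> ap prd (pl n on) = n"
    unfolding prd_def by (subst rec_suc[OF K_in zr_in]) (auto intro!: ap_K ap_in[OF rec_in] K_in)
qed

lemma Kprd_in: "ap (cv (CombK ty1 Nt)) prd \<in> D (Nt \<Rrightarrow> Nt \<Rrightarrow> Nt)"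
  by (rule ap_in[OF K_in prd_in])

lemma msf_in: "a \<in> C ==> msf a \<in> D ty1"
  unfolding msf_def by (intro rec_in Kprd_in)

lemma ms_in: "a \<in> C ==> d \<in> C ==> ap (msf a) d \<in> C"
  using msf_in ap_in by blast

lemma ms_z: "a \<in> C ==> ap (msf a) zr = a"
  unfolding msf_def by (rule rec_zero[OF Kprd_in])

lemma ms_S: "a \<in> C ==> d \<in> C ==> ap (msf a) (pl d on) = ap prd (ap (msf a) d)"
  unfolding msf_def by (subst rec_suc[OF Kprd_in]) (simp_all add: ap_K[OF prd_in])

lemma prd_cases: "d \<in> C ==> d = zr \<or> d = pl (ap prd d) on"
  by (rule ind[where P = "%d. d = zr \<or> d = pl (ap prd d) on" and
        A = "x0 \<^bold>= \<^bold>0 \<^bold>\<or> x0 \<^bold>= Var 3 ty1 \<cdot> x0 \<^bold>+ \<^bold>1" and v = "v0((3, ty1) := prd)"])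
    (auto simp: prd_in prd_S)

lemma ms_le: assumes "a \<in> C" "d \<in> C" shows "ltr d a \<or> d = a --> pl d (ap (msf a) d) = a"
proof (rule ind[where P = "%d. ltr d a \<or> d = a --> pl d (ap (msf a) d) = a" and
        A = "x0 \<^bold>< x1 \<^bold>\<or> x0 \<^bold>= x1 \<^bold>\<longrightarrow> x0 \<^bold>+ Var 3 ty1 \<cdot> x0 \<^bold>= x1" and
        v = "v0((1, Nt) := a, (3, ty1) := msf a)"])
  fix d assume d: "d \<in> C" "ltr d a \<or> d = a --> pl d (ap (msf a) d) = a"
  show "ltr (pl d on) a \<or> pl d on = a --> pl (pl d on) (ap (msf a) (pl d on)) = a"
  proof
    assume L: "ltr (pl d on) a \<or> pl d on = a"
    have "ltr d (pl d on)" using lt_S[of d d] d by simp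
    then have da: "ltr d a" using L lt_trans[of d "pl d on" a] d assms pl_in on_in by metis
    then have eq: "pl d (ap (msf a) d) = a" using d by blast
    have "ap (msf a) d ~= zr" using eq da d lt_irrefl add_z by metis
    then have "ap (msf a) d = pl (ap prd (ap (msf a) d)) on" using prd_cases ms_in assms d by blast
    then show "pl (pl d on) (ap (msf a) (pl d on)) = a"
      using eq S_add[of d "ap prd (ap (msf a) d)"] add_S[of d "ap prd (ap (msf a) d)"] d
        ms_S[of a d] assms ap_in[OF prd_in ms_in] by metis
  qed
qed (use assms msf_in ms_z in auto)

lemma ms_gt: assumes "a \<in> C" "d \<in> C" shows "ltr a d \<or> a = d --> ap (msf a) d = zr"
proof (rule ind[where P = "%d. ltr a d \<or> a = d --> ap (msf a) d = zr" and
        A = "x1 \<^bold>< x0 \<^bold>\<or> x1 \<^bold>= x0 \<^bold>\<longrightarrow> Var 3 ty1 \<cdot> x0 \<^bold>= \<^bold>0" and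
        v = "v0((1, Nt) := a, (3, ty1) := msf a)"])
  fix d assume d: "d \<in> C" "ltr a d \<or> a = d --> ap (msf a) d = zr"
  show "ltr a (pl d on) \<or> a = pl d on --> ap (msf a) (pl d on) = zr"
  proof
    assume L: "ltr a (pl d on) \<or> a = pl d on"
    show "ap (msf a) (pl d on) = zr"
    proof (cases "ltr a d \<or> a = d")
      case True
      then show ?thesis using d ms_S assms prd_z by simp
    next
      case False
      then have a: "a = pl d on" using L lt_S[of a d] d assms by blast
      then have "pl d (ap (msf a) d) = pl d on" using ms_le[of a d] lt_S[of d d] d assms by simp
      then have "ap (msf a) d = on"
        using cancel[of "ap (msf a) d" on d] ms_in d assms add_comm[of d on] add_comm[of d "ap (msf a) d"] on_in
        by metis
      then show ?thesis using ms_S[of a d] d assms prd_S[of zr] by simp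
    qed
  qed
qed (use assms msf_in ms_z in auto)

lemma lt_diff: assumes "a \<in> C" "b \<in> C" "ltr a b" shows "\<exists>c\<in>C. b = pl (pl a c) on"
proof -
  let ?m = "ap (msf b) a"
  have eq: "pl a ?m = b" using ms_le assms by blast
  then have "?m ~= zr" using assms lt_irrefl add_z by metis
  then have "?m = pl (ap prd ?m) on" using prd_cases ms_in assms by blast
  then show ?thesis using eq add_S[of a "ap prd ?m"] assms ap_in[OF prd_in ms_in] by metis
qed

end

section \<open>From the numbers of a model to an ordered field\<close>

lemma (in aca_model) dosr: "dosr C zr on pl ti ltr"
proof
  show "ti on a = a" if "a \<in> C" for a using that mult_comm[of on a] by simp
  show "ti (pl a b) c = pl (ti a c) (ti b c)" if "a \<in> C" "b \<in> C" "c \<in> C" for a b c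
    using that mult_comm[of "pl a b" c] distrib[of c a b] mult_comm[of c a] mult_comm[of c b] by simp
  show "a = b" if "a \<in> C" "b \<in> C" "c \<in> C" "pl a c = pl b c" for a b c using that cancel by blast
  show "ltr a c" if "a \<in> C" "b \<in> C" "c \<in> C" "ltr a b" "ltr b c" for a b c using that lt_trans by blast
  show lp: "ltr (pl c a) (pl c b)" if "a \<in> C" "b \<in> C" "c \<in> C" "ltr a b" for a b c
    using that add_mono[of a b c] add_comm[of c a] add_comm[of c b] by simp
  show "a = zr \<or> ltr zr a" if "a \<in> C" for a using z_le[OF that] .
  show "ltr zr on" using lt_S[of zr zr] by simp
  show "\<exists>c\<in>C. b = pl (pl a c) on" if "a \<in> C" "b \<in> C" "ltr a b" for a b
    using lt_diff[OF that] .
  show "ltr (ti c a) (ti c b)" if h: "a \<in> C" "b \<in> C" "c \<in> C" "ltr a b" "ltr zr c" for a b c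
  proof -
    obtain d where d: "d \<in> C" "c = pl (pl zr d) on" using lt_diff[OF zr_in h(3,5)] by blast
    then have "c = pl d on" by simp
    then have 1: "ltr (ti a c) (ti b c)" using h(1,2,4) d(1) mult_mono[of a b d] by simp
    have 2: "ti c a = ti a c" "ti c b = ti b c" by (rule mult_comm; rule h)+
    show ?thesis unfolding 2 by (rule 1)
  qed
  show "pl a b = pl b a" "ti a b = ti b a" if "a \<in> C" "b \<in> C" for a b
    using add_comm[OF that] mult_comm[OF that] .
  show "ltr a b \<or> a = b \<or> ltr b a" if "a \<in> C" "b \<in> C" for a b using lt_total[OF that] .
  show "pl (pl a b) c = pl a (pl b c)" "ti (ti a b) c = ti a (ti b c)"
    if "a \<in> C" "b \<in> C" "c \<in> C" for a b c
    using add_assoc[OF that] mult_assoc[OF that] .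
  show "\<not> ltr a a" if "a \<in> C" for a using lt_irrefl[OF that] .
qed simp_all

definition countermodel :: "(ty => tm set) \<times> (tm => tm => tm) \<times> (const => tm) \<times> (tm => tm => bool) => bool" where
  "countermodel M \<longleftrightarrow> (case M of (D, ap, cv, ltr) => aca_model D ap cv ltr \<and>
     (\<exists>v. prestructure.val D v \<and> \<not> prestructure.holds D ap cv (=) ltr v (URY \<^bold>\<longleftrightarrow> OPEN)))"

text \<open>Types cannot depend on a model that exists only under the assumption that \<open>ACA0w\<close> does
  not prove the equivalence.  Therefore the type of its numbers is defined from a structure
  that comes from a countermodel if there is one, and is standard otherwise.\<close>

definition the_model where "the_model = (SOME M. countermodel M)"

definition mC :: "tm set" where
  "mC = (if Ex countermodel then fst the_model Nt else range (%n. Var n Nt))"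
definition mz :: tm where
  "mz = (if Ex countermodel then fst (snd (snd the_model)) Zero else Var 0 Nt)"
definition mu' :: tm where
  "mu' = (if Ex countermodel then fst (snd (snd the_model)) One else Var 1 Nt)"
fun vnum :: "tm => nat" where "vnum (Var n \<rho>) = n" | "vnum t = 0"
definition mp :: "tm => tm => tm" where
  "mp = (if Ex countermodel then (%a b. fst (snd the_model) (fst (snd the_model) (fst (snd (snd the_model)) Plus) a) b)
    else (%a b. Var (vnum a + vnum b) Nt))"
definition mt :: "tm => tm => tm" where
  "mt = (if Ex countermodel then (%a b. fst (snd the_model) (fst (snd the_model) (fst (snd (snd the_model)) Times) a) b)
    else (%a b. Var (vnum a * vnum b) Nt))"
definition ml :: "tm => tm => bool" where
  "ml = (if Ex countermodel then snd (snd (snd the_model)) else (%a b. vnum a < vnum b))"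

lemma the_model: "Ex countermodel ==> countermodel the_model"
  unfolding the_model_def by (rule someI_ex)

interpretation M: dosr mC mz mu' mp mt ml
proof (cases "Ex countermodel")
  case True
  obtain D ap cv ltr where M: "the_model = (D, ap, cv, ltr)" by (cases the_model)
  have "countermodel (D, ap, cv, ltr)" using the_model[OF True] M by simp
  then have "aca_model D ap cv ltr" unfolding countermodel_def by simp
  from aca_model.dosr[OF this] show "dosr mC mz mu' mp mt ml"
    unfolding mC_def mz_def mu'_def mp_def mt_def ml_def if_P[OF True] M fst_conv snd_conv .
next
  case False
  show "dosr mC mz mu' mp mt ml"
    unfolding mC_def mz_def mu'_def mp_def mt_def ml_def using False
    by unfold_locales (auto simp: algebra_simps dest!: less_imp_Suc_add intro!: rev_image_eqI)
qed

typedef mnum = mC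
  using M.z_in by blast

setup_lifting type_definition_mnum

instantiation mnum :: linordered_semidom
begin

lift_definition zero_mnum :: mnum is mz by (rule M.z_in)
lift_definition one_mnum :: mnum is mu' by (rule M.u_in)
lift_definition plus_mnum :: "mnum => mnum => mnum" is mp by (rule M.p_in)
lift_definition times_mnum :: "mnum => mnum => mnum" is mt by (rule M.t_in)
lift_definition less_mnum :: "mnum => mnum => bool" is ml .
definition less_eq_mnum :: "mnum => mnum => bool" where "a <= b \<longleftrightarrow> a < b \<or> a = (b :: mnum)"
definition minus_mnum :: "mnum => mnum => mnum" where
  "a - b = (if b <= a then (SOME c. a = b + c) else (0 :: mnum))"

instance
proof -
  have ac: "(a + b) + c = a + (b + c)" "a + b = b + a" for a b c :: mnum
    by (transfer, simp add: M.p_assoc, transfer, rule M.p_comm)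
  have z: "0 + a = a" for a :: mnum by transfer (rule M.z_p)
  have cancel: "a + c = b + c ==> a = b" for a b c :: mnum by transfer (rule M.p_cancel)
  have diff: "\<exists>c. b = a + c" if "a <= b" for a b :: mnum
  proof (cases "a < b")
    case True
    then have "\<exists>c. b = (a + c) + 1" by transfer (use M.l_diff in blast)
    then show ?thesis using ac(1) by metis
  next
    case False
    then have "b = a + 0" using that ac z by (metis less_eq_mnum_def)
    then show ?thesis by blast
  qed
  have irrefl: "\<not> a < a" for a :: mnum by transfer (rule M.l_irrefl)
  have trans: "a < b ==> b < c ==> a < c" for a b c :: mnum by transfer (rule M.l_trans)
  have total: "a < b \<or> a = b \<or> b < a" for a b :: mnum by transfer (rule M.l_total)
  have mono: "a < b ==> c + a < c + b" for a b c :: mnum by transfer (rule M.l_p)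
  have least: "a = 0 \<or> 0 < a" for a :: mnum by transfer (rule M.z_least)
  have minus: "b + (a - b) = a" if "b <= a" for a b :: mnum
    using someI_ex[OF diff[OF that]] that by (simp add: minus_mnum_def)
  have minus0: "a - b = 0" if "\<not> b <= a" for a b :: mnum using that by (simp add: minus_mnum_def)
  have le_add: "a <= a + b" for a b :: mnum
    using least[of b] mono[of 0 b a] ac z unfolding less_eq_mnum_def by metis
  have le_iff: "a <= b \<longleftrightarrow> (\<exists>c. b = a + c)" for a b :: mnum using diff le_add by blast
  have minus_eq: "a - b = c" if "a = b + c" for a b c :: mnum
    using minus[of b a] le_add[of b c] cancel[of "a - b" b c] ac that by metis
  have tz: "0 * a = 0" "a * b = b * a" "(a * b) * c = a * (b * c)" "1 * a = a" "(a + b) * c = a * c + b * c" for a b c :: mnum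
    by (transfer, simp add: M.z_t, transfer, simp add: M.t_comm, transfer, simp add: M.t_assoc, transfer,
        simp add: M.u_t, transfer, simp add: M.distr)
  have tmono: "a < b ==> 0 < c ==> c * a < c * b" for a b c :: mnum by transfer (rule M.l_t)
  show "OFCLASS(mnum, linordered_semidom_class)"
  proof
    fix a b c :: mnum
    show "a + b + c = a + (b + c)" "a + b = b + a" "0 + a = a" by (rule ac z)+
    show "a + b - a = b" by (rule minus_eq) simp
    show "a - b - c = a - (b + c)"
    proof (cases "b + c <= a")
      case True
      then obtain d where "a = (b + c) + d" using diff by blast
      then show ?thesis using minus_eq[of a b "c + d"] minus_eq[of "c + d" c d] minus_eq[of a "b + c" d] ac by metis
    next
      case False
      have "a - b - c = 0"
      proof (cases "b <= a")
        case True
        then have "\<not> c <= a - b" using False minus[OF True] le_iff ac by metis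
        then show ?thesis by (rule minus0)
      next
        case nb: False
        have "0 - c = 0"
        proof (cases "c <= 0")
          case True
          then have "c = 0" using least[of c] irrefl trans unfolding less_eq_mnum_def by metis
          then show ?thesis using minus_eq[of 0 0 0] z by simp
        qed (rule minus0)
        then show ?thesis using minus0[OF nb] by simp
      qed
      then show ?thesis using minus0[OF False] by simp
    qed
    show "a * b * c = a * (b * c)" "a * b = b * a" "1 * a = a" "(a + b) * c = a * c + b * c" by (rule tz)+
    show dl: "a * (b + c) = a * b + a * c" using tz by metis
    show "0 * a = 0" "a * 0 = 0" using tz by metis+
    show "(0 :: mnum) ~= 1" by transfer (use M.z_l_u M.l_irrefl M.z_in in metis)
    show "(a < b) = (a <= b \<and> \<not> b <= a)" using irrefl trans unfolding less_eq_mnum_def by metis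
    show "a <= a" "a <= b ==> b <= c ==> a <= c" "a <= b ==> b <= a ==> a = b" "a <= b \<or> b <= a"
      using irrefl trans total unfolding less_eq_mnum_def by metis+
    show "a <= b ==> c + a <= c + b" using mono unfolding less_eq_mnum_def by metis
    show "(0 :: mnum) < 1" by transfer (rule M.z_l_u)
    show "a < b ==> 0 < c ==> c * a < c * b" by (rule tmono)
    show "b <= a ==> a - b + b = a" using minus ac by metis
    show "a ~= 0 ==> b ~= 0 ==> a * b ~= 0" using tmono[of 0 b a] least tz irrefl by metis
    show "a * (b - c) = a * b - a * c"
    proof (cases "c <= b")
      case True
      then obtain d where d: "b = c + d" using diff by blast
      then have "a * b = a * c + a * d" using tz by metis
      then show ?thesis using minus_eq[OF d] minus_eq[of "a * b" "a * c" "a * d"] by simp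
    next
      case False
      then have "b <= c" using total unfolding less_eq_mnum_def by blast
      then obtain d where "c = b + d" using diff by blast
      then have le: "a * c = a * b + a * d" using tz by metis
      have "a * b - a * c = 0"
      proof (cases "a * c <= a * b")
        case True
        then have "a * b = a * c" using le le_add[of "a * b" "a * d"] irrefl trans
          unfolding less_eq_mnum_def by metis
        then show ?thesis using minus_eq[of "a * b" "a * c" 0] ac z by metis
      qed (rule minus0)
      moreover have "a * 0 = 0" using tz by metis
      ultimately show ?thesis using minus0[OF False] by simp
    qed
  qed
qed

end

lifting_forget mnum.lifting

\<comment> \<open>Formal differences of numbers, the integers of the model: \<open>fract\<close>
  builds fractions over an integral domain, so negative numbers come first.\<close>
quotient_type mint = "mnum \<times> mnum" / "%x y. fst x + snd y = fst y + snd x"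
  morphisms Rep_mint Abs_mint
proof (rule equivpI)
  show "reflp (%x y :: mnum \<times> mnum. fst x + snd y = fst y + snd x)" by (simp add: reflp_def)
  show "symp (%x y :: mnum \<times> mnum. fst x + snd y = fst y + snd x)" by (simp add: symp_def)
  show "transp (%x y :: mnum \<times> mnum. fst x + snd y = fst y + snd x)"
  proof (rule transpI)
    fix x y w :: "mnum \<times> mnum"
    assume "fst x + snd y = fst y + snd x" "fst y + snd w = fst w + snd y"
    then have "(fst x + snd y) + (fst y + snd w) = (fst y + snd x) + (fst w + snd y)" by simp
    then have "(fst x + snd w) + (fst y + snd y) = (fst w + snd x) + (fst y + snd y)"
      by (simp add: ac_simps)
    then show "fst x + snd w = fst w + snd x" by simp
  qed
qed

instantiation mint :: linordered_idom
begin

lift_definition zero_mint :: mint is "(0, 0)" .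
lift_definition one_mint :: mint is "(1, 0)" .
lift_definition plus_mint :: "mint => mint => mint" is "%x y. (fst x + fst y, snd x + snd y)"
  by (simp add: algebra_simps) (metis add.assoc add.commute)
lift_definition uminus_mint :: "mint => mint" is "%x. (snd x, fst x)"
  by (simp add: add.commute)
lift_definition minus_mint :: "mint => mint => mint" is "%x y. (fst x + snd y, snd x + fst y)"
  by (simp add: algebra_simps) (metis add.assoc add.commute)
lift_definition times_mint :: "mint => mint => mint" is
  "%x y. (fst x * fst y + snd x * snd y, fst x * snd y + snd x * fst y)"
proof -
  fix x x' y y' :: "mnum \<times> mnum"
  obtain a b a' b' c d c' d' where e: "x = (a, b)" "x' = (a', b')" "y = (c, d)" "y' = (c', d')"
    by (cases x, cases x', cases y, cases y')
  assume "fst x + snd x' = fst x' + snd x" "fst y + snd y' = fst y' + snd y"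
  then have xy: "a + b' = a' + b" "c + d' = c' + d" by (simp_all add: e)
  \<comment> \<open>The first hypothesis is multiplied by \<open>c\<close> and \<open>d\<close>, the
    second by \<open>a'\<close> and \<open>b'\<close>. In the sum the mixed products
    \<open>a' * c\<close>, \<open>a' * d\<close>, \<open>b' * c\<close>, \<open>b' * d\<close> occur
    on both sides and cancel.\<close>
  have "(a + b') * c + (a' + b) * d + a' * (c + d') + b' * (c' + d)
    = (a' + b) * c + (a + b') * d + a' * (c' + d) + b' * (c + d')"
    unfolding xy by simp
  then have "((a * c + b * d) + (a' * d' + b' * c')) + (a' * c + a' * d + b' * c + b' * d) =
      ((a' * c' + b' * d') + (a * d + b * c)) + (a' * c + a' * d + b' * c + b' * d)"
    by (simp add: algebra_simps)
  then have "(a * c + b * d) + (a' * d' + b' * c') = (a' * c' + b' * d') + (a * d + b * c)"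
    by (rule add_right_imp_eq)
  then show "fst (fst x * fst y + snd x * snd y, fst x * snd y + snd x * fst y) +
      snd (fst x' * fst y' + snd x' * snd y', fst x' * snd y' + snd x' * fst y') =
    fst (fst x' * fst y' + snd x' * snd y', fst x' * snd y' + snd x' * fst y') +
      snd (fst x * fst y + snd x * snd y, fst x * snd y + snd x * fst y)"
    by (simp add: e)
qed
lift_definition less_eq_mint :: "mint => mint => bool" is "%x y. fst x + snd y <= fst y + snd x"
proof -
  have *: "fst x' + snd y' <= fst y' + snd x'"
    if "fst x + snd x' = fst x' + snd x" "fst y + snd y' = fst y' + snd y" "fst x + snd y <= fst y + snd x"
    for x x' y y' :: "mnum \<times> mnum"
  proof -
    have "(fst x' + snd y') + (snd x + fst y) = (fst x + snd y) + (snd x' + fst y')"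
      using that(1,2) by (metis add.assoc add.commute)
    also have "\<dots> <= (fst y + snd x) + (snd x' + fst y')" using that(3) by simp
    also have "\<dots> = (fst y' + snd x') + (snd x + fst y)" by (simp add: ac_simps)
    finally show ?thesis by simp
  qed
  show "!!x x' y y' :: mnum \<times> mnum. fst x + snd x' = fst x' + snd x ==> fst y + snd y' = fst y' + snd y ==>
      (fst x + snd y <= fst y + snd x) = (fst x' + snd y' <= fst y' + snd x')"
    by (metis *)
qed
definition less_mint :: "mint => mint => bool" where "a < b \<longleftrightarrow> a <= b \<and> \<not> b <= (a :: mint)"
definition abs_mint :: "mint => mint" where "\<bar>a\<bar> = (if a < 0 then - a else (a :: mint))"
definition sgn_mint :: "mint => mint" where "sgn a = (if a = 0 then 0 else if 0 < a then 1 else (- 1 :: mint))"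

instance
proof
  fix a b c :: mint
  show "a + b + c = a + (b + c)" "a + b = b + a" "0 + a = a" "- a + a = 0" "a - b = a + - b"
    by (transfer, simp add: algebra_simps)+
  show "a * b * c = a * (b * c)" "a * b = b * a" "1 * a = a" "(a + b) * c = a * c + b * c"
    by (transfer, simp add: algebra_simps)+
  show "a + b - a = b" "a - b - c = a - (b + c)" "0 * a = 0" "a * 0 = 0"
    by (transfer, simp add: algebra_simps)+
  show "(0 :: mint) ~= 1" by transfer simp
  show "a <= a" "a <= b \<or> b <= a" by (transfer, auto)+
  show "(a < b) = (a <= b \<and> \<not> b <= a)" by (simp add: less_mint_def)
  show "a <= b ==> b <= a ==> a = b" by transfer simp
  show "a <= c" if "a <= b" "b <= c"
    using that
  proof transfer
    fix a b c :: "mnum \<times> mnum"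
    assume "fst a + snd b <= fst b + snd a" "fst b + snd c <= fst c + snd b"
    then have "(fst a + snd b) + (fst b + snd c) <= (fst b + snd a) + (fst c + snd b)" by (rule add_mono)
    then have "(fst a + snd c) + (fst b + snd b) <= (fst c + snd a) + (fst b + snd b)" by (simp add: ac_simps)
    then show "fst a + snd c <= fst c + snd a" by simp
  qed
  show "c + a <= c + b" if "a <= b"
    using that
  proof transfer
    fix a b c :: "mnum \<times> mnum"
    assume "fst a + snd b <= fst b + snd a"
    then have "(fst c + snd c) + (fst a + snd b) <= (fst c + snd c) + (fst b + snd a)"
      by (rule add_left_mono)
    then show "fst (fst c + fst a, snd c + snd a) + snd (fst c + fst b, snd c + snd b)
      <= fst (fst c + fst b, snd c + snd b) + snd (fst c + fst a, snd c + snd a)"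
      by (simp add: ac_simps)
  qed
  show "c * a < c * b" if "a < b" "0 < c"
  proof -
    have "0 <= c \<and> \<not> c <= 0 ==> a <= b \<and> \<not> b <= a ==> c * a <= c * b \<and> \<not> c * b <= c * a"
    proof transfer
      fix a b c :: "mnum \<times> mnum"
      obtain a1 a2 b1 b2 c1 c2 where e: "a = (a1, a2)" "b = (b1, b2)" "c = (c1, c2)"
        by (cases a, cases b, cases c)
      assume "fst (0, 0) + snd c <= fst c + snd (0, 0) \<and> \<not> fst c + snd (0, 0) <= fst (0, 0) + snd c"
        "fst a + snd b <= fst b + snd a \<and> \<not> fst b + snd a <= fst a + snd b"
      then have lt: "c2 < c1" "a1 + b2 < b1 + a2" by (auto simp: e)
      \<comment> \<open>The positive multiplier is the number \<open>d\<close>; the terms with the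
        common part \<open>c2\<close> are the same on both sides and are collected in
        \<open>?r\<close>.\<close>
      define d where "d = c1 - c2"
      have d: "c1 = c2 + d" "0 < d"
      proof -
        show "c1 = c2 + d" using lt(1) by (simp add: d_def)
        then show "0 < d" using lt(1) by (metis add.right_neutral add_less_cancel_left)
      qed
      have "d * (a1 + b2) < d * (b1 + a2)" using lt(2) d(2) by (rule mult_strict_left_mono)
      then have "(c1 * a1 + c2 * a2) + (c1 * b2 + c2 * b1) < (c1 * b1 + c2 * b2) + (c1 * a2 + c2 * a1)"
      proof -
        let ?r = "c2 * a1 + c2 * a2 + c2 * b1 + c2 * b2"
        assume "d * (a1 + b2) < d * (b1 + a2)"
        then have "d * (a1 + b2) + ?r < d * (b1 + a2) + ?r" by simp
        then show ?thesis unfolding d(1) by (simp add: algebra_simps)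
      qed
      then show "fst (fst c * fst a + snd c * snd a, fst c * snd a + snd c * fst a) +
         snd (fst c * fst b + snd c * snd b, fst c * snd b + snd c * fst b)
         <= fst (fst c * fst b + snd c * snd b, fst c * snd b + snd c * fst b) +
            snd (fst c * fst a + snd c * snd a, fst c * snd a + snd c * fst a) \<and>
         \<not> fst (fst c * fst b + snd c * snd b, fst c * snd b + snd c * fst b) +
            snd (fst c * fst a + snd c * snd a, fst c * snd a + snd c * fst a)
            <= fst (fst c * fst a + snd c * snd a, fst c * snd a + snd c * fst a) +
               snd (fst c * fst b + snd c * snd b, fst c * snd b + snd c * fst b)"
        unfolding less_le_not_le e fst_conv snd_conv .
    qed
    then show ?thesis using that unfolding less_mint_def by blast
  qed
  show "\<bar>a\<bar> = (if a < 0 then - a else a)" by (rule abs_mint_def)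
  show "sgn a = (if a = 0 then 0 else if 0 < a then 1 else - 1)" by (rule sgn_mint_def)
qed

end

lift_definition mint_of :: "mnum => mint" is "%a. (a, 0)" .

lemma mint_of_simps:
  "mint_of 0 = 0" "mint_of 1 = 1" "mint_of (a + b) = mint_of a + mint_of b"
  "mint_of (a * b) = mint_of a * mint_of b" "mint_of a = mint_of b \<longleftrightarrow> a = b"
  "mint_of a <= mint_of b \<longleftrightarrow> a <= b"
  by (transfer, simp)+

lemma mint_diff: "\<exists>a b. x = mint_of a - mint_of b"
  by transfer (metis add.commute add.right_neutral add_0 fst_conv snd_conv surj_pair)

definition num :: "tm => mint fract" where "num a = Fract (mint_of (Abs_mnum a)) 1"

lemma num_simps:
  "num mz = 0" "num mu' = 1"
  "a \<in> mC ==> b \<in> mC ==> num (mp a b) = num a + num b"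
  "a \<in> mC ==> b \<in> mC ==> num (mt a b) = num a * num b"
  "a \<in> mC ==> b \<in> mC ==> num a = num b \<longleftrightarrow> a = b"
  "a \<in> mC ==> b \<in> mC ==> num a < num b \<longleftrightarrow> ml a b"
proof -
  have 0: "Abs_mnum mz = 0" "Abs_mnum mu' = 1" by (simp_all add: zero_mnum_def one_mnum_def)
  show "num mz = 0" "num mu' = 1" by (simp_all add: num_def 0 mint_of_simps Zero_fract_def One_fract_def)
  show "num (mp a b) = num a + num b" if "a \<in> mC" "b \<in> mC"
  proof -
    have "Abs_mnum (mp a b) = Abs_mnum a + Abs_mnum b"
      using that by (simp add: plus_mnum_def Abs_mnum_inverse)
    then show ?thesis by (simp add: num_def mint_of_simps)
  qed
  show "num (mt a b) = num a * num b" if "a \<in> mC" "b \<in> mC"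
  proof -
    have "Abs_mnum (mt a b) = Abs_mnum a * Abs_mnum b"
      using that by (simp add: times_mnum_def Abs_mnum_inverse)
    then show ?thesis by (simp add: num_def mint_of_simps)
  qed
  show "num a = num b \<longleftrightarrow> a = b" if "a \<in> mC" "b \<in> mC"
    using that by (simp add: num_def eq_fract mint_of_simps Abs_mnum_inject)
  show "num a < num b \<longleftrightarrow> ml a b" if "a \<in> mC" "b \<in> mC"
  proof -
    have "ml a b \<longleftrightarrow> Abs_mnum a < Abs_mnum b" using that by (simp add: less_mnum_def Abs_mnum_inverse)
    also have "\<dots> \<longleftrightarrow> mint_of (Abs_mnum a) < mint_of (Abs_mnum b)"
      by (simp add: mint_of_simps flip: not_le)
    finally show ?thesis by (simp add: num_def)
  qed
qed

text \<open>A change of signs makes the denominator positive, and a positive element of the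
  discretely ordered integers is the successor of a number; hence the form
  \<open>num d + 1\<close>.\<close>

lemma num_frac: "\<exists>p\<in>mC. \<exists>m\<in>mC. \<exists>d\<in>mC. x = (num p - num m) / (num d + 1)"
proof -
  obtain y w where x: "x = Fract y w" "0 < w"
  proof -
    obtain a b where ab: "x = Fract a b" "b ~= 0" by (cases x) auto
    then have "x = Fract (- a) (- b)" by simp
    then show ?thesis using ab that[of a b] that[of "- a" "- b"] by (cases "0 < b") auto
  qed
  obtain a b where y: "y = mint_of a - mint_of b" using mint_diff by blast
  obtain c d where w: "w = mint_of c - mint_of d" using mint_diff by blast
  have "d < c" using x(2) w by (simp add: mint_of_simps flip: not_le)
  then obtain k where k: "c = (d + k) + 1"
  proof -
    have "ml (Rep_mnum d) (Rep_mnum c)" using \<open>d < c\<close> by (simp add: less_mnum_def)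
    then obtain k where "k \<in> mC" "Rep_mnum c = mp (mp (Rep_mnum d) k) mu'"
      using M.l_diff[OF Rep_mnum Rep_mnum] by blast
    then have "c = (d + Abs_mnum k) + 1"
      by (metis Abs_mnum_inverse Rep_mnum_inverse one_mnum.rep_eq plus_mnum.rep_eq)
    then show ?thesis by (rule that)
  qed
  then have w': "w = mint_of k + 1" by (simp add: w mint_of_simps)
  let ?n = "%a. num (Rep_mnum a)"
  have n: "?n a = Fract (mint_of a) 1" for a by (simp add: num_def Rep_mnum_inverse)
  have "0 < w" using x(2) .
  then have "x = Fract y 1 / Fract w 1" by (simp add: x)
  also have "Fract y 1 = ?n a - ?n b" by (simp add: n y)
  also have "Fract w 1 = ?n k + 1" by (simp add: n w' One_fract_def)
  finally show ?thesis using Rep_mnum by blast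
qed

section \<open>Definability in a model\<close>

locale field_model = aca_model D ap cv ltr
  for D :: "ty => 'd set" and ap cv and ltr :: "'d => 'd => bool" +
  fixes num :: "'d => 'k::linordered_field"
  assumes num_zr: "num zr = 0" and num_on: "num on = 1"
    and num_pl: "a \<in> C ==> b \<in> C ==> num (pl a b) = num a + num b"
    and num_ti: "a \<in> C ==> b \<in> C ==> num (ti a b) = num a * num b"
    and num_eq: "a \<in> C ==> b \<in> C ==> num a = num b \<longleftrightarrow> a = b"
    and num_less: "a \<in> C ==> b \<in> C ==> num a < num b \<longleftrightarrow> ltr a b"
    and num_frac: "\<exists>p\<in>C. \<exists>m\<in>C. \<exists>d\<in>C. x = (num p - num m) / (num d + 1)"
begin

definition nv :: "'k => 'd" where "nv n = (if n \<in> num ` C then inv_into C num n else zr)"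

lemma nv_in [simp]: "nv n \<in> C"
  by (auto simp: nv_def inv_into_into)

lemma num_nv: "n \<in> num ` C ==> num (nv n) = n"
  by (auto simp: nv_def f_inv_into_f)

lemma nv_num [simp]: "a \<in> C ==> nv (num a) = a"
  using num_nv[of "num a"] num_eq[of "nv (num a)" a] by auto

text \<open>In combinators, \<open>S Plus (S K K)\<close>. The construction repeats that of
  \<open>double_tm\<close>, and \<open>pwf\<close> that of \<open>pow2_tm\<close>, so that the
  powers of 2 in formulas evaluate to \<open>pw\<close>.\<close>

definition dbl :: 'd where
  "dbl = ap (ap (cv (CombS Nt Nt Nt)) (cv Plus))
     (ap (ap (cv (CombS Nt ty1 Nt)) (cv (CombK Nt ty1))) (cv (CombK Nt Nt)))"

definition pwf :: 'd where "pwf = ap (ap (cv Rec0) (ap (cv (CombK ty1 Nt)) dbl)) on"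

definition pw :: "'k => 'k" where "pw n = num (ap pwf (nv n))"

lemma S_in: "cv (CombS \<rho> \<sigma> \<tau>) \<in> D ((\<rho> \<Rrightarrow> \<sigma> \<Rrightarrow> \<tau>) \<Rrightarrow> (\<rho> \<Rrightarrow> \<sigma>) \<Rrightarrow> \<rho> \<Rrightarrow> \<tau>)"
  using cv_in[of "CombS \<rho> \<sigma> \<tau>"] by simp

lemma Plus_in: "cv Plus \<in> D (Nt \<Rrightarrow> Nt \<Rrightarrow> Nt)" and Times_in: "cv Times \<in> D (Nt \<Rrightarrow> Nt \<Rrightarrow> Nt)"
  using cv_in[of Plus] cv_in[of Times] by auto

lemma SKK_in: "ap (ap (cv (CombS \<rho> (\<rho> \<Rrightarrow> \<rho>) \<rho>)) (cv (CombK \<rho> (\<rho> \<Rrightarrow> \<rho>)))) (cv (CombK \<rho> \<rho>)) \<in> D (\<rho> \<Rrightarrow> \<rho>)"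
  by (rule ap_in[OF ap_in[OF S_in K_in] K_in])

lemma SKK: "x \<in> D \<rho> ==>
    ap (ap (ap (cv (CombS \<rho> (\<rho> \<Rrightarrow> \<rho>) \<rho>)) (cv (CombK \<rho> (\<rho> \<Rrightarrow> \<rho>)))) (cv (CombK \<rho> \<rho>))) x = x"
  by (subst ap_S[OF K_in K_in]) (auto intro!: ap_K ap_in[OF K_in])

lemma dbl_in: "dbl \<in> D ty1" and dbl: "m \<in> C ==> ap dbl m = pl m m"
  unfolding dbl_def using ap_in[OF ap_in[OF S_in Plus_in] SKK_in] ap_S[OF Plus_in SKK_in] SKK by auto

lemma Kdbl_in: "ap (cv (CombK ty1 Nt)) dbl \<in> D (Nt \<Rrightarrow> Nt \<Rrightarrow> Nt)"
  by (rule ap_in[OF K_in dbl_in])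

lemma pwf_in: "pwf \<in> D ty1"
  unfolding pwf_def by (intro rec_in Kdbl_in on_in)

lemma pwf_S: "n \<in> C ==> ap pwf (pl n on) = pl (ap pwf n) (ap pwf n)" and pwf_z: "ap pwf zr = on"
proof -
  show "ap pwf zr = on" unfolding pwf_def by (rule rec_zero[OF Kdbl_in on_in])
  assume n: "n \<in> C"
  have "ap pwf n \<in> C" using pwf_in ap_in n by blast
  then show "ap pwf (pl n on) = pl (ap pwf n) (ap pwf n)"
    using n unfolding pwf_def by (subst rec_suc[OF Kdbl_in on_in]) (simp_all add: ap_K[OF dbl_in] dbl)
qed

abbreviation (input) fitD :: "ty => 'd => bool" where "fitD \<equiv> %\<sigma> x. x \<in> D \<sigma>"

text \<open>In \<open>DF \<Gamma> \<tau> F\<close> the variable that is bound first comes first, so that abstraction is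
  definitional.\<close>

primrec DF :: "ty list => ty => ('d list => 'd) => bool" where
  "DF [] \<tau> F \<longleftrightarrow> F [] \<in> D \<tau>"
| "DF (\<sigma> # \<Gamma>) \<tau> F \<longleftrightarrow> (\<exists>H. DF \<Gamma> (\<sigma> \<Rrightarrow> \<tau>) H \<and>
    (\<forall>l x. list_all2 fitD \<Gamma> l --> x \<in> D \<sigma> --> F (x # l) = ap (H l) x))"

lemma DF_in: "DF \<Gamma> \<tau> F ==> list_all2 fitD \<Gamma> l ==> F l \<in> D \<tau>"
  by (induction \<Gamma> arbitrary: \<tau> F l) (auto simp: list_all2_Cons1, use ap_in in blast)

lemma DF_const: "a \<in> D \<tau> ==> DF \<Gamma> \<tau> (%_. a)"
proof (induction \<Gamma> arbitrary: \<tau> a)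
  case (Cons \<sigma> \<Gamma>)
  have "DF \<Gamma> (\<sigma> \<Rrightarrow> \<tau>) (%_. ap (cv (CombK \<tau> \<sigma>)) a)" using Cons ap_in K_in by blast
  then show ?case using ap_K Cons.prems by auto
qed simp

text \<open>Combinatory completeness, one variable at a time: applications are abstracted by
  \<open>S\<close>, as constants are by \<open>K\<close> and the variable itself by
  \<open>S K K\<close>.\<close>

lemma DF_app: "DF \<Gamma> (\<sigma> \<Rrightarrow> \<tau>) F ==> DF \<Gamma> \<sigma> G ==> DF \<Gamma> \<tau> (%l. ap (F l) (G l))"
proof (induction \<Gamma> arbitrary: \<sigma> \<tau> F G)
  case Nil
  then show ?case by (auto intro: ap_in)
next
  case (Cons \<rho> \<Gamma>)
  obtain HF where HF: "DF \<Gamma> (\<rho> \<Rrightarrow> \<sigma> \<Rrightarrow> \<tau>) HF"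
    "!!l x. list_all2 fitD \<Gamma> l ==> x \<in> D \<rho> ==> F (x # l) = ap (HF l) x" using Cons.prems(1) by auto
  obtain HG where HG: "DF \<Gamma> (\<rho> \<Rrightarrow> \<sigma>) HG"
    "!!l x. list_all2 fitD \<Gamma> l ==> x \<in> D \<rho> ==> G (x # l) = ap (HG l) x" using Cons.prems(2) by auto
  have "DF \<Gamma> (\<rho> \<Rrightarrow> \<tau>) (%l. ap (ap (cv (CombS \<rho> \<sigma> \<tau>)) (HF l)) (HG l))"
    by (rule Cons.IH[OF Cons.IH[OF DF_const[OF S_in] HF(1)] HG(1)])
  moreover have "ap (F (x # l)) (G (x # l)) = ap (ap (ap (cv (CombS \<rho> \<sigma> \<tau>)) (HF l)) (HG l)) x"
    if "list_all2 fitD \<Gamma> l" "x \<in> D \<rho>" for l x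
    using that ap_S[OF DF_in[OF HF(1)] DF_in[OF HG(1)]] HF(2) HG(2) by simp
  ultimately show ?case by auto
qed

lemma DF_weak: assumes "DF \<Gamma> \<tau> F" shows "DF (\<sigma> # \<Gamma>) \<tau> (%l. F (tl l))"
proof -
  have "DF \<Gamma> (\<sigma> \<Rrightarrow> \<tau>) (%l. ap (cv (CombK \<tau> \<sigma>)) (F l))" by (rule DF_app[OF DF_const[OF K_in] assms])
  then show ?thesis using ap_K DF_in[OF assms] by auto
qed

lemma DF_weaks: "DF \<Gamma> \<tau> F ==> DF (\<Delta> @ \<Gamma>) \<tau> (%l. F (drop (length \<Delta>) l))"
proof (induction \<Delta>)
  case (Cons \<sigma> \<Delta>)
  from DF_weak[OF Cons.IH[OF Cons.prems]] show ?case by (simp add: drop_Suc)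
qed simp

lemma DF_hd: "DF (\<sigma> # \<Gamma>) \<sigma> hd"
  using DF_const[OF SKK_in, of \<Gamma> \<sigma>] SKK by auto

text \<open>Environments append a new variable at the end while \<open>DF\<close> binds the head of
  its list; \<open>rev\<close> mediates.\<close>

definition DfN :: "ty list => ('d list => 'k) => bool" where
  "DfN \<Gamma> F \<longleftrightarrow> (\<exists>F0. DF (rev \<Gamma>) Nt F0 \<and> (\<forall>l. list_all2 fitD \<Gamma> l --> F l = num (F0 (rev l))))"

lemma fit_rev: "list_all2 fitD (rev \<Gamma>) (rev l) \<longleftrightarrow> list_all2 fitD \<Gamma> l"
  by (rule list_all2_rev)

lemma DfN_map2:
  assumes "DfN \<Gamma> F" "DfN \<Gamma> G" "h \<in> D (Nt \<Rrightarrow> Nt \<Rrightarrow> Nt)"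
    "!!a b. a \<in> C ==> b \<in> C ==> num (ap (ap h a) b) = f (num a) (num b)"
  shows "DfN \<Gamma> (%l. f (F l) (G l))"
proof -
  obtain F0 G0 where F0: "DF (rev \<Gamma>) Nt F0" "!!l. list_all2 fitD \<Gamma> l ==> F l = num (F0 (rev l))"
    and G0: "DF (rev \<Gamma>) Nt G0" "!!l. list_all2 fitD \<Gamma> l ==> G l = num (G0 (rev l))"
    using assms(1,2) unfolding DfN_def by auto
  have "DF (rev \<Gamma>) Nt (%l. ap (ap h (F0 l)) (G0 l))"
    by (rule DF_app[OF DF_app[OF DF_const[OF assms(3)] F0(1)] G0(1)])
  moreover have "f (F l) (G l) = num (ap (ap h (F0 (rev l))) (G0 (rev l)))" if "list_all2 fitD \<Gamma> l" for l
    using that F0(2) G0(2) assms(4) DF_in[OF F0(1), of "rev l"] DF_in[OF G0(1), of "rev l"] fit_rev by simp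
  ultimately show ?thesis unfolding DfN_def by blast
qed

lemma num_nonneg: "a \<in> C ==> 0 <= num a"
  using num_less[of a zr] num_zr by (simp add: not_less[symmetric])

lemma Rec_in: "f \<in> D (Nt \<Rrightarrow> Nt \<Rrightarrow> Nt) ==> ap (cv Rec0) f \<in> D (Nt \<Rrightarrow> Nt \<Rrightarrow> Nt)"
  using cv_in[of Rec0] by (auto intro: ap_in)

lemma num_ms: assumes "a \<in> C" "b \<in> C"
  shows "num (ap (msf a) b) = (if num b <= num a then num a - num b else 0)"
proof (cases "num b <= num a")
  case True
  then have "ltr b a \<or> b = a" using num_less[of b a] num_eq[of b a] assms by (auto simp: le_less)
  then have "pl b (ap (msf a) b) = a" using ms_le assms by blast
  then have "num b + num (ap (msf a) b) = num a" using num_pl[of b "ap (msf a) b"] ms_in assms by simp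
  then show ?thesis using True by (simp add: algebra_simps)
next
  case False
  then have "ltr a b" using num_less[of a b] assms by auto
  then show ?thesis using ms_gt[of a b] assms num_zr False by simp
qed

text \<open>All elements of the model may be used as constants, among them a functional from
  \<open>mu_exists\<close>, so \<open>okc\<close> imposes no condition on the sorts.\<close>

sublocale definability "num ` C" pw DfN fitD "%_. True" Nt nv
proof
  show "0 \<in> num ` C" "1 \<in> num ` C" using num_zr num_on by (metis imageI zr_in, metis imageI on_in)
  show "a + b \<in> num ` C" "a * b \<in> num ` C" if "a \<in> num ` C" "b \<in> num ` C" for a b
    using that num_pl[symmetric] num_ti[symmetric] by auto
  show "0 <= a" if "a \<in> num ` C" for a using that num_nonneg by auto
  have diff: "b - a - 1 \<in> num ` C" if h: "a \<in> num ` C" "b \<in> num ` C" "a < b" for a b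
  proof -
    obtain x y where xy: "x \<in> C" "y \<in> C" "a = num x" "b = num y" using h by auto
    then obtain z where "z \<in> C" "y = pl (pl x z) on" using lt_diff[of x y] num_less h by auto
    then have "b - a - 1 = num z" using xy by (simp add: num_pl num_on)
    then show ?thesis using \<open>z \<in> C\<close> by blast
  qed
  show "b - a \<in> num ` C" if ab: "a \<in> num ` C" "b \<in> num ` C" "a <= b" for a b
  proof (cases "a = b")
    case True
    then show ?thesis using num_zr by (metis diff_self imageI zr_in)
  next
    case False
    then obtain z where "z \<in> C" "b - a - 1 = num z" using diff[of a b] ab by auto
    then have "b - a = num (pl z on)" by (simp add: num_pl num_on)
    then show ?thesis using \<open>z \<in> C\<close> by simp
  qed
  show "1 <= a" if a: "a \<in> num ` C" "0 < a" for a
  proof -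
    have "0 \<in> num ` C" using num_zr by (metis imageI zr_in)
    then obtain z where "z \<in> C" "a - 0 - 1 = num z" using diff[of 0 a] a by auto
    then show ?thesis using num_nonneg[of z] by simp
  qed
  show "\<exists>p\<in>num ` C. \<exists>m\<in>num ` C. \<exists>d\<in>num ` C. x = (p - m) / (d + 1)" for x using num_frac[of x] by auto
  show "pw 0 = 1" using pwf_z num_on nv_num[OF zr_in] by (simp add: pw_def num_zr)
  have ap_pwf: "ap pwf a \<in> C" if "a \<in> C" for a using pwf_in ap_in that by blast
  show "pw n \<in> num ` C" if "n \<in> num ` C" for n using ap_pwf by (simp add: pw_def)
  show "pw (n + 1) = 2 * pw n" if h: "n \<in> num ` C" for n
  proof -
    obtain a where a: "a \<in> C" "n = num a" using h by auto
    then have "nv (n + 1) = pl a on" using nv_num[of "pl a on"] by (simp add: num_pl num_on)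
    then show ?thesis using a ap_pwf by (simp add: pw_def pwf_S num_pl)
  qed
  show "nv n \<in> D Nt" for n by simp
  show "\<exists>\<Gamma> l. True \<and> list_all2 fitD \<Gamma> l" by (intro exI[of _ "[]"]) simp
  show "F l \<in> num ` C" if "DfN \<Gamma> F" "list_all2 fitD \<Gamma> l" for \<Gamma> F l
    using that DF_in fit_rev unfolding DfN_def by blast
  show "DfN \<Gamma> (%_. c)" if "c \<in> num ` C" for \<Gamma> c
    using that DF_const unfolding DfN_def by blast
  show "\<exists>F. DfN (\<Gamma> @ [Nt]) F \<and> (\<forall>l n. list_all2 fitD \<Gamma> l --> n \<in> num ` C --> F (l @ [nv n]) = n)" for \<Gamma>
  proof (intro exI[of _ "%l. num (hd (rev l))"] conjI)
    show "DfN (\<Gamma> @ [Nt]) (%l. num (hd (rev l)))"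
      unfolding DfN_def using DF_hd[of Nt "rev \<Gamma>"] by (intro exI[of _ hd]) simp
  qed (use num_nv in simp)
  show "\<exists>G. DfN (\<Gamma> @ [s]) G \<and> (\<forall>l a. list_all2 fitD \<Gamma> l --> a \<in> D s --> G (l @ [a]) = F l)"
    if h: "DfN \<Gamma> F" for \<Gamma> F s
  proof -
    obtain F0 where F0: "DF (rev \<Gamma>) Nt F0" "!!l. list_all2 fitD \<Gamma> l ==> F l = num (F0 (rev l))"
      using h unfolding DfN_def by auto
    have "DfN (\<Gamma> @ [s]) (%l. num (F0 (tl (rev l))))"
      unfolding DfN_def using DF_weak[OF F0(1), of s] by (intro exI[of _ "%l. F0 (tl l)"]) simp
    then show ?thesis using F0(2) by (intro exI[of _ "%l. num (F0 (tl (rev l)))"]) simp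
  qed
  show "DfN \<Gamma> (%l. F l + G l)" if "DfN \<Gamma> F" "DfN \<Gamma> G" for \<Gamma> F G
    by (rule DfN_map2[OF that Plus_in]) (simp add: num_pl)
  show "DfN \<Gamma> (%l. F l * G l)" if "DfN \<Gamma> F" "DfN \<Gamma> G" for \<Gamma> F G
    by (rule DfN_map2[OF that Times_in]) (simp add: num_ti)
  show "DfN \<Gamma> (%l. if G l <= F l then F l - G l else 0)" if "DfN \<Gamma> F" "DfN \<Gamma> G" for \<Gamma> F G
    by (rule DfN_map2[OF that Rec_in[OF Kprd_in], of "%a b. if b <= a then a - b else 0"])
      (simp add: num_ms flip: msf_def)
  show "DfN \<Gamma> (%l. pw (F l))" if h: "DfN \<Gamma> F" for \<Gamma> F
  proof -
    obtain F0 where F0: "DF (rev \<Gamma>) Nt F0" "!!l. list_all2 fitD \<Gamma> l ==> F l = num (F0 (rev l))"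
      using h unfolding DfN_def by auto
    have "pw (F l) = num (ap pwf (F0 (rev l)))" if "list_all2 fitD \<Gamma> l" for l
      using that F0 DF_in[OF F0(1), of "rev l"] fit_rev by (simp add: pw_def)
    then show ?thesis using DF_app[OF DF_const[OF pwf_in] F0(1)] unfolding DfN_def by blast
  qed
  show "\<exists>H. DfN (\<Gamma> @ \<Delta>) H \<and> (\<forall>l l'. list_all2 fitD \<Gamma> l --> list_all2 fitD \<Delta> l' -->
        H (l @ l') = F (l @ [nv (G (l @ l')), nv (G' (l @ l'))]))"
    if F: "DfN (\<Gamma> @ [Nt, Nt]) F" and G: "DfN (\<Gamma> @ \<Delta>) G" and G': "DfN (\<Gamma> @ \<Delta>) G'" for \<Gamma> \<Delta> F G G'
  proof -
    obtain F0 where F0: "DF (Nt # Nt # rev \<Gamma>) Nt F0"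
      "!!l. list_all2 fitD (\<Gamma> @ [Nt, Nt]) l ==> F l = num (F0 (rev l))"
      using F unfolding DfN_def by auto
    \<comment> \<open>Both number variables are abstracted; the resulting object is weakened by
      \<open>\<Delta>\<close> and applied to the two values.\<close>
    obtain H where H: "DF (rev \<Gamma>) (Nt \<Rrightarrow> Nt \<Rrightarrow> Nt) H"
      "!!l x y. list_all2 fitD (rev \<Gamma>) l ==> x \<in> C ==> y \<in> C ==> F0 (y # x # l) = ap (ap (H l) x) y"
      using F0(1) by (auto simp: list_all2_Cons1)
    obtain G0 where G0: "DF (rev (\<Gamma> @ \<Delta>)) Nt G0"
      "!!l. list_all2 fitD (\<Gamma> @ \<Delta>) l ==> G l = num (G0 (rev l))" using G unfolding DfN_def by auto
    obtain G1 where G1: "DF (rev (\<Gamma> @ \<Delta>)) Nt G1"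
      "!!l. list_all2 fitD (\<Gamma> @ \<Delta>) l ==> G' l = num (G1 (rev l))" using G' unfolding DfN_def by auto
    have "DF (rev (\<Gamma> @ \<Delta>)) Nt (%l. ap (ap (H (drop (length \<Delta>) l)) (G0 l)) (G1 l))"
      using DF_app[OF DF_app[OF DF_weaks[OF H(1), of "rev \<Delta>"]]] G0(1) G1(1) by simp
    moreover have "num (ap (ap (H (drop (length \<Delta>) (rev (l @ l')))) (G0 (rev (l @ l')))) (G1 (rev (l @ l')))) =
        F (l @ [nv (G (l @ l')), nv (G' (l @ l'))])" if l: "list_all2 fitD \<Gamma> l" "list_all2 fitD \<Delta> l'" for l l'
    proof -
      have ll: "list_all2 fitD (\<Gamma> @ \<Delta>) (l @ l')" using l by (rule list_all2_appendI)
      then have in_: "G0 (rev (l @ l')) \<in> C" "G1 (rev (l @ l')) \<in> C"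
        using DF_in[OF G0(1)] DF_in[OF G1(1)] fit_rev by blast+
      have "length l' = length \<Delta>" using l(2) by (simp add: list_all2_lengthD)
      moreover have "list_all2 fitD (\<Gamma> @ [Nt, Nt]) (l @ [nv (G (l @ l')), nv (G' (l @ l'))])"
        using l by (auto intro!: list_all2_appendI)
      ultimately show ?thesis
        using F0(2) G0(2)[OF ll] G1(2)[OF ll] in_ H(2)[of "rev l"] l(1) fit_rev by simp
    qed
    ultimately show ?thesis unfolding DfN_def
      by (intro exI[of _ "%l. num (ap (ap (H (drop (length \<Delta>) (rev l))) (G0 (rev l))) (G1 (rev l)))"]) blast
  qed
  show "\<exists>G. DfN \<Gamma> G \<and> (\<forall>l. list_all2 fitD \<Gamma> l -->
      ((\<exists>n\<in>num ` C. F (l @ [nv n]) = 0) -->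
        F (l @ [nv (G l)]) = 0 \<and> (\<forall>n\<in>num ` C. F (l @ [nv n]) = 0 --> G l <= n)) \<and>
      (\<not> (\<exists>n\<in>num ` C. F (l @ [nv n]) = 0) --> G l = 0))" if F: "DfN (\<Gamma> @ [Nt]) F" for \<Gamma> F
  proof -
    obtain F0 where F0: "DF (Nt # rev \<Gamma>) Nt F0"
      "!!l. list_all2 fitD (\<Gamma> @ [Nt]) l ==> F l = num (F0 (rev l))"
      using F unfolding DfN_def by auto
    obtain H where H: "DF (rev \<Gamma>) ty1 H"
      "!!l x. list_all2 fitD (rev \<Gamma>) l ==> x \<in> C ==> F0 (x # l) = ap (H l) x"
      using F0(1) by auto
    obtain \<mu> where \<mu>: "\<mu> \<in> D ty2" "!!f. f \<in> D ty1 ==> ((\<exists>n\<in>C. ap f n = zr) -->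
        ap f (ap \<mu> f) = zr \<and> (\<forall>i\<in>C. ap f i = zr --> \<not> ltr i (ap \<mu> f))) \<and>
        (\<not> (\<exists>n\<in>C. ap f n = zr) --> ap \<mu> f = zr)" using mu_exists by blast
    let ?G = "%l. num (ap \<mu> (H (rev l)))"
    have "DfN \<Gamma> ?G" unfolding DfN_def using DF_app[OF DF_const[OF \<mu>(1)] H(1)] by blast
    moreover have "((\<exists>n\<in>num ` C. F (l @ [nv n]) = 0) -->
        F (l @ [nv (?G l)]) = 0 \<and> (\<forall>n\<in>num ` C. F (l @ [nv n]) = 0 --> ?G l <= n)) \<and>
      (\<not> (\<exists>n\<in>num ` C. F (l @ [nv n]) = 0) --> ?G l = 0)" if l: "list_all2 fitD \<Gamma> l" for l
    proof -
      have rl: "list_all2 fitD (rev \<Gamma>) (rev l)" using l fit_rev by blast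
      have h: "H (rev l) \<in> D ty1" using DF_in[OF H(1) rl] .
      then have m: "ap \<mu> (H (rev l)) \<in> C" using ap_in[OF \<mu>(1)] by blast
      have apH: "ap (H (rev l)) a \<in> C" if "a \<in> C" for a using h that ap_in by blast
      have "F (l @ [a]) = num (ap (H (rev l)) a)" if "a \<in> C" for a
        using F0(2)[of "l @ [a]"] H(2)[OF rl that] that l by (simp add: list_all2_appendI)
      then have F0: "F (l @ [a]) = 0 \<longleftrightarrow> ap (H (rev l)) a = zr" if "a \<in> C" for a
        using that num_eq[OF apH[OF that] zr_in] num_zr by simp
      have "?G l <= num a \<longleftrightarrow> \<not> ltr a (ap \<mu> (H (rev l)))" if "a \<in> C" for a
        using num_less[OF that m] by (simp flip: not_less)
      then show ?thesis using \<mu>(2)[OF h] F0 m num_zr by simp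
    qed
    ultimately show ?thesis by (intro exI[of _ ?G]) blast
  qed
qed simp_all

end

context field_model begin

subsection \<open>Objects of higher type\<close>

text \<open>The counterpart of \<open>df\<close> for values of arbitrary type, needed to turn
  definable functions into objects of the model.\<close>

definition dft :: "ty list \<times> 'x set \<times> ('x => 'd list) => ty => ('x => 'd) => bool" where
  "dft c \<tau> F \<longleftrightarrow> valid c \<and> (case c of (\<Gamma>, X, \<pi>) =>
     \<exists>F0. DF (rev \<Gamma>) \<tau> F0 \<and> (\<forall>x\<in>X. F x = F0 (rev (\<pi> x))))"

lemma dft_valid: "dft c \<tau> F ==> valid c"
  by (simp add: dft_def)

lemma dft_in: "dft c \<tau> F ==> x \<in> dom c ==> F x \<in> D \<tau>"
  using fit_rev by (auto simp: dft_def valid_def split: prod.splits intro!: DF_in)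

lemma dft_const: "valid c ==> a \<in> D \<tau> ==> dft c \<tau> (%_. a)"
  by (auto simp: dft_def split: prod.splits intro!: exI[of _ "%_. a"] DF_const)

lemma dft_app:
  assumes "dft c (\<sigma> \<Rrightarrow> \<tau>) F" "dft c \<sigma> G" shows "dft c \<tau> (%x. ap (F x) (G x))"
proof -
  obtain \<Gamma> X \<pi> where c: "c = (\<Gamma>, X, \<pi>)" by (cases c)
  obtain F0 G0 where "DF (rev \<Gamma>) (\<sigma> \<Rrightarrow> \<tau>) F0" "\<forall>x\<in>X. F x = F0 (rev (\<pi> x))"
    "DF (rev \<Gamma>) \<sigma> G0" "\<forall>x\<in>X. G x = G0 (rev (\<pi> x))" using assms unfolding dft_def c by auto
  then show ?thesis using DF_app dft_valid[OF assms(1)] unfolding dft_def c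
    by (auto intro!: exI[of _ "%l. ap (F0 l) (G0 l)"])
qed

lemma dft_weakv:
  assumes "dft c \<tau> F" "!!a. a \<in> A ==> i a \<in> D s" shows "dft (pushv s A i c) \<tau> (%p. F (fst p))"
proof -
  obtain \<Gamma> X \<pi> where c: "c = (\<Gamma>, X, \<pi>)" by (cases c)
  obtain F0 where "DF (rev \<Gamma>) \<tau> F0" "\<forall>x\<in>X. F x = F0 (rev (\<pi> x))" using assms unfolding dft_def c by auto
  moreover have "valid (pushv s A i c)" using valid_pushv[OF dft_valid[OF assms(1)]] assms(2) by blast
  ultimately show ?thesis using DF_weak[of "rev \<Gamma>" \<tau> F0 s] unfolding dft_def c pushv_def
    by (auto simp del: DF.simps intro!: exI[of _ "%l. F0 (tl l)"])
qed

lemma dft_var: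
  assumes "valid c" "!!a. a \<in> A ==> i a \<in> D s" shows "dft (pushv s A i c) s (%p. i (snd p))"
proof -
  obtain \<Gamma> X \<pi> where c: "c = (\<Gamma>, X, \<pi>)" by (cases c)
  have "valid (pushv s A i c)" using valid_pushv[OF assms(1)] assms(2) by blast
  then show ?thesis using DF_hd[of s "rev \<Gamma>"] unfolding dft_def c pushv_def
    by (auto simp del: DF.simps intro!: exI[of _ hd])
qed

text \<open>Comprehension: \<open>DF\<close> for a longer list means that the first variable is
  already abstracted, so the abstracting object can be read off.\<close>

lemma dft_abs:
  assumes "dft (pushv s A i c) \<tau> F" "valid c" "!!a. a \<in> A ==> i a \<in> D s"
  shows "\<exists>H. dft c (s \<Rrightarrow> \<tau>) H \<and> (\<forall>x\<in>dom c. \<forall>a\<in>A. F (x, a) = ap (H x) (i a))"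
proof -
  obtain \<Gamma> X \<pi> where c: "c = (\<Gamma>, X, \<pi>)" by (cases c)
  obtain F0 where F0: "DF (s # rev \<Gamma>) \<tau> F0" "\<forall>x\<in>X. \<forall>a\<in>A. F (x, a) = F0 (i a # rev (\<pi> x))"
    using assms(1) unfolding dft_def c pushv_def by auto
  obtain H where H: "DF (rev \<Gamma>) (s \<Rrightarrow> \<tau>) H"
    "!!l x. list_all2 fitD (rev \<Gamma>) l ==> x \<in> D s ==> F0 (x # l) = ap (H l) x" using F0(1) by auto
  have "list_all2 fitD (rev \<Gamma>) (rev (\<pi> x))" if "x \<in> X" for x
    using assms(2) that unfolding valid_def c fit_rev by auto
  then show ?thesis using assms(2,3) H F0(2) unfolding dft_def c
    by (intro exI[of _ "%x. H (rev (\<pi> x))"]) auto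
qed

lemma df_dft: assumes "dft c Nt F" shows "df c (%x. num (F x))"
proof -
  obtain \<Gamma> X \<pi> where c: "c = (\<Gamma>, X, \<pi>)" by (cases c)
  obtain F0 where "DF (rev \<Gamma>) Nt F0" "\<forall>x\<in>X. F x = F0 (rev (\<pi> x))" using assms unfolding dft_def c by auto
  then show ?thesis using dft_valid[OF assms] unfolding df_def c DfN_def
    by (auto intro!: exI[of _ "%l. num (F0 (rev l))"])
qed

lemma dft_df: assumes "df c F" shows "dft c Nt (%x. nv (F x))"
proof -
  obtain \<Gamma> X \<pi> where c: "c = (\<Gamma>, X, \<pi>)" by (cases c)
  obtain F' F0 where F: "DF (rev \<Gamma>) Nt F0" "\<forall>l. list_all2 fitD \<Gamma> l --> F' l = num (F0 (rev l))"
    "\<forall>x\<in>X. F x = F' (\<pi> x)" using assms unfolding df_def c DfN_def by auto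
  have v: "\<forall>x\<in>X. list_all2 fitD \<Gamma> (\<pi> x)" using df_valid[OF assms] by (simp add: valid_def c)
  then have "\<forall>x\<in>X. F0 (rev (\<pi> x)) \<in> C" using DF_in[OF F(1)] fit_rev by blast
  then show ?thesis using F v df_valid[OF assms] unfolding dft_def c by auto
qed

definition sq :: "'d => 'k => 'k" where "sq x n = num (ap x (nv n))"

lemma sq_num: "a \<in> C ==> sq x (num a) = num (ap x a)"
  by (simp add: sq_def)

text \<open>Extensionality of the model: an object of type 1 is determined by the sequence through
  which the arithmetic of the field sees it.\<close>

lemma sq_inj: assumes "x \<in> D ty1" "y \<in> D ty1" "!!n. n \<in> num ` C ==> sq x n = sq y n" shows "x = y"
proof (rule ext[OF assms(1,2)])
  fix a assume a: "a \<in> C"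
  then have "num (ap x a) = num (ap y a)" using assms(3)[of "num a"] by (simp add: sq_num)
  then show "ap x a = ap y a" using num_eq[of "ap x a" "ap y a"] ap_in assms(1,2) a by blast
qed

lemma df_sq: assumes "dft c ty1 F" shows "df (push c) (%p. sq (F (fst p)) (snd p))"
  unfolding sq_def
  by (rule df_dft, rule dft_app[of _ Nt], rule dft_weakv[OF assms]) (auto intro!: dft_var dft_valid[OF assms])

lemma sq_abs:
  assumes "df (push c) (%p. F (fst p) (snd p))" "valid c"
  shows "\<exists>H. dft c ty1 H \<and> (\<forall>x\<in>dom c. \<forall>n\<in>num ` C. sq (H x) n = F x n)"
proof -
  obtain H where H: "dft c ty1 H" "\<forall>x\<in>dom c. \<forall>n\<in>num ` C. nv (F x n) = ap (H x) (nv n)"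
    using dft_abs[OF dft_df[OF assms(1)] assms(2)] by auto
  have "F x n \<in> num ` C" if "x \<in> dom c" "n \<in> num ` C" for x n using df_N[OF assms(1), of "(x, n)"] that by simp
  then have "sq (H x) n = F x n" if "x \<in> dom c" "n \<in> num ` C" for x n
    using H(2) that num_nv unfolding sq_def by metis
  then show ?thesis using H(1) by blast
qed

definition env0 :: "ty list \<times> unit set \<times> (unit => 'd list)" where "env0 = ([], {()}, %_. [])"

definition env1 :: "ty list \<times> (unit \<times> 'd) set \<times> (unit \<times> 'd => 'd list)" where
  "env1 = pushv ty1 (D ty1) (%x. x) env0"

lemma env0: "valid env0" "dom env0 = {()}" and env1: "valid env1" "dom env1 = {()} \<times> D ty1"
proof -
  show "valid env0" "dom env0 = {()}" by (simp_all add: env0_def valid_def)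
  then show "valid env1" "dom env1 = {()} \<times> D ty1" unfolding env1_def by (auto intro: valid_pushv)
qed

lemma sq_exists:
  assumes "df (push env0) (%p. F (snd p))" shows "\<exists>x\<in>D ty1. \<forall>n\<in>num ` C. sq x n = F n"
  using sq_abs[of env0 "%_. F"] assms dft_in[of env0 ty1 _ "()"] env0 by auto

text \<open>Two abstractions, over the index \<open>n\<close> and then over \<open>x\<close>, turn a
  definable function on reals into an object of type \<open>ty11\<close>.\<close>

lemma fun_exists:
  assumes "df (push env1) (%p. F (snd (fst p)) (snd p))"
  shows "\<exists>g\<in>D ty11. \<forall>x\<in>D ty1. \<forall>n\<in>num ` C. sq (ap g x) n = F x n"
proof -
  obtain H where H: "dft env1 ty1 H" "\<forall>x\<in>D ty1. \<forall>n\<in>num ` C. sq (H ((), x)) n = F x n"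
    using sq_abs[of env1 "%x. F (snd x)"] assms env1 by auto
  obtain H' where H': "dft env0 ty11 H'" "\<forall>x\<in>D ty1. H ((), x) = ap (H' ()) x"
    using dft_abs[OF H(1)[unfolded env1_def] env0(1)] env0 by auto
  then show ?thesis using H(2) dft_in[OF H'(1), of "()"] env0 by auto
qed

lemma dft_x: "dft env1 ty1 snd"
  unfolding env1_def using dft_var[of env0 "D ty1" "%x. x" ty1] env0 by simp

lemma df_ap_x: "Y \<in> D ty11 ==> df (push env1) (%p. sq (ap Y (snd (fst p))) (snd p))"
  by (rule df_sq[of env1 "%x. ap Y (snd x)"]) (intro dft_app[of _ ty1] dft_const dft_x env1)

section \<open>The meaning of the formulas about reals\<close>

text \<open>Bound names are chosen above those of the body, so under further binders a formula is
  evaluated in a valuation that agrees with the original one below a bound.\<close>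

definition agree :: "nat => (nat \<times> ty => 'd) => (nat \<times> ty => 'd) => bool" where
  "agree B v v' \<longleftrightarrow> (\<forall>z. fst z < B --> v' z = v z)"

lemma agree_refl [simp]: "agree B v v"
  by (simp add: agree_def)

lemma agree_trans: "agree B v v' ==> agree B v' v'' ==> agree B v v''"
  by (simp add: agree_def)

lemma agree_mono: "agree B v v' ==> B' <= B ==> agree B' v v'"
  by (auto simp: agree_def)

lemma agree_upd: "agree B v v' ==> B <= x ==> agree B v (v'((x, \<rho>) := d))"
  by (auto simp: agree_def)

lemma ev_agree: "agree B v v' ==> bound_tm t <= B ==> ev v' t = ev v t"
  by (rule ev_cong) (auto simp: agree_def dest: vars_tm_bound)

fun qv :: "(nat \<times> ty => 'd) => frac => 'k" where
  "qv v (p, m, d) = (num (ev v p) - num (ev v m)) / num (ev v d)"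

fun qok :: "(nat \<times> ty => 'd) => frac => bool" where
  "qok v (p, m, d) \<longleftrightarrow> ev v p \<in> C \<and> ev v m \<in> C \<and> ev v d \<in> C \<and> 0 < num (ev v d)"

fun bound_q :: "frac => nat" where
  "bound_q (p, m, d) = max (bound_tm p) (max (bound_tm m) (bound_tm d))"

lemma qv_agree: "agree B v v' ==> bound_q a <= B ==> qv v' a = qv v a \<and> qok v' a = qok v a"
  by (cases a) (auto simp: ev_agree)

lemma q_zero: "qok v q_zero" "qv v q_zero = 0" "bound_q q_zero = 0"
  by (simp_all add: q_zero_def num_zr num_on)

lemma q_neg: "qok v (q_neg a) = qok v a" "qv v (q_neg a) = - qv v a" "bound_q (q_neg a) = bound_q a"
  by (cases a; auto simp: diff_divide_distrib)+

lemma q_add: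
  assumes "qok v a" "qok v b"
  shows "qok v (q_add a b)" "qv v (q_add a b) = qv v a + qv v b"
  using assms by (cases a; cases b; simp add: num_pl num_ti field_simps)+

lemma bound_q_add: "bound_q (q_add a b) = max (bound_q a) (bound_q b)"
  by (cases a; cases b) (simp add: ac_simps)

lemma q_diff:
  assumes "qok v a" "qok v b"
  shows "qok v (q_diff a b)" "qv v (q_diff a b) = qv v a - qv v b"
  using assms by (simp_all add: q_diff_def q_add q_neg)

lemma bound_q_diff: "bound_q (q_diff a b) = max (bound_q a) (bound_q b)"
  by (simp add: q_diff_def bound_q_add q_neg)

lemma holds_q_less: assumes "qok v a" "qok v b" shows "holds v (q_less a b) \<longleftrightarrow> qv v a < qv v b"
proof -
  obtain p m d p' m' d' where e: "a = (p, m, d)" "b = (p', m', d')" by (cases a, cases b)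
  let ?n = "%t. num (ev v t)"
  have "holds v (q_less a b) \<longleftrightarrow> ?n p * ?n d' + ?n m' * ?n d < ?n p' * ?n d + ?n m * ?n d'"
    using assms by (simp add: e num_pl num_ti flip: num_less)
  also have "\<dots> \<longleftrightarrow> (?n p - ?n m) * ?n d' < (?n p' - ?n m') * ?n d" by (auto simp: algebra_simps)
  also have "\<dots> \<longleftrightarrow> qv v a < qv v b" using assms by (simp add: e divide_less_eq less_divide_eq mult.commute)
  finally show ?thesis .
qed

lemma bound_q_less: "bound_fm (q_less a b) = max (bound_q a) (bound_q b)"
  by (cases a; cases b) (simp add: ac_simps)

lemma holds_q_leq: "qok v a ==> qok v b ==> holds v (q_leq a b) \<longleftrightarrow> qv v a <= qv v b"
  by (simp add: q_leq_def holds_q_less not_less)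

lemma holds_q_abs_less: "qok v a ==> qok v b ==> holds v (q_abs_less a b) \<longleftrightarrow> \<bar>qv v a\<bar> < qv v b"
  by (auto simp: q_abs_less_def holds_q_less q_neg abs_less_iff)

lemma holds_q_abs_leq: "qok v a ==> qok v b ==> holds v (q_abs_leq a b) \<longleftrightarrow> \<bar>qv v a\<bar> <= qv v b"
  by (auto simp: q_abs_leq_def holds_q_leq q_neg abs_le_iff)

lemma bound_q_abs: "bound_fm (q_abs_less a b) = max (bound_q a) (bound_q b)"
    "bound_fm (q_abs_leq a b) = max (bound_q a) (bound_q b)"
  by (auto simp: q_abs_less_def q_abs_leq_def q_leq_def bound_q_less q_neg)

lemma ev_pow2: "ev v t \<in> C ==> num (ev v (pow2_tm t)) = pw (num (ev v t)) \<and> ev v (pow2_tm t) \<in> C"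
  using ap_in[OF pwf_in] by (simp add: pow2_tm_def double_tm_def pw_def pwf_def dbl_def)

lemma bound_pow2: "bound_tm (pow2_tm t) = bound_tm t"
  by (simp add: pow2_tm_def double_tm_def)

lemma q_exp: assumes "ev v t \<in> C"
  shows "qok v (q_exp t)" "qv v (q_exp t) = e (num (ev v t))" "qok v (q_exp1 t)" "qv v (q_exp1 t) = 2 * e (num (ev v t))"
  using ev_pow2[OF assms] pw_pos[of "num (ev v t)"] assms
  by (auto simp: q_exp_def q_exp1_def e_def num_zr num_on num_pl)

lemma bound_q_exp: "bound_q (q_exp t) = bound_tm t" "bound_q (q_exp1 t) = bound_tm t"
  by (simp_all add: q_exp_def q_exp1_def bound_pow2)

lemma holds_is_pair:
  assumes "ev v k \<in> C" "ev v n \<in> C" "ev v d \<in> C"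
  shows "holds v (is_pair k n d) \<longleftrightarrow> ispair (num (ev v k)) (num (ev v n)) (num (ev v d))"
  using assms by (simp add: is_pair_def ispair_def num_pl num_ti num_on flip: num_eq)

lemma bound_is_pair: "bound_fm (is_pair k n d) <= x \<longleftrightarrow> bound_tm k <= x \<and> bound_tm n <= x \<and> bound_tm d <= x"
  by (auto simp: is_pair_def)

lemma holds_is_rat:
  assumes "ev v k \<in> C" "ev v p \<in> C" "ev v m \<in> C" "ev v d \<in> C"
  shows "holds v (is_rat k p m d) \<longleftrightarrow> israt (num (ev v k)) (num (ev v p)) (num (ev v m)) (num (ev v d))"
proof -
  let ?n = "%t. num (ev v t)"
  have "holds v (\<^bold>\<forall>\<^sub>0n. \<^bold>\<not> (is_pair k n d \<^bold>\<and> ((n \<^bold>= p \<^bold>+ p \<^bold>\<and> m \<^bold>= \<^bold>0) \<^bold>\<or> (n \<^bold>+ \<^bold>1 \<^bold>= m \<^bold>+ m \<^bold>\<and> p \<^bold>= \<^bold>0)))) \<longleftrightarrow>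
    (\<forall>a\<in>C. \<not> (ispair (?n k) (num a) (?n d) \<and>
      ((num a = ?n p + ?n p \<and> ?n m = 0) \<or> (num a + 1 = ?n m + ?n m \<and> ?n p = 0))))"
    unfolding all0_def using assms
    by (intro all_fresh_iff) (auto simp: holds_is_pair bound_is_pair num_pl num_on simp flip: num_eq num_zr)
  then show ?thesis unfolding is_rat_def ex0_def israt_def holds.simps by auto
qed

lemma bound_is_rat: "bound_fm (is_rat k p m d) <= x ==>
    bound_tm k <= x \<and> bound_tm p <= x \<and> bound_tm m <= x \<and> bound_tm d <= x"
  unfolding is_rat_def ex0_def all0_def by (auto dest!: bound_all_fresh simp: bound_is_pair)

lemma bound_with_rat: assumes "bound_fm (with_rat k \<Phi>) <= x"
  shows "bound_tm k <= x \<and> bound_fm (\<Phi> (Var 0 Nt, Var 0 Nt, Var 0 Nt \<^bold>+ \<^bold>1)) <= x"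
  using assms unfolding with_rat_def ex0_def all0_def by (auto dest!: bound_all_fresh bound_is_rat)

text \<open>The three quantifiers choose their names from the body, so the meaning of the body is
  required for arbitrary terms and for every valuation agreeing below \<open>B\<close>. Since a code
  determines its rational, the existential statement reduces to the value
  \<open>rat\<close>.\<close>

lemma holds_with_rat:
  assumes bound: "!!a z. bound_fm (\<Phi> a) <= z ==> B <= z \<and> bound_q a <= z"
    and \<Phi>: "!!v' a. val v' ==> agree B v v' ==> qok v' a ==> holds v' (\<Phi> a) \<longleftrightarrow> Q (qv v' a)"
    and v: "val v" and k: "ev v k \<in> C"
  shows "holds v (with_rat k \<Phi>) \<longleftrightarrow> Q (rat (num (ev v k)))"
proof -
  let ?S = "%p m d. israt (num (ev v k)) (num p) (num m) (num d) \<and> Q ((num p - num m) / (num d + 1))"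
  have 3: "holds v'' (\<^bold>\<exists>\<^sub>0d. is_rat k p m d \<^bold>\<and> \<Phi> (p, m, d \<^bold>+ \<^bold>1)) \<longleftrightarrow> (\<exists>d\<in>C. ?S (ev v'' p) (ev v'' m) d)"
    if h: "val v''" "agree (max B (bound_tm k)) v v''" "ev v'' p \<in> C" "ev v'' m \<in> C" for v'' p m
  proof -
    have "holds v'' (\<^bold>\<forall>\<^sub>0d. \<^bold>\<not> (is_rat k p m d \<^bold>\<and> \<Phi> (p, m, d \<^bold>+ \<^bold>1))) \<longleftrightarrow> (\<forall>d\<in>C. \<not> ?S (ev v'' p) (ev v'' m) d)"
      unfolding all0_def
    proof (rule all_fresh_iff)
      fix x d assume x: "bound_fm (\<^bold>\<not> (is_rat k p m (Var 0 Nt) \<^bold>\<and> \<Phi> (p, m, Var 0 Nt \<^bold>+ \<^bold>1))) <= x" and d: "d \<in> C"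
      let ?w = "v''((x, Nt) := d)"
      have b: "bound_tm k <= x" "bound_tm p <= x" "bound_tm m <= x" "B <= x"
        using x bound[of "(p, m, Var 0 Nt \<^bold>+ \<^bold>1)" x] by (auto dest: bound_is_rat)
      have kk: "ev v'' k = ev v k" using ev_agree[OF h(2)] by simp
      have "holds ?w (is_rat k p m (Var x Nt)) \<longleftrightarrow> israt (num (ev v k)) (num (ev v'' p)) (num (ev v'' m)) (num d)"
        by (subst holds_is_rat) (use b h d k kk in auto)
      moreover have "holds ?w (\<Phi> (p, m, Var x Nt \<^bold>+ \<^bold>1)) \<longleftrightarrow> Q ((num (ev v'' p) - num (ev v'' m)) / (num d + 1))"
        by (subst \<Phi>) (use b h d num_nonneg[OF d] in \<open>auto simp: num_pl num_on intro!: agree_upd intro: agree_mono\<close>)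
      ultimately show "holds ?w (\<^bold>\<not> (is_rat k p m (Var x Nt) \<^bold>\<and> \<Phi> (p, m, Var x Nt \<^bold>+ \<^bold>1))) \<longleftrightarrow> \<not> ?S (ev v'' p) (ev v'' m) d"
        by simp
    qed
    then show ?thesis unfolding ex0_def holds.simps by blast
  qed
  have bnd: "bound_fm (\<^bold>\<exists>\<^sub>0d. is_rat k p m d \<^bold>\<and> \<Phi> (p, m, d \<^bold>+ \<^bold>1)) <= x ==>
      B <= x \<and> bound_tm k <= x \<and> bound_tm p <= x \<and> bound_tm m <= x" for p m x
    using bound[of "(p, m, Var 0 Nt \<^bold>+ \<^bold>1)" x] unfolding ex0_def all0_def
    by (auto dest!: bound_all_fresh bound_is_rat)
  have 2: "holds v'' (\<^bold>\<exists>\<^sub>0m. \<^bold>\<exists>\<^sub>0d. is_rat k p m d \<^bold>\<and> \<Phi> (p, m, d \<^bold>+ \<^bold>1)) \<longleftrightarrow> (\<exists>m\<in>C. \<exists>d\<in>C. ?S (ev v'' p) m d)"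
    if h: "val v''" "agree (max B (bound_tm k)) v v''" "ev v'' p \<in> C" for v'' p
  proof -
    have "holds v'' (\<^bold>\<forall>\<^sub>0m. \<^bold>\<not> (\<^bold>\<exists>\<^sub>0d. is_rat k p m d \<^bold>\<and> \<Phi> (p, m, d \<^bold>+ \<^bold>1))) \<longleftrightarrow> (\<forall>m\<in>C. \<not> (\<exists>d\<in>C. ?S (ev v'' p) m d))"
      unfolding all0_def[of "%m. \<^bold>\<not> (\<^bold>\<exists>\<^sub>0d. is_rat k p m d \<^bold>\<and> \<Phi> (p, m, d \<^bold>+ \<^bold>1))"]
    proof (rule all_fresh_iff)
      fix x d assume x: "bound_fm (\<^bold>\<not> (\<^bold>\<exists>\<^sub>0d. is_rat k p (Var 0 Nt) d \<^bold>\<and> \<Phi> (p, Var 0 Nt, d \<^bold>+ \<^bold>1))) <= x" and d: "d \<in> C"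
      then have b: "B <= x" "bound_tm k <= x" "bound_tm p <= x" using bnd[of p "Var 0 Nt" x] by auto
      show "holds (v''((x, Nt) := d)) (\<^bold>\<not> (\<^bold>\<exists>\<^sub>0da. is_rat k p (Var x Nt) da \<^bold>\<and> \<Phi> (p, Var x Nt, da \<^bold>+ \<^bold>1))) \<longleftrightarrow>
          \<not> (\<exists>da\<in>C. ?S (ev v'' p) d da)"
        unfolding holds.simps by (subst 3) (use b h d in \<open>auto intro!: agree_upd\<close>)
    qed
    then show ?thesis unfolding ex0_def[of "%m. \<^bold>\<exists>\<^sub>0d. is_rat k p m d \<^bold>\<and> \<Phi> (p, m, d \<^bold>+ \<^bold>1)"] holds.simps by blast
  qed
  have "holds v (\<^bold>\<forall>\<^sub>0p. \<^bold>\<not> (\<^bold>\<exists>\<^sub>0m. \<^bold>\<exists>\<^sub>0d. is_rat k p m d \<^bold>\<and> \<Phi> (p, m, d \<^bold>+ \<^bold>1))) \<longleftrightarrow> (\<forall>p\<in>C. \<not> (\<exists>m\<in>C. \<exists>d\<in>C. ?S p m d))"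
    unfolding all0_def[of "%p. \<^bold>\<not> (\<^bold>\<exists>\<^sub>0m. \<^bold>\<exists>\<^sub>0d. is_rat k p m d \<^bold>\<and> \<Phi> (p, m, d \<^bold>+ \<^bold>1))"]
  proof (rule all_fresh_iff)
    fix x d assume x: "bound_fm (\<^bold>\<not> (\<^bold>\<exists>\<^sub>0m. \<^bold>\<exists>\<^sub>0d. is_rat k (Var 0 Nt) m d \<^bold>\<and> \<Phi> (Var 0 Nt, m, d \<^bold>+ \<^bold>1))) <= x" and d: "d \<in> C"
    then have "bound_fm (\<^bold>\<forall>\<^sub>0m. \<^bold>\<not> (\<^bold>\<exists>\<^sub>0d. is_rat k (Var 0 Nt) m d \<^bold>\<and> \<Phi> (Var 0 Nt, m, d \<^bold>+ \<^bold>1))) <= x"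
      unfolding ex0_def[of "%m. \<^bold>\<exists>\<^sub>0d. is_rat k (Var 0 Nt) m d \<^bold>\<and> \<Phi> (Var 0 Nt, m, d \<^bold>+ \<^bold>1)"] by simp
    then have "bound_fm (\<^bold>\<exists>\<^sub>0d. is_rat k (Var 0 Nt) (Var 0 Nt) d \<^bold>\<and> \<Phi> (Var 0 Nt, Var 0 Nt, d \<^bold>+ \<^bold>1)) <= x"
      unfolding all0_def[of "%m. \<^bold>\<not> (\<^bold>\<exists>\<^sub>0d. is_rat k (Var 0 Nt) m d \<^bold>\<and> \<Phi> (Var 0 Nt, m, d \<^bold>+ \<^bold>1))"]
      by (auto dest!: bound_all_fresh)
    then have b: "B <= x" "bound_tm k <= x" using bnd by blast+
    show "holds (v((x, Nt) := d)) (\<^bold>\<not> (\<^bold>\<exists>\<^sub>0m. \<^bold>\<exists>\<^sub>0da. is_rat k (Var x Nt) m da \<^bold>\<and> \<Phi> (Var x Nt, m, da \<^bold>+ \<^bold>1))) \<longleftrightarrow>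
        \<not> (\<exists>m\<in>C. \<exists>da\<in>C. ?S d m da)"
      unfolding holds.simps by (subst 2) (use b v d in \<open>auto intro!: agree_upd\<close>)
  qed
  then have "holds v (with_rat k \<Phi>) \<longleftrightarrow> (\<exists>p\<in>C. \<exists>m\<in>C. \<exists>d\<in>C. ?S p m d)"
    unfolding with_rat_def ex0_def[of "%p. \<^bold>\<exists>\<^sub>0m. \<^bold>\<exists>\<^sub>0d. is_rat k p m d \<^bold>\<and> \<Phi> (p, m, d \<^bold>+ \<^bold>1)"] holds.simps by blast
  also have "\<dots> \<longleftrightarrow> Q (rat (num (ev v k)))"
  proof
    assume "\<exists>p\<in>C. \<exists>m\<in>C. \<exists>d\<in>C. ?S p m d"
    then obtain p m d where "p \<in> C" "m \<in> C" "d \<in> C" "?S p m d" by blast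
    then show "Q (rat (num (ev v k)))" using rat_eqI[of "num p" "num m" "num d"] by simp
  next
    assume Q: "Q (rat (num (ev v k)))"
    obtain p m d where "p \<in> C" "m \<in> C" "d \<in> C" "israt (num (ev v k)) (num p) (num m) (num d)"
      using israt_exists[of "num (ev v k)"] k by auto
    then show "\<exists>p\<in>C. \<exists>m\<in>C. \<exists>d\<in>C. ?S p m d" using Q rat_eqI[of "num p" "num m" "num d"] by auto
  qed
  finally show ?thesis .
qed

lemma holds_with_rat2:
  assumes bound: "!!a b z. bound_fm (\<Psi> a b) <= z ==> B <= z \<and> bound_q a <= z \<and> bound_q b <= z"
    and \<Psi>: "!!v' a b. val v' ==> agree B v v' ==> qok v' a ==> qok v' b ==>
      holds v' (\<Psi> a b) \<longleftrightarrow> Q (qv v' a) (qv v' b)"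
    and v: "val v" and s: "ev v s \<in> C" and t: "ev v t \<in> C"
  shows "holds v (with_rat s (%a. with_rat t (\<Psi> a))) \<longleftrightarrow> Q (rat (num (ev v s))) (rat (num (ev v t)))"
proof (rule holds_with_rat[where B = "max B (bound_tm t)" and Q = "%q. Q q (rat (num (ev v t)))", OF _ _ v s])
  fix a z assume "bound_fm (with_rat t (\<Psi> a)) <= z"
  from bound_with_rat[OF this] show "max B (bound_tm t) <= z \<and> bound_q a <= z" using bound by (metis max.bounded_iff)
next
  fix v' a assume v': "val v'" "agree (max B (bound_tm t)) v v'" "qok v' a"
  have tt: "ev v' t = ev v t" using ev_agree[OF v'(2)] by simp
  have "holds v' (with_rat t (\<Psi> a)) \<longleftrightarrow> Q (qv v' a) (rat (num (ev v' t)))"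
  proof (rule holds_with_rat[where B = "max B (bound_q a)", OF _ _ v'(1)])
    fix b z assume "bound_fm (\<Psi> a b) <= z"
    from bound[OF this] show "max B (bound_q a) <= z \<and> bound_q b <= z" by auto
  next
    fix v'' b assume v'': "val v''" "agree (max B (bound_q a)) v' v''" "qok v'' b"
    have "agree B v v''" using agree_trans[of B v v' v''] agree_mono[OF v'(2)] agree_mono[OF v''(2)] by simp
    moreover have "qv v'' a = qv v' a" "qok v'' a" using qv_agree[OF v''(2), of a] v'(3) by auto
    ultimately show "holds v'' (\<Psi> a b) \<longleftrightarrow> Q (qv v' a) (qv v'' b)" using \<Psi>[OF v''(1) _ _ v''(3), of a] by simp
  qed (use tt t in simp)
  then show "holds v' (with_rat t (\<Psi> a)) \<longleftrightarrow> Q (qv v' a) (rat (num (ev v t)))" by (simp add: tt)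
qed

lemma bound_with_rat2:
  assumes "!!a b z. bound_fm (\<Psi> a b) <= z ==> B <= z" "bound_fm (with_rat s (%a. with_rat t (\<Psi> a))) <= x"
  shows "bound_tm s <= x \<and> bound_tm t <= x \<and> B <= x"
  using bound_with_rat[OF assms(2)] bound_with_rat[of t] assms(1) by blast

lemma ap_val [simp]: "x \<in> D ty1 ==> a \<in> C ==> ap x a \<in> C" and ap_ty11 [simp]: "y \<in> D ty11 ==> x \<in> D ty1 ==> ap y x \<in> D ty1"
  using ap_in by blast+

definition req :: "('k => 'k) => ('k => 'k) => bool" where
  "req \<xi> \<eta> \<longleftrightarrow> (\<forall>n\<in>num ` C. \<bar>rat (\<xi> n) - rat (\<eta> n)\<bar> <= 2 * e n)"

definition rless :: "('k => 'k) => ('k => 'k) => bool" where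
  "rless \<xi> \<eta> \<longleftrightarrow> (\<exists>n\<in>num ` C. rat (\<xi> n) + 2 * e n < rat (\<eta> n))"

definition rdist :: "('k => 'k) => ('k => 'k) => 'k => bool" where
  "rdist \<xi> \<eta> r \<longleftrightarrow> (\<exists>n\<in>num ` C. \<bar>rat (\<xi> n) - rat (\<eta> n)\<bar> < r - 2 * e n)"

context
  fixes v :: "nat \<times> ty => 'd" and x y :: tm
  assumes v: "val v" and x: "ev v x \<in> D ty1"
begin

lemma holds_is_real: "holds v (is_real x) \<longleftrightarrow> isreal (sq (ev v x))"
proof -
  let ?X = "ev v x"
  have *: "holds v (is_real x) \<longleftrightarrow> (\<forall>n\<in>C. \<forall>i\<in>C. \<bar>rat (num (ap ?X n)) - rat (num (ap ?X (pl n i)))\<bar> < e (num n))"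
    unfolding is_real_def all0_def
  proof (rule all_fresh_iff, rule all_fresh_iff)
    let ?F = "%n i. with_rat (x \<cdot> n) (%a. with_rat (x \<cdot> (n \<^bold>+ i)) (%b. q_abs_less (q_diff a b) (q_exp n)))"
    have bnd: "bound_fm (?F n i) <= z ==> bound_tm x <= z \<and> bound_tm n <= z \<and> bound_tm i <= z" for n i z
      using bound_with_rat2[of "%a b. q_abs_less (q_diff a b) (q_exp n)" 0] by force
    fix a b n i
    assume a: "bound_fm (all_fresh Nt (?F (Var 0 Nt))) <= a" and b: "bound_fm (?F (Var a Nt) (Var 0 Nt)) <= b"
      and n: "n \<in> C" and i: "i \<in> C"
    have 1: "bound_tm x <= a" "bound_tm x <= b" "a < b"
      using bnd[OF bound_all_fresh[OF a]] bnd[OF b] by auto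
    let ?w = "v((a, Nt) := n, (b, Nt) := i)"
    have "holds ?w (?F (Var a Nt) (Var b Nt)) \<longleftrightarrow>
        (%q r. \<bar>q - r\<bar> < e (num n)) (rat (num (ev ?w (x \<cdot> Var a Nt)))) (rat (num (ev ?w (x \<cdot> (Var a Nt \<^bold>+ Var b Nt)))))"
    proof (rule holds_with_rat2[where B = "Suc a" and v = ?w])
      fix v' p q assume "val v'" "agree (Suc a) ?w v'" "qok v' p" "qok v' q"
      moreover from this have "ev v' (Var a Nt) = n" using 1 by (simp add: agree_def)
      ultimately show "holds v' (q_abs_less (q_diff p q) (q_exp (Var a Nt))) \<longleftrightarrow> \<bar>qv v' p - qv v' q\<bar> < e (num n)"
        using q_exp[of v' "Var a Nt"] n by (simp add: holds_q_abs_less q_diff)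
    qed (use 1 v x n i in \<open>auto simp: bound_q_abs bound_q_diff bound_q_exp\<close>)
    then show "holds ?w (?F (Var a Nt) (Var b Nt)) \<longleftrightarrow>
        \<bar>rat (num (ap ?X n)) - rat (num (ap ?X (pl n i)))\<bar> < e (num n)" using 1 by simp
  qed
  have "isreal (sq ?X) \<longleftrightarrow> (\<forall>n\<in>C. \<forall>i\<in>C. \<bar>rat (num (ap ?X n)) - rat (num (ap ?X (pl n i)))\<bar> < e (num n))"
    using x unfolding isreal_def by (auto simp: sq_num simp flip: num_pl)
  then show ?thesis using * by blast
qed

context
  assumes y: "ev v y \<in> D ty1"
begin

lemma holds_all0_rat2:
  assumes \<Psi>: "!!n v' a b. val v' ==> qok v' a ==> qok v' b ==> ev v' n \<in> C ==> agree B v v' ==>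
      holds v' (\<Psi> n a b) \<longleftrightarrow> Q (num (ev v' n)) (qv v' a) (qv v' b)"
    and bound: "!!n a b z. bound_fm (\<Psi> n a b) <= z ==> B <= z \<and> bound_tm n <= z \<and> bound_q a <= z \<and> bound_q b <= z"
  shows "holds v (\<^bold>\<forall>\<^sub>0n. with_rat (x \<cdot> n) (%a. with_rat (y \<cdot> n) (\<Psi> n a))) \<longleftrightarrow>
    (\<forall>n\<in>num ` C. Q n (rat (sq (ev v x) n)) (rat (sq (ev v y) n)))"
proof -
  have "holds v (\<^bold>\<forall>\<^sub>0n. with_rat (x \<cdot> n) (%a. with_rat (y \<cdot> n) (\<Psi> n a))) \<longleftrightarrow>
    (\<forall>n\<in>C. Q (num n) (rat (sq (ev v x) (num n))) (rat (sq (ev v y) (num n))))"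
    unfolding all0_def
  proof (rule all_fresh_iff)
    fix a n assume a: "bound_fm (with_rat (x \<cdot> Var 0 Nt) (%a. with_rat (y \<cdot> Var 0 Nt) (\<Psi> (Var 0 Nt) a))) <= a"
      and n: "n \<in> C"
    have 1: "bound_tm x <= a" "bound_tm y <= a" "B <= a"
      using bound_with_rat2[OF _ a, of B] bound by auto
    let ?w = "v((a, Nt) := n)"
    have "holds ?w (with_rat (x \<cdot> Var a Nt) (%p. with_rat (y \<cdot> Var a Nt) (\<Psi> (Var a Nt) p))) \<longleftrightarrow>
        Q (num n) (rat (num (ev ?w (x \<cdot> Var a Nt)))) (rat (num (ev ?w (y \<cdot> Var a Nt))))"
    proof (rule holds_with_rat2[where B = "max (Suc a) B" and v = ?w])
      fix v' p q assume v': "val v'" "agree (max (Suc a) B) ?w v'" "qok v' p" "qok v' q"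
      have "ev v' (Var a Nt) = n" using v'(2) by (simp add: agree_def)
      moreover have "agree B v v'"
        by (rule agree_trans[OF agree_upd[OF agree_refl 1(3)] agree_mono[OF v'(2)]]) simp
      ultimately show "holds v' (\<Psi> (Var a Nt) p q) \<longleftrightarrow> Q (num n) (qv v' p) (qv v' q)"
        using \<Psi>[OF v'(1,3,4), of "Var a Nt"] n by simp
    next
      fix p q z assume "bound_fm (\<Psi> (Var a Nt) p q) <= z"
      from bound[OF this] show "max (Suc a) B <= z \<and> bound_q p <= z \<and> bound_q q <= z" by auto
    qed (use v x y n 1 in auto)
    then show "holds ?w (with_rat (x \<cdot> Var a Nt) (%p. with_rat (y \<cdot> Var a Nt) (\<Psi> (Var a Nt) p))) \<longleftrightarrow>
        Q (num n) (rat (sq (ev v x) (num n))) (rat (sq (ev v y) (num n)))" using 1 n by (simp add: sq_num)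
  qed
  then show ?thesis by simp
qed

lemma holds_real_eq: "holds v (real_eq x y) \<longleftrightarrow> req (sq (ev v x)) (sq (ev v y))"
  unfolding real_eq_def req_def
  by (rule holds_all0_rat2[where B = 0])
    (auto simp: holds_q_abs_leq q_diff q_exp bound_q_abs bound_q_diff bound_q_exp)

lemma holds_ex0_rat2:
  assumes "!!n v' a b. val v' ==> qok v' a ==> qok v' b ==> ev v' n \<in> C ==> agree B v v' ==>
      holds v' (\<Psi> n a b) \<longleftrightarrow> Q (num (ev v' n)) (qv v' a) (qv v' b)"
    and "!!n a b z. bound_fm (\<Psi> n a b) <= z ==> B <= z \<and> bound_tm n <= z \<and> bound_q a <= z \<and> bound_q b <= z"
  shows "holds v (\<^bold>\<exists>\<^sub>0n. with_rat (x \<cdot> n) (%a. with_rat (y \<cdot> n) (\<Psi> n a))) \<longleftrightarrow>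
    (\<exists>n\<in>num ` C. Q n (rat (sq (ev v x) n)) (rat (sq (ev v y) n)))"
proof -
  have "holds v (\<^bold>\<forall>\<^sub>0n. \<^bold>\<not> with_rat (x \<cdot> n) (%a. with_rat (y \<cdot> n) (\<Psi> n a))) \<longleftrightarrow>
    (\<forall>n\<in>C. \<not> Q (num n) (rat (sq (ev v x) (num n))) (rat (sq (ev v y) (num n))))"
    unfolding all0_def
  proof (rule all_fresh_iff)
    fix a n assume a: "bound_fm (\<^bold>\<not> with_rat (x \<cdot> Var 0 Nt) (%a. with_rat (y \<cdot> Var 0 Nt) (\<Psi> (Var 0 Nt) a))) <= a"
      and n: "n \<in> C"
    have 1: "bound_tm x <= a" "bound_tm y <= a" "B <= a"
      using bound_with_rat2[of "\<Psi> (Var 0 Nt)" B "x \<cdot> Var 0 Nt" "y \<cdot> Var 0 Nt" a] a assms(2) by auto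
    let ?w = "v((a, Nt) := n)"
    have "holds ?w (with_rat (x \<cdot> Var a Nt) (%p. with_rat (y \<cdot> Var a Nt) (\<Psi> (Var a Nt) p))) \<longleftrightarrow>
        Q (num n) (rat (num (ev ?w (x \<cdot> Var a Nt)))) (rat (num (ev ?w (y \<cdot> Var a Nt))))"
    proof (rule holds_with_rat2[where B = "max (Suc a) B" and v = ?w])
      fix v' p q assume v': "val v'" "agree (max (Suc a) B) ?w v'" "qok v' p" "qok v' q"
      have "ev v' (Var a Nt) = n" using v'(2) by (simp add: agree_def)
      moreover have "agree B v v'"
        by (rule agree_trans[OF agree_upd[OF agree_refl 1(3)] agree_mono[OF v'(2)]]) simp
      ultimately show "holds v' (\<Psi> (Var a Nt) p q) \<longleftrightarrow> Q (num n) (qv v' p) (qv v' q)"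
        using assms(1)[OF v'(1,3,4), of "Var a Nt"] n by simp
    next
      fix p q z assume "bound_fm (\<Psi> (Var a Nt) p q) <= z"
      from assms(2)[OF this] show "max (Suc a) B <= z \<and> bound_q p <= z \<and> bound_q q <= z" by auto
    qed (use v x y n 1 in auto)
    then show "holds ?w (\<^bold>\<not> with_rat (x \<cdot> Var a Nt) (%p. with_rat (y \<cdot> Var a Nt) (\<Psi> (Var a Nt) p))) \<longleftrightarrow>
        \<not> Q (num n) (rat (sq (ev v x) (num n))) (rat (sq (ev v y) (num n)))" using 1 n by (simp add: sq_num)
  qed
  then show ?thesis unfolding ex0_def holds.simps by auto
qed

lemma holds_real_less: "holds v (real_less x y) \<longleftrightarrow> rless (sq (ev v x)) (sq (ev v y))"
  unfolding real_less_def rless_def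
  by (rule holds_ex0_rat2[where B = 0])
    (auto simp: holds_q_less q_add q_exp bound_q_less bound_q_add bound_q_exp)

lemma holds_dist_less:
  assumes "qok v r"
  shows "holds v (dist_less x y r) \<longleftrightarrow> rdist (sq (ev v x)) (sq (ev v y)) (qv v r)"
  unfolding dist_less_def rdist_def
proof (rule holds_ex0_rat2[where B = "bound_q r"])
  fix n v' a b assume "agree (bound_q r) v v'" "qok v' a" "qok v' b" "ev v' n \<in> C"
  moreover from this have "qv v' r = qv v r" "qok v' r" using qv_agree[of _ v v' r] assms by auto
  ultimately show "holds v' (q_abs_less (q_diff a b) (q_diff r (q_exp1 n))) \<longleftrightarrow>
      \<bar>qv v' a - qv v' b\<bar> < qv v r - 2 * e (num (ev v' n))"
    by (simp add: holds_q_abs_less q_diff q_exp)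
qed (auto simp: bound_q_abs bound_q_diff bound_q_exp)

end

end

lemma bound_is_real: "bound_fm (is_real x) <= z ==> bound_tm x <= z"
  unfolding is_real_def all0_def
  by (drule bound_all_fresh, drule bound_all_fresh, drule bound_with_rat) simp

lemma bound_real_eq: "bound_fm (real_eq x y) <= z ==> bound_tm x <= z \<and> bound_tm y <= z"
  unfolding real_eq_def all0_def
  by (drule bound_all_fresh, drule bound_with_rat2[where B = 0, rotated]) auto

lemma bound_real_less: "bound_fm (real_less x y) <= z ==> bound_tm x <= z \<and> bound_tm y <= z"
proof -
  assume "bound_fm (real_less x y) <= z"
  then have "bound_fm (\<^bold>\<not> with_rat (x \<cdot> Var 0 Nt) (%a. with_rat (y \<cdot> Var 0 Nt) (%b. q_less (q_add a (q_exp1 (Var 0 Nt))) b))) <= z"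
    unfolding real_less_def ex0_def all0_def by (auto dest!: bound_all_fresh)
  then show ?thesis using bound_with_rat2[where B = 0, of _ "x \<cdot> Var 0 Nt" "y \<cdot> Var 0 Nt" z] by auto
qed

lemma bound_dist_less: "bound_fm (dist_less x y r) <= z ==> bound_tm x <= z \<and> bound_tm y <= z \<and> bound_q r <= z"
proof -
  assume "bound_fm (dist_less x y r) <= z"
  then have "bound_fm (\<^bold>\<not> with_rat (x \<cdot> Var 0 Nt) (%a. with_rat (y \<cdot> Var 0 Nt) (%b. q_abs_less (q_diff a b) (q_diff r (q_exp1 (Var 0 Nt)))))) <= z"
    unfolding dist_less_def ex0_def all0_def by (auto dest!: bound_all_fresh)
  then show ?thesis using bound_with_rat2[where B = "bound_q r" and
    \<Psi> = "%a b. q_abs_less (q_diff a b) (q_diff r (q_exp1 (Var 0 Nt)))", of "x \<cdot> Var 0 Nt" "y \<cdot> Var 0 Nt" z]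
    by (auto simp: bound_q_abs bound_q_diff)
qed

section \<open>Functions, sets and the two statements in the model\<close>

definition onD :: "('d => bool) => bool" where "onD P \<longleftrightarrow> (\<forall>x\<in>D ty1. isreal (sq x) --> P x)"

lemma holds_allR:
  assumes "val v" "!!a d. bound_fm (F (Var 0 ty1)) <= a ==> d \<in> D ty1 ==>
    holds (v((a, ty1) := d)) (F (Var a ty1)) \<longleftrightarrow> P d"
  shows "holds v (\<^bold>\<forall>\<^sub>Rx. F x) \<longleftrightarrow> onD P"
  unfolding allR_def all1_def onD_def
  by (rule all_fresh_iff) (use assms in \<open>auto simp: holds_is_real\<close>)

lemma bound_allR: "bound_fm (\<^bold>\<forall>\<^sub>Rx. F x) <= z ==> bound_fm (F (Var 0 ty1)) <= z"
  unfolding allR_def all1_def by (auto dest!: bound_all_fresh)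

definition Fun :: "'d => bool" where
  "Fun Y \<longleftrightarrow> onD (%x. isreal (sq (ap Y x))) \<and>
     onD (%x. onD (%y. req (sq x) (sq y) --> req (sq (ap Y x)) (sq (ap Y y))))"

lemma bound_real_fun: "bound_fm (real_fun Y) <= z ==> bound_tm Y <= z"
  unfolding real_fun_def by (auto dest!: bound_allR bound_is_real)

lemma holds_real_fun: assumes "val v" "ev v Y \<in> D ty11" shows "holds v (real_fun Y) \<longleftrightarrow> Fun (ev v Y)"
proof -
  have 1: "holds v (\<^bold>\<forall>\<^sub>Rx. is_real (Y \<cdot> x)) \<longleftrightarrow> onD (%x. isreal (sq (ap (ev v Y) x)))"
    by (rule holds_allR) (use assms in \<open>auto simp: holds_is_real dest!: bound_is_real\<close>)
  have 2: "holds v (\<^bold>\<forall>\<^sub>Rx. \<^bold>\<forall>\<^sub>Ry. real_eq x y \<^bold>\<longrightarrow> real_eq (Y \<cdot> x) (Y \<cdot> y)) \<longleftrightarrow>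
      onD (%x. onD (%y. req (sq x) (sq y) --> req (sq (ap (ev v Y) x)) (sq (ap (ev v Y) y))))"
    by (rule holds_allR, rule assms(1), rule holds_allR)
      (use assms in \<open>auto simp: holds_real_eq dest!: bound_allR bound_real_eq\<close>)
  show ?thesis using 1 2 by (simp add: real_fun_def Fun_def)
qed

lemma sq_const: "a \<in> C ==> sq (ap (cv (CombK Nt Nt)) a) = (%_. num a)"
  by (simp add: sq_def ap_K fun_eq_iff)

lemma K_ap [simp]: "a \<in> C ==> ap (cv (CombK Nt Nt)) a \<in> D ty1"
  using ap_in[OF K_in] by blast

lemma ev_const: assumes "ev v k \<in> C"
  shows "ev v (const_real k) \<in> D ty1" "sq (ev v (const_real k)) = (%_. num (ev v k))"
  using assms by (simp_all add: const_real_def sq_const)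

lemma ev_zero_one: "ev v real_zero \<in> D ty1" "sq (ev v real_zero) = (%_. 0)"
  "ev v real_one \<in> D ty1" "sq (ev v real_one) = (%_. 5)"
  by (simp_all add: real_zero_def real_one_def ev_const num_zr num_on num_pl)

lemma bound_const: "bound_tm (const_real k) = bound_tm k" "bound_tm real_zero = 0" "bound_tm real_one = 0"
  by (simp_all add: const_real_def real_zero_def real_one_def)

definition Mem :: "'d => 'd => bool" where "Mem Y x \<longleftrightarrow> rless (%_. 0) (sq (ap Y x))"

lemma bound_mem: "bound_fm (mem x Y) <= z ==> bound_tm x <= z \<and> bound_tm Y <= z"
  unfolding mem_def by (auto dest!: bound_real_less)

lemma holds_mem: "val v ==> ev v x \<in> D ty1 ==> ev v Y \<in> D ty11 ==> holds v (mem x Y) \<longleftrightarrow> Mem (ev v Y) (ev v x)"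
  unfolding mem_def Mem_def by (subst holds_real_less) (auto simp: ev_zero_one)

text \<open>A formula with a place for a real, together with the set of objects it describes.
  \<open>B\<close> bounds the names of its parameters, so the formula may be put under further
  binders.\<close>

definition denotes :: "nat => (nat \<times> ty => 'd) => (tm => fm) => ('d => bool) => bool" where
  "denotes B v P S \<longleftrightarrow> (\<forall>t z. bound_fm (P t) <= z --> B <= z \<and> bound_tm t <= z) \<and>
     (\<forall>v' t. agree B v v' --> val v' --> ev v' t \<in> D ty1 --> holds v' (P t) = S (ev v' t))"

lemma denotes_agree: "denotes B v P S ==> agree B v v' ==> denotes B v' P S"
  unfolding denotes_def using agree_trans by blast

lemma denotes_not: "denotes B v P S ==> denotes B v (%t. \<^bold>\<not> P t) (%x. \<not> S x)"
  by (simp add: denotes_def)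

lemma denotes_mem: assumes "ev v Y \<in> D ty11" shows "denotes (bound_tm Y) v (%t. mem t Y) (Mem (ev v Y))"
  unfolding denotes_def
  by (use assms ev_agree[of _ v _ Y] in \<open>auto simp: holds_mem dest!: bound_mem\<close>)

definition Ball :: "('k => 'k) => 'k => ('d => bool) => bool" where
  "Ball \<xi> r S \<longleftrightarrow> onD (%y. rdist \<xi> (sq y) r --> S y)"

lemma holds_ball_subset:
  assumes "val v" "denotes B v P S" "ev v x \<in> D ty1" "qok v r"
  shows "holds v (ball_subset x r P) \<longleftrightarrow> Ball (sq (ev v x)) (qv v r) S"
  unfolding ball_subset_def Ball_def
proof (rule holds_allR[OF assms(1)])
  fix a d assume a: "bound_fm (dist_less x (Var 0 ty1) r \<^bold>\<longrightarrow> P (Var 0 ty1)) <= a" and d: "d \<in> D ty1"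
  let ?w = "v((a, ty1) := d)"
  have "bound_fm (dist_less x (Var 0 ty1) r) <= a" "bound_fm (P (Var 0 ty1)) <= a" using a by auto
  then have b: "bound_tm x <= a" "bound_q r <= a" "B <= a"
    using bound_dist_less assms(2) unfolding denotes_def by blast+
  have "qv ?w r = qv v r" "qok ?w r" using qv_agree[OF agree_upd[OF agree_refl b(2)], of r] assms(4) b by auto
  moreover have "holds ?w (P (Var a ty1)) \<longleftrightarrow> S d"
    using assms(1,2) d agree_upd[OF agree_refl b(3), of v] unfolding denotes_def by simp
  ultimately show "holds ?w (dist_less x (Var a ty1) r \<^bold>\<longrightarrow> P (Var a ty1)) \<longleftrightarrow>
      (rdist (sq (ev v x)) (sq d) (qv v r) --> S d)"
    using assms(1,3) b d by (simp add: holds_dist_less)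
qed

lemma bound_ball_subset: "denotes B v P S ==> bound_fm (ball_subset x r P) <= z ==>
    bound_tm x <= z \<and> bound_q r <= z \<and> B <= z"
  unfolding ball_subset_def denotes_def by (auto dest!: bound_allR bound_dist_less)

definition Open :: "('d => bool) => bool" where
  "Open S \<longleftrightarrow> onD (%x. S x --> (\<exists>k\<in>num ` C. 0 < rat k \<and> Ball (sq x) (rat k) S))"

lemma holds_is_open: assumes "val v" "denotes B v P S" shows "holds v (is_open P) \<longleftrightarrow> Open S"
  unfolding is_open_def Open_def
proof (rule holds_allR[OF assms(1)])
  let ?E = "%x. \<^bold>\<exists>\<^sub>0k. with_rat k (%r. q_less q_zero r \<^bold>\<and> ball_subset x r P)"
  fix a d assume a: "bound_fm (P (Var 0 ty1) \<^bold>\<longrightarrow> ?E (Var 0 ty1)) <= a" and d: "d \<in> D ty1"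
  let ?w = "v((a, ty1) := d)"
  have b: "B <= a" using a assms(2) unfolding denotes_def by auto
  have ag: "agree B v ?w" by (rule agree_upd[OF agree_refl b])
  have P: "holds ?w (P (Var a ty1)) \<longleftrightarrow> S d" using assms d ag unfolding denotes_def by simp
  have "holds ?w (\<^bold>\<forall>\<^sub>0k. \<^bold>\<not> with_rat k (%r. q_less q_zero r \<^bold>\<and> ball_subset (Var a ty1) r P)) \<longleftrightarrow>
      (\<forall>k\<in>C. \<not> (0 < rat (num k) \<and> Ball (sq d) (rat (num k)) S))"
    unfolding all0_def
  proof (rule all_fresh_iff)
    fix b k assume b: "bound_fm (\<^bold>\<not> with_rat (Var 0 Nt) (%r. q_less q_zero r \<^bold>\<and> ball_subset (Var a ty1) r P)) <= b"
      and k: "k \<in> C"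
    have B: "bound_fm (q_less q_zero r \<^bold>\<and> ball_subset (Var a ty1) r P) <= z ==>
        max (Suc a) B <= z \<and> bound_q r <= z" for r z
      using bound_ball_subset[OF assms(2), of "Var a ty1" r z] by auto
    have "bound_fm (with_rat (Var 0 Nt) (%r. q_less q_zero r \<^bold>\<and> ball_subset (Var a ty1) r P)) <= b"
      using b by simp
    from B[OF conjunct2[OF bound_with_rat[OF this]]] have "max (Suc a) B <= b" ..
    then have ag': "agree (max (Suc a) B) ?w (?w((b, Nt) := k))" by (auto intro: agree_upd)
    have "holds (?w((b, Nt) := k)) (with_rat (Var b Nt) (%r. q_less q_zero r \<^bold>\<and> ball_subset (Var a ty1) r P)) \<longleftrightarrow>
      (%q. 0 < q \<and> Ball (sq d) q S) (rat (num (ev (?w((b, Nt) := k)) (Var b Nt))))"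
    proof (rule holds_with_rat[OF B, where v = "?w((b, Nt) := k)"])
      fix v' r assume v': "val v'" "agree (max (Suc a) B) (?w((b, Nt) := k)) v'" "qok v' r"
      have ag2: "agree (max (Suc a) B) ?w v'" by (rule agree_trans[OF ag' v'(2)])
      then have "agree B v v'" using agree_trans[OF ag] agree_mono by (meson max.cobounded2)
      moreover have "ev v' (Var a ty1) = d" using ag2 by (simp add: agree_def)
      ultimately show "holds v' (q_less q_zero r \<^bold>\<and> ball_subset (Var a ty1) r P) \<longleftrightarrow>
          0 < qv v' r \<and> Ball (sq d) (qv v' r) S"
        using holds_ball_subset[OF v'(1) denotes_agree[OF assms(2)], of "Var a ty1" r] v'(3) d
        by (simp add: holds_q_less q_zero)
    qed (use assms(1) d k in simp_all)
    then show "holds (?w((b, Nt) := k)) (\<^bold>\<not> with_rat (Var b Nt) (%r. q_less q_zero r \<^bold>\<and> ball_subset (Var a ty1) r P)) \<longleftrightarrow>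
      \<not> (0 < rat (num k) \<and> Ball (sq d) (rat (num k)) S)" by simp
  qed
  then show "holds ?w (P (Var a ty1) \<^bold>\<longrightarrow> ?E (Var a ty1)) \<longleftrightarrow>
      (S d --> (\<exists>k\<in>num ` C. 0 < rat k \<and> Ball (sq d) (rat k) S))"
    unfolding ex0_def holds.simps P by auto
qed

lemma holds_open_closed:
  assumes "val v" "ev v Y \<in> D ty11"
  shows "holds v (open_set Y) \<longleftrightarrow> Fun (ev v Y) \<and> Open (Mem (ev v Y))"
    and "holds v (closed_set Y) \<longleftrightarrow> Fun (ev v Y) \<and> Open (%x. \<not> Mem (ev v Y) x)"
  unfolding open_set_def closed_set_def
  using holds_is_open[OF assms(1) denotes_mem[OF assms(2)]]
    holds_is_open[OF assms(1) denotes_not[OF denotes_mem[OF assms(2)]]] holds_real_fun[OF assms]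
  by simp_all

lemma bound_open_closed: "bound_fm (open_set Y) <= z ==> bound_tm Y <= z" "bound_fm (closed_set Y) <= z ==> bound_tm Y <= z"
  unfolding open_set_def closed_set_def by (auto dest!: bound_real_fun)

definition Cont :: "'d => bool" where
  "Cont g \<longleftrightarrow> Fun g \<and> onD (%x. \<forall>k\<in>num ` C. \<exists>l\<in>num ` C. onD (%y.
     rdist (sq x) (sq y) (e l) --> rdist (sq (ap g x)) (sq (ap g y)) (e k)))"

lemma holds_cont_fun: assumes "val v" "ev v g \<in> D ty11" shows "holds v (cont_fun g) \<longleftrightarrow> Cont (ev v g)"
proof -
  let ?g = "ev v g"
  let ?R = "%x k l. \<^bold>\<forall>\<^sub>Ry. dist_less x y (q_exp l) \<^bold>\<longrightarrow> dist_less (g \<cdot> x) (g \<cdot> y) (q_exp k)"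
  let ?S = "%x k l. onD (%y. rdist (sq x) (sq y) (e (num l)) --> rdist (sq (ap ?g x)) (sq (ap ?g y)) (e (num k)))"
  have bR: "bound_tm x <= z \<and> bound_tm k <= z \<and> bound_tm l <= z \<and> bound_tm g <= z" if "bound_fm (?R x k l) <= z" for x k l z
    using bound_allR[OF that] by (auto dest!: bound_dist_less simp: bound_q_exp)
  have R: "holds w (?R x k l) \<longleftrightarrow> ?S (ev w x) (ev w k) (ev w l)"
    if h: "val w" "ev w x \<in> D ty1" "ev w k \<in> C" "ev w l \<in> C" "ev w g = ?g" for w x k l
    by (rule holds_allR[OF h(1)])
      (use h assms(2) in \<open>auto simp: holds_dist_less q_exp bound_q_exp dest!: bound_dist_less\<close>)
  have bE: "bound_tm x <= z \<and> bound_tm k <= z \<and> bound_tm g <= z" if "bound_fm (\<^bold>\<exists>\<^sub>0l. ?R x k l) <= z" for x k z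
    using that unfolding ex0_def all0_def by (auto dest!: bound_all_fresh bR)
  have E: "holds w (\<^bold>\<exists>\<^sub>0l. ?R x k l) \<longleftrightarrow> (\<exists>l\<in>C. ?S (ev w x) (ev w k) l)"
    if h: "val w" "ev w x \<in> D ty1" "ev w k \<in> C" "ev w g = ?g" for w x k
  proof -
    have "holds w (\<^bold>\<forall>\<^sub>0l. \<^bold>\<not> ?R x k l) \<longleftrightarrow> (\<forall>l\<in>C. \<not> ?S (ev w x) (ev w k) l)"
      unfolding all0_def
    proof (rule all_fresh_iff)
      fix b l assume "bound_fm (\<^bold>\<not> ?R x k (Var 0 Nt)) <= b" and l: "l \<in> C"
      then have "bound_fm (?R x k (Var 0 Nt)) <= b" by simp
      from bR[OF this] have "bound_tm x <= b \<and> bound_tm k <= b \<and> bound_tm g <= b" by blast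
      with l show "holds (w((b, Nt) := l)) (\<^bold>\<not> ?R x k (Var b Nt)) \<longleftrightarrow> \<not> ?S (ev w x) (ev w k) l"
        unfolding holds.simps by (subst R) (use h l in auto)
    qed
    then show ?thesis unfolding ex0_def holds.simps by blast
  qed
  have bA: "bound_tm x <= z \<and> bound_tm g <= z" if "bound_fm (\<^bold>\<forall>\<^sub>0k. \<^bold>\<exists>\<^sub>0l. ?R x k l) <= z" for x z
    using bE[OF bound_all_fresh[OF that[unfolded all0_def[of "%k. \<^bold>\<exists>\<^sub>0l. ?R x k l"]]]] by blast
  have A: "holds w (\<^bold>\<forall>\<^sub>0k. \<^bold>\<exists>\<^sub>0l. ?R x k l) \<longleftrightarrow> (\<forall>k\<in>C. \<exists>l\<in>C. ?S (ev w x) k l)"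
    if h: "val w" "ev w x \<in> D ty1" "ev w g = ?g" for w x
    unfolding all0_def[of "%k. \<^bold>\<exists>\<^sub>0l. ?R x k l"]
  proof (rule all_fresh_iff)
    fix b k assume "bound_fm (\<^bold>\<exists>\<^sub>0l. ?R x (Var 0 Nt) l) <= b" and k: "k \<in> C"
    then have "bound_tm x <= b \<and> bound_tm g <= b" using bE[of x "Var 0 Nt" b] by auto
    then show "holds (w((b, Nt) := k)) (\<^bold>\<exists>\<^sub>0l. ?R x (Var b Nt) l) \<longleftrightarrow> (\<exists>l\<in>C. ?S (ev w x) k l)"
      by (subst E) (use h k in auto)
  qed
  have "holds v (\<^bold>\<forall>\<^sub>Rx. \<^bold>\<forall>\<^sub>0k. \<^bold>\<exists>\<^sub>0l. ?R x k l) \<longleftrightarrow> onD (%x. \<forall>k\<in>C. \<exists>l\<in>C. ?S x k l)"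
  proof (rule holds_allR[OF assms(1)])
    fix a d assume "bound_fm (\<^bold>\<forall>\<^sub>0k. \<^bold>\<exists>\<^sub>0l. ?R (Var 0 ty1) k l) <= a" and d: "d \<in> D ty1"
    then have "bound_tm g <= a" using bA by blast
    then show "holds (v((a, ty1) := d)) (\<^bold>\<forall>\<^sub>0k. \<^bold>\<exists>\<^sub>0l. ?R (Var a ty1) k l) \<longleftrightarrow> (\<forall>k\<in>C. \<exists>l\<in>C. ?S d k l)"
      by (subst A) (use assms d in auto)
  qed
  then show ?thesis using holds_real_fun[OF assms] by (simp add: cont_fun_def Cont_def)
qed

definition NthBall :: "'k => ('d => bool) => bool" where
  "NthBall n S \<longleftrightarrow> (\<exists>k\<in>num ` C. \<exists>l\<in>num ` C. \<exists>a\<in>num ` C. \<exists>b\<in>num ` C.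
     ispair n k l \<and> ispair l a b \<and> Ball (%_. k) ((a + 1) / (b + 1)) S)"

lemma bound_ex_fresh: "bound_fm (\<^bold>\<exists>\<^sub>0x. F x) <= z ==> bound_fm (F (Var 0 Nt)) <= z"
  unfolding ex0_def all0_def by (auto dest!: bound_all_fresh)

lemma holds_ex0:
  assumes "!!x d. bound_fm (F (Var 0 Nt)) <= x ==> d \<in> C ==> holds (v((x, Nt) := d)) (F (Var x Nt)) \<longleftrightarrow> P d"
  shows "holds v (\<^bold>\<exists>\<^sub>0x. F x) \<longleftrightarrow> (\<exists>d\<in>C. P d)"
proof -
  have "holds v (all_fresh Nt (%x. \<^bold>\<not> F x)) \<longleftrightarrow> (\<forall>d\<in>C. \<not> P d)"
    by (rule all_fresh_iff) (simp add: assms)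
  then show ?thesis by (simp add: ex0_def all0_def)
qed

lemma holds_nth_ball_subset:
  assumes "val v" "denotes B v P S" "ev v n \<in> C"
  shows "holds v (nth_ball_subset n P) \<longleftrightarrow> NthBall (num (ev v n)) S"
proof -
  let ?F = "%k l a b. is_pair n k l \<^bold>\<and> is_pair l a b \<^bold>\<and> ball_subset (const_real k) (a \<^bold>+ \<^bold>1, \<^bold>0, b \<^bold>+ \<^bold>1) P"
  let ?S = "%k l a b. ispair (num (ev v n)) (num k) (num l) \<and> ispair (num l) (num a) (num b) \<and>
    Ball (%_. num k) ((num a + 1) / (num b + 1)) S"
  let ?M = "max B (bound_tm n)"
  have b0: "?M <= z \<and> bound_tm k <= z \<and> bound_tm l <= z \<and> bound_tm a <= z \<and> bound_tm b <= z"
    if "bound_fm (?F k l a b) <= z" for k l a b z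
  proof -
    have "bound_fm (ball_subset (const_real k) (a \<^bold>+ \<^bold>1, \<^bold>0, b \<^bold>+ \<^bold>1) P) <= z" using that by simp
    from bound_ball_subset[OF assms(2) this] show ?thesis using that by (auto simp: bound_const bound_is_pair)
  qed
  have 0: "holds w (?F k l a b) \<longleftrightarrow> ?S (ev w k) (ev w l) (ev w a) (ev w b)"
    if h: "val w" "agree ?M v w" "ev w k \<in> C" "ev w l \<in> C" "ev w a \<in> C" "ev w b \<in> C" for w k l a b
  proof -
    have "ev w n = ev v n" using ev_agree[OF h(2)] by simp
    moreover have "qok w (a \<^bold>+ \<^bold>1, \<^bold>0, b \<^bold>+ \<^bold>1)"
      using h num_nonneg[of "ev w b"] by (simp add: num_pl num_on)
    ultimately show ?thesis
      using h assms(3) holds_ball_subset[OF h(1) denotes_agree[OF assms(2) agree_mono[OF h(2)]], of "const_real k" "(a \<^bold>+ \<^bold>1, \<^bold>0, b \<^bold>+ \<^bold>1)"]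
      by (simp add: holds_is_pair ev_const num_pl num_on num_zr)
  qed
  have b1: "?M <= z \<and> bound_tm k <= z \<and> bound_tm l <= z \<and> bound_tm a <= z"
    if "bound_fm (\<^bold>\<exists>\<^sub>0b. ?F k l a b) <= z" for k l a z
    using b0[OF bound_ex_fresh[OF that]] by blast
  have 1: "holds w (\<^bold>\<exists>\<^sub>0b. ?F k l a b) \<longleftrightarrow> (\<exists>b\<in>C. ?S (ev w k) (ev w l) (ev w a) b)"
    if h: "val w" "agree ?M v w" "ev w k \<in> C" "ev w l \<in> C" "ev w a \<in> C" for w k l a
  proof (rule holds_ex0)
    fix x d assume x: "bound_fm (?F k l a (Var 0 Nt)) <= x" and d: "d \<in> C"
    show "holds (w((x, Nt) := d)) (?F k l a (Var x Nt)) \<longleftrightarrow> ?S (ev w k) (ev w l) (ev w a) d"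
      by (subst 0) (use b0[OF x] h d in \<open>auto intro!: agree_upd\<close>)
  qed
  have b2: "?M <= z \<and> bound_tm k <= z \<and> bound_tm l <= z" if "bound_fm (\<^bold>\<exists>\<^sub>0a. \<^bold>\<exists>\<^sub>0b. ?F k l a b) <= z" for k l z
    using b1[OF bound_ex_fresh[OF that]] by blast
  have 2: "holds w (\<^bold>\<exists>\<^sub>0a. \<^bold>\<exists>\<^sub>0b. ?F k l a b) \<longleftrightarrow> (\<exists>a\<in>C. \<exists>b\<in>C. ?S (ev w k) (ev w l) a b)"
    if h: "val w" "agree ?M v w" "ev w k \<in> C" "ev w l \<in> C" for w k l
  proof (rule holds_ex0)
    fix x d assume x: "bound_fm (\<^bold>\<exists>\<^sub>0b. ?F k l (Var 0 Nt) b) <= x" and d: "d \<in> C"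
    show "holds (w((x, Nt) := d)) (\<^bold>\<exists>\<^sub>0b. ?F k l (Var x Nt) b) \<longleftrightarrow> (\<exists>b\<in>C. ?S (ev w k) (ev w l) d b)"
      by (subst 1) (use b1[OF x] h d in \<open>auto intro!: agree_upd\<close>)
  qed
  have b3: "?M <= z \<and> bound_tm k <= z" if "bound_fm (\<^bold>\<exists>\<^sub>0l. \<^bold>\<exists>\<^sub>0a. \<^bold>\<exists>\<^sub>0b. ?F k l a b) <= z" for k z
    using b2[OF bound_ex_fresh[OF that]] by blast
  have 3: "holds w (\<^bold>\<exists>\<^sub>0l. \<^bold>\<exists>\<^sub>0a. \<^bold>\<exists>\<^sub>0b. ?F k l a b) \<longleftrightarrow> (\<exists>l\<in>C. \<exists>a\<in>C. \<exists>b\<in>C. ?S (ev w k) l a b)"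
    if h: "val w" "agree ?M v w" "ev w k \<in> C" for w k
  proof (rule holds_ex0)
    fix x d assume x: "bound_fm (\<^bold>\<exists>\<^sub>0a. \<^bold>\<exists>\<^sub>0b. ?F k (Var 0 Nt) a b) <= x" and d: "d \<in> C"
    show "holds (w((x, Nt) := d)) (\<^bold>\<exists>\<^sub>0a. \<^bold>\<exists>\<^sub>0b. ?F k (Var x Nt) a b) \<longleftrightarrow> (\<exists>a\<in>C. \<exists>b\<in>C. ?S (ev w k) d a b)"
      by (subst 2) (use b2[OF x] h d in \<open>auto intro!: agree_upd\<close>)
  qed
  have "holds v (\<^bold>\<exists>\<^sub>0k. \<^bold>\<exists>\<^sub>0l. \<^bold>\<exists>\<^sub>0a. \<^bold>\<exists>\<^sub>0b. ?F k l a b) \<longleftrightarrow> (\<exists>k\<in>C. \<exists>l\<in>C. \<exists>a\<in>C. \<exists>b\<in>C. ?S k l a b)"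
  proof (rule holds_ex0)
    fix x d assume x: "bound_fm (\<^bold>\<exists>\<^sub>0l. \<^bold>\<exists>\<^sub>0a. \<^bold>\<exists>\<^sub>0b. ?F (Var 0 Nt) l a b) <= x" and d: "d \<in> C"
    show "holds (v((x, Nt) := d)) (\<^bold>\<exists>\<^sub>0l. \<^bold>\<exists>\<^sub>0a. \<^bold>\<exists>\<^sub>0b. ?F (Var x Nt) l a b) \<longleftrightarrow> (\<exists>l\<in>C. \<exists>a\<in>C. \<exists>b\<in>C. ?S d l a b)"
      by (subst 3) (use b3[OF x] assms d in \<open>auto intro!: agree_upd\<close>)
  qed
  then show ?thesis by (simp add: nth_ball_subset_def NthBall_def)
qed

lemma bound_nth_ball_subset: "denotes B v P S ==> bound_fm (nth_ball_subset n P) <= z ==> bound_tm n <= z \<and> B <= z"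
  unfolding nth_ball_subset_def
  by (drule bound_ex_fresh, drule bound_ex_fresh, drule bound_ex_fresh, drule bound_ex_fresh)
    (auto dest!: bound_ball_subset simp: bound_is_pair)

lemma holds_OPEN: "val v ==> holds v OPEN \<longleftrightarrow> (\<forall>Y\<in>D ty11. Fun Y \<and> Open (Mem Y) -->
    (\<exists>X\<in>D ty1. (\<forall>n\<in>num ` C. sq X n <= 1) \<and> (\<forall>n\<in>num ` C. sq X n = 1 \<longleftrightarrow> NthBall n (Mem Y))))"
  unfolding OPEN_def all11_def
proof (rule all_fresh_iff)
  let ?F = "%Y X. (\<^bold>\<forall>\<^sub>0n. X \<cdot> n \<^bold>\<le> \<^bold>1) \<^bold>\<and> (\<^bold>\<forall>\<^sub>0n. X \<cdot> n \<^bold>= \<^bold>1 \<^bold>\<longleftrightarrow> nth_ball_subset n (%x. mem x Y))"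
  fix a Y assume v: "val v" and Y: "Y \<in> D ty11"
  let ?w = "v((a, ty11) := Y)" and ?Y = "Var a ty11"
  have w: "val ?w" "ev ?w ?Y = Y" using v Y by simp_all
  have "holds ?w (all_fresh ty1 (%X. \<^bold>\<not> ?F ?Y X)) \<longleftrightarrow> (\<forall>X\<in>D ty1. \<not> ((\<forall>n\<in>C. num (ap X n) <= 1) \<and>
      (\<forall>n\<in>C. num (ap X n) = 1 \<longleftrightarrow> NthBall (num n) (Mem Y))))"
  proof (rule all_fresh_iff)
    fix b X assume b: "bound_fm (\<^bold>\<not> ?F ?Y (Var 0 ty1)) <= b" and X: "X \<in> D ty1"
    let ?u = "?w((b, ty1) := X)" and ?X = "Var b ty1"
    have den: "denotes (Suc a) ?w (%x. mem x ?Y) (Mem Y)"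
      using denotes_mem[of ?w ?Y] w Y by simp
    have "bound_fm (\<^bold>\<forall>\<^sub>0n. Var 0 ty1 \<cdot> n \<^bold>= \<^bold>1 \<^bold>\<longleftrightarrow> nth_ball_subset n (%x. mem x ?Y)) <= b" using b by simp
    from bound_all_fresh[OF this[unfolded all0_def]] have "Suc a <= b"
      using bound_nth_ball_subset[OF den, of "Var 0 Nt" b] by simp
    then have u: "val ?u" "ev ?u ?Y = Y" "ev ?u ?X = X" using w X Y by auto
    have den: "denotes (Suc a) ?u (%x. mem x ?Y) (Mem Y)"
      using denotes_mem[of ?u ?Y] u Y by simp
    have 1: "holds ?u (\<^bold>\<forall>\<^sub>0n. ?X \<cdot> n \<^bold>\<le> \<^bold>1) \<longleftrightarrow> (\<forall>n\<in>C. num (ap X n) <= 1)"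
      unfolding all0_def
      by (rule all_fresh_iff) (use X num_less[OF on_in] in \<open>auto simp: num_on simp flip: not_less\<close>)
    have 2: "holds ?u (\<^bold>\<forall>\<^sub>0n. ?X \<cdot> n \<^bold>= \<^bold>1 \<^bold>\<longleftrightarrow> nth_ball_subset n (%x. mem x ?Y)) \<longleftrightarrow>
        (\<forall>n\<in>C. num (ap X n) = 1 \<longleftrightarrow> NthBall (num n) (Mem Y))"
      unfolding all0_def
    proof (rule all_fresh_iff)
      fix c n assume c: "bound_fm (?X \<cdot> Var 0 Nt \<^bold>= \<^bold>1 \<^bold>\<longleftrightarrow> nth_ball_subset (Var 0 Nt) (%x. mem x ?Y)) <= c" and n: "n \<in> C"
      have "bound_fm (nth_ball_subset (Var 0 Nt) (%x. mem x ?Y)) <= c" "Suc b <= c" using c by auto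
      then have c': "Suc a <= c" "Suc b <= c" using bound_nth_ball_subset[OF den] by blast+
      let ?t = "?u((c, Nt) := n)"
      have "holds ?t (nth_ball_subset (Var c Nt) (%x. mem x ?Y)) \<longleftrightarrow> NthBall (num (ev ?t (Var c Nt))) (Mem Y)"
        by (rule holds_nth_ball_subset[OF _ denotes_agree[OF den agree_upd[OF agree_refl c'(1)]]]) (use u n in auto)
      moreover have "ap X n = on \<longleftrightarrow> num (ap X n) = 1" using num_eq[of "ap X n" on] num_on X n by simp
      ultimately show "holds ?t (?X \<cdot> Var c Nt \<^bold>= \<^bold>1 \<^bold>\<longleftrightarrow> nth_ball_subset (Var c Nt) (%x. mem x ?Y)) \<longleftrightarrow>
          (num (ap X n) = 1 \<longleftrightarrow> NthBall (num n) (Mem Y))" using c' u by auto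
    qed
    show "holds ?u (\<^bold>\<not> ?F ?Y ?X) \<longleftrightarrow> \<not> ((\<forall>n\<in>C. num (ap X n) <= 1) \<and>
      (\<forall>n\<in>C. num (ap X n) = 1 \<longleftrightarrow> NthBall (num n) (Mem Y)))" unfolding holds.simps 1 2 by blast
  qed
  moreover have "holds ?w (open_set ?Y) \<longleftrightarrow> Fun Y \<and> Open (Mem Y)" using holds_open_closed[OF w(1), of ?Y] w Y by simp
  ultimately show "holds ?w (open_set ?Y \<^bold>\<longrightarrow> (\<^bold>\<exists>\<^sub>1X. ?F ?Y X)) \<longleftrightarrow> (Fun Y \<and> Open (Mem Y) -->
    (\<exists>X\<in>D ty1. (\<forall>n\<in>num ` C. sq X n <= 1) \<and> (\<forall>n\<in>num ` C. sq X n = 1 \<longleftrightarrow> NthBall n (Mem Y))))"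
    unfolding ex1_def all1_def by (auto simp: sq_num)
qed

lemma holds_URY: "val v ==> holds v URY \<longleftrightarrow> (\<forall>C\<^sub>0\<in>D ty11. \<forall>C\<^sub>1\<in>D ty11.
    (Fun C\<^sub>0 \<and> Open (%x. \<not> Mem C\<^sub>0 x)) \<and> (Fun C\<^sub>1 \<and> Open (%x. \<not> Mem C\<^sub>1 x)) \<and>
    onD (%x. \<not> (Mem C\<^sub>0 x \<and> Mem C\<^sub>1 x)) -->
    (\<exists>g\<in>D ty11. Cont g \<and>
      onD (%x. \<not> rless (sq (ap g x)) (%_. 0) \<and> \<not> rless (%_. 5) (sq (ap g x))) \<and>
      onD (%x. (Mem C\<^sub>0 x \<longleftrightarrow> req (sq (ap g x)) (%_. 0)) \<and> (Mem C\<^sub>1 x \<longleftrightarrow> req (sq (ap g x)) (%_. 5)))))"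
  unfolding URY_def all11_def
proof (rule all_fresh_iff, rule all_fresh_iff)
  let ?A = "%C\<^sub>0 C\<^sub>1. closed_set C\<^sub>0 \<^bold>\<and> closed_set C\<^sub>1 \<^bold>\<and> (\<^bold>\<forall>\<^sub>Rx. \<^bold>\<not> (mem x C\<^sub>0 \<^bold>\<and> mem x C\<^sub>1))"
  let ?G1 = "%g. \<^bold>\<forall>\<^sub>Rx. real_leq real_zero (g \<cdot> x) \<^bold>\<and> real_leq (g \<cdot> x) real_one"
  let ?G2 = "%C\<^sub>0 C\<^sub>1 g. \<^bold>\<forall>\<^sub>Rx. (mem x C\<^sub>0 \<^bold>\<longleftrightarrow> real_eq (g \<cdot> x) real_zero) \<^bold>\<and> (mem x C\<^sub>1 \<^bold>\<longleftrightarrow> real_eq (g \<cdot> x) real_one)"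
  let ?B = "%C\<^sub>0 C\<^sub>1. \<^bold>\<exists>\<^sub>1\<^sub>1g. cont_fun g \<^bold>\<and> ?G1 g \<^bold>\<and> ?G2 C\<^sub>0 C\<^sub>1 g"
  fix a b c0 c1
  assume v: "val v" and "bound_fm (all_fresh ty11 (%C\<^sub>1. ?A (Var 0 ty11) C\<^sub>1 \<^bold>\<longrightarrow> ?B (Var 0 ty11) C\<^sub>1)) <= a"
    and b: "bound_fm (?A (Var a ty11) (Var 0 ty11) \<^bold>\<longrightarrow> ?B (Var a ty11) (Var 0 ty11)) <= b"
    and c: "c0 \<in> D ty11" "c1 \<in> D ty11"
  let ?w = "v((a, ty11) := c0, (b, ty11) := c1)"
  let ?c0 = "Var a ty11" and ?c1 = "Var b ty11"
  have "bound_fm (closed_set ?c0) <= b" using b by simp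
  then have ab: "Suc a <= b" using bound_open_closed by fastforce
  then have w: "val ?w" "ev ?w ?c0 = c0" "ev ?w ?c1 = c1" using v c by auto
  have R: "holds ?w (\<^bold>\<forall>\<^sub>Rx. \<^bold>\<not> (mem x ?c0 \<^bold>\<and> mem x ?c1)) \<longleftrightarrow> onD (%x. \<not> (Mem c0 x \<and> Mem c1 x))"
  proof (rule holds_allR[OF w(1)])
    fix x d assume x: "bound_fm (\<^bold>\<not> (mem (Var 0 ty1) ?c0 \<^bold>\<and> mem (Var 0 ty1) ?c1)) <= x" and d: "d \<in> D ty1"
    then have x': "a < x" "b < x" by (auto dest!: bound_mem)
    then show "holds (?w((x, ty1) := d)) (\<^bold>\<not> (mem (Var x ty1) ?c0 \<^bold>\<and> mem (Var x ty1) ?c1)) \<longleftrightarrow> \<not> (Mem c0 d \<and> Mem c1 d)"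
      using w c d holds_mem[of "?w((x, ty1) := d)" "Var x ty1"] by simp
  qed
  have "holds ?w (all_fresh ty11 (%g. \<^bold>\<not> (cont_fun g \<^bold>\<and> ?G1 g \<^bold>\<and> ?G2 ?c0 ?c1 g))) \<longleftrightarrow>
    (\<forall>g\<in>D ty11. \<not> (Cont g \<and> onD (%x. \<not> rless (sq (ap g x)) (%_. 0) \<and> \<not> rless (%_. 5) (sq (ap g x))) \<and>
      onD (%x. (Mem c0 x \<longleftrightarrow> req (sq (ap g x)) (%_. 0)) \<and> (Mem c1 x \<longleftrightarrow> req (sq (ap g x)) (%_. 5)))))"
  proof (rule all_fresh_iff)
    fix y g assume y: "bound_fm (\<^bold>\<not> (cont_fun (Var 0 ty11) \<^bold>\<and> ?G1 (Var 0 ty11) \<^bold>\<and> ?G2 ?c0 ?c1 (Var 0 ty11))) <= y"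
      and g: "g \<in> D ty11"
    have "bound_fm (?G2 ?c0 ?c1 (Var 0 ty11)) <= y" using y by simp
    then have y': "a < y" "b < y" by (auto dest!: bound_allR bound_mem)
    let ?u = "?w((y, ty11) := g)" and ?g = "Var y ty11"
    have u: "val ?u" "ev ?u ?c0 = c0" "ev ?u ?c1 = c1" "ev ?u ?g = g" using w c g y' by auto
    have G1: "holds ?u (?G1 ?g) \<longleftrightarrow> onD (%x. \<not> rless (sq (ap g x)) (%_. 0) \<and> \<not> rless (%_. 5) (sq (ap g x)))"
    proof (rule holds_allR[OF u(1)])
      fix x d assume "bound_fm (real_leq real_zero (?g \<cdot> Var 0 ty1) \<^bold>\<and> real_leq (?g \<cdot> Var 0 ty1) real_one) <= x"
        and d: "d \<in> D ty1"
      then have x: "y < x" unfolding real_leq_def by (auto dest!: bound_real_less)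
      then show "holds (?u((x, ty1) := d)) (real_leq real_zero (?g \<cdot> Var x ty1) \<^bold>\<and> real_leq (?g \<cdot> Var x ty1) real_one) \<longleftrightarrow>
          \<not> rless (sq (ap g d)) (%_. 0) \<and> \<not> rless (%_. 5) (sq (ap g d))"
        using u d g holds_real_less[of "?u((x, ty1) := d)"] unfolding real_leq_def by (simp add: ev_zero_one)
    qed
    have G2: "holds ?u (?G2 ?c0 ?c1 ?g) \<longleftrightarrow>
        onD (%x. (Mem c0 x \<longleftrightarrow> req (sq (ap g x)) (%_. 0)) \<and> (Mem c1 x \<longleftrightarrow> req (sq (ap g x)) (%_. 5)))"
    proof (rule holds_allR[OF u(1)])
      fix x d assume x: "bound_fm ((mem (Var 0 ty1) ?c0 \<^bold>\<longleftrightarrow> real_eq (?g \<cdot> Var 0 ty1) real_zero) \<^bold>\<and>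
        (mem (Var 0 ty1) ?c1 \<^bold>\<longleftrightarrow> real_eq (?g \<cdot> Var 0 ty1) real_one)) <= x" and d: "d \<in> D ty1"
      have "bound_fm (mem (Var 0 ty1) ?c0) <= x" "bound_fm (mem (Var 0 ty1) ?c1) <= x"
        "bound_fm (real_eq (?g \<cdot> Var 0 ty1) real_zero) <= x" using x by auto
      then have x: "a < x" "b < x" "y < x" using bound_mem bound_real_eq by fastforce+
      let ?t = "?u((x, ty1) := d)"
      have t: "val ?t" "ev ?t ?c0 = c0" "ev ?t ?c1 = c1" "ev ?t (?g \<cdot> Var x ty1) = ap g d" "ev ?t (Var x ty1) = d"
        using u x d by auto
      show "holds ?t ((mem (Var x ty1) ?c0 \<^bold>\<longleftrightarrow> real_eq (?g \<cdot> Var x ty1) real_zero) \<^bold>\<and>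
          (mem (Var x ty1) ?c1 \<^bold>\<longleftrightarrow> real_eq (?g \<cdot> Var x ty1) real_one)) \<longleftrightarrow>
        (Mem c0 d \<longleftrightarrow> req (sq (ap g d)) (%_. 0)) \<and> (Mem c1 d \<longleftrightarrow> req (sq (ap g d)) (%_. 5))"
        unfolding holds.simps
        using holds_mem[OF t(1), of "Var x ty1" ?c0] holds_mem[OF t(1), of "Var x ty1" ?c1]
          holds_real_eq[OF t(1), of "?g \<cdot> Var x ty1" real_zero] holds_real_eq[OF t(1), of "?g \<cdot> Var x ty1" real_one]
          t(2-5) c d g ev_zero_one[of ?t] by auto
    qed
    show "holds ?u (\<^bold>\<not> (cont_fun ?g \<^bold>\<and> ?G1 ?g \<^bold>\<and> ?G2 ?c0 ?c1 ?g)) \<longleftrightarrow>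
      \<not> (Cont g \<and> onD (%x. \<not> rless (sq (ap g x)) (%_. 0) \<and> \<not> rless (%_. 5) (sq (ap g x))) \<and>
      onD (%x. (Mem c0 x \<longleftrightarrow> req (sq (ap g x)) (%_. 0)) \<and> (Mem c1 x \<longleftrightarrow> req (sq (ap g x)) (%_. 5))))"
      using holds_cont_fun[OF u(1), of ?g] u(4) g unfolding holds.simps G1 G2 by auto
  qed
  moreover have "holds ?w (closed_set ?c0) \<longleftrightarrow> Fun c0 \<and> Open (%x. \<not> Mem c0 x)"
    "holds ?w (closed_set ?c1) \<longleftrightarrow> Fun c1 \<and> Open (%x. \<not> Mem c1 x)"
    using holds_open_closed(2)[OF w(1), of ?c0] holds_open_closed(2)[OF w(1), of ?c1] w(2,3) c by simp_all
  ultimately show "holds ?w (?A ?c0 ?c1 \<^bold>\<longrightarrow> ?B ?c0 ?c1) \<longleftrightarrow>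
    ((Fun c0 \<and> Open (%x. \<not> Mem c0 x)) \<and> (Fun c1 \<and> Open (%x. \<not> Mem c1 x)) \<and>
    onD (%x. \<not> (Mem c0 x \<and> Mem c1 x)) -->
    (\<exists>g\<in>D ty11. Cont g \<and>
      onD (%x. \<not> rless (sq (ap g x)) (%_. 0) \<and> \<not> rless (%_. 5) (sq (ap g x))) \<and>
      onD (%x. (Mem c0 x \<longleftrightarrow> req (sq (ap g x)) (%_. 0)) \<and> (Mem c1 x \<longleftrightarrow> req (sq (ap g x)) (%_. 5)))))"
    unfolding ex11_def all11_def holds.simps R by blast
qed

end

lemma wf_with_rat:
  assumes "tm_ty k = Some Nt"
    "!!p m d. tm_ty p = Some Nt ==> tm_ty m = Some Nt ==> tm_ty d = Some Nt ==> wf_fm (\<Phi> (p, m, d))"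
  shows "wf_fm (with_rat k \<Phi>)"
  unfolding with_rat_def is_rat_def is_pair_def ex0_def all0_def
  by (simp, intro wf_all_fresh, simp, intro wf_all_fresh, simp, intro wf_all_fresh, simp)
    (auto intro!: wf_all_fresh assms simp: assms(1))

lemma wf_URY_OPEN: "wf_fm (URY \<^bold>\<longleftrightarrow> OPEN)"
proof -
  have pow: "tm_ty t = Some Nt ==> tm_ty (pow2_tm t) = Some Nt" for t
    by (simp add: pow2_tm_def double_tm_def)
  have ball: "wf_fm (ball_subset x (p, m, d) P)"
    if "tm_ty x = Some ty1" "tm_ty p = Some Nt" "tm_ty m = Some Nt" "tm_ty d = Some Nt"
      "!!y. tm_ty y = Some ty1 ==> wf_fm (P y)" for x p m d P
    using that unfolding ball_subset_def dist_less_def allR_def all1_def ex0_def all0_def is_real_def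
    by (auto intro!: wf_all_fresh wf_with_rat simp: pow q_abs_less_def q_diff_def q_exp_def q_exp1_def)
  have mem: "wf_fm (mem x Y)" if "tm_ty x = Some ty1" "tm_ty Y = Some ty11" for x Y
    using that unfolding mem_def real_less_def ex0_def all0_def
    by (auto intro!: wf_all_fresh wf_with_rat simp: pow q_exp1_def real_zero_def const_real_def)
  have op: "wf_fm (is_open P)" if "!!y. tm_ty y = Some ty1 ==> wf_fm (P y)" for P
    using that unfolding is_open_def allR_def all1_def ex0_def all0_def is_real_def
    by (auto intro!: wf_all_fresh wf_with_rat ball simp: pow q_abs_less_def q_diff_def q_exp_def q_zero_def)
  have rf: "wf_fm (real_fun Y)" if "tm_ty Y = Some ty11" for Y
    using that unfolding real_fun_def allR_def all1_def ex0_def all0_def is_real_def real_eq_def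
    by (auto intro!: wf_all_fresh wf_with_rat simp: pow q_abs_less_def q_abs_leq_def q_leq_def q_diff_def q_exp_def q_exp1_def)
  have "wf_fm OPEN" unfolding OPEN_def open_set_def all11_def ex1_def all1_def all0_def nth_ball_subset_def ex0_def
    by (auto intro!: wf_all_fresh ball mem op rf simp: is_pair_def const_real_def)
  moreover have "wf_fm URY" unfolding URY_def closed_set_def all11_def ex11_def allR_def all1_def all0_def
      cont_fun_def dist_less_def real_leq_def real_less_def real_eq_def ex0_def is_real_def
    by (auto intro!: wf_all_fresh wf_with_rat mem op rf simp: pow q_abs_less_def q_abs_leq_def q_leq_def q_diff_def q_exp_def
      q_exp1_def real_zero_def real_one_def const_real_def)
  ultimately show ?thesis by simp
qed

section \<open>\<open>URY\<close> and \<open>OPEN\<close> in a model\<close>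

context field_model begin

lemma rless_0: "isreal \<xi> ==> rless (%_. 0) \<xi> \<longleftrightarrow> lt 0 \<xi>"
  unfolding rless_def using real_less_iff[OF isreal_const[OF N0]] lt_open lt_mono
  by (auto simp: rat_0)

lemma rless_const: assumes "isreal \<xi>" "k \<in> num ` C" shows "rless \<xi> (%_. k) \<longleftrightarrow> ut \<xi> (rat k)"
  unfolding rless_def using real_less_iff[OF assms(1) isreal_const[OF assms(2)]] ut_open[of \<xi> "rat k"] ut_mono[of \<xi> _ "rat k"]
  by (auto intro: less_imp_le)

lemma req_iff: "isreal \<xi> ==> isreal \<eta> ==> req \<xi> \<eta> \<longleftrightarrow> (\<forall>a. lt a \<xi> \<longleftrightarrow> lt a \<eta>)"
  unfolding req_def by (rule real_eq_iff)

lemma rdist_iff: "isreal \<xi> ==> isreal \<eta> ==> rdist \<xi> \<eta> r \<longleftrightarrow> near \<xi> \<eta> r"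
  unfolding rdist_def by (rule near_iff)

lemma Fun_real: "Fun Y ==> x \<in> D ty1 ==> isreal (sq x) ==> isreal (sq (ap Y x))"
  by (simp add: Fun_def onD_def)

lemma Mem_iff: "Fun Y ==> x \<in> D ty1 ==> isreal (sq x) ==> Mem Y x \<longleftrightarrow> lt 0 (sq (ap Y x))"
  by (simp add: Mem_def rless_0 Fun_real)

lemma Ball_iff: "isreal \<xi> ==> Ball \<xi> r S \<longleftrightarrow> (\<forall>y\<in>D ty1. isreal (sq y) --> near \<xi> (sq y) r --> S y)"
  by (auto simp: Ball_def onD_def rdist_iff)

lemma Open_cong: assumes "!!x. x \<in> D ty1 ==> isreal (sq x) ==> S x \<longleftrightarrow> S' x" shows "Open S \<longleftrightarrow> Open S'"
proof -
  have "Ball \<xi> r S = Ball \<xi> r S'" for \<xi> r using assms by (auto simp: Ball_def onD_def)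
  then show ?thesis using assms by (auto simp: Open_def onD_def)
qed

text \<open>\<open>URY\<close> speaks of closed sets and \<open>OPEN\<close> of open ones, both
  given as positivity sets. The complement has an indicator function in the model because \<mu>
  decides whether a real is positive.\<close>

lemma complement_exists:
  assumes "Y \<in> D ty11" "Fun Y"
  shows "\<exists>Z\<in>D ty11. Fun Z \<and> (\<forall>x\<in>D ty1. isreal (sq x) --> (Mem Z x \<longleftrightarrow> \<not> Mem Y x))"
proof -
  have "dec env1 (%x. lt 0 (sq (ap Y (snd x))))"
    by (rule dec_lt[OF df_ap_x[OF assms(1)] dfq_const[OF env1(1)]])
  then have "df (push env1) (%p. if lt 0 (sq (ap Y (snd (fst p)))) then 0 else 1)"
    unfolding dec_def by (rule df_weak)
  then have "df (push env1) (%p. 5 * (if lt 0 (sq (ap Y (snd (fst p)))) then 0 else 1))"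
    by (intro df_mult df_const N5 valid_push env1)
  from fun_exists[OF this] obtain Z where Z: "Z \<in> D ty11"
    "!!x n. x \<in> D ty1 ==> n \<in> num ` C ==> sq (ap Z x) n = 5 * (if lt 0 (sq (ap Y x)) then 0 else 1)" by blast
  have k: "5 * (if lt 0 (sq (ap Y x)) then 0 else 1) \<in> num ` C" for x using N0 N5 by auto
  have r: "isreal (sq (ap Z x))" and l: "lt a (sq (ap Z x)) \<longleftrightarrow> a < (if lt 0 (sq (ap Y x)) then 0 else 1)"
    if "x \<in> D ty1" for x a
  proof -
    let ?K = "%_ :: 'k. 5 * (if lt 0 (sq (ap Y x)) then 0 else 1) :: 'k"
    have "isreal (sq (ap Z x)) \<longleftrightarrow> isreal ?K" by (rule isreal_cong) (rule Z(2)[OF that])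
    then show "isreal (sq (ap Z x))" using isreal_const[OF k] by simp
    have "lt a (sq (ap Z x)) \<longleftrightarrow> lt a ?K" by (rule lt_cong) (rule Z(2)[OF that])
    then show "lt a (sq (ap Z x)) \<longleftrightarrow> a < (if lt 0 (sq (ap Y x)) then 0 else 1)" by (simp add: rat_0 rat_5)
  qed
  have "req (sq (ap Z x)) (sq (ap Z y))"
    if "x \<in> D ty1" "y \<in> D ty1" "isreal (sq x)" "isreal (sq y)" "req (sq x) (sq y)" for x y
  proof -
    have "req (sq (ap Y x)) (sq (ap Y y))" using assms(2) that by (simp add: Fun_def onD_def)
    then have "lt 0 (sq (ap Y x)) \<longleftrightarrow> lt 0 (sq (ap Y y))" using req_iff Fun_real[OF assms(2)] that by blast
    then show ?thesis using req_iff[OF r r] l that by auto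
  qed
  then have "Fun Z" using r by (simp add: Fun_def onD_def)
  moreover have "Mem Z x \<longleftrightarrow> \<not> Mem Y x" if "x \<in> D ty1" "isreal (sq x)" for x
    using Mem_iff[OF \<open>Fun Z\<close> that] Mem_iff[OF assms(2) that] l[OF that(1)] by simp
  ultimately show ?thesis using Z(1) by blast
qed

definition Enum :: "'d => ('d => bool) => bool" where
  "Enum X S \<longleftrightarrow> X \<in> D ty1 \<and> (\<forall>n\<in>num ` C. sq X n = 1 \<longleftrightarrow> NthBall n S)"

text \<open>A ball that is not selected gets radius 0 and thus contributes no point to
  \<open>dlt\<close>.\<close>

definition rads :: "'d => 'k => 'k" where "rads X n = (if sq X n = 1 then rad n else 0)"

definition cen :: "'k => 'k" where "cen n = rat (prl n)"

text \<open>By \<open>ball_code\<close>, a point of an open set lies in some ball of the enumeration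
  that stays inside the set, so the selected balls cover it.\<close>

lemma dlt_Enum:
  assumes "Enum X S" "Open S" "x \<in> D ty1" "isreal (sq x)"
  shows "dlt cen (rads X) (sq x) 0 \<longleftrightarrow> S x"
proof
  assume "dlt cen (rads X) (sq x) 0"
  then obtain n where n: "n \<in> num ` C" "lt (cen n - rads X n) (sq x)" "ut (sq x) (cen n + rads X n)"
    unfolding dlt_def by auto
  then have "cen n - rads X n < cen n + rads X n" using lt_ut_less[OF assms(4)] by blast
  then have X: "sq X n = 1" by (auto simp: rads_def split: if_splits)
  then have "NthBall n S" using assms(1) n(1) unfolding Enum_def by blast
  then obtain k l a b where k: "k \<in> num ` C" "l \<in> num ` C" "a \<in> num ` C" "b \<in> num ` C"
    "ispair n k l" "ispair l a b" "Ball (%_. k) ((a + 1) / (b + 1)) S" unfolding NthBall_def by blast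
  then have "cen n = rat k" "rads X n = (a + 1) / (b + 1)"
    using pr_eq[OF n(1) k(1,2,5)] pr_eq[OF k(2,3,4,6)] X by (simp_all add: cen_def rads_def rad_def)
  then have "near (%_. k) (sq x) ((a + 1) / (b + 1))" using n near_const[OF assms(4)] by simp
  then show "S x" using k(7) assms(3,4) Ball_iff[OF isreal_const[OF k(1)]] by blast
next
  assume "S x"
  then obtain \<delta> where \<delta>: "0 < \<delta>" "Ball (sq x) \<delta> S" using assms unfolding Open_def onD_def by blast
  obtain n k l a b where n: "n \<in> num ` C" "k \<in> num ` C" "l \<in> num ` C" "a \<in> num ` C" "b \<in> num ` C"
    "ispair n k l" "ispair l a b" "prl n = k" "rad n = (a + 1) / (b + 1)" "lt (rat k - rad n) (sq x)" "ut (sq x) (rat k + rad n)"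
    "!!\<eta>. lt (rat k - rad n) \<eta> ==> ut \<eta> (rat k + rad n) ==> near (sq x) \<eta> \<delta>"
    using ball_code[OF assms(4) \<delta>(1)] by blast
  have "Ball (%_. k) (rad n) S"
    unfolding Ball_iff[OF isreal_const[OF n(2)]]
    using near_const n(12) \<delta>(2) Ball_iff[OF assms(4)] by blast
  then have "NthBall n S" unfolding NthBall_def n(9)[symmetric] using n(1-7,9) by metis
  then have "sq X n = 1" using assms(1) n(1) unfolding Enum_def by blast
  then show "dlt cen (rads X) (sq x) 0" unfolding dlt_def using n
    by (intro bexI[of _ n]) (auto simp: cen_def rads_def)
qed

lemma dfq_cen: "df c F ==> dfq c (%x. cen (F x))"
  unfolding cen_def by (intro dfq_rat df_prl)

lemma dfq_rads: assumes "valid c" "X \<in> D ty1" shows "dfq (push c) (%p. rads X (snd p))"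
proof -
  let ?i = "%p. if sq X (snd p) = 1 then 0 else 1 :: 'k"
  have X: "df (push c) (%p. sq X (snd p))" by (rule df_sq[of c "%_. X"]) (rule dft_const[OF assms])
  have i: "df (push c) ?i" using dec_eq[OF X df_const[OF valid_push[OF assms(1)] N1]] by (simp add: dec_def)
  have "df (push c) (%p. if ?i p <= 1 then 1 - ?i p else 0)" by (intro df_monus i df_const N1 valid_push assms)
  from dfq_mult[OF dfq_df[OF this] dfq_rad[OF df_var[OF assms(1)]]] show ?thesis
    by (rule dfq_cong) (simp add: rads_def)
qed

lemma OPEN_URY: assumes "val v" "holds v OPEN" shows "holds v URY"
  unfolding holds_URY[OF assms(1)]
proof (intro ballI impI)
  fix C0 C1 assume C: "C0 \<in> D ty11" "C1 \<in> D ty11"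
    and "(Fun C0 \<and> Open (%x. \<not> Mem C0 x)) \<and> (Fun C1 \<and> Open (%x. \<not> Mem C1 x)) \<and> onD (%x. \<not> (Mem C0 x \<and> Mem C1 x))"
  then have F: "Fun C0" "Fun C1" and op: "Open (%x. \<not> Mem C0 x)" "Open (%x. \<not> Mem C1 x)"
    and dis: "!!x. x \<in> D ty1 ==> isreal (sq x) ==> \<not> Mem C0 x \<or> \<not> Mem C1 x" by (auto simp: onD_def)
  have en: "\<exists>X. Enum X (%x. \<not> Mem Y x)" if Y: "Y \<in> D ty11" "Fun Y" "Open (%x. \<not> Mem Y x)" for Y
  proof -
    obtain Z where Z: "Z \<in> D ty11" "Fun Z" "!!x. x \<in> D ty1 ==> isreal (sq x) ==> Mem Z x \<longleftrightarrow> \<not> Mem Y x"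
      using complement_exists[OF Y(1,2)] by blast
    have "Ball \<xi> r (Mem Z) = Ball \<xi> r (%x. \<not> Mem Y x)" for \<xi> r using Z(3) by (auto simp: Ball_def onD_def)
    moreover have "Open (Mem Z)" using Open_cong[of "Mem Z" "%x. \<not> Mem Y x"] Z(3) Y(3) by blast
    ultimately show ?thesis using assms Z(1,2) unfolding holds_OPEN[OF assms(1)] Enum_def NthBall_def by metis
  qed
  obtain X0 X1 where X: "Enum X0 (%x. \<not> Mem C0 x)" "Enum X1 (%x. \<not> Mem C1 x)" using en C F op by metis
  let ?G = "gcut cen (rads X0) cen (rads X1)"
  have d0: "dlt cen (rads X0) (sq x) 0 \<longleftrightarrow> \<not> Mem C0 x" and d1: "dlt cen (rads X1) (sq x) 0 \<longleftrightarrow> \<not> Mem C1 x"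
    if "x \<in> D ty1" "isreal (sq x)" for x
    using dlt_Enum[OF X(1) op(1) that] dlt_Enum[OF X(2) op(2) that] by auto
  have XD: "X0 \<in> D ty1" "X1 \<in> D ty1" using X by (simp_all add: Enum_def)
  note ax = env1(1) dfq_cen[OF df_var[OF env1(1)]] dfq_rads[OF env1(1) XD(1)] dfq_cen[OF df_var[OF env1(1)]]
    dfq_rads[OF env1(1) XD(2)] df_sq[OF dft_x]
  obtain g where g: "g \<in> D ty11" "!!x n. x \<in> D ty1 ==> n \<in> num ` C ==> sq (ap g x) n = cutreal (?G (sq x)) n"
    using fun_exists[OF df_gfun[OF ax]] by blast
  have gr: "isreal (sq (ap g x))" and gl: "lt a (sq (ap g x)) \<longleftrightarrow> ?G (sq x) a" if "x \<in> D ty1" for x a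
  proof -
    have x: "((), x) \<in> dom env1" using that env1(2) by simp
    have "isreal (sq (ap g x)) \<longleftrightarrow> isreal (cutreal (?G (sq x)))" by (rule isreal_cong) (rule g(2)[OF that])
    then show "isreal (sq (ap g x))" using gfun(1)[OF ax x] by simp
    have "lt a (sq (ap g x)) \<longleftrightarrow> lt a (cutreal (?G (sq x)))" by (rule lt_cong) (rule g(2)[OF that])
    then show "lt a (sq (ap g x)) \<longleftrightarrow> ?G (sq x) a" using gfun(2)[OF ax x] by simp
  qed
  have "Fun g" unfolding Fun_def onD_def
  proof (intro conjI ballI impI gr)
    fix x y assume xy: "x \<in> D ty1" "y \<in> D ty1" "isreal (sq x)" "isreal (sq y)" "req (sq x) (sq y)"
    then have "dlt A R (sq x) t \<longleftrightarrow> dlt A R (sq y) t" for A R t using dlt_eqreal req_iff by blast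
    then have "?G (sq x) a = ?G (sq y) a" for a by (simp add: gcut_def)
    then show "req (sq (ap g x)) (sq (ap g y))" using req_iff[OF gr gr] gl xy by simp
  qed
  moreover have "\<exists>l\<in>num ` C. onD (%y. rdist (sq x) (sq y) (e l) --> rdist (sq (ap g x)) (sq (ap g y)) (e k))"
    if x: "x \<in> D ty1" "isreal (sq x)" and k: "k \<in> num ` C" for x k
  proof -
    have "e k <= 1" using pw_pos[OF k] by (simp add: e_def)
    \<comment> \<open>The quarter compensates the factor 4 of \<open>near_shift\<close>, and
      \<open>gcut_cont\<close> takes a tolerance of at most 1.\<close>
    then have "0 < e k / 4" "e k / 4 <= 1" using e_pos[OF k] by auto
    moreover have "dlt cen (rads X0) (sq x) 0 \<or> dlt cen (rads X1) (sq x) 0" using d0[OF x] d1[OF x] dis[OF x] by blast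
    ultimately obtain \<delta> where \<delta>: "0 < \<delta>" "!!\<eta> q. isreal \<eta> ==> near (sq x) \<eta> \<delta> ==>
        (?G (sq x) q --> ?G \<eta> (q - e k / 4)) \<and> (?G \<eta> q --> ?G (sq x) (q - e k / 4))"
      using gcut_cont[OF x(2), of cen "rads X0" cen "rads X1" "e k / 4"] by blast
    obtain l where l: "l \<in> num ` C" "e l < \<delta>" using e_small[OF \<delta>(1)] by blast
    have "rdist (sq (ap g x)) (sq (ap g y)) (e k)"
      if y: "y \<in> D ty1" "isreal (sq y)" "rdist (sq x) (sq y) (e l)" for y
    proof -
      have "near (sq x) (sq y) (e l)" using y(3) unfolding rdist_iff[OF x(2) y(2)] .
      then have nr: "near (sq x) (sq y) \<delta>" by (rule near_mono) (use l(2) in simp)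
      have "near (sq (ap g x)) (sq (ap g y)) (4 * (e k / 4))"
        by (rule near_shift[OF gr[OF x(1)] gr[OF y(1)] \<open>0 < e k / 4\<close>])
          (use \<delta>(2)[OF y(2) nr] in \<open>simp_all only: gl[OF x(1)] gl[OF y(1)]\<close>)
      then show ?thesis using rdist_iff[OF gr[OF x(1)] gr[OF y(1)]] by simp
    qed
    then show ?thesis using l(1) unfolding onD_def by blast
  qed
  ultimately have "Cont g" unfolding Cont_def onD_def by blast
  moreover have "\<not> rless (sq (ap g x)) (%_. 0) \<and> \<not> rless (%_. 5) (sq (ap g x))" if x: "x \<in> D ty1" "isreal (sq x)" for x
  proof
    have "\<not> ut (sq (ap g x)) 0"
    proof
      assume "ut (sq (ap g x)) 0"
      then obtain b where b: "b < 0" "ut (sq (ap g x)) b" using ut_open by blast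
      moreover have "lt b (sq (ap g x))" using gl[OF x(1)] b(1) by (simp add: gcut_def)
      ultimately show False using lt_ut_less[OF gr[OF x(1)]] by blast
    qed
    then show "\<not> rless (sq (ap g x)) (%_. 0)" using rless_const[OF gr[OF x(1)] N0] by (simp add: rat_0)
    show "\<not> rless (%_. 5) (sq (ap g x))"
    proof
      assume "rless (%_. 5) (sq (ap g x))"
      then obtain a where "1 < a" "lt a (sq (ap g x))"
        using real_less_iff[OF isreal_const[OF N5] gr[OF x(1)]] unfolding rless_def by (auto simp: rat_5)
      then have "?G (sq x) 1" using gl[OF x(1)] gcut_mono by (meson less_imp_le)
      then show False using not_gcut_1 by blast
    qed
  qed
  moreover have "(Mem C0 x \<longleftrightarrow> req (sq (ap g x)) (%_. 0)) \<and> (Mem C1 x \<longleftrightarrow> req (sq (ap g x)) (%_. 5))"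
    if x: "x \<in> D ty1" "isreal (sq x)" for x
  proof
    have "req (sq (ap g x)) (%_. 0) \<longleftrightarrow> (\<forall>a. ?G (sq x) a \<longleftrightarrow> a < 0)"
      using req_iff[OF gr[OF x(1)] isreal_const[OF N0]] gl[OF x(1)] by (simp add: rat_0)
    also have "\<dots> \<longleftrightarrow> \<not> ?G (sq x) 0"
    proof
      assume "\<not> ?G (sq x) 0"
      moreover have "?G (sq x) a" if "a < 0" for a using that by (simp add: gcut_def)
      ultimately show "\<forall>a. ?G (sq x) a \<longleftrightarrow> a < 0" using gcut_mono not_less by blast
    qed simp
    finally show "Mem C0 x \<longleftrightarrow> req (sq (ap g x)) (%_. 0)" using gcut_0_iff d0[OF x] by simp
    have "req (sq (ap g x)) (%_. 5) \<longleftrightarrow> (\<forall>a. ?G (sq x) a \<longleftrightarrow> a < 1)"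
      using req_iff[OF gr[OF x(1)] isreal_const[OF N5]] gl[OF x(1)] by (simp add: rat_5)
    also have "\<dots> \<longleftrightarrow> (\<forall>a<1. ?G (sq x) a)"
      using gcut_mono[of cen "rads X0" cen "rads X1" "sq x" _ 1] not_gcut_1[of cen "rads X0" cen "rads X1" "sq x"]
      by (auto simp: not_less[symmetric])
    also have "\<dots> \<longleftrightarrow> \<not> dlt cen (rads X1) (sq x) 0" by (rule gcut_1_iff) (use d0[OF x] d1[OF x] dis[OF x] in blast)
    finally show "Mem C1 x \<longleftrightarrow> req (sq (ap g x)) (%_. 5)" using d1[OF x] by simp
  qed
  ultimately show "\<exists>g\<in>D ty11. Cont g \<and>
      onD (%x. \<not> rless (sq (ap g x)) (%_. 0) \<and> \<not> rless (%_. 5) (sq (ap g x))) \<and>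
      onD (%x. (Mem C0 x \<longleftrightarrow> req (sq (ap g x)) (%_. 0)) \<and> (Mem C1 x \<longleftrightarrow> req (sq (ap g x)) (%_. 5)))"
    using g(1) unfolding onD_def by blast
qed

lemma URY_OPEN: assumes "val v" "holds v URY" shows "holds v OPEN"
  unfolding holds_OPEN[OF assms(1)]
proof (intro ballI impI)
  fix Y assume Y: "Y \<in> D ty11" "Fun Y \<and> Open (Mem Y)"
  obtain C0 where C0: "C0 \<in> D ty11" "Fun C0" "!!x. x \<in> D ty1 ==> isreal (sq x) ==> Mem C0 x \<longleftrightarrow> \<not> Mem Y x"
    using complement_exists Y by blast
  have o0: "Open (%x. \<not> Mem C0 x)" using Open_cong[of "Mem Y" "%x. \<not> Mem C0 x"] C0(3) Y(2) by blast
  \<comment> \<open>The second closed set is empty, given by the constant function 0. The Urysohn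
    function then vanishes exactly outside \<open>Y\<close>.\<close>
  define C1 where "C1 = ap (cv (CombK ty1 ty1)) (ap (cv (CombK Nt Nt)) zr)"
  have C1: "C1 \<in> D ty11" "!!x. x \<in> D ty1 ==> sq (ap C1 x) = (%_. 0)"
    unfolding C1_def by (blast intro: ap_in K_in zr_in) (simp add: ap_K sq_const num_zr)
  have F1: "Fun C1" by (simp add: Fun_def onD_def C1(2) isreal_const[OF N0] req_iff)
  have M1: "\<not> Mem C1 x" if "x \<in> D ty1" for x by (simp add: Mem_def C1(2)[OF that] rless_0 isreal_const[OF N0] rat_0)
  have "0 < rat 5" by (simp only: rat_5 zero_less_one)
  then have o1: "Open (%x. \<not> Mem C1 x)" unfolding Open_def onD_def Ball_def using M1 N5 by blast
  have "(Fun C0 \<and> Open (%x. \<not> Mem C0 x)) \<and> (Fun C1 \<and> Open (%x. \<not> Mem C1 x)) \<and>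
      onD (%x. \<not> (Mem C0 x \<and> Mem C1 x))" using C0(2) o0 F1 o1 M1 by (simp add: onD_def)
  from assms(2)[unfolded holds_URY[OF assms(1)], THEN bspec, OF C0(1), THEN bspec, OF C1(1), THEN mp, OF this]
  obtain g where g0: "g \<in> D ty11" "Cont g"
    "onD (%x. \<not> rless (sq (ap g x)) (%_. 0) \<and> \<not> rless (%_. 5) (sq (ap g x)))"
    "onD (%x. (Mem C0 x \<longleftrightarrow> req (sq (ap g x)) (%_. 0)) \<and> (Mem C1 x \<longleftrightarrow> req (sq (ap g x)) (%_. 5)))" by blast
  have g: "g \<in> D ty11" "Cont g"
    "!!x. x \<in> D ty1 ==> isreal (sq x) ==> \<not> rless (sq (ap g x)) (%_. 0)"
    "!!x. x \<in> D ty1 ==> isreal (sq x) ==> Mem C0 x \<longleftrightarrow> req (sq (ap g x)) (%_. 0)"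
    using g0 unfolding onD_def by blast+
  have Fg: "Fun g" using g(2) by (simp add: Cont_def)
  note gr = Fun_real[OF Fg]
  have MY: "Mem Y x \<longleftrightarrow> lt 0 (sq (ap g x))" if x: "x \<in> D ty1" "isreal (sq x)" for x
  proof -
    have nu: "\<not> ut (sq (ap g x)) 0" using g(3)[OF x] rless_const[OF gr[OF x] N0] by (simp add: rat_0)
    have neg: "lt a (sq (ap g x))" if "a < 0" for a using not_lt_ut[OF gr[OF x] _ that] nu by blast
    have "req (sq (ap g x)) (%_. 0) \<longleftrightarrow> (\<forall>a. lt a (sq (ap g x)) \<longleftrightarrow> a < 0)"
      using req_iff[OF gr[OF x] isreal_const[OF N0]] by (simp only: lt_const rat_0)
    also have "\<dots> \<longleftrightarrow> \<not> lt 0 (sq (ap g x))"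
    proof
      assume n: "\<not> lt 0 (sq (ap g x))"
      have "a < 0" if "lt a (sq (ap g x))" for a
      proof (rule ccontr)
        assume "\<not> a < 0"
        then have "0 <= a" by simp
        from lt_mono[OF that this] n show False by blast
      qed
      then show "\<forall>a. lt a (sq (ap g x)) \<longleftrightarrow> a < 0" using neg by blast
    qed blast
    finally show ?thesis using C0(3)[OF x] g(4)[OF x] by blast
  qed
  \<comment> \<open>An object is determined by its sequence, so the choice in \<open>\<Phi>\<close>
    below returns the object itself, and \<open>\<Phi>\<close> acts on sequences as \<open>g\<close>
    acts on objects.\<close>
  define R where "R = (%\<xi>. \<exists>x\<in>D ty1. \<xi> = sq x \<and> isreal (sq x))"
  define \<Phi> where "\<Phi> = (%\<xi>. sq (ap g (SOME x. x \<in> D ty1 \<and> sq x = \<xi>)))"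
  have \<Phi>: "\<Phi> (sq x) = sq (ap g x)" if "x \<in> D ty1" for x
  proof -
    have "(SOME y. y \<in> D ty1 \<and> sq y = sq x) = x"
      by (rule some_equality) (use that sq_inj in auto)
    then show ?thesis by (simp add: \<Phi>_def)
  qed
  have Kc: "\<exists>x\<in>D ty1. (%_. k) = sq x" if "k \<in> num ` C" for k
  proof -
    from that have "nv k \<in> C" "k = num (nv k)" by (simp_all add: num_nv)
    then show ?thesis using sq_const K_ap by (intro bexI[of _ "ap (cv (CombK Nt Nt)) (nv k)"]) simp_all
  qed
  have v: "valid env0" "() \<in> dom env0" using env0 by simp_all
  have 1: "isreal \<xi>" if "R \<xi>" for \<xi> using that by (auto simp: R_def)
  have 2: "isreal (\<Phi> \<xi>)" if "R \<xi>" for \<xi> using that \<Phi> gr by (auto simp: R_def)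
  have 3: "R (%_. k)" if "k \<in> num ` C" for k using Kc[OF that] isreal_const[OF that] by (auto simp: R_def)
  have 4: "\<exists>\<xi>. R \<xi> \<and> (\<forall>n\<in>num ` C. \<xi> n = F n)" if h: "df (push env0) (%p. F (snd p))" "isreal F" for F
  proof -
    obtain x where x: "x \<in> D ty1" "!!n. n \<in> num ` C ==> sq x n = F n" using sq_exists[OF h(1)] by blast
    have "isreal (sq x) \<longleftrightarrow> isreal F" by (rule isreal_cong) (rule x(2))
    then show ?thesis using x h(2) unfolding R_def by blast
  qed
  have "df (push (push env0)) (%p. sq (ap g (ap (cv (CombK Nt Nt)) (nv (snd (fst p))))) (snd p))"
    by (rule df_sq[of "push env0" "%p. ap g (ap (cv (CombK Nt Nt)) (nv (snd p)))"])
      (intro dft_app[of _ ty1] dft_app[of _ Nt] dft_const dft_var valid_push v K_in g nv_in)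
  then have 5: "df (push (push env0)) (%p. \<Phi> (%_. snd (fst p)) (snd p))"
  proof (rule df_cong)
    fix p assume "p \<in> dom (push (push env0))"
    then have "snd (fst p) \<in> num ` C" by auto
    then have "(%_. snd (fst p)) = sq (ap (cv (CombK Nt Nt)) (nv (snd (fst p))))" by (simp add: sq_const num_nv)
    then have "\<Phi> (%_. snd (fst p)) = sq (ap g (ap (cv (CombK Nt Nt)) (nv (snd (fst p)))))" using \<Phi> by simp
    then show "\<Phi> (%_. snd (fst p)) (snd p) = sq (ap g (ap (cv (CombK Nt Nt)) (nv (snd (fst p))))) (snd p)" by simp
  qed
  have 6: "\<exists>\<delta>>0. \<forall>\<eta>. R \<eta> --> near \<xi> \<eta> \<delta> --> near (\<Phi> \<xi>) (\<Phi> \<eta>) \<epsilon>" if h: "R \<xi>" "0 < \<epsilon>" for \<xi> \<epsilon>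
  proof -
    obtain x where x: "x \<in> D ty1" "\<xi> = sq x" "isreal (sq x)" using h by (auto simp: R_def)
    obtain k where k: "k \<in> num ` C" "e k < \<epsilon>" using e_small[OF h(2)] by blast
    have "\<forall>k\<in>num ` C. \<exists>l\<in>num ` C. onD (%y. rdist (sq x) (sq y) (e l) --> rdist (sq (ap g x)) (sq (ap g y)) (e k))"
      using g(2) x(1,3) unfolding Cont_def onD_def by blast
    then obtain l where l: "l \<in> num ` C" "onD (%y. rdist (sq x) (sq y) (e l) --> rdist (sq (ap g x)) (sq (ap g y)) (e k))"
      using k(1) by blast
    have "near (\<Phi> \<xi>) (\<Phi> \<eta>) \<epsilon>" if \<eta>: "R \<eta>" "near \<xi> \<eta> (e l)" for \<eta>
    proof -
      obtain y where y: "y \<in> D ty1" "\<eta> = sq y" "isreal (sq y)" using \<eta> by (auto simp: R_def)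
      have "near (sq x) (sq y) (e l)" using \<eta>(2) unfolding x(2) y(2) .
      then have "rdist (sq x) (sq y) (e l)" unfolding rdist_iff[OF x(3) y(3)] .
      then have "rdist (sq (ap g x)) (sq (ap g y)) (e k)" using l(2) y(1,3) by (simp add: onD_def)
      then have "near (sq (ap g x)) (sq (ap g y)) (e k)" unfolding rdist_iff[OF gr[OF x(1,3)] gr[OF y(1,3)]] .
      then have "near (sq (ap g x)) (sq (ap g y)) \<epsilon>" by (rule near_mono) (use k(2) in simp)
      then show ?thesis unfolding x(2) y(2) \<Phi>[OF x(1)] \<Phi>[OF y(1)] .
    qed
    then show ?thesis using e_pos[OF l(1)] by blast
  qed
  let ?P = "%n. \<forall>s t. cen n - rad n < s \<and> s <= t \<and> t < cen n + rad n --> bounded_below \<Phi> s t"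
  have "dec (push env0) (%p. ?P (snd p))"
    by (rule dec_ball_subset[OF v 1 2 3 4 5 6 extends_push[OF extends_refl[OF v(1)]]])
      (intro dfq_cen dfq_rad df_var v | assumption)+
  \<comment> \<open>\<open>dec\<close> codes truth by 0, whereas membership in the set
    \<open>X\<close> is coded by 1; the negation exchanges the two.\<close>
  from dec_not[OF this] have "df (push env0) (%p. if \<not> ?P (snd p) then 0 else 1)" unfolding dec_def .
  from sq_exists[of "%n. if \<not> ?P n then 0 else 1", OF this]
  obtain X where X: "X \<in> D ty1" "!!n. n \<in> num ` C ==> sq X n = (if \<not> ?P n then 0 else 1)" by blast
  have NB: "NthBall n (Mem Y) \<longleftrightarrow> ?P n" if n: "n \<in> num ` C" for n
  proof -
    obtain k l where kl: "k \<in> num ` C" "l \<in> num ` C" "ispair n k l" using ispair_exists[OF n] by blast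
    obtain a b where ab: "a \<in> num ` C" "b \<in> num ` C" "ispair l a b" using ispair_exists[OF kl(2)] by blast
    note pr = pr_eq[OF n kl] pr_eq[OF kl(2) ab]
    have "NthBall n (Mem Y) \<longleftrightarrow> Ball (%_. k) (rad n) (Mem Y)"
    proof
      assume "NthBall n (Mem Y)"
      then obtain k' l' a' b' where *: "k' \<in> num ` C" "l' \<in> num ` C" "a' \<in> num ` C" "b' \<in> num ` C"
        "ispair n k' l'" "ispair l' a' b'" "Ball (%_. k') ((a' + 1) / (b' + 1)) (Mem Y)" unfolding NthBall_def by blast
      then show "Ball (%_. k) (rad n) (Mem Y)"
        using pr_eq[OF n *(1,2,5)] pr_eq[OF *(2,3,4,6)] pr by (simp add: rad_def)
    next
      assume "Ball (%_. k) (rad n) (Mem Y)"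
      then show "NthBall n (Mem Y)" using kl ab pr unfolding NthBall_def rad_def by metis
    qed
    also have "\<dots> \<longleftrightarrow> (\<forall>\<xi>. R \<xi> --> near (%_. k) \<xi> (rad n) --> lt 0 (\<Phi> \<xi>))"
      unfolding Ball_iff[OF isreal_const[OF kl(1)]] R_def using MY \<Phi> by auto
    also have "\<dots> \<longleftrightarrow> ?P n"
    proof -
      have "cen n = rat k" unfolding cen_def pr(1) ..
      then show ?thesis using ball_subset_iff[OF v 1 2 3 4 5 6 kl(1), of "rad n"] by (simp only:)
    qed
    finally show ?thesis .
  qed
  have I: "(if \<not> Q then 0 else 1 :: 'k) = 1 \<longleftrightarrow> Q" "(if \<not> Q then 0 else 1 :: 'k) <= 1" for Q by auto
  show "\<exists>X\<in>D ty1. (\<forall>n\<in>num ` C. sq X n <= 1) \<and> (\<forall>n\<in>num ` C. sq X n = 1 \<longleftrightarrow> NthBall n (Mem Y))"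
  proof (rule bexI[OF _ X(1)], intro conjI ballI)
    fix n assume n: "n \<in> num ` C"
    show "sq X n <= 1" unfolding X(2)[OF n] by (rule I(2))
    show "sq X n = 1 \<longleftrightarrow> NthBall n (Mem Y)" unfolding X(2)[OF n] NB[OF n] by (rule I(1))
  qed
qed

lemma URY_iff_OPEN: "val v ==> holds v (URY \<^bold>\<longleftrightarrow> OPEN)"
  unfolding holds.simps using URY_OPEN[of v] OPEN_URY[of v] by blast

end

theorem ACA0w_URY_iff_OPEN: "ACA0w \<turnstile> (URY \<^bold>\<longleftrightarrow> OPEN)"
proof (rule ccontr)
  assume nd: "\<not> ACA0w \<turnstile> (URY \<^bold>\<longleftrightarrow> OPEN)"
  have sub: "RCA0w \<subseteq> ACA0w" by (auto simp: ACA0w_def)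
  have "\<exists>D ap cv ltr. countermodel (D, ap, cv, ltr)"
    unfolding countermodel_def prod.case aca_model_def aca_model_axioms_def conj_assoc
    by (rule model_existence[OF sub wf_URY_OPEN nd])
  then have ex: "Ex countermodel" by blast
  obtain D ap cv ltr where M: "the_model = (D, ap, cv, ltr)" by (cases the_model)
  have "countermodel (D, ap, cv, ltr)" using the_model[OF ex] unfolding M .
  then have cm: "aca_model D ap cv ltr"
    "\<exists>v. prestructure.val D v \<and> \<not> prestructure.holds D ap cv (=) ltr v (URY \<^bold>\<longleftrightarrow> OPEN)"
    unfolding countermodel_def prod.case by blast+
  \<comment> \<open>A countermodel now exists, so the definitions by cases behind
    \<open>mnum\<close> refer to this model, and the field built from \<open>mnum\<close> is its
    field of fractions.\<close>
  have eqs: "mC = D Nt" "mz = cv Zero" "mu' = cv One" "mp = (%a b. ap (ap (cv Plus) a) b)"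
    "mt = (%a b. ap (ap (cv Times) a) b)" "ml = ltr"
    unfolding mC_def mz_def mu'_def mp_def mt_def ml_def if_P[OF ex] M fst_conv snd_conv by (rule refl)+
  note n = num_simps[unfolded eqs] num_frac[unfolded eqs]
  have "field_model D ap cv ltr num"
    by (rule field_model.intro[OF cm(1)], rule field_model_axioms.intro) (rule n; assumption)+
  from field_model.URY_iff_OPEN[OF this] cm(2) show False by blast
qed

theorem theorem5p3:
  shows
    "(\<exists>e. \<forall>\<zeta>. zeta_functional \<zeta> \<longrightarrow>
        (\<exists>\<Phi>. Phi_functional \<Phi> \<and>
          (\<forall>Y x. kleene e [zeta_arg \<zeta>, Fun2 Feferman_mu, fun2_arg Y, Fun1 x] (\<Phi> Y x)))) \<and>
     (\<exists>e. \<forall>\<Psi>. Psi_functional \<Psi> \<longrightarrow>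
        (\<exists>\<zeta>. zeta_functional \<zeta> \<and>
          (\<forall>C\<^sub>0 C\<^sub>1 x n. kleene e
             [psi_arg \<Psi>, Fun2 Feferman_mu, fun2_arg C\<^sub>0, fun2_arg C\<^sub>1, Fun1 x, Num n]
             (\<zeta> C\<^sub>0 C\<^sub>1 x n)))) \<and>
     ACA0w \<turnstile> (URY \<^bold>\<longleftrightarrow> OPEN)"
proof (intro conjI)
  obtain e where "\<And>\<zeta> Y x. kleene e [zeta_arg \<zeta>, Fun2 Feferman_mu, fun2_arg Y, Fun1 x] (Phi_of \<zeta> Y x)"
    using Phi_computable by blast
  then show "\<exists>e. \<forall>\<zeta>. zeta_functional \<zeta> \<longrightarrow>
      (\<exists>\<Phi>. Phi_functional \<Phi> \<and>
        (\<forall>Y x. kleene e [zeta_arg \<zeta>, Fun2 Feferman_mu, fun2_arg Y, Fun1 x] (\<Phi> Y x)))"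
    using Phi_of_correct by (intro exI[of _ e] allI impI) blast
  obtain e where "\<And>\<Psi> C D x n. kleene e
      [psi_arg \<Psi>, Fun2 Feferman_mu, fun2_arg C, fun2_arg D, Fun1 x, Num n] (zeta_of \<Psi> C D x n)"
    using zeta_computable by blast
  then show "\<exists>e. \<forall>\<Psi>. Psi_functional \<Psi> \<longrightarrow>
      (\<exists>\<zeta>. zeta_functional \<zeta> \<and>
        (\<forall>C\<^sub>0 C\<^sub>1 x n. kleene e
           [psi_arg \<Psi>, Fun2 Feferman_mu, fun2_arg C\<^sub>0, fun2_arg C\<^sub>1, Fun1 x, Num n]
           (\<zeta> C\<^sub>0 C\<^sub>1 x n)))"
    using zeta_of_correct by (intro exI[of _ e] allI impI) blast
  show "ACA0w \<turnstile> (URY \<^bold>\<longleftrightarrow> OPEN)" by (rule ACA0w_URY_iff_OPEN)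
qed

end
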